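(* Let $d\in(0,2)$, $\alpha=1-d/2\in(0,1)$, $p\in(-\infty,1/2)$, let $R$ be a Bessel process of dimension $d$ started from $0$ with local time $L$ at level $0$, and let $\hat R_t=\frac{t^{p}}{\sqrt{1-2p}}R_{t^{1-2p}}$ be the noise reinforced Bessel process. The process $\hat R^{2\alpha}$ is a continuous semimartingale with canonical decomposition $$\hat R_t^{2\alpha}=2\alpha\int_0^t\hat R_s^{2\alpha-1}\,\mathrm{d}B'_s+\hat V_t,$$ where $B'$ is a Brownian motion and $\hat V$ is a process with bounded variation. More precisely, the canonical decomposition of $\hat V$ as the sum of its absolutely continuous and its singular components (with respect to the Lebesgue measure on $\mathbb{R}_+$) is given by $$\hat V_t=2\alpha p\int_0^t\frac{\hat R_s^{2\alpha}}{s}\,\mathrm{d}s+\hat L_t,\qquad\text{where}\qquad \hat L_t=(1-2p)^{-\alpha}\int_0^{t^{1-2p}}s^{2\alpha p/(1-2p)}\,\mathrm{d}L_s.$$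
   Context: Let $B$ be a standard Brownian motion and $R$ the Bessel process of dimension $d$ started from $0$ driven by $B$, i.e. $R\ge 0$ and $R_t^2=2\int_0^tR_s\,\mathrm{d}B_s+d\,t$. By convention $\hat R_0=0$. The local time $L$ at level $0$ of $R$ is the continuous non-decreasing process in the Doob-Meyer decomposition of the submartingale $R^{2\alpha}$: $R_t^{2\alpha}=2\alpha\int_0^tR_s^{2\alpha-1}\,\mathrm{d}B_s+L_t$; its Stieltjes measure is a.s. singular with respect to Lebesgue measure and supported by the zero set of $R$. As usual in stochastic calculus, a process with bounded variation is one whose paths have bounded variation on every compact time interval. *)

theory Defs
  imports "HOL-Probability.Probability"
begin

text \<open>
  Conventions. A process is a map \<open>real \<Rightarrow> 'a \<Rightarrow> real\<close> of which only the times \<open>t \<ge> 0\<close> matter.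
  Continuous processes have all their paths continuous; identities between processes
  (and sign and monotonicity of paths) are required almost surely, simultaneously for all times,
  i.e. up to indistinguishability. Filtrations are indexed by \<open>real\<close> so that the library notions
  \<open>filtration\<close> and \<open>stopping_time\<close> apply.
\<close>

definition complete_filtration :: "'a measure \<Rightarrow> (real \<Rightarrow> 'a measure) \<Rightarrow> bool" where
  "complete_filtration M F \<longleftrightarrow>
     filtration (space M) F \<and> (\<forall>t. subalgebra M (F t)) \<and>
     (\<forall>N\<in>null_sets M. \<forall>A. A \<subseteq> N \<longrightarrow> A \<in> sets (F 0))"

definition adapted :: "(real \<Rightarrow> 'a measure) \<Rightarrow> (real \<Rightarrow> 'a \<Rightarrow> real) \<Rightarrow> bool" where
  "adapted F X \<longleftrightarrow> (\<forall>t\<ge>0. X t \<in> borel_measurable (F t))"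

definition progressive :: "(real \<Rightarrow> 'a measure) \<Rightarrow> (real \<Rightarrow> 'a \<Rightarrow> real) \<Rightarrow> bool" where
  "progressive F X \<longleftrightarrow>
     (\<forall>t\<ge>0. (\<lambda>(s, \<omega>). X s \<omega>) \<in> borel_measurable (restrict_space borel {0..t} \<Otimes>\<^sub>M F t))"

definition continuous_adapted ::
  "'a measure \<Rightarrow> (real \<Rightarrow> 'a measure) \<Rightarrow> (real \<Rightarrow> 'a \<Rightarrow> real) \<Rightarrow> bool" where
  "continuous_adapted M F X \<longleftrightarrow>
     adapted F X \<and> (\<forall>\<omega>\<in>space M. continuous_on {0..} (\<lambda>t. X t \<omega>))"

definition brownian_motion ::
  "'a measure \<Rightarrow> (real \<Rightarrow> 'a measure) \<Rightarrow> (real \<Rightarrow> 'a \<Rightarrow> real) \<Rightarrow> bool" where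
  "brownian_motion M F B \<longleftrightarrow>
     continuous_adapted M F B \<and> (AE \<omega> in M. B 0 \<omega> = 0) \<and>
     (\<forall>s t. 0 \<le> s \<and> s < t \<longrightarrow>
        distributed M lborel (\<lambda>\<omega>. B t \<omega> - B s \<omega>) (\<lambda>x. ennreal (normal_density 0 (sqrt (t - s)) x)) \<and>
        prob_space.indep_set M (sets (F s))
          {(\<lambda>\<omega>. B t \<omega> - B s \<omega>) -` A \<inter> space M |A. A \<in> sets borel})"


subsection \<open>The stochastic integral\<close>

text \<open>
  The data \<open>(n, \<tau>, \<xi>)\<close> represent the simple integrand
  \<open>\<Sum>i<n. \<xi>\<^sub>i 1\<^bsub>(\<tau>\<^sub>i, \<tau>\<^sub>i\<^sub>+\<^sub>1]\<^esub>\<close>, where \<open>\<xi>\<^sub>i\<close> is bounded and known at time \<open>\<tau>\<^sub>i\<close>.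
\<close>

type_synonym 'a simple_data = "nat \<times> (nat \<Rightarrow> real) \<times> (nat \<Rightarrow> 'a \<Rightarrow> real)"

fun simple_integrand :: "'a measure \<Rightarrow> (real \<Rightarrow> 'a measure) \<Rightarrow> 'a simple_data \<Rightarrow> bool" where
  "simple_integrand M F (n, \<tau>, \<xi>) \<longleftrightarrow>
     0 \<le> \<tau> 0 \<and> (\<forall>i<n. \<tau> i \<le> \<tau> (Suc i)) \<and>
     (\<forall>i<n. \<xi> i \<in> borel_measurable (F (\<tau> i)) \<and> (\<exists>C. \<forall>\<omega>\<in>space M. \<bar>\<xi> i \<omega>\<bar> \<le> C))"

fun simple_process :: "'a simple_data \<Rightarrow> real \<Rightarrow> 'a \<Rightarrow> real" where
  "simple_process (n, \<tau>, \<xi>) s \<omega> = (\<Sum>i<n. \<xi> i \<omega> * indicator {\<tau> i<..\<tau> (Suc i)} s)"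

fun simple_integral :: "(real \<Rightarrow> 'a \<Rightarrow> real) \<Rightarrow> 'a simple_data \<Rightarrow> real \<Rightarrow> 'a \<Rightarrow> real" where
  "simple_integral X (n, \<tau>, \<xi>) t \<omega> =
     (\<Sum>i<n. \<xi> i \<omega> * (X (min t (\<tau> (Suc i))) \<omega> - X (min t (\<tau> i)) \<omega>))"

text \<open>
  \<open>ito_integral M F B H I\<close>: the integrand \<open>H\<close> is progressive and a.s. locally square integrable,
  and \<open>I\<close> is a continuous version of \<open>\<integral>\<^sub>0\<^sup>t H\<^sub>s dB\<^sub>s\<close>, that is, the limit, locally uniformly in
  time in probability, of the elementary integrals of simple integrands \<open>S k\<close> such that
  \<open>\<integral>\<^sub>0\<^sup>t (S k - H)\<^sup>2 ds\<close> tends to \<open>0\<close> in probability for every \<open>t\<close>. For a Brownian motion \<open>B\<close>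
  this determines \<open>I\<close> up to indistinguishability; in particular \<open>I 0 = 0\<close> a.s.
\<close>

definition ito_integral ::
  "'a measure \<Rightarrow> (real \<Rightarrow> 'a measure) \<Rightarrow> (real \<Rightarrow> 'a \<Rightarrow> real) \<Rightarrow> (real \<Rightarrow> 'a \<Rightarrow> real) \<Rightarrow>
   (real \<Rightarrow> 'a \<Rightarrow> real) \<Rightarrow> bool" where
  "ito_integral M F B H I \<longleftrightarrow>
     progressive F H \<and>
     (AE \<omega> in M. \<forall>t\<ge>0. set_integrable lborel {0..t} (\<lambda>s. (H s \<omega>)\<^sup>2)) \<and>
     continuous_adapted M F I \<and>
     (\<exists>S :: nat \<Rightarrow> 'a simple_data.
        (\<forall>k. simple_integrand M F (S k)) \<and>
        (\<forall>t\<ge>0. \<forall>\<epsilon>>0.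
           (\<lambda>k. measure M {\<omega>\<in>space M.
              ennreal \<epsilon> < (\<integral>\<^sup>+s\<in>{0..t}. ennreal ((simple_process (S k) s \<omega> - H s \<omega>)\<^sup>2) \<partial>lborel)})
           \<longlonglongrightarrow> 0) \<and>
        (\<forall>t\<ge>0. \<forall>\<epsilon>>0.
           (\<lambda>k. measure M {\<omega>\<in>space M.
              \<exists>s\<in>{0..t}. \<epsilon> < \<bar>simple_integral B (S k) s \<omega> - I s \<omega>\<bar>})
           \<longlonglongrightarrow> 0))"


subsection \<open>Continuous semimartingales\<close>

definition martingale ::
  "'a measure \<Rightarrow> (real \<Rightarrow> 'a measure) \<Rightarrow> (real \<Rightarrow> 'a \<Rightarrow> real) \<Rightarrow> bool" where
  "martingale M F X \<longleftrightarrow>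
     adapted F X \<and> (\<forall>t\<ge>0. integrable M (X t)) \<and>
     (\<forall>s t. 0 \<le> s \<and> s \<le> t \<longrightarrow> (AE \<omega> in M. real_cond_exp M (F s) (X t) \<omega> = X s \<omega>))"

definition continuous_local_martingale ::
  "'a measure \<Rightarrow> (real \<Rightarrow> 'a measure) \<Rightarrow> (real \<Rightarrow> 'a \<Rightarrow> real) \<Rightarrow> bool" where
  "continuous_local_martingale M F X \<longleftrightarrow>
     continuous_adapted M F X \<and>
     (\<exists>T :: nat \<Rightarrow> 'a \<Rightarrow> real.
        (\<forall>n. stopping_time F (T n) \<and> (\<forall>\<omega>\<in>space M. 0 \<le> T n \<omega>)) \<and>
        (AE \<omega> in M. incseq (\<lambda>n. T n \<omega>) \<and> filterlim (\<lambda>n. T n \<omega>) at_top sequentially) \<and>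
        (\<forall>n. martingale M F (\<lambda>t \<omega>. X (min t (T n \<omega>)) \<omega>)))"

definition bounded_variation_path :: "(real \<Rightarrow> real) \<Rightarrow> bool" where
  "bounded_variation_path v \<longleftrightarrow>
     (\<forall>t\<ge>0. \<exists>C. \<forall>(n::nat) u. mono_on {..n} u \<longrightarrow> u ` {..n} \<subseteq> {0..t} \<longrightarrow>
        (\<Sum>i<n. \<bar>v (u (Suc i)) - v (u i)\<bar>) \<le> C)"

text \<open>
  \<open>X\<close> is a continuous semimartingale with canonical decomposition \<open>X = X\<^sub>0 + N + V\<close>
  into a continuous local martingale and a continuous adapted process with bounded variation,
  both starting from \<open>0\<close>.
\<close>

definition canonical_decomposition ::
  "'a measure \<Rightarrow> (real \<Rightarrow> 'a measure) \<Rightarrow> (real \<Rightarrow> 'a \<Rightarrow> real) \<Rightarrow> (real \<Rightarrow> 'a \<Rightarrow> real) \<Rightarrow>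
   (real \<Rightarrow> 'a \<Rightarrow> real) \<Rightarrow> bool" where
  "canonical_decomposition M F X N V \<longleftrightarrow>
     adapted F X \<and> (AE \<omega> in M. continuous_on {0..} (\<lambda>t. X t \<omega>)) \<and>
     continuous_local_martingale M F N \<and> (AE \<omega> in M. N 0 \<omega> = 0) \<and>
     continuous_adapted M F V \<and> (AE \<omega> in M. V 0 \<omega> = 0) \<and>
     (AE \<omega> in M. bounded_variation_path (\<lambda>t. V t \<omega>)) \<and>
     (AE \<omega> in M. \<forall>t\<ge>0. X t \<omega> = X 0 \<omega> + N t \<omega> + V t \<omega>)"


subsection \<open>Stieltjes measures\<close>

text \<open>
  For \<open>l\<close> continuous and non-decreasing on \<open>[0,\<infinity>)\<close>; the extension by a constant to the negative
  half-line charges neither that half-line nor the point \<open>0\<close>.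
\<close>

definition stieltjes :: "(real \<Rightarrow> real) \<Rightarrow> real measure" where
  "stieltjes l = interval_measure (\<lambda>s. l (max 0 s))"

definition lebesgue_singular :: "real measure \<Rightarrow> bool" where
  "lebesgue_singular \<mu> \<longleftrightarrow> (\<exists>N\<in>null_sets lborel. emeasure \<mu> (- N) = 0)"


subsection \<open>Bessel processes and their local times\<close>

text \<open>The equation at \<open>t = 0\<close> forces \<open>R\<^sub>0 = 0\<close> a.s., as stochastic integrals start from \<open>0\<close>.\<close>

definition bessel_process ::
  "'a measure \<Rightarrow> (real \<Rightarrow> 'a measure) \<Rightarrow> real \<Rightarrow> (real \<Rightarrow> 'a \<Rightarrow> real) \<Rightarrow> (real \<Rightarrow> 'a \<Rightarrow> real) \<Rightarrow> bool"
where
  "bessel_process M F d B R \<longleftrightarrow>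
     continuous_adapted M F R \<and>
     (AE \<omega> in M. \<forall>t\<ge>0. 0 \<le> R t \<omega>) \<and>
     (\<exists>I. ito_integral M F B R I \<and>
        (AE \<omega> in M. \<forall>t\<ge>0. (R t \<omega>)\<^sup>2 = 2 * I t \<omega> + d * t))"

text \<open>
  When \<open>2\<alpha> - 1 \<le> 0\<close>, the value \<open>0 powr (2\<alpha> - 1) = 0\<close> of the integrand on the zero set of \<open>R\<close>
  is immaterial, because that set is a.s. Lebesgue-null.
\<close>

definition bessel_local_time ::
  "'a measure \<Rightarrow> (real \<Rightarrow> 'a measure) \<Rightarrow> real \<Rightarrow> (real \<Rightarrow> 'a \<Rightarrow> real) \<Rightarrow> (real \<Rightarrow> 'a \<Rightarrow> real) \<Rightarrow>
   (real \<Rightarrow> 'a \<Rightarrow> real) \<Rightarrow> bool" where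
  "bessel_local_time M F \<alpha> B R L \<longleftrightarrow>
     continuous_adapted M F L \<and>
     (AE \<omega> in M. mono_on {0..} (\<lambda>t. L t \<omega>)) \<and>
     (\<exists>I. ito_integral M F B (\<lambda>t \<omega>. R t \<omega> powr (2 * \<alpha> - 1)) I \<and>
        (AE \<omega> in M. \<forall>t\<ge>0. R t \<omega> powr (2 * \<alpha>) = 2 * \<alpha> * I t \<omega> + L t \<omega>))"


subsection \<open>Noise reinforcement\<close>

definition reinforced :: "real \<Rightarrow> (real \<Rightarrow> 'a \<Rightarrow> real) \<Rightarrow> real \<Rightarrow> 'a \<Rightarrow> real" where
  "reinforced p R t \<omega> =
     (if t = 0 then 0 else t powr p / sqrt (1 - 2 * p) * R (t powr (1 - 2 * p)) \<omega>)"

definition reinforced_local_time ::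
  "real \<Rightarrow> real \<Rightarrow> (real \<Rightarrow> 'a \<Rightarrow> real) \<Rightarrow> real \<Rightarrow> 'a \<Rightarrow> real" where
  "reinforced_local_time \<alpha> p L t \<omega> =
     (1 - 2 * p) powr (- \<alpha>) *
       (LINT s:{0..t powr (1 - 2 * p)}|stieltjes (\<lambda>u. L u \<omega>). s powr (2 * \<alpha> * p / (1 - 2 * p)))"

text \<open>The process \<open>reinforced p R\<close> observes \<open>R\<close> at the deterministic times \<open>t powr (1 - 2p)\<close>.\<close>

definition reinforced_filtration ::
  "real \<Rightarrow> (real \<Rightarrow> 'a measure) \<Rightarrow> real \<Rightarrow> 'a measure" where
  "reinforced_filtration p F t = F (max 0 t powr (1 - 2 * p))"

lemma complete_reinforced_filtration:
  assumes "complete_filtration M F" "p < 1/2"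
  shows "complete_filtration M (reinforced_filtration p F)"
proof -
  have le: "max 0 s powr (1 - 2 * p) \<le> max 0 t powr (1 - 2 * p)" if "s \<le> t" for s t :: real
    using that assms(2) by (intro powr_mono2) auto
  have F: "filtration (space M) F" "\<forall>t. subalgebra M (F t)"
    and N: "\<forall>N\<in>null_sets M. \<forall>A. A \<subseteq> N \<longrightarrow> A \<in> sets (F 0)"
    using assms(1) unfolding complete_filtration_def by auto
  have "filtration (space M) (reinforced_filtration p F)"
    using filtration.space_F[OF F(1)] filtration.sets_F_mono[OF F(1) le]
    by unfold_locales (simp_all add: reinforced_filtration_def)
  then show ?thesis
    using F(2) N by (simp add: complete_filtration_def reinforced_filtration_def)
qed

end

theory Submission
  imports Defs
begin

text \<open>
  Put \<open>q = 1 - 2p\<close>, \<open>\<beta> = p/q\<close> and \<open>\<gamma> = 2\<alpha>p/q\<close>. With \<open>u = t\<^sup>q\<close>,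
  the reinforced process \<open>R'\<close> satisfies
  \<open>R'\<^sub>t\<^sup>2\<^sup>\<alpha> = q\<^sup>-\<^sup>\<alpha> u\<^sup>\<gamma> R\<^sub>u\<^sup>2\<^sup>\<alpha>\<close>, and integrating \<open>s\<^sup>\<gamma>\<close> by parts against
  \<open>R\<^sup>2\<^sup>\<alpha> = 2\<alpha>J + L\<close> splits \<open>u\<^sup>\<gamma> R\<^sub>u\<^sup>2\<^sup>\<alpha>\<close> into \<open>2\<alpha> \<integral> s\<^sup>\<gamma> dJ\<close>, \<open>\<integral> s\<^sup>\<gamma> dL\<close> and the
  absolutely continuous part \<open>\<gamma> \<integral> s\<^sup>\<gamma>\<^sup>-\<^sup>1 R\<^sub>s\<^sup>2\<^sup>\<alpha> ds\<close>. The time changed process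
  \<open>B'\<^sub>t = q\<^sup>-\<^sup>1\<^sup>/\<^sup>2 \<integral>\<^sub>0\<^sup>u s\<^sup>\<beta> dB\<^sub>s\<close> has the characteristic functions of Brownian increments, and a
  change of integrator turns \<open>\<integral> s\<^sup>\<gamma> dJ\<close> into \<open>\<integral> R'\<^sup>2\<^sup>\<alpha>\<^sup>-\<^sup>1 dB'\<close>. As \<open>\<gamma>\<close> may be negative, all of
  this needs control at \<open>0\<close>: optional stopping gives \<open>P(sup\<^sub>s\<^sub>\<le>\<^sub>t |J\<^sub>s| \<ge> a) \<le> C t\<^sup>\<alpha>/a\<close>, and the
  same for \<open>L\<close>, so by Borel-Cantelli \<open>J\<close> and \<open>L\<close> are \<open>O(t\<^sup>\<eta>)\<close> for all \<open>\<eta> < \<alpha>\<close>, while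
  \<open>\<gamma> > -\<alpha>\<close>. The weighted integrals are defined path by path through integration by parts,
  so that no further stochastic integration theory is needed.
\<close>

subsection \<open>Filtrations, hitting times and approximation in probability\<close>

text \<open>A stochastic integral is known here only through simple integrands converging in
  probability, so even the mean of a given integral at a stopping time has to be extracted from such
  approximations. Stopping while the energy, the time integral of the squared integrand, is bounded
  allows the energies of the approximations to be truncated; they then converge in mean square and
  give mean zero together with a comparison of energy and second moment up to a factor 4. Constants
  do not matter, since only powers of \<open>t\<close> near 0 are wanted. For \<open>J\<close> no
  moment is available beforehand: its control comes from \<open>E R_T^2 \<le> d t\<close> and from
  \<open>2 \<alpha> J\<close> being the difference of the non-negative processes
  \<open>R^(2 \<alpha>)\<close> and \<open>L\<close>. The rates suffice for every
  \<open>p < 1/2\<close> because \<open>\<beta> = p/(1-2p)\<close> exceeds \<open>-1/2\<close>,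
  whence \<open>\<gamma> = 2 \<alpha> \<beta> > -\<alpha>\<close>; the Brownian motion itself has
  rate 1/2, which handles the weight \<open>s^\<beta>\<close> in the same way. Likewise
  \<open>2 \<beta> + 1 = 1/q\<close>, so the variance of the integral of \<open>s^\<beta>\<close> up
  to time \<open>t^q\<close> is proportional to \<open>t\<close>.\<close>

abbreviation sq_int :: "real set \<Rightarrow> (real \<Rightarrow> real) \<Rightarrow> ennreal" where
  "sq_int A f \<equiv> \<integral>\<^sup>+s\<in>A. ennreal ((f s)\<^sup>2) \<partial>lborel"

text \<open>By continuity a strict excess at one time persists nearby. The quantifier over all times
  thus becomes countable, which makes the event measurable.\<close>

lemma ex_less_iff_rational:
  fixes f :: "real \<Rightarrow> real"
  assumes "continuous_on {0..t} f" "0 \<le> t"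
  shows "(\<exists>s\<in>{0..t}. c < f s) \<longleftrightarrow> (\<exists>s\<in>{0..t} \<inter> \<rat>. c < f s)"
proof
  assume "\<exists>s\<in>{0..t}. c < f s"
  then obtain s where s: "s \<in> {0..t}" "c < f s" by auto
  show "\<exists>s\<in>{0..t} \<inter> \<rat>. c < f s"
  proof (cases "t = 0")
    case True then show ?thesis using s by (intro bexI[of _ 0]) auto
  next
    case False
    obtain e where e: "e > 0" "\<And>x. x \<in> {0..t} \<Longrightarrow> \<bar>x - s\<bar> < e \<Longrightarrow> \<bar>f x - f s\<bar> < f s - c"
      using assms(1) s unfolding continuous_on_iff dist_real_def
      by (metis diff_gt_0_iff_gt)
    have "max 0 (s - e) < min t (s + e)" using e s False assms by auto
    then obtain r where "r \<in> \<rat>" "max 0 (s - e) < r" "r < min t (s + e)"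
      using Rats_dense_in_real by blast
    moreover from this have "\<bar>f r - f s\<bar> < f s - c" using s by (intro e(2)) auto
    ultimately show ?thesis by (intro bexI[of _ r]) auto
  qed
qed auto

lemma measurable_exceed:
  fixes Y :: "real \<Rightarrow> 'b \<Rightarrow> real"
  assumes "\<And>u. u \<in> {0..t} \<Longrightarrow> Y u \<in> borel_measurable K"
    and "\<And>w. w \<in> space K \<Longrightarrow> continuous_on {0..t} (\<lambda>u. Y u w)" and "0 \<le> t"
  shows "{w\<in>space K. \<exists>s\<in>{0..t}. c < Y s w} \<in> sets K"
proof -
  have "{w\<in>space K. \<exists>s\<in>{0..t}. c < Y s w} = (\<Union>s\<in>{0..t} \<inter> \<rat>. {w\<in>space K. c < Y s w})"
    using ex_less_iff_rational[OF assms(2,3)] by blast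
  also have "\<dots> \<in> sets K"
    using assms(1) countable_rat by (intro sets.countable_UN') (auto intro!: borel_measurable_less)
  finally show ?thesis .
qed

text \<open>Compactness: the maximum over \<open>{0..t}\<close> is attained, and it lies above
  \<open>c - 1/(n+1)\<close> for every \<open>n\<close>. This reduces the weak inequality to
  countably many strict ones.\<close>

lemma ex_ge_iff_exceed:
  fixes f :: "real \<Rightarrow> real"
  assumes "continuous_on {0..t} f" "0 \<le> t"
  shows "(\<exists>s\<in>{0..t}. c \<le> f s) \<longleftrightarrow> (\<forall>n. \<exists>s\<in>{0..t}. c - inverse (real (Suc n)) < f s)"
proof
  assume R: "\<forall>n. \<exists>s\<in>{0..t}. c - inverse (real (Suc n)) < f s"
  obtain s where s: "s \<in> {0..t}" "\<And>y. y \<in> {0..t} \<Longrightarrow> f y \<le> f s"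
    using continuous_attains_sup[OF compact_Icc _ assms(1)] assms(2) by auto
  have "c \<le> f s + 0"
  proof (rule LIMSEQ_le_const)
    show "(\<lambda>n. f s + inverse (real (Suc n))) \<longlonglongrightarrow> f s + 0"
      by (intro tendsto_add tendsto_const LIMSEQ_inverse_real_of_nat)
    have "c \<le> f s + inverse (real (Suc n))" for n
      using R[rule_format, of n] s(2) by force
    then show "\<exists>N. \<forall>n\<ge>N. c \<le> f s + inverse (real (Suc n))" by blast
  qed
  then show "\<exists>s\<in>{0..t}. c \<le> f s" using s(1) by auto
next
  assume "\<exists>s\<in>{0..t}. c \<le> f s"
  then obtain s where "s \<in> {0..t}" "c \<le> f s" by blast
  moreover have "0 < inverse (real (Suc n))" for n by simp
  ultimately show "\<forall>n. \<exists>s\<in>{0..t}. c - inverse (real (Suc n)) < f s"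
    by (metis diff_less_eq less_add_same_cancel1 order_le_less_trans)
qed

lemma measurable_reach:
  fixes Y :: "real \<Rightarrow> 'b \<Rightarrow> real"
  assumes "\<And>u. u \<in> {0..t} \<Longrightarrow> Y u \<in> borel_measurable K"
    and "\<And>w. w \<in> space K \<Longrightarrow> continuous_on {0..t} (\<lambda>u. Y u w)" and "0 \<le> t"
  shows "{w\<in>space K. \<exists>s\<in>{0..t}. c \<le> Y s w} \<in> sets K"
proof -
  have "{w\<in>space K. \<exists>s\<in>{0..t}. c \<le> Y s w} =
    {w\<in>space K. \<forall>n. \<exists>s\<in>{0..t}. c - inverse (real (Suc n)) < Y s w}"
    using ex_ge_iff_exceed[OF assms(2,3)] by blast
  also have "\<dots> \<in> sets K"
    using measurable_exceed[OF assms] by (intro sets.sets_Collect_countable_All) auto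
  finally show ?thesis .
qed

text \<open>Rounding \<open>S\<close> up to multiples of \<open>1/(m+1)\<close> leaves countably
  many values, where measurability is a case distinction; continuity of paths passes to the limit.
  The sigma-algebra \<open>K\<close> is arbitrary, so the lemma serves for \<open>F t\<close>, for
  \<open>M\<close> and for products with the time axis.\<close>

lemma measurable_at_random_time:
  fixes X :: "real \<Rightarrow> 'b \<Rightarrow> real"
  assumes X: "\<And>u. u \<in> {0..t} \<Longrightarrow> X u \<in> borel_measurable K"
    and cont: "\<And>w. w \<in> space K \<Longrightarrow> continuous_on {0..t} (\<lambda>u. X u w)"
    and S[measurable]: "S \<in> borel_measurable K"
    and S01: "\<And>w. w \<in> space K \<Longrightarrow> S w \<in> {0..t}"
  shows "(\<lambda>w. X (S w) w) \<in> borel_measurable K"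
proof (cases "space K = {}")
  case False
  then have t: "0 \<le> t" using S01 by force
  \<comment> \<open>Rounding up may leave \<open>{0..t}\<close>; the clamping keeps the rounded time
    where \<open>X\<close> is known to be measurable.\<close>
  define D where "D m x = max 0 (min t (real_of_int \<lceil>x * real (Suc m)\<rceil> / real (Suc m)))" for m x
  show ?thesis
  proof (rule borel_measurable_LIMSEQ_real[where u="\<lambda>m w. X (D m (S w)) w" and u'="\<lambda>w. X (S w) w"])
    fix w assume w: "w \<in> space K"
    have "(\<lambda>m. D m (S w)) \<longlonglongrightarrow> max 0 (min t (S w))"
      unfolding D_def
    proof (intro tendsto_intros)
      show "(\<lambda>m. real_of_int \<lceil>S w * real (Suc m)\<rceil> / real (Suc m)) \<longlonglongrightarrow> S w"
      proof (rule tendsto_sandwich[where f="\<lambda>_. S w" and h="\<lambda>m. S w + inverse (real (Suc m))"])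
        show "(\<lambda>m. S w + inverse (real (Suc m))) \<longlonglongrightarrow> S w"
          using tendsto_add[OF tendsto_const LIMSEQ_inverse_real_of_nat, of "S w"] by simp
        have "real_of_int \<lceil>S w * real (Suc m)\<rceil> \<le> S w * real (Suc m) + 1" for m
          by linarith
        then have "real_of_int \<lceil>S w * real (Suc m)\<rceil> / real (Suc m) \<le> (S w * real (Suc m) + 1) / real (Suc m)" for m
          by (intro divide_right_mono) auto
        moreover have "(S w * real (Suc m) + 1) / real (Suc m) = S w + inverse (real (Suc m))" for m
          by (simp add: field_simps)
        ultimately show "\<forall>\<^sub>F m in sequentially. real_of_int \<lceil>S w * real (Suc m)\<rceil> / real (Suc m) \<le> S w + inverse (real (Suc m))"
          by (intro always_eventually allI) metis
        show "\<forall>\<^sub>F m in sequentially. S w \<le> real_of_int \<lceil>S w * real (Suc m)\<rceil> / real (Suc m)"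
          by (intro always_eventually allI) (simp add: field_simps del: of_nat_Suc)
      qed simp
    qed
    then have "(\<lambda>m. D m (S w)) \<longlonglongrightarrow> S w" using S01[OF w] by simp
    then show "(\<lambda>m. X (D m (S w)) w) \<longlonglongrightarrow> X (S w) w"
      using S01[OF w] t
      by (intro continuous_on_tendsto_compose[OF cont[OF w], where g="\<lambda>m. D m (S w)"]) (auto simp: D_def)
  next
    fix m
    have "(\<lambda>w. (\<lambda>i::int. X (max 0 (min t (real_of_int i / real (Suc m))))) \<lceil>S w * real (Suc m)\<rceil> w)
        \<in> borel_measurable K"
      by (rule measurable_compose_countable) (use t X in \<open>auto\<close>)
    then show "(\<lambda>w. X (D m (S w)) w) \<in> borel_measurable K"
      by (simp add: D_def)
  qed
qed (auto simp: measurable_def)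

section \<open>Complete filtrations and adapted continuous processes\<close>

locale filtered_space = prob_space M for M :: "'a measure" +
  fixes F :: "real \<Rightarrow> 'a measure"
  assumes complete: "complete_filtration M F"
begin

lemma filtration: "filtration (space M) F"
  and subalg: "subalgebra M (F t)"
  using complete by (auto simp: complete_filtration_def)

lemma space_F [simp]: "space (F t) = space M"
  by (rule filtration.space_F[OF filtration])

lemma sets_F_mono: "s \<le> t \<Longrightarrow> sets (F s) \<subseteq> sets (F t)"
  by (rule filtration.sets_F_mono[OF filtration])

lemma sets_F_M: "A \<in> sets (F t) \<Longrightarrow> A \<in> sets M"
  using subalg by (auto simp: subalgebra_def)

lemma measurable_F_mono: "f \<in> borel_measurable (F s) \<Longrightarrow> s \<le> t \<Longrightarrow> f \<in> borel_measurable (F t)"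
  using measurable_mono[of borel borel "F s" "F t"] sets_F_mono by auto

lemma measurable_F_M: "f \<in> borel_measurable (F s) \<Longrightarrow> f \<in> borel_measurable M"
  by (rule measurable_from_subalg[OF subalg])

text \<open>Completeness puts the exceptional set into every \<open>F t\<close>. A process may
  therefore be redefined on it without losing adaptedness, which is how versions with all paths
  continuous are produced later.\<close>

lemma AE_null_setE:
  assumes "AE w in M. P w"
  obtains N where "N \<in> null_sets M" "\<And>w. w \<in> space M - N \<Longrightarrow> P w" "\<And>t. 0 \<le> t \<Longrightarrow> N \<in> sets (F t)"
proof -
  obtain N where N: "{w\<in>space M. \<not> P w} \<subseteq> N" "emeasure M N = 0" "N \<in> sets M"
    using assms by (auto elim: AE_E)
  then have "N \<in> null_sets M" by auto
  moreover have "N \<in> sets (F 0)" using complete calculation by (auto simp: complete_filtration_def)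
  ultimately show ?thesis using N that sets_F_mono[of 0] by blast
qed

lemma continuous_adaptedD:
  assumes "continuous_adapted M F X"
  shows "0 \<le> t \<Longrightarrow> X t \<in> borel_measurable (F t)"
    and "0 \<le> t \<Longrightarrow> X t \<in> borel_measurable M"
    and "0 \<le> s \<Longrightarrow> s \<le> t \<Longrightarrow> X s \<in> borel_measurable (F t)"
    and "w \<in> space M \<Longrightarrow> continuous_on {0..} (\<lambda>t. X t w)"
    and "w \<in> space M \<Longrightarrow> continuous_on {0..u} (\<lambda>t. X t w)"
proof -
  show *: "0 \<le> t \<Longrightarrow> X t \<in> borel_measurable (F t)" for t
    using assms by (auto simp: continuous_adapted_def adapted_def)
  then show "0 \<le> t \<Longrightarrow> X t \<in> borel_measurable M" by (rule measurable_F_M)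
  show "0 \<le> s \<Longrightarrow> s \<le> t \<Longrightarrow> X s \<in> borel_measurable (F t)" using * measurable_F_mono by blast
  show **: "w \<in> space M \<Longrightarrow> continuous_on {0..} (\<lambda>t. X t w)"
    using assms by (auto simp: continuous_adapted_def)
  show "w \<in> space M \<Longrightarrow> continuous_on {0..u} (\<lambda>t. X t w)"
    by (rule continuous_on_subset[OF **]) auto
qed

text \<open>On the product space the first coordinate is itself a random time, so evaluation at a
  random time gives joint measurability.\<close>

lemma continuous_adapted_progressive:
  assumes "continuous_adapted M F X"
  shows "progressive F X"
  unfolding progressive_def
proof (intro allI impI)
  fix t :: real assume t: "0 \<le> t"
  let ?K = "restrict_space borel {0..t} \<Otimes>\<^sub>M F t"
  have sp: "space ?K = {0..t} \<times> space M" by (simp add: space_pair_measure space_restrict_space)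
  have "(\<lambda>z. (\<lambda>u z. X u (snd z)) (fst z) z) \<in> borel_measurable ?K"
  proof (rule measurable_at_random_time[where t=t and X="\<lambda>u z. X u (snd z)" and S=fst])
    show "(\<lambda>z. X u (snd z)) \<in> borel_measurable ?K" if "u \<in> {0..t}" for u
      using continuous_adaptedD(3)[OF assms, of u t] that
      by (intro measurable_compose[OF measurable_snd]) auto
    show "fst \<in> borel_measurable ?K"
      by (intro measurable_compose[OF measurable_fst measurable_restrict_space1]) simp
  qed (use sp continuous_adaptedD(5)[OF assms] in auto)
  then show "(\<lambda>(s, w). X s w) \<in> borel_measurable ?K" by (simp add: case_prod_beta)
qed

lemma progressive_measurable:
  assumes "progressive F H" "0 \<le> t"
  shows "(\<lambda>(s, w). indicator {0..t} s * H s w) \<in> borel_measurable (borel \<Otimes>\<^sub>M F t)"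
proof -
  have P: "(\<lambda>(s, w). H s w) \<in> borel_measurable (restrict_space borel {0..t} \<Otimes>\<^sub>M F t)"
    using assms by (auto simp: progressive_def)
  \<comment> \<open>Clamping the time maps the whole line measurably into \<open>{0..t}\<close>; the
    indicator then hides the values at clamped times.\<close>
  have "(\<lambda>z. (max 0 (min t (fst z)), snd z)) \<in> (borel \<Otimes>\<^sub>M F t) \<rightarrow>\<^sub>M (restrict_space borel {0..t} \<Otimes>\<^sub>M F t)"
    by (intro measurable_Pair measurable_restrict_space2) (use assms in auto)
  from measurable_compose[OF this P]
  have [measurable]: "(\<lambda>z. H (max 0 (min t (fst z))) (snd z)) \<in> borel_measurable (borel \<Otimes>\<^sub>M F t)"
    by simp
  have "(\<lambda>z. indicator {0..t} (fst z) * H (max 0 (min t (fst z))) (snd z)) \<in> borel_measurable (borel \<Otimes>\<^sub>M F t)"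
    by measurable
  moreover have "(\<lambda>z. indicator {0..t} (fst z) * H (max 0 (min t (fst z))) (snd z)) =
     (\<lambda>(s, w). indicator {0..t} s * H s w)"
    by (auto simp: fun_eq_iff indicator_def max_def min_def)
  ultimately show ?thesis by simp
qed

lemma measurable_ident_subalgebra: "(\<lambda>x. x) \<in> M \<rightarrow>\<^sub>M F t"
proof (rule measurableI)
  fix A assume A: "A \<in> sets (F t)"
  then have "(\<lambda>x. x) -` A \<inter> space M = A" using sets.sets_into_space[OF A] by auto
  then show "(\<lambda>x. x) -` A \<inter> space M \<in> sets M" using sets_F_M[OF A] by simp
qed simp

lemma measurable_pair_F_M:
  assumes "f \<in> borel_measurable (borel \<Otimes>\<^sub>M F t)"
  shows "f \<in> borel_measurable (borel \<Otimes>\<^sub>M M)"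
proof -
  have "(\<lambda>z. (fst z, snd z)) \<in> borel \<Otimes>\<^sub>M M \<rightarrow>\<^sub>M borel \<Otimes>\<^sub>M F t"
  proof (intro measurable_Pair)
    have "(\<lambda>x. x) \<in> M \<rightarrow>\<^sub>M F t"
      by (rule measurable_ident_subalgebra)
    from measurable_compose[OF measurable_snd this] show "snd \<in> borel \<Otimes>\<^sub>M M \<rightarrow>\<^sub>M F t" .
  qed simp
  from measurable_compose[OF this assms] show ?thesis by simp
qed

lemma progressive_measurable_M:
  assumes "progressive F H" "0 \<le> t"
  shows "(\<lambda>(s, w). indicator {0..t} s * H s w) \<in> borel_measurable (borel \<Otimes>\<^sub>M M)"
  by (rule measurable_pair_F_M[OF progressive_measurable[OF assms]])

text \<open>Only the exceptional set has to be measurable, not \<open>P\<close>. Finitely many path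
  properties can thus be assumed simultaneously, at the price of adding the error
  probabilities.\<close>

definition likely :: "real \<Rightarrow> ('a \<Rightarrow> bool) \<Rightarrow> bool" where
  "likely e P \<longleftrightarrow> (\<exists>E\<in>sets M. prob E < e \<and> (\<forall>w\<in>space M - E. P w))"

lemma likely_mono: "likely e P \<Longrightarrow> e \<le> e' \<Longrightarrow> (\<And>w. w \<in> space M \<Longrightarrow> P w \<Longrightarrow> Q w) \<Longrightarrow> likely e' Q"
  unfolding likely_def by (meson DiffD1 order_less_le_trans)

lemma likely_conj: "likely e P \<Longrightarrow> likely e' Q \<Longrightarrow> likely (e + e') (\<lambda>w. P w \<and> Q w)"
proof -
  assume "likely e P" "likely e' Q"
  then obtain E E' where E: "E \<in> sets M" "prob E < e" "\<forall>w\<in>space M - E. P w"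
     "E' \<in> sets M" "prob E' < e'" "\<forall>w\<in>space M - E'. Q w" unfolding likely_def by blast
  then have "prob (E \<union> E') < e + e'" using measure_Un_le[of E M E'] by auto
  then show ?thesis using E unfolding likely_def by (intro bexI[of _ "E \<union> E'"]) auto
qed

lemma likely_AE: "AE w in M. P w \<Longrightarrow> 0 < e \<Longrightarrow> likely e P"
proof (erule AE_null_setE)
  fix N assume "0 < e" "N \<in> null_sets M" "\<And>w. w \<in> space M - N \<Longrightarrow> P w"
  then show ?thesis unfolding likely_def by (intro bexI[of _ N]) (auto simp: measure_eq_0_null_sets)
qed

lemma likely_measure_less:
  assumes "likely e P" "{w\<in>space M. \<not> P w} \<in> sets M"
  shows "prob {w\<in>space M. \<not> P w} < e"
proof -
  obtain E where E: "E \<in> sets M" "prob E < e" "\<forall>w\<in>space M - E. P w"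
    using assms(1) unfolding likely_def by blast
  have "prob {w\<in>space M. \<not> P w} \<le> prob E" using E by (intro finite_measure_mono) auto
  then show ?thesis using E by simp
qed

lemma likelyI_measure:
  "{w\<in>space M. \<not> P w} \<in> sets M \<Longrightarrow> prob {w\<in>space M. \<not> P w} < e \<Longrightarrow> likely e P"
  unfolding likely_def by (intro bexI[of _ "{w\<in>space M. \<not> P w}"]) auto

lemma prob_eventually_tendsto_0:
  assumes m: "\<And>n. {w\<in>space M. \<not> P n w} \<in> sets M"
    and ev: "AE w in M. \<forall>\<^sub>F n in sequentially. P n w"
  shows "(\<lambda>n. prob {w\<in>space M. \<not> P n w}) \<longlonglongrightarrow> 0"
proof -
  have "(\<lambda>n. \<integral>w. indicator {w\<in>space M. \<not> P n w} w \<partial>M) \<longlonglongrightarrow> (\<integral>w. (0::real) \<partial>M)"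
  proof (rule integral_dominated_convergence[where w="\<lambda>_. 1"])
    show "AE w in M. (\<lambda>n. indicator {w\<in>space M. \<not> P n w} w :: real) \<longlonglongrightarrow> 0"
      using ev by (auto elim!: eventually_mono intro!: tendsto_eventually)
  qed (use m in \<open>auto intro!: borel_measurable_indicator split: split_indicator\<close>)
  then show ?thesis using m by simp
qed

text \<open>Turns a pathwise limit into a deterministic choice: if almost every path has the
  property from some index on, then one fixed index works off a small event.\<close>

lemma likely_eventually:
  assumes m: "\<And>n. {w\<in>space M. \<not> P n w} \<in> sets M"
    and ev: "AE w in M. \<forall>\<^sub>F n in sequentially. P n w" and e: "0 < e"
  shows "\<forall>\<^sub>F n in sequentially. likely e (P n)"
  using order_tendstoD(2)[OF prob_eventually_tendsto_0[OF m ev] e]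
  by eventually_elim (rule likelyI_measure[OF m])

section \<open>Simple integrals and their limits in probability\<close>

lemma simple_integral_continuous:
  assumes S: "simple_integrand M F S" and X: "continuous_on {0..} (\<lambda>t. X t w)"
  shows "continuous_on {0..} (\<lambda>t. simple_integral X S t w)"
proof -
  obtain n \<tau> \<xi> where [simp]: "S = (n, \<tau>, \<xi>)" by (cases S) auto
  have \<tau>: "0 \<le> \<tau> i" if "i \<le> n" for i
    using that S by (induction i) (auto intro: order_trans)
  show ?thesis
    unfolding simple_integral.simps \<open>S = _\<close>
    using \<tau> by (intro continuous_intros continuous_on_compose2[OF X]) auto
qed

lemma simple_integral_measurable:
  assumes S: "simple_integrand M F S" and X: "\<And>t. 0 \<le> t \<Longrightarrow> X t \<in> borel_measurable M" and "0 \<le> t"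
  shows "simple_integral X S t \<in> borel_measurable M"
proof -
  obtain n \<tau> \<xi> where [simp]: "S = (n, \<tau>, \<xi>)" by (cases S) auto
  have \<tau>: "0 \<le> \<tau> i" if "i \<le> n" for i
    using that S by (induction i) (auto intro: order_trans)
  have "\<xi> i \<in> borel_measurable M" if "i < n" for i
    using S that measurable_F_M by auto
  then have "(\<lambda>w. \<Sum>i<n. \<xi> i w * (X (min t (\<tau> (Suc i))) w - X (min t (\<tau> i)) w)) \<in> borel_measurable M"
    using \<tau> assms(3) by (intro borel_measurable_sum borel_measurable_times borel_measurable_diff X) auto
  then show ?thesis by (simp cong: measurable_cong)
qed

lemma simple_process_measurable:
  assumes S: "simple_integrand M F S"
  shows "(\<lambda>(s, w). simple_process S s w) \<in> borel_measurable (borel \<Otimes>\<^sub>M M)"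
proof -
  obtain n \<tau> \<xi> where [simp]: "S = (n, \<tau>, \<xi>)" by (cases S) auto
  have "\<xi> i \<in> borel_measurable M" if "i < n" for i
    using S that measurable_F_M by auto
  then have "(\<lambda>z. \<Sum>i<n. \<xi> i (snd z) * indicator {\<tau> i<..\<tau> (Suc i)} (fst z)) \<in> borel_measurable (borel \<Otimes>\<^sub>M M)"
    by (intro borel_measurable_sum borel_measurable_times measurable_compose[OF measurable_snd]
       measurable_compose[OF measurable_fst]) auto
  then show ?thesis by (simp add: case_prod_beta)
qed

lemma set_nn_integral_measurable:
  assumes "(\<lambda>(s, w). indicator {0..t} s * f s w) \<in> borel_measurable (borel \<Otimes>\<^sub>M K)"
  shows "(\<lambda>w. \<integral>\<^sup>+s\<in>{0..t::real}. ennreal ((f s w)\<^sup>2) \<partial>lborel) \<in> borel_measurable K"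
proof -
  have [measurable]: "(\<lambda>z. indicator {0..t} (fst z) * f (fst z) (snd z)) \<in> borel_measurable (borel \<Otimes>\<^sub>M K)"
    using assms by (simp add: case_prod_beta)
  have "(\<lambda>z. indicator {0..t} (snd z) * f (snd z) (fst z)) \<in> borel_measurable (K \<Otimes>\<^sub>M lborel)"
    by (rule measurable_compose[where g="\<lambda>z. indicator {0..t} (fst z) * f (fst z) (snd z)"
        and f="\<lambda>z. (snd z, fst z)" and N="borel \<Otimes>\<^sub>M K", simplified]) measurable
  then have "(\<lambda>w. \<integral>\<^sup>+s. ennreal ((indicator {0..t} s * f s w)\<^sup>2) \<partial>lborel) \<in> borel_measurable K"
    by (intro sigma_finite_measure.borel_measurable_nn_integral sigma_finite_lborel) (simp add: case_prod_beta)
  also have "(\<lambda>w. \<integral>\<^sup>+s. ennreal ((indicator {0..t} s * f s w)\<^sup>2) \<partial>lborel) =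
     (\<lambda>w. \<integral>\<^sup>+s\<in>{0..t}. ennreal ((f s w)\<^sup>2) \<partial>lborel)"
    by (intro ext nn_integral_cong) (auto split: split_indicator)
  finally show ?thesis .
qed

lemma qdist_measurable:
  assumes "progressive F H" "simple_integrand M F S" "0 \<le> t"
  shows "(\<lambda>w. \<integral>\<^sup>+s\<in>{0..t}. ennreal ((simple_process S s w - H s w)\<^sup>2) \<partial>lborel) \<in> borel_measurable M"
proof (rule set_nn_integral_measurable)
  have [measurable]: "(\<lambda>z. simple_process S (fst z) (snd z)) \<in> borel_measurable (borel \<Otimes>\<^sub>M M)"
    "(\<lambda>z. indicator {0..t} (fst z) * H (fst z) (snd z)) \<in> borel_measurable (borel \<Otimes>\<^sub>M M)"
    using simple_process_measurable[OF assms(2)] progressive_measurable_M[OF assms(1,3)]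
    by (simp_all add: case_prod_beta)
  show "(\<lambda>(s, w). indicator {0..t} s * (simple_process S s w - H s w)) \<in> borel_measurable (borel \<Otimes>\<^sub>M M)"
    by (simp add: case_prod_beta right_diff_distrib)
qed

text \<open>The approximation clause of \<open>ito_integral\<close> with a single accuracy in place
  of a sequence: the same \<open>e\<close> bounds the exceptional probability, the energy distance
  and the uniform distance. In this form approximations can be built for one horizon and one
  accuracy at a time.\<close>

definition ito_approx :: "(real \<Rightarrow> 'a \<Rightarrow> real) \<Rightarrow> (real \<Rightarrow> 'a \<Rightarrow> real) \<Rightarrow> (real \<Rightarrow> 'a \<Rightarrow> real) \<Rightarrow> bool" where
  "ito_approx B H I \<longleftrightarrow> (\<forall>t\<ge>0. \<forall>e>0. \<exists>S. simple_integrand M F S \<and>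
     likely e (\<lambda>w. (sq_int {0..t} (\<lambda>s. simple_process S s w - H s w)) \<le> ennreal e \<and>
       (\<forall>s\<in>{0..t}. \<bar>simple_integral B S s w - I s w\<bar> \<le> e)))"

lemma ito_sup_sets:
  assumes "continuous_adapted M F B" "continuous_adapted M F I" "simple_integrand M F S" "0 \<le> t"
  shows "{w\<in>space M. \<exists>s\<in>{0..t}. e < \<bar>simple_integral B S s w - I s w\<bar>} \<in> sets M"
proof (rule measurable_exceed)
  show "(\<lambda>w. \<bar>simple_integral B S u w - I u w\<bar>) \<in> borel_measurable M" if "u \<in> {0..t}" for u
    using simple_integral_measurable[OF assms(3) continuous_adaptedD(2)[OF assms(1)]]
      continuous_adaptedD(2)[OF assms(2)] that by simp
  show "continuous_on {0..t} (\<lambda>u. \<bar>simple_integral B S u w - I u w\<bar>)" if "w \<in> space M" for w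
    using that
    by (intro continuous_intros continuous_adaptedD[OF assms(2)]
       continuous_on_subset[OF simple_integral_continuous[OF assms(3) continuous_adaptedD(4)[OF assms(1)]]]) auto
qed fact

lemma ito_approxI:
  assumes "continuous_adapted M F B" "ito_integral M F B H I"
  shows "ito_approx B H I"
  unfolding ito_approx_def
proof (intro allI impI)
  fix t e :: real assume te: "0 \<le> t" "0 < e"
  have prog: "progressive F H" and I: "continuous_adapted M F I"
    using assms(2) by (auto simp: ito_integral_def)
  obtain S where S: "\<And>k. simple_integrand M F (S k)"
    and 1: "\<And>t \<epsilon>. t\<ge>0 \<Longrightarrow> \<epsilon>>0 \<Longrightarrow> (\<lambda>k. prob {w\<in>space M.
              ennreal \<epsilon> < (sq_int {0..t} (\<lambda>s. simple_process (S k) s w - H s w))})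
           \<longlonglongrightarrow> 0"
    and 2: "\<And>t \<epsilon>. t\<ge>0 \<Longrightarrow> \<epsilon>>0 \<Longrightarrow>
           (\<lambda>k. prob {w\<in>space M. \<exists>s\<in>{0..t}. \<epsilon> < \<bar>simple_integral B (S k) s w - I s w\<bar>}) \<longlonglongrightarrow> 0"
    using assms(2) unfolding ito_integral_def by blast
  have "\<forall>\<^sub>F k in sequentially.
     prob {w\<in>space M. ennreal e < (sq_int {0..t} (\<lambda>s. simple_process (S k) s w - H s w))} < e/2 \<and>
     prob {w\<in>space M. \<exists>s\<in>{0..t}. e < \<bar>simple_integral B (S k) s w - I s w\<bar>} < e/2"
    using te by (intro eventually_conj order_tendstoD(2)[OF 1] order_tendstoD(2)[OF 2]) auto
  then obtain k where k:
     "prob {w\<in>space M. ennreal e < (sq_int {0..t} (\<lambda>s. simple_process (S k) s w - H s w))} < e/2"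
     "prob {w\<in>space M. \<exists>s\<in>{0..t}. e < \<bar>simple_integral B (S k) s w - I s w\<bar>} < e/2"
    by (auto simp: eventually_sequentially)
  have "likely (e/2 + e/2) (\<lambda>w. (sq_int {0..t} (\<lambda>s. simple_process (S k) s w - H s w)) \<le> ennreal e \<and>
       (\<forall>s\<in>{0..t}. \<bar>simple_integral B (S k) s w - I s w\<bar> \<le> e))"
  proof (intro likely_conj likelyI_measure)
    have [measurable]: "(\<lambda>w. \<integral>\<^sup>+s\<in>{0..t}. ennreal ((simple_process (S k) s w - H s w)\<^sup>2) \<partial>lborel) \<in> borel_measurable M"
      by (rule qdist_measurable[OF prog S te(1)])
    show "{w\<in>space M. \<not> (sq_int {0..t} (\<lambda>s. simple_process (S k) s w - H s w)) \<le> ennreal e} \<in> sets M"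
      by measurable
  qed (use k ito_sup_sets[OF assms(1) I S te(1), of e] in \<open>auto simp: not_le\<close>)
  then show "\<exists>S. simple_integrand M F S \<and>
     likely e (\<lambda>w. (sq_int {0..t} (\<lambda>s. simple_process S s w - H s w)) \<le> ennreal e \<and>
       (\<forall>s\<in>{0..t}. \<bar>simple_integral B S s w - I s w\<bar> \<le> e))"
    using S by (intro exI[of _ "S k"] conjI) simp_all
qed

text \<open>Diagonal choice: the simple integrand with index \<open>k\<close> is taken for horizon
  \<open>k\<close> and accuracy \<open>1/(k+1)\<close>, hence eventually serves every fixed horizon
  and accuracy.\<close>

lemma ito_integralI:
  assumes H: "progressive F H" "AE w in M. \<forall>t\<ge>0. set_integrable lborel {0..t} (\<lambda>s. (H s w)\<^sup>2)"
    and I: "continuous_adapted M F I" and ap: "ito_approx B H I"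
  shows "ito_integral M F B H I"
proof -
  have "\<exists>S. simple_integrand M F S \<and>
     likely (inverse (real (Suc k))) (\<lambda>w. (sq_int {0..real k} (\<lambda>s. simple_process S s w - H s w)) \<le> ennreal (inverse (real (Suc k))) \<and>
       (\<forall>s\<in>{0..real k}. \<bar>simple_integral B S s w - I s w\<bar> \<le> inverse (real (Suc k))))" for k
    using ap[unfolded ito_approx_def, rule_format, of "real k" "inverse (real (Suc k))"] by simp
  then obtain S where S: "\<And>k. simple_integrand M F (S k)"
     "\<And>k. likely (inverse (real (Suc k))) (\<lambda>w. (sq_int {0..real k} (\<lambda>s. simple_process (S k) s w - H s w)) \<le> ennreal (inverse (real (Suc k))) \<and>
       (\<forall>s\<in>{0..real k}. \<bar>simple_integral B (S k) s w - I s w\<bar> \<le> inverse (real (Suc k))))"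
    using choice[where Q="\<lambda>k S. simple_integrand M F S \<and>
     likely (inverse (real (Suc k))) (\<lambda>w. (sq_int {0..real k} (\<lambda>s. simple_process S s w - H s w)) \<le> ennreal (inverse (real (Suc k))) \<and>
       (\<forall>s\<in>{0..real k}. \<bar>simple_integral B S s w - I s w\<bar> \<le> inverse (real (Suc k))))"] by blast
  have lim: "(\<lambda>k. inverse (real (Suc k))) \<longlonglongrightarrow> 0" by (rule LIMSEQ_inverse_real_of_nat)
  \<comment> \<open>One estimate for both convergence clauses: once \<open>k\<close> passes
    \<open>t\<close> and \<open>1/(k+1)\<close> is below the threshold, the bad event
    \<open>Q k\<close> lies in an exceptional set of probability below
    \<open>1/(k+1)\<close>.\<close>
  have key: "(\<lambda>k. prob {w\<in>space M. Q k w}) \<longlonglongrightarrow> 0"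
    if Q: "\<And>k w. real k \<ge> t \<Longrightarrow> inverse (real (Suc k)) < \<epsilon> \<Longrightarrow> w \<in> space M \<Longrightarrow>
      (sq_int {0..real k} (\<lambda>s. simple_process (S k) s w - H s w)) \<le> ennreal (inverse (real (Suc k))) \<Longrightarrow>
       (\<forall>s\<in>{0..real k}. \<bar>simple_integral B (S k) s w - I s w\<bar> \<le> inverse (real (Suc k))) \<Longrightarrow> \<not> Q k w"
      and \<epsilon>: "\<epsilon> > 0" for Q t \<epsilon>
  proof (rule tendsto_sandwich[OF _ _ tendsto_const lim])
    have "\<forall>\<^sub>F k in sequentially. real k \<ge> t \<and> inverse (real (Suc k)) < \<epsilon>"
      using order_tendstoD(2)[OF lim \<epsilon>] eventually_ge_at_top[of "nat \<lceil>t\<rceil>"]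
      by eventually_elim linarith
    then show "\<forall>\<^sub>F k in sequentially. prob {w\<in>space M. Q k w} \<le> inverse (real (Suc k))"
    proof eventually_elim
      case (elim k)
      obtain E where E: "E \<in> sets M" "prob E < inverse (real (Suc k))" "\<And>w. w \<in> space M - E \<Longrightarrow> \<not> Q k w"
        using S(2)[of k] Q elim unfolding likely_def by (metis (no_types, lifting) DiffD1)
      have "prob {w\<in>space M. Q k w} \<le> prob E" using E by (intro finite_measure_mono) auto
      then show ?case using E by simp
    qed
  qed (auto simp: measure_nonneg)
  show ?thesis unfolding ito_integral_def
  proof (intro conjI H I exI[of _ S] allI impI S(1))
    fix t \<epsilon> :: real assume "0 \<le> t" and e: "0 < \<epsilon>"
    show "(\<lambda>k. prob {w\<in>space M. ennreal \<epsilon> < (sq_int {0..t} (\<lambda>s. simple_process (S k) s w - H s w))}) \<longlonglongrightarrow> 0"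
    proof (rule key[OF _ e, of t], unfold not_less)
      fix k w assume k: "real k \<ge> t" "inverse (real (Suc k)) < \<epsilon>"
       and b: "(sq_int {0..real k} (\<lambda>s. simple_process (S k) s w - H s w)) \<le> ennreal (inverse (real (Suc k)))"
      have "(sq_int {0..t} (\<lambda>s. simple_process (S k) s w - H s w)) \<le>
        (sq_int {0..real k} (\<lambda>s. simple_process (S k) s w - H s w))"
        using k by (intro nn_integral_mono) (auto split: split_indicator)
      also note b
      also have "ennreal (inverse (real (Suc k))) \<le> ennreal \<epsilon>" using k by (intro ennreal_leI) simp
      finally show "(sq_int {0..t} (\<lambda>s. simple_process (S k) s w - H s w)) \<le> ennreal \<epsilon>" .
    qed
    show "(\<lambda>k. prob {w\<in>space M. \<exists>s\<in>{0..t}. \<epsilon> < \<bar>simple_integral B (S k) s w - I s w\<bar>}) \<longlonglongrightarrow> 0"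
      by (rule key[OF _ e, of t]) force
  qed
qed

text \<open>The first time at which \<open>K\<close> reaches level 1, capped at \<open>t\<close>;
  inserting \<open>t\<close> keeps the set non-empty. The level is normalised because several
  thresholds are stopped at once by taking \<open>K\<close> as a maximum of rescaled
  processes.\<close>

definition hit :: "real \<Rightarrow> (real \<Rightarrow> 'a \<Rightarrow> real) \<Rightarrow> 'a \<Rightarrow> real" where
  "hit t K w = Inf (insert t {s\<in>{0..t}. 1 \<le> K s w})"

text \<open>For \<open>u < t\<close> the inserted point \<open>t\<close> cannot account for an
  infimum below \<open>u\<close>, and the closed set of times above the level attains its
  infimum.\<close>

lemma hit_le_iff:
  assumes "continuous_on {0..t} (\<lambda>s. K s w)" "0 \<le> t" "u < t"
  shows "hit t K w \<le> u \<longleftrightarrow> (\<exists>s\<in>{0..u}. 1 \<le> K s w)"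
proof -
  let ?A = "insert t {s\<in>{0..t}. 1 \<le> K s w}"
  have "{s\<in>{0..t}. 1 \<le> K s w} = {0..t} \<inter> (\<lambda>s. K s w) -` {1..}" by auto
  also have "closed \<dots>" by (rule continuous_closed_preimage[OF assms(1)]) auto
  finally have "closed ?A" by (rule closed_insert)
  moreover have bdd: "bdd_below ?A" by (rule bdd_belowI[of _ 0]) (use assms in auto)
  ultimately have "Inf ?A \<in> ?A" by (intro closed_contains_Inf) auto
  moreover have "Inf ?A \<le> s" if "s \<in> {0..u}" "1 \<le> K s w" for s
    using that assms by (intro cInf_lower bdd) auto
  ultimately show ?thesis unfolding hit_def using assms by (fastforce intro: order_trans)
qed

lemma hit_props:
  assumes "continuous_on {0..t} (\<lambda>s. K s w)" "0 \<le> t"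
  shows "0 \<le> hit t K w" "hit t K w \<le> t" "\<And>s. 0 \<le> s \<Longrightarrow> s < hit t K w \<Longrightarrow> K s w < 1"
    "(\<exists>s\<in>{0..t}. 1 \<le> K s w) \<Longrightarrow> 1 \<le> K (hit t K w) w"
    "K 0 w \<le> 1 \<Longrightarrow> K (hit t K w) w \<le> 1"
    "\<And>s. 0 \<le> s \<Longrightarrow> s \<le> t \<Longrightarrow> 1 \<le> K s w \<Longrightarrow> hit t K w \<le> s"
proof -
  let ?A = "insert t {s\<in>{0..t}. 1 \<le> K s w}"
  have "{s\<in>{0..t}. 1 \<le> K s w} = {0..t} \<inter> (\<lambda>s. K s w) -` {1..}" by auto
  also have "closed \<dots>" by (rule continuous_closed_preimage[OF assms(1)]) auto
  finally have cl: "closed {s\<in>{0..t}. 1 \<le> K s w}" "closed ?A" by auto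
  have bdd: "bdd_below ?A" "bdd_below {s\<in>{0..t}. 1 \<le> K s w}"
    by (auto intro!: bdd_belowI[of _ 0] simp: assms)
  have inA: "Inf ?A \<in> ?A" by (intro closed_contains_Inf cl bdd) auto
  show 0: "0 \<le> hit t K w" "hit t K w \<le> t" using inA assms unfolding hit_def by auto
  show 6: "hit t K w \<le> s" if "0 \<le> s" "s \<le> t" "1 \<le> K s w" for s
    unfolding hit_def by (rule cInf_lower) (use that bdd in auto)
  show lt: "K s w < 1" if "0 \<le> s" "s < hit t K w" for s
    using 6[of s] that 0 by force
  show "1 \<le> K (hit t K w) w" if "\<exists>s\<in>{0..t}. 1 \<le> K s w"
  proof (rule ccontr)
    assume n: "\<not> ?thesis"
    from \<open>\<exists>s\<in>{0..t}. 1 \<le> K s w\<close> obtain s where s: "s \<in> {0..t}" "1 \<le> K s w" ..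
    then have "hit t K w \<le> s" using 6 by auto
    moreover have "hit t K w = t" using inA n unfolding hit_def by auto
    ultimately show False using s n by auto
  qed
  \<comment> \<open>No overshoot: the value at a positive hitting time is the limit from the left of
    values below 1, and at hitting time 0 it is the initial value.\<close>
  show "K (hit t K w) w \<le> 1" if "K 0 w \<le> 1"
  proof (cases "hit t K w = 0")
    case False
    then have pos: "0 < hit t K w" using 0 by simp
    have "continuous (at_left (hit t K w)) (\<lambda>s. K s w)"
      using assms(1) pos 0 by (metis at_within_Icc_at_left atLeastAtMost_iff continuous_on_subset
        continuous_on_eq_continuous_within less_imp_le order_refl atLeastatMost_subset_iff)
    then have "((\<lambda>s. K s w) \<longlongrightarrow> K (hit t K w) w) (at_left (hit t K w))"
      by (simp add: continuous_within)
    then show ?thesis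
    proof (rule tendsto_upperbound)
      show "\<forall>\<^sub>F s in at_left (hit t K w). K s w \<le> 1"
        using eventually_at_left[of 0 "hit t K w"] pos lt by (auto intro!: exI[of _ 0] less_imp_le)
    qed simp
  qed (use that in simp)
qed

lemma hit_stopping_time:
  assumes K: "continuous_adapted M F K" and t: "0 \<le> t"
  shows "stopping_time F (hit t K)"
proof (rule stopping_timeI)
  fix u
  have cont: "continuous_on {0..t} (\<lambda>s. K s w)" if "w \<in> space M" for w
    by (rule continuous_adaptedD(5)[OF K that])
  show "Measurable.pred (F u) (\<lambda>w. hit t K w \<le> u)"
  proof (cases "u < t")
    case False
    then have "hit t K w \<le> u" if "w \<in> space (F u)" for w
      using hit_props(2)[where K=K, OF cont t] that by force
    then have "{w\<in>space (F u). hit t K w \<le> u} = space (F u)" by auto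
    then show ?thesis unfolding pred_def by (simp only: sets.top)
  next
    case True
    have "{w\<in>space (F u). hit t K w \<le> u} = {w\<in>space (F u). \<exists>s\<in>{0..u}. 1 \<le> K s w}"
      using hit_le_iff[where K=K, OF cont t True] by auto
    also have "\<dots> \<in> sets (F u)"
    proof (cases "0 \<le> u")
      case True
      then show ?thesis
        by (intro measurable_reach continuous_adaptedD[OF K]) auto
    qed auto
    finally show ?thesis by (simp add: pred_def)
  qed
qed

lemma stopping_time_measurable_M:
  assumes "stopping_time F T"
  shows "T \<in> borel_measurable M"
  using subalg by (intro measurable_stopping_time[OF assms]) (auto simp: subalgebra_def)

end

subsection \<open>Simple integrands and Brownian increments\<close>

type_synonym 'b step_list = "(real \<times> real \<times> ('b \<Rightarrow> real)) list"

text \<open>The list may contain overlapping intervals in any order, which makes sums and products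
  of integrands easy. The test function \<open>\<phi>\<close> covers both uses: the indicator of
  \<open>s \<le> x\<close> yields the value of the process at \<open>s\<close>, and
  \<open>X (min t x)\<close> yields the integral up to \<open>t\<close>.\<close>

definition step_sum :: "(real \<Rightarrow> real) \<Rightarrow> 'b step_list \<Rightarrow> 'b \<Rightarrow> real" where
  "step_sum \<phi> xs w = (\<Sum>(a, b, \<eta>)\<leftarrow>xs. \<eta> w * (\<phi> b - \<phi> a))"

lemma step_sum_simps [simp]:
  "step_sum \<phi> [] w = 0"
  "step_sum \<phi> ((a, b, \<eta>) # xs) w = \<eta> w * (\<phi> b - \<phi> a) + step_sum \<phi> xs w"
  "step_sum \<phi> (xs @ ys) w = step_sum \<phi> xs w + step_sum \<phi> ys w"
  by (simp_all add: step_sum_def)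

lemma sum_telescope_between:
  fixes f :: "nat \<Rightarrow> real"
  assumes "j \<le> k" "k \<le> n"
  shows "(\<Sum>i<n. (if j \<le> i \<and> i < k then 1 else 0) * (f (Suc i) - f i)) = f k - f j"
proof -
  have "(\<Sum>i<n. (if j \<le> i \<and> i < k then 1 else 0) * (f (Suc i) - f i)) = (\<Sum>i=j..<k. f (Suc i) - f i)"
    using assms by (intro sum.mono_neutral_cong_right) auto
  also have "\<dots> = f k - f j" using assms by (simp add: sum_Suc_diff')
  finally show ?thesis .
qed

lemma indicator_Ioc_eq_diff:
  "a \<le> b \<Longrightarrow> indicator {a<..b} (s::real) = (if s \<le> b then 1 else 0) - (if s \<le> a then 1 else (0::real))"
  by (auto simp: indicator_def)

context filtered_space begin

definition step_list_adapted :: "'a step_list \<Rightarrow> bool" where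
  "step_list_adapted xs \<longleftrightarrow> (\<forall>(a, b, \<eta>)\<in>set xs. 0 \<le> a \<and> a \<le> b \<and> \<eta> \<in> borel_measurable (F a) \<and>
     (\<exists>C. \<forall>w\<in>space M. \<bar>\<eta> w\<bar> \<le> C))"

lemma step_list_adapted_simps [simp]:
  "step_list_adapted []"
  "step_list_adapted ((a, b, \<eta>) # xs) \<longleftrightarrow> 0 \<le> a \<and> a \<le> b \<and> \<eta> \<in> borel_measurable (F a) \<and>
     (\<exists>C. \<forall>w\<in>space M. \<bar>\<eta> w\<bar> \<le> C) \<and> step_list_adapted xs"
  "step_list_adapted (xs @ ys) \<longleftrightarrow> step_list_adapted xs \<and> step_list_adapted ys"
  unfolding step_list_adapted_def by (simp_all add: ball_Un)

text \<open>The coefficient of a cell is the sum of the \<open>\<eta>\<close> of all entries whose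
  interval contains it. Such an \<open>\<eta>\<close> is known at the left end of its interval,
  hence at the start of the cell.\<close>

lemma step_list_on_partition:
  assumes "step_list_adapted xs" and \<tau>: "strict_mono_on {..n} \<tau>" "0 \<le> \<tau> 0"
    and "\<forall>(a, b, \<eta>)\<in>set xs. a \<in> \<tau> ` {..n} \<and> b \<in> \<tau> ` {..n}"
  shows "\<exists>\<xi>. simple_integrand M F (n, \<tau>, \<xi>) \<and>
    (\<forall>\<phi> w. (\<Sum>i<n. \<xi> i w * (\<phi> (\<tau> (Suc i)) - \<phi> (\<tau> i))) = step_sum \<phi> xs w)"
  using assms(1,4)
proof (induction xs)
  case Nil
  have "\<forall>i<n. \<tau> i \<le> \<tau> (Suc i)" using \<tau>(1) by (auto simp: strict_mono_on_def intro!: less_imp_le)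
  then show ?case using \<tau>(2) by (intro exI[of _ "\<lambda>_ _. 0"]) auto
next
  case (Cons x xs)
  obtain a b \<eta> where x: "x = (a, b, \<eta>)" by (cases x) auto
  obtain \<xi> where \<xi>: "simple_integrand M F (n, \<tau>, \<xi>)"
    "\<And>\<phi> w. (\<Sum>i<n. \<xi> i w * (\<phi> (\<tau> (Suc i)) - \<phi> (\<tau> i))) = step_sum \<phi> xs w"
    using Cons x by auto
  obtain j k where jk: "a = \<tau> j" "b = \<tau> k" "j \<le> n" "k \<le> n"
    using Cons.prems x by auto
  have ab: "0 \<le> a" "a \<le> b" "\<eta> \<in> borel_measurable (F a)" "\<exists>C. \<forall>w\<in>space M. \<bar>\<eta> w\<bar> \<le> C"
    using Cons.prems x by auto
  have "j \<le> k" using jk ab(2) strict_mono_onD[OF \<tau>(1), of k j] by fastforce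
  define \<zeta> where "\<zeta> i w = \<xi> i w + \<eta> w * (if j \<le> i \<and> i < k then 1 else 0)" for i w
  have mono: "\<tau> i \<le> \<tau> i'" if "i \<le> i'" "i' \<le> n" for i i'
    using strict_mono_onD[OF \<tau>(1), of i i'] that by (cases "i = i'") auto
  have "simple_integrand M F (n, \<tau>, \<zeta>)"
    unfolding simple_integrand.simps
  proof (intro conjI allI impI)
    fix i assume i: "i < n"
    have "\<eta> \<in> borel_measurable (F (\<tau> i))" if "j \<le> i"
      using measurable_F_mono[OF ab(3)] jk mono[OF that] i by auto
    then have "(\<lambda>w. \<eta> w * (if j \<le> i \<and> i < k then 1 else 0)) \<in> borel_measurable (F (\<tau> i))"
      by (cases "j \<le> i \<and> i < k") auto
    then show "\<zeta> i \<in> borel_measurable (F (\<tau> i))"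
      using \<xi>(1) i unfolding \<zeta>_def by (intro borel_measurable_add) auto
    obtain C D where "\<forall>w\<in>space M. \<bar>\<eta> w\<bar> \<le> C" "\<forall>w\<in>space M. \<bar>\<xi> i w\<bar> \<le> D"
      using ab(4) \<xi>(1) i by auto
    then have "\<bar>\<zeta> i w\<bar> \<le> C + D" if "w \<in> space M" for w
      using that unfolding \<zeta>_def by (force intro: order_trans[OF abs_triangle_ineq])
    then show "\<exists>C. \<forall>w\<in>space M. \<bar>\<zeta> i w\<bar> \<le> C" by blast
  qed (use \<xi>(1) in auto)
  moreover have "(\<Sum>i<n. \<zeta> i w * (\<phi> (\<tau> (Suc i)) - \<phi> (\<tau> i))) = step_sum \<phi> (x # xs) w" for \<phi> w
  proof -
    have "(\<Sum>i<n. \<zeta> i w * (\<phi> (\<tau> (Suc i)) - \<phi> (\<tau> i))) = step_sum \<phi> xs w +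
       \<eta> w * (\<Sum>i<n. (if j \<le> i \<and> i < k then 1 else 0) * (\<phi> (\<tau> (Suc i)) - \<phi> (\<tau> i)))"
      unfolding \<zeta>_def \<xi>(2)[symmetric] sum_distrib_left sum.distrib[symmetric]
      by (intro sum.cong) (auto simp: algebra_simps)
    then show ?thesis
      using sum_telescope_between[of j k n "\<lambda>i. \<phi> (\<tau> i)"] \<open>j \<le> k\<close> jk x by simp
  qed
  ultimately show ?case by blast
qed

lemma step_list_simple:
  assumes "step_list_adapted xs"
  obtains n \<tau> \<xi> where "simple_integrand M F (n, \<tau>, \<xi>)"
    "\<And>\<phi> w. (\<Sum>i<n. \<xi> i w * (\<phi> (\<tau> (Suc i)) - \<phi> (\<tau> i))) = step_sum \<phi> xs w"
proof -
  \<comment> \<open>The point 0 keeps the set of endpoints non-empty even for an empty list, so that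
    a first partition point exists.\<close>
  define P where "P = insert 0 ((\<lambda>(a, b, \<eta>). a) ` set xs \<union> (\<lambda>(a, b, \<eta>). b) ` set xs)"
  have P: "finite P" "P \<noteq> {}" "\<And>x. x \<in> P \<Longrightarrow> 0 \<le> x"
    using assms unfolding P_def by (auto simp: step_list_adapted_def split: prod.splits)
  define \<sigma> where "\<sigma> = sorted_list_of_set P"
  define n where "n = length \<sigma> - 1"
  have len: "length \<sigma> = Suc n" using P unfolding n_def \<sigma>_def by (simp add: card_gt_0_iff)
  have set: "set \<sigma> = P" using P by (simp add: \<sigma>_def)
  have im: "(!) \<sigma> ` {..n} = P" unfolding set[symmetric] using len by (auto simp: in_set_conv_nth less_Suc_eq_le)
  have "strict_mono_on {..n} ((!) \<sigma>)"
    using strict_sorted_iff[of \<sigma>] len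
    by (auto intro!: strict_mono_onI sorted_wrt_nth_less[of "(<)"] simp: \<sigma>_def)
  moreover have "0 \<le> \<sigma> ! 0" using P(3) im by auto
  moreover have "\<forall>(a, b, \<eta>)\<in>set xs. a \<in> (!) \<sigma> ` {..n} \<and> b \<in> (!) \<sigma> ` {..n}"
    unfolding im P_def by force
  ultimately show ?thesis using step_list_on_partition[OF assms, of n "(!) \<sigma>"] that by blast
qed

definition steps_of :: "'a simple_data \<Rightarrow> 'a step_list" where
  "steps_of S = (case S of (n, \<tau>, \<xi>) \<Rightarrow> map (\<lambda>i. (\<tau> i, \<tau> (Suc i), \<xi> i)) [0..<n])"

lemma simple_partition_nonneg:
  "simple_integrand M F (n, \<tau>, \<xi>) \<Longrightarrow> i \<le> n \<Longrightarrow> 0 \<le> \<tau> i"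
  by (induction i) (auto intro: order_trans)

lemma simple_partition_mono:
  "simple_integrand M F (n, \<tau>, \<xi>) \<Longrightarrow> i \<le> j \<Longrightarrow> j \<le> n \<Longrightarrow> \<tau> i \<le> \<tau> j"
proof (induction j)
  case (Suc j) then show ?case
    using le_SucE[of i j] by (cases "i = Suc j") (auto intro: order_trans[of _ "\<tau> j"])
qed auto

lemma step_sum_steps_of:
  "step_sum \<phi> (steps_of (n, \<tau>, \<xi>)) w = (\<Sum>i<n. \<xi> i w * (\<phi> (\<tau> (Suc i)) - \<phi> (\<tau> i)))"
  by (induction n) (auto simp: steps_of_def)

lemma steps_of_adapted: "simple_integrand M F S \<Longrightarrow> step_list_adapted (steps_of S)"
  using simple_partition_nonneg by (cases S) (auto simp: step_list_adapted_def steps_of_def)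

lemma simple_process_eq_step_sum:
  assumes "simple_integrand M F (n, \<tau>, \<xi>)"
  shows "simple_process (n, \<tau>, \<xi>) s w = (\<Sum>i<n. \<xi> i w * ((\<lambda>x. if s \<le> x then 1 else 0) (\<tau> (Suc i)) - (\<lambda>x. if s \<le> x then 1 else 0) (\<tau> i)))"
  using assms by (simp add: indicator_Ioc_eq_diff)

lemma simple_of_steps:
  assumes "step_list_adapted xs"
  obtains S where "simple_integrand M F S"
    "\<And>s w. simple_process S s w = step_sum (\<lambda>x. if s \<le> x then 1 else 0) xs w"
    "\<And>X t w. simple_integral X S t w = step_sum (\<lambda>x. X (min t x) w) xs w"
proof -
  obtain n \<tau> \<xi> where S: "simple_integrand M F (n, \<tau>, \<xi>)"
    "\<And>\<phi> w. (\<Sum>i<n. \<xi> i w * (\<phi> (\<tau> (Suc i)) - \<phi> (\<tau> i))) = step_sum \<phi> xs w"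
    by (rule step_list_simple[OF assms]) (rule that)
  show ?thesis
  proof (rule that[OF S(1)])
    show "simple_process (n, \<tau>, \<xi>) s w = step_sum (\<lambda>x. if s \<le> x then 1 else 0) xs w" for s w
      by (subst simple_process_eq_step_sum[OF S(1)]) (rule S(2))
    show "simple_integral X (n, \<tau>, \<xi>) t w = step_sum (\<lambda>x. X (min t x) w) xs w" for X t w
      unfolding simple_integral.simps by (rule S(2)[of w "\<lambda>x. X (min t x) w"])
  qed
qed

lemma steps_of_process:
  "simple_integrand M F S \<Longrightarrow> step_sum (\<lambda>x. if s \<le> x then 1 else 0) (steps_of S) w = simple_process S s w"
  by (cases S) (simp only: step_sum_steps_of simple_process_eq_step_sum)

lemma steps_of_integral:
  "step_sum (\<lambda>x. X (min t x) w) (steps_of S) w = simple_integral X S t w"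
  by (cases S) (simp only: step_sum_steps_of simple_integral.simps)

lemma simple_diff:
  assumes "simple_integrand M F S" "simple_integrand M F S'"
  obtains U where "simple_integrand M F U"
    "\<And>s w. simple_process U s w = simple_process S s w - simple_process S' s w"
    "\<And>X t w. simple_integral X U t w = simple_integral X S t w - simple_integral X S' t w"
proof -
  let ?ys = "map (\<lambda>(a, b, \<eta>). (a, b, \<lambda>w. - \<eta> w)) (steps_of S')"
  have neg: "step_sum \<phi> (map (\<lambda>(a, b, \<eta>). (a, b, \<lambda>w. - \<eta> w)) xs) w = - step_sum \<phi> xs w"
    for \<phi> w and xs :: "'a step_list" by (induction xs) (auto simp: algebra_simps)
  have "step_list_adapted (steps_of S @ ?ys)"
    using steps_of_adapted[OF assms(1)] steps_of_adapted[OF assms(2)]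
    by (fastforce simp: step_list_adapted_def)
  then obtain U where U: "simple_integrand M F U"
    "\<And>s w. simple_process U s w = step_sum (\<lambda>x. if s \<le> x then 1 else 0) (steps_of S @ ?ys) w"
    "\<And>X t w. simple_integral X U t w = step_sum (\<lambda>x. X (min t x) w) (steps_of S @ ?ys) w"
    by (rule simple_of_steps) blast
  show ?thesis
    by (rule that[OF U(1)])
      (simp_all only: U step_sum_simps neg steps_of_process[OF assms(1)] steps_of_process[OF assms(2)] steps_of_integral
        diff_conv_add_uminus)
qed

text \<open>Cuts each entry down to the window from \<open>v\<close> to \<open>u'\<close> and
  multiplies it by \<open>\<psi>\<close>. The outer \<open>max a\<close> matters when
  \<open>a > u'\<close>: the clipped interval is then empty, but has to sit at a time when
  \<open>\<eta>\<close> is already known.\<close>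

definition steps_restrict :: "real \<Rightarrow> real \<Rightarrow> ('a \<Rightarrow> real) \<Rightarrow> 'a step_list \<Rightarrow> 'a step_list" where
  "steps_restrict v u' \<psi> xs = map (\<lambda>(a, b, \<eta>). (max a (max v (min a u')), max a (max v (min b u')), \<lambda>w. \<psi> w * \<eta> w)) xs"

lemma steps_restrict_adapted:
  assumes "step_list_adapted xs" "0 \<le> v" "v \<le> u'" "\<psi> \<in> borel_measurable (F v)" "\<forall>w\<in>space M. \<bar>\<psi> w\<bar> \<le> C"
  shows "step_list_adapted (steps_restrict v u' \<psi> xs)"
  using assms(1)
proof (induction xs)
  case (Cons x xs)
  obtain a b \<eta> where x: "x = (a, b, \<eta>)" by (cases x) auto
  let ?u = "max a (max v (min a u'))"
  have ab: "0 \<le> a" "a \<le> b" "\<eta> \<in> borel_measurable (F a)" using Cons.prems x by auto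
  obtain D where D: "\<forall>w\<in>space M. \<bar>\<eta> w\<bar> \<le> D" using Cons.prems x by auto
  have [measurable]: "\<eta> \<in> borel_measurable (F ?u)" "\<psi> \<in> borel_measurable (F ?u)"
    by (rule measurable_F_mono[OF ab(3)] measurable_F_mono[OF assms(4)]; simp)+
  have "(\<lambda>w. \<psi> w * \<eta> w) \<in> borel_measurable (F ?u)" by measurable
  moreover have "\<forall>w\<in>space M. \<bar>\<psi> w * \<eta> w\<bar> \<le> C * D"
    using assms(5) D by (auto simp: abs_mult intro!: mult_mono order_trans[OF abs_ge_zero])
  ultimately show ?case
    using Cons ab assms(2) by (auto simp: x steps_restrict_def simp del: max.bounded_iff le_max_iff_disj)
qed (simp add: steps_restrict_def)

lemma step_sum_restrict:
  assumes "v \<le> u'" "step_list_adapted xs"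
  shows "step_sum \<phi> (steps_restrict v u' \<psi> xs) w =
    \<psi> w * (step_sum (\<lambda>x. \<phi> (min u' x)) xs w - step_sum (\<lambda>x. \<phi> (min v x)) xs w)"
  using assms(2)
proof (induction xs)
  case (Cons x xs)
  obtain a b \<eta> where x: "x = (a, b, \<eta>)" by (cases x) auto
  have "a \<le> b" using Cons.prems x by auto
  then have "\<phi> (max a (max v (min b u'))) - \<phi> (max a (max v (min a u'))) =
     (\<phi> (min u' b) - \<phi> (min u' a)) - (\<phi> (min v b) - \<phi> (min v a))"
    using assms(1) by (auto simp: max_def min_def)
  then have "\<psi> w * \<eta> w * (\<phi> (max a (max v (min b u'))) - \<phi> (max a (max v (min a u')))) =
     \<psi> w * \<eta> w * ((\<phi> (min u' b) - \<phi> (min u' a)) - (\<phi> (min v b) - \<phi> (min v a)))" by simp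
  moreover have "step_sum \<phi> (steps_restrict v u' \<psi> xs) w =
    \<psi> w * (step_sum (\<lambda>x. \<phi> (min u' x)) xs w - step_sum (\<lambda>x. \<phi> (min v x)) xs w)"
    using Cons by (cases x) auto
  ultimately show ?case by (simp add: x steps_restrict_def algebra_simps)
qed (simp add: steps_restrict_def)

text \<open>Multiplication by a step function with coefficients known at the left endpoints stays
  within simple integrands, and the integral becomes a sum of weighted increments. This serves to
  cut at a fixed time, to cut at a stopping time, and to insert powers of time.\<close>

lemma simple_mult_steps:
  assumes S: "simple_integrand M F S"
    and v: "\<And>i. i < m \<Longrightarrow> 0 \<le> v i" "\<And>i. i < m \<Longrightarrow> v i \<le> v (Suc i)"
    and \<psi>: "\<And>i. i < m \<Longrightarrow> \<psi> i \<in> borel_measurable (F (v i))" "\<And>i w. i < m \<Longrightarrow> w \<in> space M \<Longrightarrow> \<bar>\<psi> i w\<bar> \<le> C i"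
  obtains U where "simple_integrand M F U"
    "\<And>s w. simple_process U s w = simple_process S s w * (\<Sum>i<m. \<psi> i w * indicator {v i<..v (Suc i)} s)"
    "\<And>X t w. simple_integral X U t w =
       (\<Sum>i<m. \<psi> i w * (simple_integral X S (min t (v (Suc i))) w - simple_integral X S (min t (v i)) w))"
proof -
  let ?x = "steps_of S"
  let ?y = "concat (map (\<lambda>i. steps_restrict (v i) (v (Suc i)) (\<psi> i) ?x) [0..<m])"
  have x: "step_list_adapted ?x" by (rule steps_of_adapted[OF S])
  have sum: "step_sum \<phi> ?y w = (\<Sum>i<m. \<psi> i w *
     (step_sum (\<lambda>x. \<phi> (min (v (Suc i)) x)) ?x w - step_sum (\<lambda>x. \<phi> (min (v i) x)) ?x w))" for \<phi> w
    using v(2) by (induction m) (auto simp: step_sum_restrict x)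
  have "step_list_adapted ?y"
  proof -
    have "step_list_adapted (steps_restrict (v i) (v (Suc i)) (\<psi> i) ?x)" if "i < m" for i
      using that \<psi> v by (intro steps_restrict_adapted[OF x, where C="C i"]) auto
    then show ?thesis by (induction m) auto
  qed
  then obtain U where U: "simple_integrand M F U"
    "\<And>s w. simple_process U s w = step_sum (\<lambda>x. if s \<le> x then 1 else 0) ?y w"
    "\<And>X t w. simple_integral X U t w = step_sum (\<lambda>x. X (min t x) w) ?y w"
    by (rule simple_of_steps) blast
  show ?thesis
  proof (rule that[OF U(1)])
    have "step_sum (\<lambda>x. if s \<le> min u' x then 1 else 0) ?x w = simple_process S s w * (if s \<le> u' then 1 else 0)" for s u' w
    proof (cases "s \<le> u'")
      case True then show ?thesis using steps_of_process[OF S, of s w] by simp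
    next
      case False
      have "step_sum (\<lambda>x. 0) xs w = 0" for xs :: "'a step_list" by (induction xs) auto
      then show ?thesis using False by simp
    qed
    then show "simple_process U s w = simple_process S s w * (\<Sum>i<m. \<psi> i w * indicator {v i<..v (Suc i)} s)" for s w
      unfolding U(2) sum sum_distrib_left
      by (intro sum.cong refl) (auto simp: indicator_Ioc_eq_diff v(2) algebra_simps)
    show "simple_integral X U t w =
       (\<Sum>i<m. \<psi> i w * (simple_integral X S (min t (v (Suc i))) w - simple_integral X S (min t (v i)) w))" for X t w
      unfolding U(3) sum by (simp add: steps_of_integral min.assoc[symmetric] flip: steps_of_integral)
  qed
qed

lemma simple_process_square:
  assumes S: "simple_integrand M F (n, \<tau>, \<xi>)"
  shows "(\<integral>\<^sup>+s. ennreal ((simple_process (n, \<tau>, \<xi>) s w)\<^sup>2) \<partial>lborel) = ennreal (\<Sum>i<n. (\<xi> i w)\<^sup>2 * (\<tau> (Suc i) - \<tau> i))"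
proof -
  have mono: "\<tau> i \<le> \<tau> j" if "i \<le> j" "j \<le> n" for i j
    using simple_partition_mono[OF S that] .
  have sq: "(simple_process (n, \<tau>, \<xi>) s w)\<^sup>2 = (\<Sum>i<n. (\<xi> i w)\<^sup>2 * indicator {\<tau> i<..\<tau> (Suc i)} s)" for s
  proof -
    \<comment> \<open>The cells are disjoint, so no cross terms occur. The second conjunct
      strengthens the induction: beyond the last endpoint the earlier cells contribute
      nothing.\<close>
    have *: "(\<Sum>i<k. \<xi> i w * indicator {\<tau> i<..\<tau> (Suc i)} s)\<^sup>2 = (\<Sum>i<k. (\<xi> i w)\<^sup>2 * indicator {\<tau> i<..\<tau> (Suc i)} s)
       \<and> (s > \<tau> k \<longrightarrow> (\<Sum>i<k. \<xi> i w * indicator {\<tau> i<..\<tau> (Suc i)} s) = 0)" if "k \<le> n" for k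
      using that
    proof (induction k)
      case (Suc k)
      show ?case
      proof (cases "s \<in> {\<tau> k<..\<tau> (Suc k)}")
        case True then show ?thesis using Suc by (auto simp: power_mult_distrib)
      next
        case False then show ?thesis using Suc mono[of k "Suc k"] by auto
      qed
    qed simp
    show ?thesis using *[of n] by simp
  qed
  have "(\<integral>\<^sup>+s. ennreal ((simple_process (n, \<tau>, \<xi>) s w)\<^sup>2) \<partial>lborel) =
     (\<integral>\<^sup>+s. (\<Sum>i<n. ennreal ((\<xi> i w)\<^sup>2) * indicator {\<tau> i<..\<tau> (Suc i)} s) \<partial>lborel)"
    unfolding sq
  proof (intro nn_integral_cong)
    fix s
    have "ennreal (\<Sum>i<n. (\<xi> i w)\<^sup>2 * indicator {\<tau> i<..\<tau> (Suc i)} s) = (\<Sum>i<n. ennreal ((\<xi> i w)\<^sup>2 * indicator {\<tau> i<..\<tau> (Suc i)} s))"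
      by (rule sum_ennreal[symmetric]) simp
    also have "\<dots> = (\<Sum>i<n. ennreal ((\<xi> i w)\<^sup>2) * indicator {\<tau> i<..\<tau> (Suc i)} s)"
      by (intro sum.cong refl) (simp split: split_indicator)
    finally show "ennreal (\<Sum>i<n. (\<xi> i w)\<^sup>2 * indicator {\<tau> i<..\<tau> (Suc i)} s) =
      (\<Sum>i<n. ennreal ((\<xi> i w)\<^sup>2) * indicator {\<tau> i<..\<tau> (Suc i)} s)" .
  qed
  also have "\<dots> = (\<Sum>i<n. ennreal ((\<xi> i w)\<^sup>2) * ennreal (\<tau> (Suc i) - \<tau> i))"
    by (subst nn_integral_sum) (auto simp: nn_integral_cmult_indicator mono)
  also have "\<dots> = ennreal (\<Sum>i<n. (\<xi> i w)\<^sup>2 * (\<tau> (Suc i) - \<tau> i))"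
    using mono by (subst sum_ennreal[symmetric]) (simp_all add: ennreal_mult)
  finally show ?thesis .
qed

text \<open>A cell is dropped when the energy accumulated by its end exceeds \<open>c\<close>. Since
  cell lengths are deterministic and the coefficient is known at the start of the cell, so is that
  energy; the truncated integrand remains adapted.\<close>

lemma simple_truncate:
  assumes S: "simple_integrand M F S" and c: "0 \<le> c"
  obtains U where "simple_integrand M F U"
    "\<And>w. (\<integral>\<^sup>+s. ennreal ((simple_process U s w)\<^sup>2) \<partial>lborel) \<le> ennreal c"
    "\<And>w. (\<integral>\<^sup>+s. ennreal ((simple_process S s w)\<^sup>2) \<partial>lborel) \<le> ennreal c \<Longrightarrow>
       (\<forall>s. simple_process U s w = simple_process S s w) \<and>
       (\<forall>X t. simple_integral X U t w = simple_integral X S t w)"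
proof -
  obtain n \<tau> \<xi> where Sd: "S = (n, \<tau>, \<xi>)" by (cases S) auto
  note S' = S[unfolded Sd]
  have mono: "\<tau> i \<le> \<tau> j" if "i \<le> j" "j \<le> n" for i j
    using simple_partition_mono[OF S' that] .
  define Q where "Q k w = (\<Sum>i<k. (\<xi> i w)\<^sup>2 * (\<tau> (Suc i) - \<tau> i))" for k w
  have Qmono: "Q k w \<le> Q l w" if "k \<le> l" "l \<le> n" for k l w
    unfolding Q_def using that mono by (intro sum_mono2) auto
  define \<zeta> where "\<zeta> i w = (if Q (Suc i) w \<le> c then \<xi> i w else 0)" for i w
  have U: "simple_integrand M F (n, \<tau>, \<zeta>)"
    unfolding simple_integrand.simps
  proof (intro conjI allI impI)
    fix i assume i: "i < n"
    have \<xi>: "\<xi> j \<in> borel_measurable (F (\<tau> i))" if "j \<le> i" for j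
    proof (rule measurable_F_mono)
      show "\<xi> j \<in> borel_measurable (F (\<tau> j))" using S' i that by simp
      show "\<tau> j \<le> \<tau> i" using i that by (intro mono) auto
    qed
    have [measurable]: "\<xi> i \<in> borel_measurable (F (\<tau> i))" by (rule \<xi>) simp
    have [measurable]: "Q (Suc i) \<in> borel_measurable (F (\<tau> i))"
      unfolding Q_def using \<xi> by (intro borel_measurable_sum borel_measurable_times borel_measurable_power) auto
    show "\<zeta> i \<in> borel_measurable (F (\<tau> i))" unfolding \<zeta>_def by measurable
    obtain D where "\<forall>w\<in>space M. \<bar>\<xi> i w\<bar> \<le> D" using S' i by auto
    then have "\<forall>w\<in>space M. \<bar>\<zeta> i w\<bar> \<le> D" unfolding \<zeta>_def by (auto intro: order_trans[OF abs_ge_zero])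
    then show "\<exists>C. \<forall>w\<in>space M. \<bar>\<zeta> i w\<bar> \<le> C" by blast
  qed (use S' in auto)
  show ?thesis
  proof (rule that[OF U])
    fix w
    \<comment> \<open>The bound by \<open>Q k\<close> has to be carried along: when a cell is kept,
      the total is at most \<open>Q (Suc k)\<close>, which is at most \<open>c\<close> by the
      criterion for keeping it.\<close>
    have "(\<Sum>i<k. (\<zeta> i w)\<^sup>2 * (\<tau> (Suc i) - \<tau> i)) \<le> c \<and>
        (\<Sum>i<k. (\<zeta> i w)\<^sup>2 * (\<tau> (Suc i) - \<tau> i)) \<le> Q k w" if "k \<le> n" for k
      using that
    proof (induction k)
      case (Suc k)
      have "0 \<le> (\<xi> k w)\<^sup>2 * (\<tau> (Suc k) - \<tau> k)" using Suc.prems mono[of k "Suc k"] by simp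
      moreover have "Q (Suc k) w = Q k w + (\<xi> k w)\<^sup>2 * (\<tau> (Suc k) - \<tau> k)" by (simp add: Q_def)
      ultimately show ?case using Suc unfolding \<zeta>_def by auto
    qed (use c in \<open>simp add: Q_def\<close>)
    then show "(\<integral>\<^sup>+s. ennreal ((simple_process (n, \<tau>, \<zeta>) s w)\<^sup>2) \<partial>lborel) \<le> ennreal c"
      unfolding simple_process_square[OF U] by (intro ennreal_leI) auto
    assume "(\<integral>\<^sup>+s. ennreal ((simple_process S s w)\<^sup>2) \<partial>lborel) \<le> ennreal c"
    then have "Q n w \<le> c" unfolding Sd simple_process_square[OF S'] Q_def using c by simp
    then have "\<zeta> i w = \<xi> i w" if "i < n" for i
      using Qmono[of "Suc i" n w] that unfolding \<zeta>_def by auto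
    then show "(\<forall>s. simple_process (n, \<tau>, \<zeta>) s w = simple_process S s w) \<and>
       (\<forall>X t. simple_integral X (n, \<tau>, \<zeta>) t w = simple_integral X S t w)"
      by (simp add: Sd)
  qed
qed

end

section \<open>Brownian increments and the isometry for simple integrands\<close>

locale brownian_space = filtered_space M F for M :: "'a measure" and F +
  fixes B :: "real \<Rightarrow> 'a \<Rightarrow> real"
  assumes brownian: "brownian_motion M F B"
begin

lemma B_cont: "continuous_adapted M F B"
  using brownian by (simp add: brownian_motion_def)

lemma B_measurable: "0 \<le> s \<Longrightarrow> s \<le> t \<Longrightarrow> B s \<in> borel_measurable (F t)"
  by (rule continuous_adaptedD(3)[OF B_cont])

text \<open>Stated for arbitrary target spaces, because it is applied to real integrands and squared
  increments as well as to complex exponentials.\<close>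

lemma increment_indep:
  assumes "0 \<le> s" "s < t" "\<eta> \<in> F s \<rightarrow>\<^sub>M K" "g \<in> borel \<rightarrow>\<^sub>M L"
  shows "indep_var K \<eta> L (\<lambda>w. g (B t w - B s w))"
proof -
  let ?A = "{\<eta> -` A \<inter> space M |A. A \<in> sets K}"
  let ?B = "{(\<lambda>w. g (B t w - B s w)) -` A \<inter> space M |A. A \<in> sets L}"
  let ?D = "{(\<lambda>w. B t w - B s w) -` A \<inter> space M |A. A \<in> sets (borel :: real measure)}"
  have ind: "indep_set (sets (F s)) ?D"
    using brownian assms by (auto simp: brownian_motion_def)
  have A: "?A \<subseteq> sets (F s)" using measurable_sets[OF assms(3)] by auto
  have D: "?B \<subseteq> ?D"
  proof safe
    fix A assume "A \<in> sets L"
    then have "g -` A \<in> sets borel" using measurable_sets[OF assms(4)] by simp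
    then show "\<exists>C. (\<lambda>w. g (B t w - B s w)) -` A \<inter> space M = (\<lambda>w. B t w - B s w) -` C \<inter> space M \<and> C \<in> sets borel"
      by (intro exI[of _ "g -` A"]) auto
  qed
  have "indep_set ?A ?B"
  proof (rule indep_setI)
    show "?A \<subseteq> events" using A indep_setD_ev1[OF ind] by (rule order_trans)
    show "?B \<subseteq> events" using D indep_setD_ev2[OF ind] by (rule order_trans)
    show "prob (a \<inter> b) = prob a * prob b" if "a \<in> ?A" "b \<in> ?B" for a b
      by (rule indep_setD[OF ind subsetD[OF A that(1)] subsetD[OF D that(2)]])
  qed
  then have "indep_set (sigma_sets (space M) ?A) (sigma_sets (space M) ?B)"
  proof (rule indep_set_sigma_sets)
    have "Int_stable {f -` A \<inter> space M |A. A \<in> sets N}" for f :: "'a \<Rightarrow> 'c" and N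
      unfolding Int_stable_def
    proof safe
      fix A A' assume "A \<in> sets N" "A' \<in> sets N"
      then show "\<exists>A''. f -` A \<inter> space M \<inter> (f -` A' \<inter> space M) = f -` A'' \<inter> space M \<and> A'' \<in> sets N"
        by (intro exI[of _ "A \<inter> A'"]) auto
    qed
    from this[of \<eta> K] this[of "\<lambda>w. g (B t w - B s w)" L]
    show "Int_stable ?A" "Int_stable ?B" by blast+
  qed
  moreover have "\<eta> \<in> M \<rightarrow>\<^sub>M K" by (rule measurable_from_subalg[OF subalg assms(3)])
  moreover have "(\<lambda>w. g (B t w - B s w)) \<in> M \<rightarrow>\<^sub>M L"
    using continuous_adaptedD(2)[OF B_cont] assms(1,2) by (intro measurable_compose[OF _ assms(4)]) auto
  ultimately show ?thesis by (simp add: indep_var_eq)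
qed

lemma increment_moments:
  assumes "0 \<le> s" "s < t"
  shows "integrable M (\<lambda>w. B t w - B s w)" "(\<integral>w. B t w - B s w \<partial>M) = 0"
    "integrable M (\<lambda>w. (B t w - B s w)\<^sup>2)" "(\<integral>w. (B t w - B s w)\<^sup>2 \<partial>M) = t - s"
proof -
  let ?n = "normal_density 0 (sqrt (t - s))"
  have d: "distributed M lborel (\<lambda>w. B t w - B s w) (\<lambda>x. ennreal (?n x))"
    using brownian assms by (auto simp: brownian_motion_def)
  have \<sigma>: "sqrt (t - s) > 0" using assms by simp
  show "integrable M (\<lambda>w. B t w - B s w)"
    using distributed_integrable[OF d, of "\<lambda>x. x"] integrable_normal_moment_nz_1[OF \<sigma>] by simp
  show "(\<integral>w. B t w - B s w \<partial>M) = 0"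
    using distributed_integral[OF d, of "\<lambda>x. x"] integral_normal_moment_nz_1[OF \<sigma>] by simp
  show "integrable M (\<lambda>w. (B t w - B s w)\<^sup>2)"
    using distributed_integrable[OF d, of "\<lambda>x. x\<^sup>2"] integrable_normal_moment[OF \<sigma>, of 0 2] by simp
  show "(\<integral>w. (B t w - B s w)\<^sup>2 \<partial>M) = t - s"
    using distributed_integral[OF d, of "\<lambda>x. x\<^sup>2"] integral_normal_moment_even[OF \<sigma>, of 0 1] assms by simp
qed

lemma increment_mult:
  assumes s: "0 \<le> s" "s \<le> t" and \<eta>: "\<eta> \<in> borel_measurable (F s)" "integrable M \<eta>"
  shows "integrable M (\<lambda>w. \<eta> w * (B t w - B s w))" "(\<integral>w. \<eta> w * (B t w - B s w) \<partial>M) = 0"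
proof -
  have "integrable M (\<lambda>w. \<eta> w * (B t w - B s w)) \<and> (\<integral>w. \<eta> w * (B t w - B s w) \<partial>M) = 0"
  proof (cases "s = t")
    case False
    then have st: "s < t" using s by simp
    have i: "indep_var borel \<eta> borel (\<lambda>w. B t w - B s w)"
      by (rule increment_indep[OF s(1) st \<eta>(1)]) simp
    show ?thesis
      using indep_var_integrable[OF i \<eta>(2) increment_moments(1)[OF s(1) st]]
        indep_var_lebesgue_integral[OF i \<eta>(2) increment_moments(1)[OF s(1) st]] increment_moments(2)[OF s(1) st]
      by simp
  qed auto
  then show "integrable M (\<lambda>w. \<eta> w * (B t w - B s w))" "(\<integral>w. \<eta> w * (B t w - B s w) \<partial>M) = 0"
    by auto
qed

lemma increment_square_mult:
  assumes s: "0 \<le> s" "s \<le> t" and \<eta>: "\<eta> \<in> borel_measurable (F s)" "\<forall>w\<in>space M. \<bar>\<eta> w\<bar> \<le> C"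
  shows "integrable M (\<lambda>w. (\<eta> w)\<^sup>2 * (B t w - B s w)\<^sup>2)"
    "(\<integral>w. (\<eta> w)\<^sup>2 * (B t w - B s w)\<^sup>2 \<partial>M) = (\<integral>w. (\<eta> w)\<^sup>2 \<partial>M) * (t - s)"
proof -
  have "integrable M (\<lambda>w. (\<eta> w)\<^sup>2 * (B t w - B s w)\<^sup>2) \<and>
    (\<integral>w. (\<eta> w)\<^sup>2 * (B t w - B s w)\<^sup>2 \<partial>M) = (\<integral>w. (\<eta> w)\<^sup>2 \<partial>M) * (t - s)"
  proof (cases "s = t")
  case False
  then have st: "s < t" using s by simp
  have i: "indep_var borel (\<lambda>w. (\<eta> w)\<^sup>2) borel (\<lambda>w. (B t w - B s w)\<^sup>2)"
    using \<eta>(1) by (intro increment_indep[OF s(1) st]) auto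
  have [measurable]: "\<eta> \<in> borel_measurable M" by (rule measurable_F_M[OF \<eta>(1)])
  have int: "integrable M (\<lambda>w. (\<eta> w)\<^sup>2)"
    using \<eta>(2) by (intro integrable_const_bound[where B="C\<^sup>2"] AE_I2) (auto intro!: power2_le_iff_abs_le[THEN iffD2] simp: abs_le_square_iff[symmetric] intro: order_trans[OF _ abs_ge_self])
  show "integrable M (\<lambda>w. (\<eta> w)\<^sup>2 * (B t w - B s w)\<^sup>2) \<and>
    (\<integral>w. (\<eta> w)\<^sup>2 * (B t w - B s w)\<^sup>2 \<partial>M) = (\<integral>w. (\<eta> w)\<^sup>2 \<partial>M) * (t - s)"
    using indep_var_integrable[OF i int increment_moments(3)[OF s(1) st]]
     indep_var_lebesgue_integral[OF i int increment_moments(3)[OF s(1) st]] increment_moments(4)[OF s(1) st] by simp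
  qed auto
  then show "integrable M (\<lambda>w. (\<eta> w)\<^sup>2 * (B t w - B s w)\<^sup>2)"
    "(\<integral>w. (\<eta> w)\<^sup>2 * (B t w - B s w)\<^sup>2 \<partial>M) = (\<integral>w. (\<eta> w)\<^sup>2 \<partial>M) * (t - s)" by auto
qed

text \<open>Induction over the cells. The cross term is \<open>\<xi> k * \<Phi> k\<close>, known at
  \<open>\<tau> k\<close>, times a centred increment independent of it, so it has mean zero and only
  the squares survive.\<close>

lemma simple_sum_moments:
  assumes S: "simple_integrand M F (n, \<tau>, \<xi>)" and "k \<le> n"
  defines "\<Phi> \<equiv> \<lambda>k w. \<Sum>i<k. \<xi> i w * (B (\<tau> (Suc i)) w - B (\<tau> i) w)"
  shows "\<Phi> k \<in> borel_measurable (F (\<tau> k)) \<and> integrable M (\<Phi> k) \<and> integrable M (\<lambda>w. (\<Phi> k w)\<^sup>2) \<and>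
    (\<integral>w. \<Phi> k w \<partial>M) = 0 \<and> (\<integral>w. (\<Phi> k w)\<^sup>2 \<partial>M) = (\<Sum>i<k. (\<integral>w. (\<xi> i w)\<^sup>2 \<partial>M) * (\<tau> (Suc i) - \<tau> i))"
  using \<open>k \<le> n\<close>
proof (induction k)
  case (Suc k)
  let ?\<Delta> = "\<lambda>w. B (\<tau> (Suc k)) w - B (\<tau> k) w"
  have \<tau>: "0 \<le> \<tau> k" "\<tau> k \<le> \<tau> (Suc k)"
    using Suc.prems simple_partition_nonneg[OF S, of k] simple_partition_mono[OF S, of k "Suc k"] by auto
  have IH: "\<Phi> k \<in> borel_measurable (F (\<tau> k))" "integrable M (\<Phi> k)" "integrable M (\<lambda>w. (\<Phi> k w)\<^sup>2)"
    "(\<integral>w. \<Phi> k w \<partial>M) = 0" "(\<integral>w. (\<Phi> k w)\<^sup>2 \<partial>M) = (\<Sum>i<k. (\<integral>w. (\<xi> i w)\<^sup>2 \<partial>M) * (\<tau> (Suc i) - \<tau> i))"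
    using Suc by auto
  have \<xi>: "\<xi> k \<in> borel_measurable (F (\<tau> k))" using S Suc.prems by auto
  have "\<exists>C. \<forall>w\<in>space M. \<bar>\<xi> k w\<bar> \<le> C" using S Suc.prems by auto
  then obtain C where C: "\<forall>w\<in>space M. \<bar>\<xi> k w\<bar> \<le> C" ..
  have [measurable]: "\<xi> k \<in> borel_measurable M" "\<Phi> k \<in> borel_measurable M"
    by (rule measurable_F_M[OF \<xi>] measurable_F_M[OF IH(1)])+
  have \<xi>int: "integrable M (\<xi> k)" using C by (intro integrable_const_bound[where B=C] AE_I2) auto
  have \<xi>\<Phi>: "integrable M (\<lambda>w. \<xi> k w * \<Phi> k w)"
  proof (rule Bochner_Integration.integrable_bound[where f="\<lambda>w. C * \<Phi> k w"])
    show "AE w in M. norm (\<xi> k w * \<Phi> k w) \<le> norm (C * \<Phi> k w)"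
      using C by (intro AE_I2) (auto simp: abs_mult intro!: mult_right_mono intro: order_trans[OF _ abs_ge_self])
  qed (use IH in auto)
  have m\<xi>\<Phi>: "(\<lambda>w. \<xi> k w * \<Phi> k w) \<in> borel_measurable (F (\<tau> k))" using \<xi> IH(1) by measurable
  note a = increment_mult[OF \<tau> \<xi> \<xi>int] and b = increment_mult[OF \<tau> m\<xi>\<Phi> \<xi>\<Phi>] and c = increment_square_mult[OF \<tau> \<xi> C]
  have 1: "\<Phi> (Suc k) = (\<lambda>w. \<Phi> k w + \<xi> k w * ?\<Delta> w)" by (simp add: \<Phi>_def fun_eq_iff)
  have 2: "(\<lambda>w. (\<Phi> (Suc k) w)\<^sup>2) = (\<lambda>w. ((\<Phi> k w)\<^sup>2 + (\<xi> k w)\<^sup>2 * (?\<Delta> w)\<^sup>2) + 2 * (\<xi> k w * \<Phi> k w * ?\<Delta> w))"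
    unfolding 1 by (auto simp: power2_eq_square algebra_simps)
  have "\<Phi> (Suc k) \<in> borel_measurable (F (\<tau> (Suc k)))"
    unfolding 1 using measurable_F_mono[OF IH(1) \<tau>(2)] measurable_F_mono[OF \<xi> \<tau>(2)] B_measurable \<tau>
    by (intro borel_measurable_add borel_measurable_times borel_measurable_diff) auto
  moreover have "integrable M (\<Phi> (Suc k))" "(\<integral>w. \<Phi> (Suc k) w \<partial>M) = 0"
    unfolding 1 using IH a by auto
  moreover have "integrable M (\<lambda>w. (\<Phi> (Suc k) w)\<^sup>2)" unfolding 2
    using IH b c by (intro Bochner_Integration.integrable_add integrable_mult_right)
  moreover have "(\<integral>w. (\<Phi> (Suc k) w)\<^sup>2 \<partial>M) = (\<integral>w. (\<Phi> k w)\<^sup>2 \<partial>M) + (\<integral>w. (\<xi> k w)\<^sup>2 * (?\<Delta> w)\<^sup>2 \<partial>M)"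
    unfolding 2 using IH b c
    by (subst Bochner_Integration.integral_add; (intro Bochner_Integration.integrable_add integrable_mult_right)?)
       (auto simp: Bochner_Integration.integral_add)
  ultimately show ?case using IH c by simp
qed (simp_all add: \<Phi>_def)

text \<open>The isometry. Cutting the integrand to the interval from 0 to \<open>t\<close> turns the
  integral up to \<open>t\<close> into a full sum over a partition, to which the inductive
  computation applies.\<close>

lemma simple_integral_moments:
  assumes S: "simple_integrand M F S" and t: "0 \<le> t"
  shows "integrable M (simple_integral B S t)" "(\<integral>w. simple_integral B S t w \<partial>M) = 0"
    "integrable M (\<lambda>w. (simple_integral B S t w)\<^sup>2)"
    "(\<integral>\<^sup>+w. ennreal ((simple_integral B S t w)\<^sup>2) \<partial>M) =
      (\<integral>\<^sup>+w. (sq_int {0<..t} (\<lambda>s. simple_process S s w)) \<partial>M)"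
proof -
  \<comment> \<open>A single step with coefficient 1 and endpoints 0 and \<open>t\<close>, written
    as a function of the index.\<close>
  obtain U where U: "simple_integrand M F U"
    "\<And>s w. simple_process U s w = simple_process S s w * (\<Sum>i<Suc 0. 1 * indicator {(if i = 0 then 0 else t)<..(if Suc i = 0 then 0 else t)} s)"
    "\<And>X u w. simple_integral X U u w =
       (\<Sum>i<Suc 0. 1 * (simple_integral X S (min u (if Suc i = 0 then 0 else t)) w - simple_integral X S (min u (if i = 0 then 0 else t)) w))"
    using simple_mult_steps[OF S, of "Suc 0" "\<lambda>i. if i = 0 then 0 else t" "\<lambda>_ _. 1" "\<lambda>_. 1"] t by auto
  obtain n \<tau> \<xi> where Ud: "U = (n, \<tau>, \<xi>)" by (cases U) auto
  note U' = U(1)[unfolded Ud]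
  have "simple_integral B S 0 w = 0" for w
  proof -
    obtain n \<tau> \<xi> where Sd: "S = (n, \<tau>, \<xi>)" by (cases S) auto
    show ?thesis using simple_partition_nonneg[OF S[unfolded Sd]] by (auto simp: Sd min_absorb1 intro!: sum.neutral)
  qed
  then have I: "simple_integral B U u w = simple_integral B S t w" if "u \<ge> t" for u w
    using that t U(3)[of B u w] by simp
  have P: "simple_process U s w = simple_process S s w * indicator {0<..t} s" for s w
    using U(2) by simp
  \<comment> \<open>A time beyond all partition points, so that none of the increments in the
    integral of \<open>U\<close> is stopped early.\<close>
  define u where "u = max t (\<tau> n)"
  have "simple_integral B S t w = (\<Sum>i<n. \<xi> i w * (B (\<tau> (Suc i)) w - B (\<tau> i) w))" for w
    using I[of u w] simple_partition_mono[OF U'] unfolding Ud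
    by (auto simp: u_def min_absorb2 le_max_iff_disj intro!: sum.cong)
  then have eq: "simple_integral B S t = (\<lambda>w. \<Sum>i<n. \<xi> i w * (B (\<tau> (Suc i)) w - B (\<tau> i) w))" by auto
  note m = simple_sum_moments[OF U' order_refl]
  show "integrable M (simple_integral B S t)" "(\<integral>w. simple_integral B S t w \<partial>M) = 0"
    and i2: "integrable M (\<lambda>w. (simple_integral B S t w)\<^sup>2)"
    unfolding eq using m by auto
  have "(\<integral>\<^sup>+w. (sq_int {0<..t} (\<lambda>s. simple_process S s w)) \<partial>M) =
     (\<integral>\<^sup>+w. (\<integral>\<^sup>+s. ennreal ((simple_process U s w)\<^sup>2) \<partial>lborel) \<partial>M)"
    unfolding P by (intro nn_integral_cong) (auto split: split_indicator)
  also have "\<dots> = (\<integral>\<^sup>+w. ennreal (\<Sum>i<n. (\<xi> i w)\<^sup>2 * (\<tau> (Suc i) - \<tau> i)) \<partial>M)"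
    unfolding Ud simple_process_square[OF U'] ..
  also have "\<dots> = ennreal (\<integral>w. (\<Sum>i<n. (\<xi> i w)\<^sup>2 * (\<tau> (Suc i) - \<tau> i)) \<partial>M)"
  proof (rule nn_integral_eq_integral)
    show "integrable M (\<lambda>w. \<Sum>i<n. (\<xi> i w)\<^sup>2 * (\<tau> (Suc i) - \<tau> i))"
    proof (intro Bochner_Integration.integrable_sum integrable_mult_left)
      fix i assume i: "i \<in> {..<n}"
      obtain C where C: "\<forall>w\<in>space M. \<bar>\<xi> i w\<bar> \<le> C" using U' i by auto
      have [measurable]: "\<xi> i \<in> borel_measurable M" using U' i measurable_F_M by auto
      show "integrable M (\<lambda>w. (\<xi> i w)\<^sup>2)"
        using C by (intro integrable_const_bound[where B="C\<^sup>2"] AE_I2) (auto simp: abs_le_square_iff[symmetric] intro: order_trans[OF _ abs_ge_self])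
    qed
  qed (use simple_partition_mono[OF U'] in \<open>auto intro!: AE_I2 sum_nonneg\<close>)
  also have "(\<integral>w. (\<Sum>i<n. (\<xi> i w)\<^sup>2 * (\<tau> (Suc i) - \<tau> i)) \<partial>M) = (\<Sum>i<n. (\<integral>w. (\<xi> i w)\<^sup>2 \<partial>M) * (\<tau> (Suc i) - \<tau> i))"
  proof (subst Bochner_Integration.integral_sum)
    fix i assume i: "i \<in> {..<n}"
    obtain C where C: "\<forall>w\<in>space M. \<bar>\<xi> i w\<bar> \<le> C" using U' i by auto
    have [measurable]: "\<xi> i \<in> borel_measurable M" using U' i measurable_F_M by auto
    show "integrable M (\<lambda>w. (\<xi> i w)\<^sup>2 * (\<tau> (Suc i) - \<tau> i))"
      using C by (intro integrable_mult_left integrable_const_bound[where B="C\<^sup>2"] AE_I2) (auto simp: abs_le_square_iff[symmetric] intro: order_trans[OF _ abs_ge_self])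
  qed auto
  also have "\<dots> = (\<integral>w. (simple_integral B S t w)\<^sup>2 \<partial>M)" unfolding eq using m by simp
  also have "ennreal \<dots> = (\<integral>\<^sup>+w. ennreal ((simple_integral B S t w)\<^sup>2) \<partial>M)"
    by (rule nn_integral_eq_integral[symmetric, OF i2]) auto
  finally show "(\<integral>\<^sup>+w. ennreal ((simple_integral B S t w)\<^sup>2) \<partial>M) =
      (\<integral>\<^sup>+w. (sq_int {0<..t} (\<lambda>s. simple_process S s w)) \<partial>M)" by simp
qed

end

subsection \<open>Optional stopping of stochastic integrals\<close>

lemma continuous_on_halfline:
  fixes f :: "real \<Rightarrow> real"
  assumes "\<And>T. 0 \<le> T \<Longrightarrow> continuous_on {0..T} f"
  shows "continuous_on {0..} f"
  unfolding continuous_on_eq_continuous_within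
proof
  fix x :: real assume x: "x \<in> {0..}"
  have "continuous_on {0..x + 1} f" using assms x by auto
  then have "continuous (at x within {0..x + 1}) f"
    using x by (auto simp: continuous_on_eq_continuous_within)
  moreover have "at x within {0..} = at x within {0..x + 1}"
    by (rule at_within_nhd[of _ "{x - 1<..<x + 1}"]) auto
  ultimately show "continuous (at x within {0..}) f" by simp
qed

lemma set_nn_integral_eq_integral:
  fixes f :: "real \<Rightarrow> real"
  assumes "set_integrable lborel {a..b} f" "\<And>s. 0 \<le> f s"
  shows "(\<integral>\<^sup>+s\<in>{a..b}. ennreal (f s) \<partial>lborel) = ennreal (integral {a..b} f)"
proof -
  have "(\<integral>\<^sup>+s\<in>{a..b}. ennreal (f s) \<partial>lborel) = (\<integral>\<^sup>+s. ennreal (indicator {a..b} s *\<^sub>R f s) \<partial>lborel)"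
    by (intro nn_integral_cong) (auto split: split_indicator)
  also have "\<dots> = ennreal (\<integral>s. indicator {a..b} s *\<^sub>R f s \<partial>lborel)"
    using assms by (intro nn_integral_eq_integral) (auto simp: set_integrable_def)
  also have "(\<integral>s. indicator {a..b} s *\<^sub>R f s \<partial>lborel) = integral {a..b} f"
    using set_borel_integral_eq_integral(2)[OF assms(1)] by (simp add: set_lebesgue_integral_def)
  finally show ?thesis .
qed

context filtered_space begin

text \<open>A version of the quadratic variation of the integral of \<open>H\<close>. All of its
  paths are finite, continuous and non-decreasing, so its hitting times are stopping times; the
  formula itself is required only almost surely.\<close>

definition energy_process :: "(real \<Rightarrow> 'a \<Rightarrow> real) \<Rightarrow> (real \<Rightarrow> 'a \<Rightarrow> real) \<Rightarrow> bool" where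
  "energy_process H A \<longleftrightarrow> continuous_adapted M F A \<and>
     (\<forall>w\<in>space M. A 0 w = 0 \<and> mono_on {0..} (\<lambda>t. A t w)) \<and>
     (AE w in M. \<forall>t\<ge>0. (sq_int {0..t} (\<lambda>s. H s w)) = ennreal (A t w))"

text \<open>On the null set where the energy may be infinite the process is set to 0; completeness
  of the filtration keeps it adapted.\<close>

lemma energy_process_exists:
  assumes H: "progressive F H" "AE w in M. \<forall>t\<ge>0. set_integrable lborel {0..t} (\<lambda>s. (H s w)\<^sup>2)"
  obtains A where "energy_process H A"
proof -
  obtain N where N: "N \<in> null_sets M" "\<And>t. 0 \<le> t \<Longrightarrow> N \<in> sets (F t)"
    "\<And>w. w \<in> space M - N \<Longrightarrow> \<forall>t\<ge>0. set_integrable lborel {0..t} (\<lambda>s. (H s w)\<^sup>2)"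
    using AE_null_setE[OF H(2)] by metis
  define A where "A t w = (if w \<in> N then 0 else enn2real (sq_int {0..t} (\<lambda>s. H s w)))" for t w
  have eq: "(sq_int {0..t} (\<lambda>s. H s w)) = ennreal (integral {0..t} (\<lambda>s. (H s w)\<^sup>2))"
    if "w \<in> space M - N" "0 \<le> t" for t w
    using N(3)[OF that(1)] that(2) by (intro set_nn_integral_eq_integral) auto
  have io: "(\<lambda>s. (H s w)\<^sup>2) integrable_on {0..t}" if "w \<in> space M - N" "0 \<le> t" for t w
    using N(3)[OF that(1)] that(2) set_borel_integral_eq_integral(1) by blast
  have A: "A t w = integral {0..t} (\<lambda>s. (H s w)\<^sup>2)" if "w \<in> space M - N" "0 \<le> t" for t w
    using that eq[OF that] unfolding A_def by (simp add: integral_nonneg io)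
  have cont: "continuous_on {0..} (\<lambda>t. A t w)" if "w \<in> space M" for w
  proof (cases "w \<in> N")
    case False
    show ?thesis
    proof (rule continuous_on_halfline)
      fix T :: real assume "0 \<le> T"
      then have "continuous_on {0..T} (\<lambda>x. integral {0..x} (\<lambda>s. (H s w)\<^sup>2))"
        using io that False by (intro indefinite_integral_continuous_1) auto
      then show "continuous_on {0..T} (\<lambda>t. A t w)"
        by (rule continuous_on_eq) (use A that False in auto)
    qed
  qed (simp add: A_def)
  have "adapted F A"
    unfolding adapted_def
  proof (intro allI impI)
    fix t :: real assume t: "0 \<le> t"
    have [measurable]: "N \<in> sets (F t)" "(\<lambda>w. \<integral>\<^sup>+s\<in>{0..t}. ennreal ((H s w)\<^sup>2) \<partial>lborel) \<in> borel_measurable (F t)"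
      using N(2)[OF t] set_nn_integral_measurable[OF progressive_measurable[OF H(1) t]] by auto
    show "A t \<in> borel_measurable (F t)" unfolding A_def by measurable
  qed
  moreover have "A 0 w = 0 \<and> mono_on {0..} (\<lambda>t. A t w)" if "w \<in> space M" for w
  proof (cases "w \<in> N")
    case False
    then show ?thesis
      using A[of w] io[of w] that by (auto intro!: mono_onI integral_subset_le)
  qed (simp add: A_def mono_on_def)
  moreover have "AE w in M. \<forall>t\<ge>0. (sq_int {0..t} (\<lambda>s. H s w)) = ennreal (A t w)"
    using AE_not_in[OF N(1)] AE_space by eventually_elim (auto simp: A eq)
  ultimately have "energy_process H A"
    using cont by (auto simp: energy_process_def continuous_adapted_def)
  then show ?thesis by (rule that)
qed

lemma energy_processD:
  assumes "energy_process H A"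
  shows "continuous_adapted M F A" "w \<in> space M \<Longrightarrow> A 0 w = 0"
    "w \<in> space M \<Longrightarrow> 0 \<le> s \<Longrightarrow> s \<le> t \<Longrightarrow> A s w \<le> A t w"
    "AE w in M. \<forall>t\<ge>0. (sq_int {0..t} (\<lambda>s. H s w)) = ennreal (A t w)"
    "w \<in> space M \<Longrightarrow> 0 \<le> t \<Longrightarrow> 0 \<le> A t w"
proof -
  show *: "continuous_adapted M F A" "w \<in> space M \<Longrightarrow> A 0 w = 0"
    "AE w in M. \<forall>t\<ge>0. (sq_int {0..t} (\<lambda>s. H s w)) = ennreal (A t w)"
    using assms by (auto simp: energy_process_def)
  show **: "w \<in> space M \<Longrightarrow> 0 \<le> s \<Longrightarrow> s \<le> t \<Longrightarrow> A s w \<le> A t w" for s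
    using assms by (auto simp: energy_process_def mono_on_def)
  show "w \<in> space M \<Longrightarrow> 0 \<le> t \<Longrightarrow> 0 \<le> A t w" using *(2) **[of 0] by simp
qed

lemma random_time_measurable:
  assumes "continuous_adapted M F X" "S \<in> borel_measurable M" "\<And>w. w \<in> space M \<Longrightarrow> S w \<in> {0..N}"
  shows "(\<lambda>w. X (S w) w) \<in> borel_measurable M"
proof (rule measurable_at_random_time[where t=N and X=X and S=S])
  show "X u \<in> borel_measurable M" if "u \<in> {0..N}" for u
    using continuous_adaptedD(2)[OF assms(1)] that by auto
  show "continuous_on {0..N} (\<lambda>u. X u w)" if "w \<in> space M" for w
    by (rule continuous_adaptedD(5)[OF assms(1) that])
qed (use assms in auto)

end

text \<open>The number \<open>k\<close> counts the grid points strictly before \<open>T\<close>, so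
  \<open>k * N / m\<close> is the first grid point at or after \<open>T\<close>. Whether a point
  lies strictly before \<open>T\<close> is decided at that point when \<open>T\<close> is a stopping
  time.\<close>

lemma grid_above:
  fixes T N :: real
  assumes "0 \<le> T" "T \<le> N" "0 < N" "0 < m"
  defines "k \<equiv> nat \<lceil>T * real m / N\<rceil>"
  shows "k \<le> m" "\<And>i. real i * N / real m < T \<longleftrightarrow> i < k" "T \<le> real k * N / real m" "real k * N / real m \<le> T + N / real m"
    "real k * N / real m \<le> N"
proof -
  have x: "0 \<le> T * real m / N" "T * real m / N \<le> real m" using assms by (auto simp: field_simps)
  then show km: "k \<le> m" unfolding k_def by linarith
  have rk: "real k = real_of_int \<lceil>T * real m / N\<rceil>" unfolding k_def using x by (simp add: ceiling_le_iff)
  show "real i * N / real m < T \<longleftrightarrow> i < k" for i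
  proof -
    have "real i * N / real m < T \<longleftrightarrow> real i < T * real m / N" using assms by (simp add: field_simps)
    also have "\<dots> \<longleftrightarrow> int i < \<lceil>T * real m / N\<rceil>" by (simp add: less_ceiling_iff)
    also have "\<dots> \<longleftrightarrow> i < k" unfolding k_def by linarith
    finally show ?thesis .
  qed
  have a: "T * real m / N \<le> real k" "real k \<le> T * real m / N + 1" unfolding rk by linarith+
  have "T * real m / N * N / real m \<le> real k * N / real m"
    using a(1) assms by (intro divide_right_mono mult_right_mono) auto
  then show "T \<le> real k * N / real m" using assms by simp
  have "real k * N \<le> (T * real m / N + 1) * N" using a(2) assms by (intro mult_right_mono) auto
  then have "real k * N / real m \<le> (T * real m / N + 1) * N / real m" by (rule divide_right_mono) simp
  also have "\<dots> = T + N / real m" using assms by (simp add: field_simps)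
  finally show "real k * N / real m \<le> T + N / real m" .
  have "real k * N / real m \<le> real m * N / real m"
    using km assms(3) by (intro divide_right_mono mult_right_mono) auto
  then show "real k * N / real m \<le> N" using assms(4) by simp
qed

lemma square_le_2: "(x::real)\<^sup>2 \<le> 2 * (x - y)\<^sup>2 + 2 * y\<^sup>2"
proof -
  have "0 \<le> (x - 2 * y)\<^sup>2" by simp
  then show ?thesis by (simp add: power2_eq_square algebra_simps)
qed

lemma ennreal_square_le_2: "ennreal ((x::real)\<^sup>2) \<le> 2 * ennreal ((x - y)\<^sup>2) + 2 * ennreal (y\<^sup>2)"
proof -
  have "ennreal (x\<^sup>2) \<le> ennreal (2 * (x - y)\<^sup>2 + 2 * y\<^sup>2)" by (intro ennreal_leI square_le_2)
  also have "\<dots> = 2 * ennreal ((x - y)\<^sup>2) + 2 * ennreal (y\<^sup>2)" by (simp add: ennreal_mult)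
  finally show ?thesis .
qed

lemma nn_integral_square_le_2:
  fixes f g :: "'b \<Rightarrow> real"
  assumes [measurable]: "f \<in> borel_measurable K" "g \<in> borel_measurable K"
  shows "(\<integral>\<^sup>+x. ennreal ((f x)\<^sup>2) \<partial>K) \<le> 2 * (\<integral>\<^sup>+x. ennreal ((f x - g x)\<^sup>2) \<partial>K) + 2 * (\<integral>\<^sup>+x. ennreal ((g x)\<^sup>2) \<partial>K)"
proof -
  have "(\<integral>\<^sup>+x. ennreal ((f x)\<^sup>2) \<partial>K) \<le> (\<integral>\<^sup>+x. 2 * ennreal ((f x - g x)\<^sup>2) + 2 * ennreal ((g x)\<^sup>2) \<partial>K)"
    by (intro nn_integral_mono ennreal_square_le_2)
  also have "\<dots> = 2 * (\<integral>\<^sup>+x. ennreal ((f x - g x)\<^sup>2) \<partial>K) + 2 * (\<integral>\<^sup>+x. ennreal ((g x)\<^sup>2) \<partial>K)"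
    by (simp add: nn_integral_add nn_integral_cmult)
  finally show ?thesis .
qed

lemma set_nn_integral_square_measurable:
  fixes f :: "real \<Rightarrow> 'b \<Rightarrow> real"
  assumes f: "(\<lambda>(s, w). f s w) \<in> borel_measurable (borel \<Otimes>\<^sub>M K)" and J: "J \<in> sets borel"
  shows "(\<lambda>w. \<integral>\<^sup>+s\<in>J. ennreal ((f s w)\<^sup>2) \<partial>lborel) \<in> borel_measurable K"
proof -
  have "(\<lambda>z. (snd z, fst z)) \<in> K \<Otimes>\<^sub>M lborel \<rightarrow>\<^sub>M borel \<Otimes>\<^sub>M K" by measurable
  from measurable_compose[OF this f] have 1: "(\<lambda>z. f (snd z) (fst z)) \<in> borel_measurable (K \<Otimes>\<^sub>M lborel)"
    by simp
  have "(\<lambda>z. indicator J (snd z) :: ennreal) \<in> borel_measurable (K \<Otimes>\<^sub>M lborel)"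
    using J by (intro measurable_compose[OF measurable_snd borel_measurable_indicator]) simp
  then have "(\<lambda>z. ennreal ((f (snd z) (fst z))\<^sup>2) * indicator J (snd z)) \<in> borel_measurable (K \<Otimes>\<^sub>M lborel)"
    by (intro borel_measurable_times_ennreal measurable_compose[OF _ measurable_ennreal] borel_measurable_power 1)
  then show ?thesis
    by (intro sigma_finite_measure.borel_measurable_nn_integral sigma_finite_lborel) (simp add: case_prod_beta)
qed

text \<open>A given integral with its energy. It is instantiated by the martingale parts of
  \<open>R^2\<close> and of \<open>R^(2 \<alpha>)\<close>, by the Brownian motion as the integral of
  1, and by the reinforced integral in the changed filtration.\<close>

locale ito_space = brownian_space M F B for M :: "'a measure" and F B +
  fixes H I A :: "real \<Rightarrow> 'a \<Rightarrow> real"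
  assumes ito: "ito_integral M F B H I" and energy: "energy_process H A"
begin

lemma H_progressive: "progressive F H" and I_cont: "continuous_adapted M F I"
  using ito by (auto simp: ito_integral_def)

lemmas A_cont = energy_processD(1)[OF energy]
  and A_0 = energy_processD(2)[OF energy]
  and A_mono = energy_processD(3)[OF energy]
  and A_eq = energy_processD(4)[OF energy]
  and A_nonneg = energy_processD(5)[OF energy]

lemma H_path_measurable:
  assumes "w \<in> space M" "0 \<le> N"
  shows "(\<lambda>s. indicator {0..N} s * H s w) \<in> borel_measurable borel"
  using measurable_compose[OF measurable_Pair2'[OF assms(1)] progressive_measurable_M[OF H_progressive assms(2)]]
  by simp

lemma simple_path_measurable:
  assumes "simple_integrand M F S" "w \<in> space M"
  shows "(\<lambda>s. simple_process S s w) \<in> borel_measurable borel"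
  using measurable_compose[OF measurable_Pair2'[OF assms(2)] simple_process_measurable[OF assms(1)]]
  by simp

section \<open>Stochastic integrals stopped at a bounded time of bounded energy\<close>

context
  fixes T :: "'a \<Rightarrow> real" and N c :: real
  assumes T: "stopping_time F T" and N: "0 < N" and T01: "\<And>w. w \<in> space M \<Longrightarrow> 0 \<le> T w \<and> T w \<le> N"
    and c: "0 \<le> c" and AT: "AE w in M. A (T w) w \<le> c"
begin

text \<open>The integrand cut at \<open>T\<close>, whose full integral should be \<open>I\<close> at
  time \<open>T\<close>. The factor for \<open>{0..N}\<close> brings in the form in which
  progressive processes are known to be jointly measurable.\<close>

definition G :: "real \<Rightarrow> 'a \<Rightarrow> real" where
  "G s w = indicator {0..T w} s * (indicator {0..N} s * H s w)"

lemma T_meas [measurable]: "T \<in> borel_measurable M"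
  by (rule stopping_time_measurable_M[OF T])

lemma G_meas: "(\<lambda>(s, w). G s w) \<in> borel_measurable (borel \<Otimes>\<^sub>M M)"
proof -
  have 1: "(\<lambda>z. indicator {0..N} (fst z) * H (fst z) (snd z)) \<in> borel_measurable (borel \<Otimes>\<^sub>M M)"
    using progressive_measurable_M[OF H_progressive] N by (simp add: case_prod_beta)
  have "(\<lambda>z. if 0 \<le> fst z \<and> fst z \<le> T (snd z) then 1 else (0 :: real)) \<in> borel_measurable (borel \<Otimes>\<^sub>M M)"
    by measurable
  from borel_measurable_times[OF this 1]
  have "(\<lambda>z. (if 0 \<le> fst z \<and> fst z \<le> T (snd z) then 1 else 0) * (indicator {0..N} (fst z) * H (fst z) (snd z)))
     \<in> borel_measurable (borel \<Otimes>\<^sub>M M)" .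
  also have "(\<lambda>z. (if 0 \<le> fst z \<and> fst z \<le> T (snd z) then 1 else 0) * (indicator {0..N} (fst z) * H (fst z) (snd z)))
     = (\<lambda>(s, w). G s w)"
    unfolding G_def by (intro ext) (auto split: split_indicator)
  finally show ?thesis .
qed

lemma G_path: "w \<in> space M \<Longrightarrow> (\<lambda>s. G s w) \<in> borel_measurable borel"
  using measurable_compose[OF measurable_Pair2' G_meas] by simp

lemma G_energy:
  "AE w in M. (\<integral>\<^sup>+s. ennreal ((G s w)\<^sup>2) \<partial>lborel) = ennreal (A (T w) w)"
  using A_eq AE_space
proof eventually_elim
  case (elim w)
  have "(\<integral>\<^sup>+s. ennreal ((G s w)\<^sup>2) \<partial>lborel) = (sq_int {0..T w} (\<lambda>s. H s w))"
    using T01[OF elim(2)] by (intro nn_integral_cong) (auto simp: G_def split: split_indicator)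
  then show ?case using elim T01[OF elim(2)] by auto
qed

lemma AT_meas [measurable]: "(\<lambda>w. A (T w) w) \<in> borel_measurable M"
  by (rule random_time_measurable[OF A_cont, of _ N]) (use T01 in auto)

lemma IT_meas [measurable]: "(\<lambda>w. I (T w) w) \<in> borel_measurable M"
  by (rule random_time_measurable[OF I_cont, of _ N]) (use T01 in auto)

definition grid :: "nat \<Rightarrow> 'a \<Rightarrow> real" where
  "grid m w = real (nat \<lceil>T w * real m / N\<rceil>) * N / real m"

lemma grid:
  assumes "w \<in> space M" "0 < m"
  shows "T w \<le> grid m w" "grid m w \<le> T w + N / real m" "grid m w \<le> N" "0 \<le> grid m w"
  using grid_above[of "T w" N m] T01[OF assms(1)] N assms(2) unfolding grid_def by auto

lemma grid_meas [measurable]: "grid m \<in> borel_measurable M"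
proof -
  have "(\<lambda>w. real (nat \<lceil>T w * real m / N\<rceil>) * N / real m) \<in> borel_measurable M" by measurable
  then show ?thesis unfolding grid_def[abs_def] .
qed

lemma grid_tendsto:
  assumes "w \<in> space M" shows "(\<lambda>m. grid m w) \<longlonglongrightarrow> T w"
proof (rule tendsto_sandwich[where f="\<lambda>_. T w" and h="\<lambda>m. T w + N / real m"])
  show "(\<lambda>m. T w + N / real m) \<longlonglongrightarrow> T w"
    using tendsto_add[OF tendsto_const lim_const_over_n[of N], of "T w"] by simp
  show "\<forall>\<^sub>F m in sequentially. T w \<le> grid m w" "\<forall>\<^sub>F m in sequentially. grid m w \<le> T w + N / real m"
    using eventually_gt_at_top[of 0] by (eventually_elim; use grid[OF assms] in blast)+
qed simp

lemma grid_close: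
  assumes "0 < \<delta>"
  shows "\<exists>m>0. likely \<delta> (\<lambda>w. \<bar>A (grid m w) w - A (T w) w\<bar> \<le> \<delta> \<and> \<bar>I (grid m w) w - I (T w) w\<bar> \<le> \<delta>)"
proof -
  have conv: "(\<lambda>m. X (grid (Suc m) w) w) \<longlonglongrightarrow> X (T w) w" if "continuous_adapted M F X" "w \<in> space M" for X w
    using that T01 grid(4)[OF that(2), of "Suc _"] LIMSEQ_Suc[OF grid_tendsto[OF that(2)]]
    by (intro continuous_on_tendsto_compose[OF continuous_adaptedD(4)[OF that]]) auto
  have [measurable]: "(\<lambda>w. A (grid (Suc m) w) w) \<in> borel_measurable M" for m
    by (rule random_time_measurable[OF A_cont, of _ N]) (use grid in auto)
  have [measurable]: "(\<lambda>w. I (grid (Suc m) w) w) \<in> borel_measurable M" for m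
    by (rule random_time_measurable[OF I_cont, of _ N]) (use grid in auto)
  have "\<forall>\<^sub>F m in sequentially. likely \<delta> (\<lambda>w. \<bar>A (grid (Suc m) w) w - A (T w) w\<bar> \<le> \<delta> \<and> \<bar>I (grid (Suc m) w) w - I (T w) w\<bar> \<le> \<delta>)"
  proof (rule likely_eventually)
    show "AE w in M. \<forall>\<^sub>F m in sequentially. \<bar>A (grid (Suc m) w) w - A (T w) w\<bar> \<le> \<delta> \<and> \<bar>I (grid (Suc m) w) w - I (T w) w\<bar> \<le> \<delta>"
      using AE_space
    proof eventually_elim
      case (elim w)
      have "\<forall>\<^sub>F m in sequentially. dist (A (grid (Suc m) w) w) (A (T w) w) < \<delta>"
        "\<forall>\<^sub>F m in sequentially. dist (I (grid (Suc m) w) w) (I (T w) w) < \<delta>"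
        using tendstoD[OF conv[OF A_cont elim] assms] tendstoD[OF conv[OF I_cont elim] assms] by auto
      then show ?case by eventually_elim (auto simp: dist_real_def)
    qed
    show "{w \<in> space M. \<not> (\<bar>A (grid (Suc m) w) w - A (T w) w\<bar> \<le> \<delta> \<and> \<bar>I (grid (Suc m) w) w - I (T w) w\<bar> \<le> \<delta>)} \<in> sets M" for m
      by measurable
  qed fact
  then obtain m where "likely \<delta> (\<lambda>w. \<bar>A (grid (Suc m) w) w - A (T w) w\<bar> \<le> \<delta> \<and> \<bar>I (grid (Suc m) w) w - I (T w) w\<bar> \<le> \<delta>)"
    by (auto simp: eventually_sequentially)
  then show ?thesis by (intro exI[of _ "Suc m"]) simp
qed

text \<open>A simple integrand close to \<open>H\<close> is cut off after the first grid point past \<open>T\<close>; truncating its energy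
  makes the approximations bounded in \<open>L\<^sup>2\<close>.\<close>

lemma stopped_approx:
  assumes e: "0 < e" "e \<le> 1"
  obtains S where "simple_integrand M F S"
    "\<And>w. (\<integral>\<^sup>+s. ennreal ((simple_process S s w)\<^sup>2) \<partial>lborel) \<le> ennreal (2 * c + 1)"
    "likely e (\<lambda>w. (sq_int {0<..N} (\<lambda>s. simple_process S s w - G s w)) \<le> ennreal e \<and>
       \<bar>simple_integral B S N w - I (T w) w\<bar> \<le> e)"
proof -
  \<comment> \<open>Budget: three exceptional events cost \<open>3 * \<delta>\<close>, the energy
    distance \<open>4 * \<delta>\<close>, the distance of integrals \<open>2 * \<delta>\<close>, and
    the truncation level asks for \<open>8 * \<delta> \<le> 1\<close>.\<close>
  define \<delta> where "\<delta> = e / 8"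
  have \<delta>: "0 < \<delta>" using e by (simp add: \<delta>_def)
  obtain S0 where S0: "simple_integrand M F S0"
     "likely \<delta> (\<lambda>w. (sq_int {0..N} (\<lambda>s. simple_process S0 s w - H s w)) \<le> ennreal \<delta> \<and>
       (\<forall>s\<in>{0..N}. \<bar>simple_integral B S0 s w - I s w\<bar> \<le> \<delta>))"
    using ito_approxI[OF B_cont ito, unfolded ito_approx_def, rule_format, of N \<delta>] N \<delta> by auto
  obtain m where m: "0 < m" "likely \<delta> (\<lambda>w. \<bar>A (grid m w) w - A (T w) w\<bar> \<le> \<delta> \<and> \<bar>I (grid m w) w - I (T w) w\<bar> \<le> \<delta>)"
    using grid_close[OF \<delta>] by auto
  define v where "v i = real i * N / real m" for i
  have v: "0 \<le> v i" "v i \<le> v (Suc i)" for i using N m(1) by (auto simp: v_def divide_right_mono)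
  \<comment> \<open>The cells starting strictly before \<open>T\<close> are kept. Each coefficient
    is known at the start of its cell because \<open>T\<close> is a stopping time, and the kept
    cells end at \<open>grid m\<close>.\<close>
  define \<psi> where "\<psi> i w = (if v i < T w then 1 else 0 :: real)" for i w
  have \<psi>: "\<psi> i \<in> borel_measurable (F (v i))" for i
    using stopping_timeD2[OF T, of "v i"] unfolding \<psi>_def by measurable
  obtain U where U: "simple_integrand M F U"
    "\<And>s w. simple_process U s w = simple_process S0 s w * (\<Sum>i<m. \<psi> i w * indicator {v i<..v (Suc i)} s)"
    "\<And>X t w. simple_integral X U t w =
       (\<Sum>i<m. \<psi> i w * (simple_integral X S0 (min t (v (Suc i))) w - simple_integral X S0 (min t (v i)) w))"
  proof (rule simple_mult_steps[where v=v and \<psi>=\<psi> and m=m and C="\<lambda>_. 1", OF S0(1) v(1) v(2) \<psi>])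
    show "\<bar>\<psi> i w\<bar> \<le> 1" for i w by (simp add: \<psi>_def)
  qed (rule that)
  have tel: "(\<Sum>i<m. \<psi> i w * (f (Suc i) - f i)) = f (nat \<lceil>T w * real m / N\<rceil>) - f 0" if "w \<in> space M" for f w
  proof -
    let ?k = "nat \<lceil>T w * real m / N\<rceil>"
    have k: "?k \<le> m" "\<And>i. v i < T w \<longleftrightarrow> i < ?k"
      using grid_above[of "T w" N m] T01[OF that] N m unfolding v_def by auto
    show ?thesis using sum_telescope_between[of 0 ?k m f] k by (simp add: \<psi>_def)
  qed
  have v0: "v 0 = 0" "v (nat \<lceil>T w * real m / N\<rceil>) = grid m w" for w by (auto simp: v_def grid_def)
  have U2: "simple_process U s w = simple_process S0 s w * indicator {0<..grid m w} s" if "w \<in> space M" for s w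
  proof -
    have "(\<Sum>i<m. \<psi> i w * indicator {v i<..v (Suc i)} s) = (\<Sum>i<m. \<psi> i w * ((if s \<le> v (Suc i) then 1 else 0) - (if s \<le> v i then 1 else 0)))"
      by (simp add: indicator_Ioc_eq_diff v)
    also have "\<dots> = indicator {0<..grid m w} s"
      using tel[OF that, of "\<lambda>i. if s \<le> v i then 1 else 0"] grid(4)[OF that m(1)] by (simp add: v0 indicator_Ioc_eq_diff)
    finally show ?thesis unfolding U(2) by simp
  qed
  have S00: "simple_integral B S0 0 w = 0" for w
  proof -
    obtain n \<tau> \<xi> where Sd: "S0 = (n, \<tau>, \<xi>)" by (cases S0) auto
    show ?thesis using simple_partition_nonneg[OF S0(1)[unfolded Sd]] by (auto simp: Sd min_absorb1 intro!: sum.neutral)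
  qed
  have U3: "simple_integral B U N w = simple_integral B S0 (grid m w) w" if "w \<in> space M" for w
  proof -
    have "simple_integral B U N w = (\<Sum>i<m. \<psi> i w * (simple_integral B S0 (min N (v (Suc i))) w - simple_integral B S0 (min N (v i)) w))"
      by (rule U(3))
    also have "\<dots> = simple_integral B S0 (grid m w) w"
      using tel[OF that, of "\<lambda>i. simple_integral B S0 (min N (v i)) w"] grid(3)[OF that m(1)] N
      by (simp only: v0 min_absorb2 S00)
    finally show ?thesis .
  qed
  \<comment> \<open>On the good event the energy of \<open>U\<close> is at most
    \<open>2 * (4 * \<delta>) + 2 * c\<close>, hence below this level, so there the truncation
    changes nothing.\<close>
  obtain S where S: "simple_integrand M F S"
    "\<And>w. (\<integral>\<^sup>+s. ennreal ((simple_process S s w)\<^sup>2) \<partial>lborel) \<le> ennreal (2 * c + 1)"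
    "\<And>w. (\<integral>\<^sup>+s. ennreal ((simple_process U s w)\<^sup>2) \<partial>lborel) \<le> ennreal (2 * c + 1) \<Longrightarrow>
       (\<forall>s. simple_process S s w = simple_process U s w) \<and>
       (\<forall>X t. simple_integral X S t w = simple_integral X U t w)"
    
  proof (rule simple_truncate[OF U(1), of "2 * c + 1"])
    show "0 \<le> 2 * c + 1" using c by simp
  qed (rule that)
  have "likely (\<delta> + \<delta> + \<delta>) (\<lambda>w. (((sq_int {0..N} (\<lambda>s. simple_process S0 s w - H s w)) \<le> ennreal \<delta> \<and>
       (\<forall>s\<in>{0..N}. \<bar>simple_integral B S0 s w - I s w\<bar> \<le> \<delta>)) \<and>
       (\<bar>A (grid m w) w - A (T w) w\<bar> \<le> \<delta> \<and> \<bar>I (grid m w) w - I (T w) w\<bar> \<le> \<delta>)) \<and>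
       (A (T w) w \<le> c \<and> (\<forall>t\<ge>0. (sq_int {0..t} (\<lambda>s. H s w)) = ennreal (A t w))))"
    using AT A_eq \<delta> by (intro likely_conj S0(2) m(2) likely_AE) auto
  then have "likely e (\<lambda>w. (sq_int {0<..N} (\<lambda>s. simple_process S s w - G s w)) \<le> ennreal e \<and>
       \<bar>simple_integral B S N w - I (T w) w\<bar> \<le> e)"
  proof (rule likely_mono)
    show "\<delta> + \<delta> + \<delta> \<le> e" using e by (simp add: \<delta>_def)
    fix w assume w: "w \<in> space M"
    assume "((((sq_int {0..N} (\<lambda>s. simple_process S0 s w - H s w)) \<le> ennreal \<delta> \<and>
       (\<forall>s\<in>{0..N}. \<bar>simple_integral B S0 s w - I s w\<bar> \<le> \<delta>)) \<and>
       (\<bar>A (grid m w) w - A (T w) w\<bar> \<le> \<delta> \<and> \<bar>I (grid m w) w - I (T w) w\<bar> \<le> \<delta>)) \<and>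
       (A (T w) w \<le> c \<and> (\<forall>t\<ge>0. (sq_int {0..t} (\<lambda>s. H s w)) = ennreal (A t w))))"
    then have 1: "(sq_int {0..N} (\<lambda>s. simple_process S0 s w - H s w)) \<le> ennreal \<delta>"
      and 2: "\<And>s. s \<in> {0..N} \<Longrightarrow> \<bar>simple_integral B S0 s w - I s w\<bar> \<le> \<delta>"
      and 3: "\<bar>A (grid m w) w - A (T w) w\<bar> \<le> \<delta>" "\<bar>I (grid m w) w - I (T w) w\<bar> \<le> \<delta>"
      and 4: "A (T w) w \<le> c" "\<And>t. 0 \<le> t \<Longrightarrow> (sq_int {0..t} (\<lambda>s. H s w)) = ennreal (A t w)"
      by auto
    note g = grid[OF w m(1)] and t = T01[OF w]
    let ?H = "\<lambda>s. indicator {0..N} s * H s w" and ?S = "\<lambda>s. simple_process S0 s w"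
    have [measurable]: "?H \<in> borel_measurable borel" "?S \<in> borel_measurable borel" "(\<lambda>s. simple_process U s w) \<in> borel_measurable borel"
       "(\<lambda>s. G s w) \<in> borel_measurable borel"
      using H_path_measurable[OF w] N simple_path_measurable[OF S0(1) w] simple_path_measurable[OF U(1) w] G_path[OF w] by auto
    \<comment> \<open>The energy spent between \<open>T\<close> and the next grid point is the
      increment of \<open>A\<close>. It can be isolated by cancellation since \<open>A\<close> is
      finite at \<open>T\<close>.\<close>
    have tail: "(\<integral>\<^sup>+s. ennreal ((?H s)\<^sup>2) * indicator {T w<..grid m w} s \<partial>lborel) \<le> ennreal \<delta>"
    proof -
      have "(sq_int {0..grid m w} (\<lambda>s. H s w)) =
        (\<integral>\<^sup>+s. ennreal ((?H s)\<^sup>2) * indicator {0..T w} s + ennreal ((?H s)\<^sup>2) * indicator {T w<..grid m w} s \<partial>lborel)"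
        using g t by (intro nn_integral_cong) (auto split: split_indicator)
      also have "\<dots> = (\<integral>\<^sup>+s. ennreal ((?H s)\<^sup>2) * indicator {0..T w} s \<partial>lborel) + (\<integral>\<^sup>+s. ennreal ((?H s)\<^sup>2) * indicator {T w<..grid m w} s \<partial>lborel)"
        by (intro nn_integral_add) auto
      also have "(\<integral>\<^sup>+s. ennreal ((?H s)\<^sup>2) * indicator {0..T w} s \<partial>lborel) = (sq_int {0..T w} (\<lambda>s. H s w))"
        using t by (intro nn_integral_cong) (auto split: split_indicator)
      finally have "ennreal (A (grid m w) w) = ennreal (A (T w) w) + (\<integral>\<^sup>+s. ennreal ((?H s)\<^sup>2) * indicator {T w<..grid m w} s \<partial>lborel)"
        using 4(2) g t by simp
      moreover have "ennreal (A (grid m w) w) \<le> ennreal (A (T w) w) + ennreal \<delta>"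
        using 3 A_nonneg[OF w, of "T w"] t \<delta> by (subst ennreal_plus[symmetric]) (auto intro!: ennreal_leI simp del: ennreal_plus)
      ultimately have "ennreal (A (T w) w) + (\<integral>\<^sup>+s. ennreal ((?H s)\<^sup>2) * indicator {T w<..grid m w} s \<partial>lborel) \<le> ennreal (A (T w) w) + ennreal \<delta>"
        by (simp only:)
      then show ?thesis by (simp only: ennreal_add_left_cancel_le ennreal_neq_top infinity_ennreal_def simp_thms)
    qed
    have pt: "ennreal ((simple_process U s w - G s w)\<^sup>2) * indicator {0<..N} s \<le>
       2 * (ennreal ((?S s - ?H s)\<^sup>2) * indicator {0..N} s) + 2 * (ennreal ((?H s)\<^sup>2) * indicator {T w<..grid m w} s)" for s
    proof -
      consider "\<not> (0 < s \<and> s \<le> N)" | "0 < s" "s \<le> N" "s \<le> T w" | "0 < s" "s \<le> N" "T w < s" "s \<le> grid m w" | "0 < s" "s \<le> N" "grid m w < s" by linarith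
      then show ?thesis
      proof cases
        case 2
        have "ennreal ((?S s - ?H s)\<^sup>2) \<le> 2 * ennreal ((?S s - ?H s)\<^sup>2)"
          by (metis (no_types) add_increasing2 mult_2 order_refl zero_le)
        then show ?thesis using 2 g by (simp add: U2[OF w] G_def)
      next
        case 3
        then show ?thesis using ennreal_square_le_2[of "?S s" "?H s"] g t by (simp add: U2[OF w] G_def)
      next
        case 4 then show ?thesis using g t by (simp add: U2[OF w] G_def)
      qed auto
    qed
    have "(sq_int {0<..N} (\<lambda>s. simple_process U s w - G s w)) \<le>
       (\<integral>\<^sup>+s. 2 * (ennreal ((?S s - ?H s)\<^sup>2) * indicator {0..N} s) + 2 * (ennreal ((?H s)\<^sup>2) * indicator {T w<..grid m w} s) \<partial>lborel)"
      by (intro nn_integral_mono pt)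
    also have "\<dots> = 2 * (\<integral>\<^sup>+s. ennreal ((?S s - ?H s)\<^sup>2) * indicator {0..N} s \<partial>lborel) + 2 * (\<integral>\<^sup>+s. ennreal ((?H s)\<^sup>2) * indicator {T w<..grid m w} s \<partial>lborel)"
      by (subst nn_integral_add) (auto simp: nn_integral_cmult)
    also have "(\<integral>\<^sup>+s. ennreal ((?S s - ?H s)\<^sup>2) * indicator {0..N} s \<partial>lborel) = (sq_int {0..N} (\<lambda>s. simple_process S0 s w - H s w))"
      by (intro nn_integral_cong) (auto split: split_indicator)
    also have "2 * \<dots> + 2 * (\<integral>\<^sup>+s. ennreal ((?H s)\<^sup>2) * indicator {T w<..grid m w} s \<partial>lborel) \<le> 2 * ennreal \<delta> + 2 * ennreal \<delta>"
      using 1 tail by (intro add_mono mult_left_mono) auto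
    also have "2 * ennreal \<delta> + 2 * ennreal \<delta> = ennreal (4 * \<delta>)"
      using \<delta> by (simp add: ennreal_mult flip: distrib_right)
    finally have close: "(sq_int {0<..N} (\<lambda>s. simple_process U s w - G s w)) \<le> ennreal (4 * \<delta>)" .
    have "(\<integral>\<^sup>+s. ennreal ((simple_process U s w)\<^sup>2) \<partial>lborel) \<le>
       (\<integral>\<^sup>+s. 2 * (ennreal ((simple_process U s w - G s w)\<^sup>2) * indicator {0<..N} s) + 2 * ennreal ((G s w)\<^sup>2) \<partial>lborel)"
    proof (intro nn_integral_mono)
      fix s show "ennreal ((simple_process U s w)\<^sup>2) \<le> 2 * (ennreal ((simple_process U s w - G s w)\<^sup>2) * indicator {0<..N} s) + 2 * ennreal ((G s w)\<^sup>2)"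
        using ennreal_square_le_2[of "simple_process U s w" "G s w"] g
        by (cases "s \<in> {0<..N}") (auto simp: U2[OF w])
    qed
    also have "\<dots> = 2 * (sq_int {0<..N} (\<lambda>s. simple_process U s w - G s w)) + 2 * (\<integral>\<^sup>+s. ennreal ((G s w)\<^sup>2) \<partial>lborel)"
      by (subst nn_integral_add) (auto simp: nn_integral_cmult)
    also have "(\<integral>\<^sup>+s. ennreal ((G s w)\<^sup>2) \<partial>lborel) = (sq_int {0..T w} (\<lambda>s. H s w))"
      using t by (intro nn_integral_cong) (auto simp: G_def split: split_indicator)
    also have "\<dots> \<le> ennreal c" using 4 t by (simp add: ennreal_leI)
    also have "2 * (sq_int {0<..N} (\<lambda>s. simple_process U s w - G s w)) + 2 * ennreal c \<le> 2 * ennreal (4 * \<delta>) + 2 * ennreal c"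
      using close by (intro add_mono mult_left_mono) auto
    also have "\<dots> = ennreal (8 * \<delta> + 2 * c)" using \<delta> c by (simp add: ennreal_mult flip: mult.assoc)
    also have "\<dots> \<le> ennreal (2 * c + 1)" using e by (intro ennreal_leI) (simp add: \<delta>_def)
    finally have "(\<integral>\<^sup>+s. ennreal ((simple_process U s w)\<^sup>2) \<partial>lborel) \<le> ennreal (2 * c + 1)"
      by (simp add: add_left_mono mult_left_mono)
    note same = S(3)[OF this]
    have "(sq_int {0<..N} (\<lambda>s. simple_process S s w - G s w)) \<le> ennreal (4 * \<delta>)"
      using close same by simp
    also have "\<dots> \<le> ennreal e" using e by (intro ennreal_leI) (simp add: \<delta>_def)
    finally have "(sq_int {0<..N} (\<lambda>s. simple_process S s w - G s w)) \<le> ennreal e" .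
    moreover have "\<bar>simple_integral B S N w - I (T w) w\<bar> \<le> e"
    proof -
      have "simple_integral B S N w = simple_integral B S0 (grid m w) w" using same U3[OF w] by simp
      moreover have "\<bar>simple_integral B S0 (grid m w) w - I (grid m w) w\<bar> \<le> \<delta>" using 2[of "grid m w"] g by auto
      ultimately show ?thesis using 3(2) e(1) \<delta>_def by linarith
    qed
    ultimately show "(sq_int {0<..N} (\<lambda>s. simple_process S s w - G s w)) \<le> ennreal e \<and>
       \<bar>simple_integral B S N w - I (T w) w\<bar> \<le> e" ..
  qed
  with S show ?thesis using that by blast
qed

text \<open>The error in mean is at most \<open>e\<close> plus \<open>6 * c + 2\<close> times the
  probability of an exceptional event, itself below \<open>e\<close>. The second factor is
  \<open>2 * (2 * c + 1) + 2 * c\<close>, from the energies of the truncated integrand and of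
  \<open>G\<close>.\<close>

definition approx_const :: real where "approx_const = 6 * c + 3"

text \<open>Both energies are bounded by constants, and this boundedness turns closeness in
  probability into closeness in mean.\<close>

lemma stopped_approx_L2:
  assumes e: "0 < e" "e \<le> 1"
  obtains S where "simple_integrand M F S"
    "(\<integral>\<^sup>+w. (sq_int {0<..N} (\<lambda>s. simple_process S s w - G s w)) \<partial>M) \<le> ennreal (approx_const * e)"
    "likely e (\<lambda>w. \<bar>simple_integral B S N w - I (T w) w\<bar> \<le> e)"
proof -
  obtain S where S: "simple_integrand M F S"
    "\<And>w. (\<integral>\<^sup>+s. ennreal ((simple_process S s w)\<^sup>2) \<partial>lborel) \<le> ennreal (2 * c + 1)"
    "likely e (\<lambda>w. (sq_int {0<..N} (\<lambda>s. simple_process S s w - G s w)) \<le> ennreal e \<and>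
       \<bar>simple_integral B S N w - I (T w) w\<bar> \<le> e)"
    by (rule stopped_approx[OF e]) (rule that)
  obtain E where E: "E \<in> sets M" "prob E < e"
    "\<And>w. w \<in> space M - E \<Longrightarrow> (sq_int {0<..N} (\<lambda>s. simple_process S s w - G s w)) \<le> ennreal e"
    using S(3) unfolding likely_def by blast
  have bd: "AE w in M. (sq_int {0<..N} (\<lambda>s. simple_process S s w - G s w)) \<le> ennreal (6 * c + 2)"
    using G_energy AT AE_space
  proof eventually_elim
    case (elim w)
    have [measurable]: "(\<lambda>s. simple_process S s w) \<in> borel_measurable borel" "(\<lambda>s. G s w) \<in> borel_measurable borel"
      using simple_path_measurable[OF S(1) elim(3)] G_path[OF elim(3)] by auto
    have "(sq_int {0<..N} (\<lambda>s. simple_process S s w - G s w)) \<le>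
       (\<integral>\<^sup>+s. ennreal ((simple_process S s w - G s w)\<^sup>2) \<partial>lborel)"
      by (intro nn_integral_mono) (auto split: split_indicator)
    also have "\<dots> \<le> (\<integral>\<^sup>+s. 2 * ennreal ((simple_process S s w)\<^sup>2) + 2 * ennreal ((G s w)\<^sup>2) \<partial>lborel)"
      using ennreal_square_le_2[of "simple_process S s w - G s w" "- G s w" for s]
      by (intro nn_integral_mono) simp
    also have "\<dots> = 2 * (\<integral>\<^sup>+s. ennreal ((simple_process S s w)\<^sup>2) \<partial>lborel) + 2 * (\<integral>\<^sup>+s. ennreal ((G s w)\<^sup>2) \<partial>lborel)"
      by (subst nn_integral_add) (auto simp: nn_integral_cmult)
    also have "\<dots> \<le> 2 * ennreal (2 * c + 1) + 2 * ennreal c"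
      using S(2)[of w] elim(1,2) by (intro add_mono mult_left_mono) (auto intro: ennreal_leI)
    also have "\<dots> = ennreal (2 * (2 * c + 1)) + ennreal (2 * c)" using c by (simp only: ennreal_mult ennreal_numeral zero_le_numeral add_nonneg_nonneg mult_nonneg_nonneg zero_le_one)
    also have "\<dots> = ennreal (2 * (2 * c + 1) + 2 * c)" using c by (intro ennreal_plus[symmetric]) auto
    also have "2 * (2 * c + 1) + 2 * c = 6 * c + 2" by simp
    finally show ?case .
  qed
  have "(\<integral>\<^sup>+w. (sq_int {0<..N} (\<lambda>s. simple_process S s w - G s w)) \<partial>M) \<le>
    (\<integral>\<^sup>+w. ennreal e + ennreal (6 * c + 2) * indicator E w \<partial>M)"
  proof -
    have "AE w in M. (sq_int {0<..N} (\<lambda>s. simple_process S s w - G s w)) \<le> ennreal e + ennreal (6 * c + 2) * indicator E w"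
      using bd AE_space
    proof eventually_elim
    case (elim w)
    show ?case
    proof (cases "w \<in> E")
      case True
      then have "ennreal e + ennreal (6 * c + 2) * indicator E w = ennreal e + ennreal (6 * c + 2)" by simp
      then show ?thesis using elim(1) by (simp only: add_increasing zero_le)
    next
      case False then show ?thesis using E(3)[of w] elim(2) by simp
    qed
    qed
    then show ?thesis by (rule nn_integral_mono_AE)
  qed
  also have "\<dots> = ennreal e + ennreal (6 * c + 2) * emeasure M E"
    using E(1) by (subst nn_integral_add) (auto simp: nn_integral_cmult_indicator emeasure_space_1)
  also have "\<dots> \<le> ennreal e + ennreal (6 * c + 2) * ennreal e"
    using E(2) by (intro add_left_mono mult_left_mono) (auto simp: emeasure_eq_measure intro!: ennreal_leI)
  also have "\<dots> = ennreal (approx_const * e)"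
  proof -
    have "ennreal (6 * c + 2) * ennreal e = ennreal ((6 * c + 2) * e)"
      using e c by (intro ennreal_mult[symmetric]) auto
    moreover have "ennreal e + ennreal ((6 * c + 2) * e) = ennreal (e + (6 * c + 2) * e)"
      using e c by (intro ennreal_plus[symmetric]) auto
    moreover have "e + (6 * c + 2) * e = approx_const * e" by (simp add: approx_const_def algebra_simps)
    ultimately show ?thesis by (simp only:)
  qed
  finally show ?thesis
  proof (rule that[OF S(1)])
    show "likely e (\<lambda>w. \<bar>simple_integral B S N w - I (T w) w\<bar> \<le> e)"
      by (rule likely_mono[OF S(3) order_refl]) blast
  qed
qed

text \<open>With accuracies \<open>2^(-k)\<close> the approximations converge almost surely to
  \<open>I\<close> at \<open>T\<close> by Borel-Cantelli, while the isometry makes them Cauchy in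
  mean square. Fatou joins the two, so that square integrability of \<open>I\<close> at
  \<open>T\<close> is a result and not an assumption.\<close>

lemma stopped_L2_limit:
  obtains \<Phi> where
    "\<And>k. integrable M (\<Phi> k)" "\<And>k. (\<integral>w. \<Phi> k w \<partial>M) = 0" "\<And>k. integrable M (\<lambda>w. (\<Phi> k w)\<^sup>2)"
    "\<And>k. (\<integral>\<^sup>+w. ennreal ((\<Phi> k w - I (T w) w)\<^sup>2) \<partial>M) \<le> ennreal (4 * approx_const * (1/2)^k)"
    "\<And>k. (\<integral>\<^sup>+w. ennreal (A (T w) w) \<partial>M) \<le> 2 * (\<integral>\<^sup>+w. ennreal ((\<Phi> k w)\<^sup>2) \<partial>M) + ennreal (2 * approx_const * (1/2)^k)"
    "\<And>k. (\<integral>\<^sup>+w. ennreal ((\<Phi> k w)\<^sup>2) \<partial>M) \<le> 2 * (\<integral>\<^sup>+w. ennreal (A (T w) w) \<partial>M) + ennreal (2 * approx_const * (1/2)^k)"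
proof -
  have C: "0 \<le> approx_const" using c by (simp add: approx_const_def)
  define Q where "Q k S \<longleftrightarrow> simple_integrand M F S \<and>
    (\<integral>\<^sup>+w. (sq_int {0<..N} (\<lambda>s. simple_process S s w - G s w)) \<partial>M) \<le> ennreal (approx_const * (1/2)^k) \<and>
    likely ((1/2)^k) (\<lambda>w. \<bar>simple_integral B S N w - I (T w) w\<bar> \<le> (1/2)^k)" for k :: nat and S
  have "\<exists>S. Q k S" for k
  proof -
    have "(0::real) < (1/2)^k" "(1/2)^k \<le> (1::real)" by (auto intro: power_le_one)
    from stopped_approx_L2[OF this] show ?thesis unfolding Q_def by blast
  qed
  then obtain S where "\<And>k. Q k (S k)" by metis
  then have S: "\<And>k. simple_integrand M F (S k)"
    "\<And>k. (\<integral>\<^sup>+w. (sq_int {0<..N} (\<lambda>s. simple_process (S k) s w - G s w)) \<partial>M) \<le> ennreal (approx_const * (1/2)^k)"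
    "\<And>k. likely ((1/2)^k) (\<lambda>w. \<bar>simple_integral B (S k) N w - I (T w) w\<bar> \<le> (1/2)^k)"
    unfolding Q_def by blast+
  define \<Phi> where "\<Phi> k = simple_integral B (S k) N" for k
  have N0: "0 \<le> N" using N by simp
  note mom = simple_integral_moments[OF S(1) N0, folded \<Phi>_def]
  have [measurable]: "\<Phi> k \<in> borel_measurable M" for k using mom(1)[of k] by auto
  obtain E where E: "\<And>k. E k \<in> sets M" "\<And>k. prob (E k) < (1/2)^k"
    "\<And>k w. w \<in> space M - E k \<Longrightarrow> \<bar>\<Phi> k w - I (T w) w\<bar> \<le> (1/2)^k"
    using S(3) unfolding likely_def \<Phi>_def by metis
  have "AE w in M. \<forall>\<^sub>F k in sequentially. w \<in> space M - E k"
  proof (rule borel_cantelli_AE1)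
    show "summable (\<lambda>k. prob (E k))"
      by (rule summable_comparison_test[where g="\<lambda>k. (1/2)^k"]) (use E(2) in \<open>auto intro!: exI[of _ 0] less_imp_le summable_geometric\<close>)
  qed (use E(1) in \<open>auto simp: less_top[symmetric]\<close>)
  then have conv: "AE w in M. (\<lambda>k. \<Phi> k w) \<longlonglongrightarrow> I (T w) w"
  proof eventually_elim
    case (elim w)
    show ?case
    proof (rule LIM_zero_cancel, rule Lim_null_comparison)
      show "\<forall>\<^sub>F k in sequentially. norm (\<Phi> k w - I (T w) w) \<le> (1/2)^k"
        using elim by eventually_elim (use E(3) in auto)
      show "(\<lambda>k. (1/2)^k :: real) \<longlonglongrightarrow> 0" by (rule LIMSEQ_power_zero) simp
    qed
  qed
  have mG: "(\<lambda>w. \<integral>\<^sup>+s\<in>{0<..N}. ennreal ((simple_process (S k) s w - G s w)\<^sup>2) \<partial>lborel) \<in> borel_measurable M"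
    and mS: "(\<lambda>w. \<integral>\<^sup>+s\<in>{0<..N}. ennreal ((simple_process (S k) s w)\<^sup>2) \<partial>lborel) \<in> borel_measurable M" for k
    using borel_measurable_diff[OF simple_process_measurable[OF S(1)[of k]] G_meas] simple_process_measurable[OF S(1)[of k]]
    by (auto intro!: set_nn_integral_square_measurable simp: case_prod_beta)
  have dist: "(\<integral>\<^sup>+w. ennreal ((\<Phi> k w - \<Phi> l w)\<^sup>2) \<partial>M) \<le> ennreal (4 * approx_const * (1/2)^k)" if "k \<le> l" for k l
  proof -
    obtain U where U: "simple_integrand M F U"
      "\<And>s w. simple_process U s w = simple_process (S k) s w - simple_process (S l) s w"
      "\<And>X t w. simple_integral X U t w = simple_integral X (S k) t w - simple_integral X (S l) t w"
      by (rule simple_diff[OF S(1)[of k] S(1)[of l]]) (rule that)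
    have "(\<integral>\<^sup>+w. ennreal ((\<Phi> k w - \<Phi> l w)\<^sup>2) \<partial>M) = (\<integral>\<^sup>+w. ennreal ((simple_integral B U N w)\<^sup>2) \<partial>M)"
      unfolding U(3) \<Phi>_def ..
    also have "\<dots> = (\<integral>\<^sup>+w. (sq_int {0<..N} (\<lambda>s. simple_process U s w)) \<partial>M)"
      by (rule simple_integral_moments(4)[OF U(1) N0])
    also have "\<dots> \<le> (\<integral>\<^sup>+w. 2 * (sq_int {0<..N} (\<lambda>s. simple_process (S k) s w - G s w))
       + 2 * (sq_int {0<..N} (\<lambda>s. simple_process (S l) s w - G s w)) \<partial>M)"
    proof (rule nn_integral_mono)
      fix w assume w: "w \<in> space M"
      have [measurable]: "(\<lambda>s. simple_process (S k) s w) \<in> borel_measurable borel" "(\<lambda>s. G s w) \<in> borel_measurable borel" for k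
        using simple_path_measurable[OF S(1) w] G_path[OF w] by auto
      have "(sq_int {0<..N} (\<lambda>s. simple_process U s w)) \<le>
        (\<integral>\<^sup>+s. 2 * (ennreal ((simple_process (S k) s w - G s w)\<^sup>2) * indicator {0<..N} s) + 2 * (ennreal ((simple_process (S l) s w - G s w)\<^sup>2) * indicator {0<..N} s) \<partial>lborel)"
      proof (intro nn_integral_mono)
        fix s
        have "ennreal ((simple_process U s w)\<^sup>2) \<le> 2 * (ennreal ((simple_process (S k) s w - G s w)\<^sup>2)) + 2 * (ennreal ((simple_process (S l) s w - G s w)\<^sup>2))"
          using ennreal_square_le_2[of "simple_process U s w" "- (simple_process (S l) s w - G s w)"]
          unfolding U(2) by (simp add: power2_commute[of "G s w"])
        then show "ennreal ((simple_process U s w)\<^sup>2) * indicator {0<..N} s \<le> 2 * (ennreal ((simple_process (S k) s w - G s w)\<^sup>2) * indicator {0<..N} s) + 2 * (ennreal ((simple_process (S l) s w - G s w)\<^sup>2) * indicator {0<..N} s)"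
          by (auto split: split_indicator)
      qed
      also have "\<dots> = 2 * (sq_int {0<..N} (\<lambda>s. simple_process (S k) s w - G s w))
       + 2 * (sq_int {0<..N} (\<lambda>s. simple_process (S l) s w - G s w))"
        by (subst nn_integral_add) (auto simp: nn_integral_cmult)
      finally show "(sq_int {0<..N} (\<lambda>s. simple_process U s w)) \<le> \<dots>" .
    qed
    also have "\<dots> = 2 * (\<integral>\<^sup>+w. (sq_int {0<..N} (\<lambda>s. simple_process (S k) s w - G s w)) \<partial>M)
       + 2 * (\<integral>\<^sup>+w. (sq_int {0<..N} (\<lambda>s. simple_process (S l) s w - G s w)) \<partial>M)"
      using mG[of k] mG[of l] by (subst nn_integral_add) (auto simp: nn_integral_cmult intro: borel_measurable_times_ennreal)
    also have "\<dots> \<le> 2 * ennreal (approx_const * (1/2)^k) + 2 * ennreal (approx_const * (1/2)^l)"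
      by (intro add_mono mult_left_mono S(2)) auto
    also have "\<dots> = ennreal (2 * (approx_const * (1/2)^k) + 2 * (approx_const * (1/2)^l))"
      using C by (simp add: ennreal_mult)
    also have "\<dots> \<le> ennreal (4 * approx_const * (1/2)^k)"
    proof (rule ennreal_leI)
      have "(1/2)^l \<le> ((1/2)^k :: real)" using that by (intro power_decreasing) auto
      then have "approx_const * (1/2)^l \<le> approx_const * (1/2)^k" using C by (intro mult_left_mono)
      then show "2 * (approx_const * (1/2)^k) + 2 * (approx_const * (1/2)^l) \<le> 4 * approx_const * (1/2)^k" by simp
    qed
    finally show ?thesis .
  qed
  show ?thesis
  proof (rule that[of \<Phi>, OF mom(1-3)])
    fix k
    \<comment> \<open>Fatou along \<open>l\<close>: the Cauchy bound for
      \<open>\<Phi> k - \<Phi> l\<close> passes to the almost sure limit.\<close>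
    have "(\<integral>\<^sup>+w. ennreal ((\<Phi> k w - I (T w) w)\<^sup>2) \<partial>M) = (\<integral>\<^sup>+w. liminf (\<lambda>l. ennreal ((\<Phi> k w - \<Phi> l w)\<^sup>2)) \<partial>M)"
      using conv by (intro nn_integral_cong_AE, eventually_elim)
        (rule lim_imp_Liminf[symmetric], simp, intro tendsto_intros tendsto_ennrealI)
    also have "\<dots> \<le> liminf (\<lambda>l. \<integral>\<^sup>+w. ennreal ((\<Phi> k w - \<Phi> l w)\<^sup>2) \<partial>M)"
      by (rule nn_integral_liminf) measurable
    also have "\<dots> \<le> ennreal (4 * approx_const * (1/2)^k)"
      using eventually_ge_at_top[of k] by (intro Liminf_le, simp, eventually_elim) (rule dist)
    finally show "(\<integral>\<^sup>+w. ennreal ((\<Phi> k w - I (T w) w)\<^sup>2) \<partial>M) \<le> ennreal (4 * approx_const * (1/2)^k)" .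
    \<comment> \<open>The single time 0, which belongs to no half-open cell, carries no Lebesgue
      measure.\<close>
    have AG: "AE w in M. ennreal (A (T w) w) = (sq_int {0<..N} (\<lambda>s. G s w))"
      using G_energy AE_space
    proof eventually_elim
      case (elim w)
      have "(\<integral>\<^sup>+s. ennreal ((G s w)\<^sup>2) \<partial>lborel) = (sq_int {0<..N} (\<lambda>s. G s w))"
      proof (rule nn_integral_cong_AE)
        show "AE s in lborel. ennreal ((G s w)\<^sup>2) = ennreal ((G s w)\<^sup>2) * indicator {0<..N} s"
          using AE_lborel_singleton[of "0::real"] by eventually_elim (auto simp: G_def split: split_indicator)
      qed
      then show ?case using elim by simp
    qed
    define \<mu> where "\<mu> = restrict_space lborel {0<..N}"
    have res: "(\<integral>\<^sup>+s\<in>{0<..N}. f s \<partial>lborel) = integral\<^sup>N \<mu> f" for f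
      unfolding \<mu>_def by (subst nn_integral_restrict_space) auto
    have two: "(sq_int {0<..N} u) \<le>
        2 * (sq_int {0<..N} (\<lambda>s. u s - u' s)) + 2 * (sq_int {0<..N} u')"
      if "u \<in> borel_measurable borel" "u' \<in> borel_measurable borel" for u u' :: "real \<Rightarrow> real"
      unfolding res using that by (intro nn_integral_square_le_2) (auto simp: \<mu>_def intro: measurable_restrict_space1)
    have paths: "(\<lambda>s. simple_process (S k) s w) \<in> borel_measurable borel" "(\<lambda>s. G s w) \<in> borel_measurable borel"
      if "w \<in> space M" for w
      using simple_path_measurable[OF S(1) that] G_path[OF that] by auto
    have small: "2 * (\<integral>\<^sup>+w. (sq_int {0<..N} (\<lambda>s. simple_process (S k) s w - G s w)) \<partial>M) + x
        \<le> x + ennreal (2 * approx_const * (1/2)^k)" for x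
    proof -
      have "2 * (\<integral>\<^sup>+w. (sq_int {0<..N} (\<lambda>s. simple_process (S k) s w - G s w)) \<partial>M)
        \<le> 2 * ennreal (approx_const * (1/2)^k)" by (intro mult_left_mono S(2)) auto
      also have "\<dots> = ennreal (2 * approx_const * (1/2)^k)"
        using C ennreal_mult[of 2 "approx_const * (1/2)^k"] by (simp add: mult.assoc)
      finally show ?thesis unfolding add.commute[of x] by (rule add_right_mono)
    qed
    have "(\<integral>\<^sup>+w. ennreal (A (T w) w) \<partial>M) \<le> (\<integral>\<^sup>+w. 2 * (sq_int {0<..N} (\<lambda>s. simple_process (S k) s w - G s w)) +
        2 * (sq_int {0<..N} (\<lambda>s. simple_process (S k) s w)) \<partial>M)"
    proof (rule nn_integral_mono_AE)
      show "AE w in M. ennreal (A (T w) w) \<le> 2 * (sq_int {0<..N} (\<lambda>s. simple_process (S k) s w - G s w)) +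
        2 * (sq_int {0<..N} (\<lambda>s. simple_process (S k) s w))"
        using AG AE_space
      proof eventually_elim
        case (elim w)
        show ?case unfolding elim(1) power2_commute[of "simple_process (S k) _ w"] by (rule two[OF paths(2,1)[OF elim(2)]])
      qed
    qed
    also have "\<dots> = 2 * (\<integral>\<^sup>+w. (sq_int {0<..N} (\<lambda>s. simple_process (S k) s w - G s w)) \<partial>M) +
        2 * (\<integral>\<^sup>+w. (sq_int {0<..N} (\<lambda>s. simple_process (S k) s w)) \<partial>M)"
      using mG[of k] mS[of k] by (subst nn_integral_add) (auto simp: nn_integral_cmult intro: borel_measurable_times_ennreal)
    also have "(\<integral>\<^sup>+w. (sq_int {0<..N} (\<lambda>s. simple_process (S k) s w)) \<partial>M) = (\<integral>\<^sup>+w. ennreal ((\<Phi> k w)\<^sup>2) \<partial>M)"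
      by (rule mom(4)[symmetric])
    also note small
    finally show "(\<integral>\<^sup>+w. ennreal (A (T w) w) \<partial>M) \<le> 2 * (\<integral>\<^sup>+w. ennreal ((\<Phi> k w)\<^sup>2) \<partial>M) + ennreal (2 * approx_const * (1/2)^k)" .
    have "(\<integral>\<^sup>+w. ennreal ((\<Phi> k w)\<^sup>2) \<partial>M) = (\<integral>\<^sup>+w. (sq_int {0<..N} (\<lambda>s. simple_process (S k) s w)) \<partial>M)"
      by (rule mom(4))
    also have "\<dots> \<le> (\<integral>\<^sup>+w. 2 * (sq_int {0<..N} (\<lambda>s. simple_process (S k) s w - G s w)) + 2 * ennreal (A (T w) w) \<partial>M)"
    proof (rule nn_integral_mono_AE)
      show "AE w in M. (sq_int {0<..N} (\<lambda>s. simple_process (S k) s w)) \<le>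
         2 * (sq_int {0<..N} (\<lambda>s. simple_process (S k) s w - G s w)) + 2 * ennreal (A (T w) w)"
        using AG AE_space
      proof eventually_elim
        case (elim w)
        show ?case unfolding elim(1) by (rule two[OF paths[OF elim(2)]])
      qed
    qed
    also have "\<dots> = 2 * (\<integral>\<^sup>+w. (sq_int {0<..N} (\<lambda>s. simple_process (S k) s w - G s w)) \<partial>M) +
        2 * (\<integral>\<^sup>+w. ennreal (A (T w) w) \<partial>M)"
      using mG[of k] by (subst nn_integral_add) (auto simp: nn_integral_cmult intro: borel_measurable_times_ennreal)
    also note small
    finally show "(\<integral>\<^sup>+w. ennreal ((\<Phi> k w)\<^sup>2) \<partial>M) \<le> 2 * (\<integral>\<^sup>+w. ennreal (A (T w) w) \<partial>M) + ennreal (2 * approx_const * (1/2)^k)" .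
  qed
qed

lemma ennreal_bound_LIMSEQ:
  fixes f :: "nat \<Rightarrow> real"
  assumes "\<And>k. a \<le> b + ennreal (f k)" "f \<longlonglongrightarrow> 0"
  shows "a \<le> b"
proof (rule ennreal_le_epsilon)
  fix e :: real assume "0 < e"
  then obtain k where "f k < e" using order_tendstoD(2)[OF assms(2)] by (auto simp: eventually_sequentially)
  then show "a \<le> b + ennreal e" using assms(1)[of k] by (meson add_left_mono ennreal_leI less_imp_le order_trans)
qed

text \<open>Mean zero passes to the limit in mean square. In place of the isometry there is a
  comparison in both directions, the factor 4 coming from two uses of
  \<open>x^2 \<le> 2 (x-y)^2 + 2 y^2\<close>.\<close>

lemma ito_stopped:
  shows ito_stopped_integrable: "integrable M (\<lambda>w. I (T w) w)"
    and ito_stopped_mean: "(\<integral>w. I (T w) w \<partial>M) = 0"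
    and ito_stopped_energy: "(\<integral>\<^sup>+w. ennreal (A (T w) w) \<partial>M) \<le> 4 * (\<integral>\<^sup>+w. ennreal ((I (T w) w)\<^sup>2) \<partial>M)"
    and ito_stopped_square: "(\<integral>\<^sup>+w. ennreal ((I (T w) w)\<^sup>2) \<partial>M) \<le> 4 * (\<integral>\<^sup>+w. ennreal (A (T w) w) \<partial>M)"
proof -
  obtain \<Phi> where \<Phi>:
    "\<And>k. integrable M (\<Phi> k)" "\<And>k. (\<integral>w. \<Phi> k w \<partial>M) = 0" "\<And>k. integrable M (\<lambda>w. (\<Phi> k w)\<^sup>2)"
    "\<And>k. (\<integral>\<^sup>+w. ennreal ((\<Phi> k w - I (T w) w)\<^sup>2) \<partial>M) \<le> ennreal (4 * approx_const * (1/2)^k)"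
    "\<And>k. (\<integral>\<^sup>+w. ennreal (A (T w) w) \<partial>M) \<le> 2 * (\<integral>\<^sup>+w. ennreal ((\<Phi> k w)\<^sup>2) \<partial>M) + ennreal (2 * approx_const * (1/2)^k)"
    "\<And>k. (\<integral>\<^sup>+w. ennreal ((\<Phi> k w)\<^sup>2) \<partial>M) \<le> 2 * (\<integral>\<^sup>+w. ennreal (A (T w) w) \<partial>M) + ennreal (2 * approx_const * (1/2)^k)"
    by (rule stopped_L2_limit) (rule that)
  have C: "0 \<le> approx_const" using c by (simp add: approx_const_def)
  have lim: "(\<lambda>k. a * (1/2)^k) \<longlonglongrightarrow> 0" for a :: real
    by (intro tendsto_mult_right_zero LIMSEQ_power_zero) simp
  have [measurable]: "\<Phi> k \<in> borel_measurable M" for k using \<Phi>(1) by auto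
  have D2: "integrable M (\<lambda>w. (\<Phi> k w - I (T w) w)\<^sup>2)" for k
  proof (rule integrableI_nonneg)
    show "(\<integral>\<^sup>+w. ennreal ((\<Phi> k w - I (T w) w)\<^sup>2) \<partial>M) < \<infinity>"
      using \<Phi>(4)[of k] by (auto intro: order_le_less_trans)
  qed auto
  have D: "integrable M (\<lambda>w. \<Phi> k w - I (T w) w)" for k
    by (rule square_integrable_imp_integrable[OF _ D2]) measurable
  show int: "integrable M (\<lambda>w. I (T w) w)"
    using Bochner_Integration.integrable_diff[OF \<Phi>(1)[of 0] D[of 0]] by simp
  \<comment> \<open>As \<open>\<Phi> k\<close> has mean zero, this mean is up to sign that of
    \<open>\<Phi> k - I\<close>; a variance being non-negative, its square is at most the mean
    square.\<close>
  have "(\<integral>w. I (T w) w \<partial>M)\<^sup>2 \<le> 4 * approx_const * (1/2)^k" for k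
  proof -
    have "(\<integral>w. I (T w) w \<partial>M)\<^sup>2 = (\<integral>w. \<Phi> k w - I (T w) w \<partial>M)\<^sup>2"
      using int \<Phi>(1,2) by (simp add: Bochner_Integration.integral_diff)
    also have "\<dots> \<le> (\<integral>w. (\<Phi> k w - I (T w) w)\<^sup>2 \<partial>M)"
      using variance_positive[of "\<lambda>w. \<Phi> k w - I (T w) w"] variance_eq[OF D D2] by simp
    also have "\<dots> \<le> 4 * approx_const * (1/2)^k"
      using \<Phi>(4)[of k] C by (subst (asm) nn_integral_eq_integral[OF D2]) auto
    finally show ?thesis .
  qed
  then have "(\<integral>w. I (T w) w \<partial>M)\<^sup>2 \<le> 0"
    by (intro LIMSEQ_le_const[OF lim]) auto
  then show "(\<integral>w. I (T w) w \<partial>M) = 0" by simp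
  have mult_4: "x \<le> 4 * y + ennreal (18 * approx_const * (1/2)^k)"
    if "x \<le> 2 * z + ennreal (2 * approx_const * (1/2)^k)" "z \<le> 2 * u' + 2 * y" "u' \<le> ennreal (4 * approx_const * (1/2)^k)"
    for x y z u' :: ennreal and k
  proof -
    have "z \<le> 2 * ennreal (4 * approx_const * (1/2)^k) + 2 * y"
      using that(3) by (intro order_trans[OF that(2)] add_right_mono mult_left_mono) auto
    then have "x \<le> 2 * (2 * ennreal (4 * approx_const * (1/2)^k) + 2 * y) + ennreal (2 * approx_const * (1/2)^k)"
      by (intro order_trans[OF that(1)] add_right_mono mult_left_mono) auto
    also have "\<dots> = 4 * y + (4 * ennreal (4 * approx_const * (1/2)^k) + ennreal (2 * approx_const * (1/2)^k))"
    proof -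
      have "2 * (2 * x + 2 * y) + z = 4 * y + (4 * x + z)" for x y z :: ennreal
        by (simp add: distrib_left ac_simps mult.assoc[symmetric])
      then show ?thesis .
    qed
    also have "4 * ennreal (4 * approx_const * (1/2)^k) + ennreal (2 * approx_const * (1/2)^k) = ennreal (4 * (4 * approx_const * (1/2)^k) + 2 * approx_const * (1/2)^k)"
    proof -
      have "4 * ennreal (4 * approx_const * (1/2)^k) = ennreal (4 * (4 * approx_const * (1/2)^k))"
        using C ennreal_mult[of 4 "4 * approx_const * (1/2)^k"] by simp
      then show ?thesis using C by (simp only: ennreal_plus[symmetric] mult_nonneg_nonneg zero_le_numeral zero_le_power zero_le_divide_1_iff)
    qed
    also have "4 * (4 * approx_const * (1/2)^k) + 2 * approx_const * (1/2)^k = 18 * approx_const * (1/2)^k" by simp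
    finally show ?thesis .
  qed
  have mult_4': "x \<le> 4 * y + ennreal (18 * approx_const * (1/2)^k)"
    if "x \<le> 2 * u' + 2 * z" "u' \<le> ennreal (4 * approx_const * (1/2)^k)" "z \<le> 2 * y + ennreal (2 * approx_const * (1/2)^k)"
    for x y z u' :: ennreal and k
  proof -
    have "x \<le> 2 * ennreal (4 * approx_const * (1/2)^k) + 2 * (2 * y + ennreal (2 * approx_const * (1/2)^k))"
      using that(2,3) by (intro order_trans[OF that(1)] add_mono mult_left_mono) auto
    also have "\<dots> = 4 * y + (2 * ennreal (4 * approx_const * (1/2)^k) + 2 * ennreal (2 * approx_const * (1/2)^k))"
    proof -
      have "2 * x + 2 * (2 * y + z) = 4 * y + (2 * x + 2 * z)" for x y z :: ennreal
        by (simp add: distrib_left ac_simps mult.assoc[symmetric])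
      then show ?thesis .
    qed
    also have "2 * ennreal (4 * approx_const * (1/2)^k) + 2 * ennreal (2 * approx_const * (1/2)^k) = ennreal (2 * (4 * approx_const * (1/2)^k) + 2 * (2 * approx_const * (1/2)^k))"
    proof -
      have "2 * ennreal (4 * approx_const * (1/2)^k) = ennreal (2 * (4 * approx_const * (1/2)^k))"
        "2 * ennreal (2 * approx_const * (1/2)^k) = ennreal (2 * (2 * approx_const * (1/2)^k))"
        using C ennreal_mult[of 2 "4 * approx_const * (1/2)^k"] ennreal_mult[of 2 "2 * approx_const * (1/2)^k"] by simp_all
      then show ?thesis using C by (simp only: ennreal_plus[symmetric] mult_nonneg_nonneg zero_le_numeral zero_le_power zero_le_divide_1_iff)
    qed
    also have "ennreal (2 * (4 * approx_const * (1/2)^k) + 2 * (2 * approx_const * (1/2)^k)) \<le> ennreal (18 * approx_const * (1/2)^k)"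
      using C by (intro ennreal_leI) simp
    finally show ?thesis by (simp only: add_left_mono)
  qed
  have dist: "(\<integral>\<^sup>+w. ennreal ((I (T w) w - \<Phi> k w)\<^sup>2) \<partial>M) \<le> ennreal (4 * approx_const * (1/2)^k)" for k
    using \<Phi>(4)[of k] by (simp only: power2_commute[of "I _ _"])
  show "(\<integral>\<^sup>+w. ennreal (A (T w) w) \<partial>M) \<le> 4 * (\<integral>\<^sup>+w. ennreal ((I (T w) w)\<^sup>2) \<partial>M)"
  proof (rule ennreal_bound_LIMSEQ)
    fix k
    have "(\<integral>\<^sup>+w. ennreal ((\<Phi> k w)\<^sup>2) \<partial>M) \<le> 2 * (\<integral>\<^sup>+w. ennreal ((\<Phi> k w - I (T w) w)\<^sup>2) \<partial>M) + 2 * (\<integral>\<^sup>+w. ennreal ((I (T w) w)\<^sup>2) \<partial>M)"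
      by (rule nn_integral_square_le_2) measurable
    from mult_4[OF \<Phi>(5)[of k] this \<Phi>(4)[of k]]
    show "(\<integral>\<^sup>+w. ennreal (A (T w) w) \<partial>M) \<le> 4 * (\<integral>\<^sup>+w. ennreal ((I (T w) w)\<^sup>2) \<partial>M) + ennreal (18 * approx_const * (1/2)^k)"
      .
  qed (rule lim)
  show "(\<integral>\<^sup>+w. ennreal ((I (T w) w)\<^sup>2) \<partial>M) \<le> 4 * (\<integral>\<^sup>+w. ennreal (A (T w) w) \<partial>M)"
  proof (rule ennreal_bound_LIMSEQ)
    fix k
    have "(\<integral>\<^sup>+w. ennreal ((I (T w) w)\<^sup>2) \<partial>M) \<le> 2 * (\<integral>\<^sup>+w. ennreal ((I (T w) w - \<Phi> k w)\<^sup>2) \<partial>M) + 2 * (\<integral>\<^sup>+w. ennreal ((\<Phi> k w)\<^sup>2) \<partial>M)"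
      by (rule nn_integral_square_le_2) measurable
    from mult_4'[OF this dist[of k] \<Phi>(6)[of k]]
    show "(\<integral>\<^sup>+w. ennreal ((I (T w) w)\<^sup>2) \<partial>M) \<le> 4 * (\<integral>\<^sup>+w. ennreal (A (T w) w) \<partial>M) + ennreal (18 * approx_const * (1/2)^k)"
      .
  qed (rule lim)
qed

end

text \<open>The martingale property follows from mean zero at all stopping times below
  \<open>T\<close>: testing against an event \<open>Y\<close> known at \<open>s\<close> amounts to
  comparing two such times.\<close>

lemma stopped_martingale:
  assumes T: "stopping_time F T" and N: "0 < N" and T01: "\<And>w. w \<in> space M \<Longrightarrow> 0 \<le> T w \<and> T w \<le> N"
    and c: "0 \<le> c" and AT: "AE w in M. A (T w) w \<le> c"
  shows "martingale M F (\<lambda>t w. a * I (min t (T w)) w)"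
proof -
  have A_le: "AE w in M. A (S w) w \<le> c" if "\<And>w. w \<in> space M \<Longrightarrow> 0 \<le> S w \<and> S w \<le> T w" for S
    using AT AE_space
  proof eventually_elim
    case (elim w)
    then show ?case using A_mono[of w "S w" "T w"] that[of w] by auto
  qed
  have I_meas: "(\<lambda>w. I (min t (T w)) w) \<in> borel_measurable (F t)" if t: "0 \<le> t" for t
  proof (rule measurable_at_random_time[where t=t and X=I and S="\<lambda>w. min t (T w)"])
    show "I u \<in> borel_measurable (F t)" if "u \<in> {0..t}" for u
      using continuous_adaptedD(3)[OF I_cont] that by auto
    show "continuous_on {0..t} (\<lambda>u. I u w)" if "w \<in> space (F t)" for w
      using continuous_adaptedD(5)[OF I_cont] that by auto
    show "min t (T w) \<in> {0..t}" if "w \<in> space (F t)" for w using T01[of w] that t by auto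
    show "(\<lambda>w. min t (T w)) \<in> borel_measurable (F t)"
    proof (rule borel_measurableI_le)
      fix u
      show "{w\<in>space (F t). min t (T w) \<le> u} \<in> sets (F t)"
      proof (cases "t \<le> u")
        case True
        then have "{w\<in>space (F t). min t (T w) \<le> u} = space (F t)" by auto
        then show ?thesis by (metis sets.top)
      next
        case False
        then have "{w\<in>space (F t). min t (T w) \<le> u} = {w\<in>space (F u). T w \<le> u}" by auto
        also have "\<dots> \<in> sets (F u)" using stopping_timeD[OF T, of u] by (simp add: pred_def)
        finally show ?thesis using sets_F_mono[of u t] False by auto
      qed
    qed
  qed
  have stop: "stopping_time F (\<lambda>w. min t (T w))" for t
    by (rule stopping_time_min[OF stopping_time_const T])
  have int: "integrable M (\<lambda>w. I (min t (T w)) w)" "(\<integral>w. I (min t (T w)) w \<partial>M) = 0" if "0 \<le> t" for t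
  proof -
    have "0 \<le> min t (T w) \<and> min t (T w) \<le> N" "0 \<le> min t (T w) \<and> min t (T w) \<le> T w" if "w \<in> space M" for w
      using T01[OF that] \<open>0 \<le> t\<close> by auto
    then show "integrable M (\<lambda>w. I (min t (T w)) w)" "(\<integral>w. I (min t (T w)) w \<partial>M) = 0"
      using ito_stopped_integrable[OF stop N _ c A_le] ito_stopped_mean[OF stop N _ c A_le] by auto
  qed
  show ?thesis
    unfolding martingale_def adapted_def
  proof (intro conjI allI impI)
    fix t :: real assume "0 \<le> t"
    then show "(\<lambda>w. a * I (min t (T w)) w) \<in> borel_measurable (F t)" "integrable M (\<lambda>w. a * I (min t (T w)) w)"
      using I_meas int by auto
  next
    fix s t :: real assume "0 \<le> s \<and> s \<le> t"
    then have st: "0 \<le> s" "s \<le> t" "0 \<le> t" by auto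
    interpret finite_measure_subalgebra M "F s"
      by unfold_locales (rule subalg)
    show "AE w in M. real_cond_exp M (F s) (\<lambda>w. a * I (min t (T w)) w) w = a * I (min s (T w)) w"
    proof (rule real_cond_exp_charact)
      fix Y assume Y: "Y \<in> sets (F s)"
      have YM [measurable]: "Y \<in> sets M" by (rule sets_F_M[OF Y])
      \<comment> \<open>Runs on to \<open>t\<close> on \<open>Y\<close> and stops at
        \<open>s\<close> elsewhere. Subtracting the mean at \<open>min s T\<close>, which is zero as
        well, leaves the increment integrated over \<open>Y\<close>.\<close>
      define T' where "T' w = (if w \<in> Y then min t (T w) else min s (T w))" for w
      have "stopping_time F T'"
      proof (rule stopping_timeI)
        fix u
        have Tu: "{w\<in>space (F u). min r (T w) \<le> u} \<in> sets (F u)" for r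
          using stopping_timeD[OF stop, of r u] by (simp add: pred_def)
        have "{w\<in>space (F u). T' w \<le> u} \<in> sets (F u)"
        proof (cases "u < s")
          case True
          then have "{w\<in>space (F u). T' w \<le> u} = {w\<in>space (F u). min s (T w) \<le> u}"
            using st by (auto simp: T'_def)
          then show ?thesis using Tu by simp
        next
          case False
          then have "{w\<in>space (F u). T' w \<le> u} = ({w\<in>space (F u). min t (T w) \<le> u} \<inter> Y) \<union> (space (F u) - Y)"
            by (auto simp: T'_def)
          moreover have "Y \<in> sets (F u)" using sets_F_mono[of s u] Y False by auto
          ultimately show ?thesis using Tu[of t] by (simp only: sets.Int sets.Un sets.compl_sets)
        qed
        then show "Measurable.pred (F u) (\<lambda>w. T' w \<le> u)" by (simp add: pred_def)
      qed
      moreover have "0 \<le> T' w \<and> T' w \<le> N" "0 \<le> T' w \<and> T' w \<le> T w" if "w \<in> space M" for w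
        using T01[OF that] st by (auto simp: T'_def)
      ultimately have T'0: "(\<integral>w. I (T' w) w \<partial>M) = 0"
        using ito_stopped_mean[OF _ N _ c A_le] by auto
      have i: "integrable M (\<lambda>w. indicator Y w * I (min t (T w)) w)" "integrable M (\<lambda>w. indicator Y w * I (min s (T w)) w)"
        using int st YM by (auto intro: integrable_real_mult_indicator simp: mult.commute[of "indicator Y _"])
      have "I (T' w) w = (indicator Y w * I (min t (T w)) w - indicator Y w * I (min s (T w)) w) + I (min s (T w)) w" for w
        by (auto simp: T'_def split: split_indicator)
      then have "0 = (\<integral>w. (indicator Y w * I (min t (T w)) w - indicator Y w * I (min s (T w)) w) + I (min s (T w)) w \<partial>M)"
        using T'0 by simp
      also have "\<dots> = (\<integral>w. indicator Y w * I (min t (T w)) w \<partial>M) - (\<integral>w. indicator Y w * I (min s (T w)) w \<partial>M)"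
        using i int st by simp
      finally show "(\<integral>w\<in>Y. a * I (min t (T w)) w \<partial>M) = (\<integral>w\<in>Y. a * I (min s (T w)) w \<partial>M)"
        by (simp add: set_lebesgue_integral_def mult.left_commute)
    qed (use int I_meas st in auto)
  qed
qed

text \<open>The localising time is the hitting time of energy level \<open>n+1\<close>, capped at
  time \<open>n+1\<close>. Level and cap grow together, so the times increase to infinity while each
  stays bounded with bounded energy.\<close>

theorem ito_local_martingale: "continuous_local_martingale M F (\<lambda>t w. a * I t w)"
proof -
  define T where "T n = hit (real (Suc n)) (\<lambda>t w. A t w / real (Suc n))" for n
  have K: "continuous_adapted M F (\<lambda>t w. A t w / real (Suc n))" for n
    using A_cont by (auto simp: continuous_adapted_def adapted_def simp del: of_nat_Suc intro!: continuous_intros)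
  have pos: "0 \<le> real (Suc n)" for n by simp
  have hp: "0 \<le> T n w" "T n w \<le> real (Suc n)" "A (T n w) w \<le> real (Suc n)"
    "\<And>s. 0 \<le> s \<Longrightarrow> s < T n w \<Longrightarrow> A s w < real (Suc n)"
    "\<And>s. 0 \<le> s \<Longrightarrow> s \<le> real (Suc n) \<Longrightarrow> real (Suc n) \<le> A s w \<Longrightarrow> T n w \<le> s"
    "(\<exists>s\<in>{0..real (Suc n)}. real (Suc n) \<le> A s w) \<Longrightarrow> real (Suc n) \<le> A (T n w) w" if "w \<in> space M" for n w
    using hit_props[where K="\<lambda>t w. A t w / real (Suc n)" and w=w, OF continuous_adaptedD(5)[OF K[of n] that] pos] A_0[OF that]
    unfolding T_def by (simp_all add: le_divide_eq_1_pos divide_less_eq_1_pos divide_le_eq_1_pos del: of_nat_Suc)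
  have st: "stopping_time F (T n)" for n
    unfolding T_def by (rule hit_stopping_time[OF K pos])
  have "martingale M F (\<lambda>t w. a * I (min t (T n w)) w)" for n
    by (rule stopped_martingale[OF st, of "real (Suc n)" _ "real (Suc n)"]) (use hp in auto)
  moreover have "AE w in M. incseq (\<lambda>n. T n w) \<and> filterlim (\<lambda>n. T n w) at_top sequentially"
  proof (rule AE_I2, intro conjI)
    fix w assume w: "w \<in> space M"
    show "incseq (\<lambda>n. T n w)"
    proof (rule incseq_SucI)
      fix n
      \<comment> \<open>If the next time came strictly earlier, the energy there would be below
        \<open>n+1\<close>, so level \<open>n+2\<close> would never be reached within its horizon.
        That time would then be its cap \<open>n+2\<close>, beyond every value of
        \<open>T n\<close>.\<close>
      show "T n w \<le> T (Suc n) w"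
      proof (rule ccontr)
        assume "\<not> ?thesis"
        then have less: "T (Suc n) w < T n w" by simp
        have "T (Suc n) w < real (Suc (Suc n))" using less hp(2)[OF w, of n] by simp
        have "A (T (Suc n) w) w < real (Suc n)" using hp(4)[OF w _ less] hp(1)[OF w] by auto
        then have "\<not> (\<exists>s\<in>{0..real (Suc (Suc n))}. real (Suc (Suc n)) \<le> A s w)" using hp(6)[OF w, of "Suc n"] by force
        then have "{s \<in> {0..real (Suc (Suc n))}. 1 \<le> A s w / real (Suc (Suc n))} = {}"
          by (auto simp: le_divide_eq_1_pos simp del: of_nat_Suc)
        then have "T (Suc n) w = real (Suc (Suc n))"
          unfolding T_def hit_def by (simp only: cInf_singleton)
        then show False using \<open>T (Suc n) w < real (Suc (Suc n))\<close> by simp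
      qed
    qed
    show "filterlim (\<lambda>n. T n w) at_top sequentially"
      unfolding filterlim_at_top
    proof
      fix Z :: real
      define Z' where "Z' = max 0 Z"
      show "\<forall>\<^sub>F n in sequentially. Z \<le> T n w"
        using eventually_ge_at_top[of "nat \<lceil>max Z' (A Z' w)\<rceil>"]
      proof eventually_elim
        case (elim n)
        then have n: "Z' < real (Suc n)" "A Z' w < real (Suc n)" by linarith+
        show ?case
        proof (rule ccontr)
          assume "\<not> ?thesis"
          then have less: "T n w < Z'" by (simp add: Z'_def)
          then have "A (T n w) w \<le> A Z' w" using A_mono[OF w, of "T n w" Z'] hp(1)[OF w] by auto
          then have "\<not> (\<exists>s\<in>{0..real (Suc n)}. real (Suc n) \<le> A s w)" using hp(6)[OF w, of n] n by force
          then have "{s \<in> {0..real (Suc n)}. 1 \<le> A s w / real (Suc n)} = {}"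
            by (auto simp: le_divide_eq_1_pos simp del: of_nat_Suc)
          then have "T (n) w = real (Suc n)"
            unfolding T_def hit_def by (simp only: cInf_singleton)
          then show False using less n by simp
        qed
      qed
    qed
  qed
  moreover have "continuous_adapted M F (\<lambda>t w. a * I t w)"
    using I_cont by (auto simp: continuous_adapted_def adapted_def intro!: continuous_intros)
  ultimately show ?thesis
    unfolding continuous_local_martingale_def using st hp(1) by (intro conjI exI[of _ T]) auto
qed

end

subsection \<open>Rates at time zero\<close>

context filtered_space begin

lemma continuous_adapted_add: "continuous_adapted M F X \<Longrightarrow> continuous_adapted M F Y \<Longrightarrow> continuous_adapted M F (\<lambda>t w. X t w + Y t w)"
  and continuous_adapted_max: "continuous_adapted M F X \<Longrightarrow> continuous_adapted M F Y \<Longrightarrow> continuous_adapted M F (\<lambda>t w. max (X t w) (Y t w))"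
  and continuous_adapted_abs: "continuous_adapted M F X \<Longrightarrow> continuous_adapted M F (\<lambda>t w. \<bar>X t w\<bar>)"
  and continuous_adapted_cmult: "continuous_adapted M F X \<Longrightarrow> continuous_adapted M F (\<lambda>t w. c * X t w)"
  and continuous_adapted_divide: "continuous_adapted M F X \<Longrightarrow> continuous_adapted M F (\<lambda>t w. X t w / c)"
  unfolding continuous_adapted_def adapted_def divide_inverse
  by (auto intro: continuous_on_add continuous_on_max continuous_on_rabs continuous_on_mult continuous_on_const
      borel_measurable_add borel_measurable_max borel_measurable_times)

lemmas continuous_adapted_intros = continuous_adapted_add continuous_adapted_max continuous_adapted_abs
  continuous_adapted_cmult continuous_adapted_divide

lemma reach_abs_sets:
  assumes Y: "continuous_adapted M F Y" and "0 \<le> t"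
  shows "{w\<in>space M. \<exists>s\<in>{0..t}. c \<le> \<bar>Y s w\<bar>} \<in> sets M"
proof (rule measurable_reach)
  show "(\<lambda>w. \<bar>Y u w\<bar>) \<in> borel_measurable M" if "u \<in> {0..t}" for u
    using continuous_adaptedD(2)[OF Y, of u] that by (intro borel_measurable_abs) auto
  show "continuous_on {0..t} (\<lambda>u. \<bar>Y u w\<bar>)" if "w \<in> space M" for w
    by (intro continuous_on_rabs continuous_adaptedD(5)[OF Y that])
qed fact

text \<open>Removes a localisation: moment bounds hold only on events where energies are below a
  level, but with a constant that does not depend on the level.\<close>

lemma prob_le_of_truncations:
  assumes E: "E \<in> sets M" and G: "\<And>n. {w\<in>space M. \<not> G n w} \<in> sets M"
    and ev: "AE w in M. \<forall>\<^sub>F n in sequentially. G n w"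
    and b: "\<And>n. prob {w\<in>E. G n w} \<le> b"
  shows "prob E \<le> b"
proof (rule LIMSEQ_le_const)
  show "(\<lambda>n. b + prob {w\<in>space M. \<not> G n w}) \<longlonglongrightarrow> b"
    using tendsto_add[OF tendsto_const prob_eventually_tendsto_0[OF G ev], of b] by simp
  have "prob E \<le> b + prob {w\<in>space M. \<not> G n w}" for n
  proof -
    have eq: "{w\<in>E. G n w} = E - {w\<in>space M. \<not> G n w}" using sets.sets_into_space[OF E] by auto
    have m: "{w\<in>E. G n w} \<in> sets M" unfolding eq using E G by auto
    have "prob E \<le> prob ({w\<in>E. G n w} \<union> {w\<in>space M. \<not> G n w})"
      using sets.sets_into_space[OF E] m G by (intro finite_measure_mono) auto
    also have "\<dots> \<le> prob {w\<in>E. G n w} + prob {w\<in>space M. \<not> G n w}"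
      using m G by (intro measure_Un_le) auto
    finally show ?thesis using b[of n] by simp
  qed
  then show "\<exists>N. \<forall>n\<ge>N. prob E \<le> b + prob {w\<in>space M. \<not> G n w}" by blast
qed

lemma Markov_prob:
  assumes Y: "integrable M Y" "AE w in M. 0 \<le> Y w" and E: "E \<in> sets M" and a: "0 < a"
    and ge: "AE w in M. w \<in> E \<longrightarrow> a \<le> Y w"
  shows "prob E \<le> (\<integral>w. Y w \<partial>M) / a"
proof -
  have "a * prob E = (\<integral>w. a * indicator E w \<partial>M)" using E by simp
  also have "\<dots> \<le> (\<integral>w. Y w \<partial>M)"
  proof (rule integral_mono_AE[OF _ Y(1)])
    show "integrable M (\<lambda>w. a * indicator E w)"
      using E by (intro integrable_mult_right integrable_real_indicator) (auto simp: less_top[symmetric])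
    show "AE w in M. a * indicator E w \<le> Y w"
      using Y(2) ge by eventually_elim (auto split: split_indicator)
  qed
  finally show ?thesis using a by (simp add: field_simps)
qed

text \<open>Borel-Cantelli along the times \<open>2^(-n)\<close>. Each event controls the supremum
  up to \<open>2^(-n)\<close>, so passing to intermediate times costs only the factor
  \<open>2^\<theta>\<close>.\<close>

lemma pathwise_rate:
  assumes Y: "continuous_adapted M F Y" and f: "summable f" and \<theta>: "0 \<le> \<theta>"
    and b: "\<And>n. prob {w\<in>space M. \<exists>s\<in>{0..(1/2)^n}. ((1/2)^n) powr \<theta> \<le> \<bar>Y s w\<bar>} \<le> f n"
  shows "AE w in M. \<exists>K>0. \<exists>t>0. \<forall>s. 0 < s \<and> s \<le> t \<longrightarrow> \<bar>Y s w\<bar> \<le> K * s powr \<theta>"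
proof -
  let ?E = "\<lambda>n. {w\<in>space M. \<exists>s\<in>{0..(1/2)^n}. ((1/2)^n) powr \<theta> \<le> \<bar>Y s w\<bar>}"
  have E: "?E n \<in> sets M" for n
    by (rule reach_abs_sets[OF Y]) simp
  have "AE w in M. \<forall>\<^sub>F n in sequentially. w \<in> space M - ?E n"
  proof (rule borel_cantelli_AE1[OF E])
    show "summable (\<lambda>n. prob (?E n))"
      by (rule summable_comparison_test[OF _ f]) (use b in \<open>auto intro!: exI[of _ 0]\<close>)
  qed (simp add: less_top[symmetric])
  then show ?thesis
  proof eventually_elim
    case (elim w)
    then obtain n0 where n0: "\<And>n. n \<ge> n0 \<Longrightarrow> w \<in> space M - ?E n" by (auto simp: eventually_sequentially)
    have "\<bar>Y s w\<bar> \<le> 2 powr \<theta> * s powr \<theta>" if s: "0 < s" "s \<le> (1/2)^n0" for s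
    proof -
      have "\<exists>n. (1/2)^n < s" using real_arch_pow_inv[of s "1/2"] s by auto
      \<comment> \<open>Locates \<open>s\<close> between two consecutive dyadic times: above
        \<open>2^(-n)\<close> and at most \<open>2^(-(n-1))\<close>.\<close>
      define n where "n = (LEAST n. (1/2)^n < s)"
      have n: "(1/2)^n < s" unfolding n_def by (rule LeastI_ex) fact
      have "n0 < n"
      proof (rule ccontr)
        assume "\<not> n0 < n"
        then have "(1/2::real)^n0 \<le> (1/2)^n" by (intro power_decreasing) auto
        then show False using n s by linarith
      qed
      then obtain m where m: "n = Suc m" "n0 \<le> m" by (cases n) auto
      have "\<not> (1/2)^m < s" using not_less_Least[of m "\<lambda>n. (1/2)^n < s"] m unfolding n_def[symmetric] by simp
      then have "s \<le> (1/2)^m" by simp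
      then have "s \<in> {0..(1/2)^m}" using s by simp
      then have "\<bar>Y s w\<bar> < ((1/2)^m) powr \<theta>" using n0[OF m(2)] by (auto simp: not_le)
      also have "\<dots> \<le> (2 * s) powr \<theta>" using n m \<theta> by (intro powr_mono2) auto
      also have "\<dots> = 2 powr \<theta> * s powr \<theta>" using s by (simp add: powr_mult)
      finally show ?thesis by simp
    qed
    then show ?case by (intro exI[of _ "2 powr \<theta>"] conjI exI[of _ "(1/2)^n0"]) auto
  qed
qed

lemma half_power_powr: "((1/2)^n) powr x = ((1/2) powr x)^n" for x :: real
  by (simp add: powr_realpow[symmetric] powr_powr powr_power mult.commute)

lemma summable_half_powr: "0 < x \<Longrightarrow> summable (\<lambda>n. C * ((1/2)^n) powr x)" for x C :: real
proof -
  assume "0 < x"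
  then have "(1/2) powr x < (1 :: real)" using powr_less_mono2[of x "1/2" 1] by simp
  then show ?thesis unfolding half_power_powr by (intro summable_mult summable_geometric) auto
qed

end

section \<open>Rates of an integral and of its energy\<close>

context ito_space begin

text \<open>Simple integrals vanish at time 0, and uniform approximation over the degenerate
  interval \<open>{0..0}\<close> forces the same on the limit.\<close>

lemma ito_integral_0: "AE w in M. I 0 w = 0"
proof -
  have m: "I 0 \<in> borel_measurable M" by (rule continuous_adaptedD(2)[OF I_cont]) simp
  have "likely e (\<lambda>w. \<bar>I 0 w\<bar> \<le> e)" if "0 < e" for e
  proof -
    obtain S where S: "simple_integrand M F S"
      "likely e (\<lambda>w. (sq_int {0..0} (\<lambda>s. simple_process S s w - H s w)) \<le> ennreal e \<and>
       (\<forall>s\<in>{0..0}. \<bar>simple_integral B S s w - I s w\<bar> \<le> e))"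
      using ito_approxI[OF B_cont ito, unfolded ito_approx_def, rule_format, of 0 e, OF order_refl \<open>0 < e\<close>] by blast
    have "simple_integral B S 0 w = 0" for w
    proof -
      obtain n \<tau> \<xi> where Sd: "S = (n, \<tau>, \<xi>)" by (cases S) auto
      show ?thesis using simple_partition_nonneg[OF S(1)[unfolded Sd]] by (auto simp: Sd min_absorb1 intro!: sum.neutral)
    qed
    then show ?thesis by (intro likely_mono[OF S(2)]) auto
  qed note l = this
  have "prob {w\<in>space M. \<not> \<bar>I 0 w\<bar> \<le> \<delta>} = 0" if \<delta>: "0 < \<delta>" for \<delta>
  proof -
    have ms: "{w\<in>space M. \<not> \<bar>I 0 w\<bar> \<le> \<delta>} \<in> sets M" using m by measurable
    have "prob {w\<in>space M. \<not> \<bar>I 0 w\<bar> \<le> \<delta>} \<le> 0 + e" if e: "0 < e" for e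
    proof -
      have "likely e (\<lambda>w. \<bar>I 0 w\<bar> \<le> \<delta>)"
        by (rule likely_mono[OF l[of "min e \<delta>"]]) (use e \<delta> in auto)
      from likely_measure_less[OF this ms] show ?thesis by simp
    qed
    then have "prob {w\<in>space M. \<not> \<bar>I 0 w\<bar> \<le> \<delta>} \<le> 0" by (rule field_le_epsilon)
    then show ?thesis by (simp add: measure_le_0_iff)
  qed note z = this
  have "AE w in M. \<bar>I 0 w\<bar> \<le> inverse (real (Suc n))" for n
  proof (rule AE_I[OF order_refl])
    show "emeasure M {w\<in>space M. \<not> \<bar>I 0 w\<bar> \<le> inverse (real (Suc n))} = 0"
      using z[of "inverse (real (Suc n))"] by (simp add: emeasure_eq_measure)
    show "{w\<in>space M. \<not> \<bar>I 0 w\<bar> \<le> inverse (real (Suc n))} \<in> sets M" using m by measurable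
  qed
  then have "AE w in M. \<forall>n. \<bar>I 0 w\<bar> \<le> inverse (real (Suc n))" by (simp add: AE_all_countable)
  then show ?thesis
  proof eventually_elim
    case (elim w)
    have "\<bar>I 0 w\<bar> \<le> 0" by (rule LIMSEQ_le_const[OF LIMSEQ_inverse_real_of_nat]) (use elim in auto)
    then show ?case by simp
  qed
qed

text \<open>A domination inequality of Lenglart type, bounding the energy by the integral. Stopping
  when the integral reaches \<open>a\<close> or the energy reaches \<open>b\<close> gives mean
  energy at most \<open>4 * a^2\<close>; if the integral never reaches \<open>a\<close>, a large
  energy at \<open>t\<close> forces energy at least \<open>b\<close> at the stop, and Markov
  applies.\<close>

lemma energy_tail:
  assumes t: "0 < t" and a: "0 < a" and b: "0 < b"
  shows "prob {w\<in>space M. b \<le> A t w} \<le> prob {w\<in>space M. \<exists>s\<in>{0..t}. a \<le> \<bar>I s w\<bar>} + 4 * a\<^sup>2 / b"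
proof -
  define K where "K s w = max (\<bar>I s w\<bar> / a) (A s w / b)" for s w
  have K: "continuous_adapted M F K"
    unfolding K_def by (intro continuous_adapted_intros A_cont I_cont)
  define T where "T = hit t K"
  have t0: "0 \<le> t" using t by simp
  note hp = hit_props[where K=K, OF continuous_adaptedD(5)[OF K] t0, folded T_def]
  have st: "stopping_time F T" unfolding T_def by (rule hit_stopping_time[OF K t0])
  have le: "AE w in M. \<bar>I (T w) w\<bar> \<le> a \<and> A (T w) w \<le> b"
    using ito_integral_0 AE_space
  proof eventually_elim
    case (elim w)
    have "K (T w) w \<le> 1" by (rule hp(5)[OF elim(2)]) (use elim A_0 in \<open>simp add: K_def\<close>)
    then show ?case using a b by (simp add: K_def divide_le_eq_1_pos)
  qed
  have T01: "0 \<le> T w \<and> T w \<le> t" if "w \<in> space M" for w using hp(1,2)[OF that] by simp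
  have leA: "AE w in M. A (T w) w \<le> b" using le by eventually_elim simp
  have b0: "0 \<le> b" using b by simp
  have e: "(\<integral>\<^sup>+w. ennreal (A (T w) w) \<partial>M) \<le> 4 * (\<integral>\<^sup>+w. ennreal ((I (T w) w)\<^sup>2) \<partial>M)"
    by (rule ito_stopped_energy[OF st t T01 b0 leA])
  have "(\<integral>\<^sup>+w. ennreal ((I (T w) w)\<^sup>2) \<partial>M) \<le> (\<integral>\<^sup>+w. ennreal (a\<^sup>2) \<partial>M)"
  proof (rule nn_integral_mono_AE)
    show "AE w in M. ennreal ((I (T w) w)\<^sup>2) \<le> ennreal (a\<^sup>2)"
      using le by eventually_elim (use a in \<open>auto intro!: ennreal_leI simp: abs_le_square_iff[symmetric]\<close>)
  qed
  then have e2: "(\<integral>\<^sup>+w. ennreal (A (T w) w) \<partial>M) \<le> ennreal (4 * a\<^sup>2)"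
    using e by (simp add: emeasure_space_1 ennreal_mult) (meson mult_left_mono order_trans zero_le)
  have mA: "(\<lambda>w. A (T w) w) \<in> borel_measurable M"
    by (rule random_time_measurable[OF A_cont stopping_time_measurable_M[OF st], of t]) (use T01 in auto)
  have An: "0 \<le> A (T w) w" if "w \<in> space M" for w using A_nonneg[OF that] T01[OF that] by simp
  have iA: "integrable M (\<lambda>w. A (T w) w)"
    using e2 An by (intro integrableI_nonneg mA AE_I2) (auto intro: order_le_less_trans)
  have EA: "(\<integral>w. A (T w) w \<partial>M) \<le> 4 * a\<^sup>2"
    using e2 An by (subst (asm) nn_integral_eq_integral[OF iA]) (auto intro: AE_I2)
  let ?E = "{w\<in>space M. b \<le> A t w}" and ?J = "{w\<in>space M. \<exists>s\<in>{0..t}. a \<le> \<bar>I s w\<bar>}"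
  have mE: "?E \<in> sets M" using continuous_adaptedD(2)[OF A_cont t0] by measurable
  have mJ: "?J \<in> sets M"
    by (rule reach_abs_sets[OF I_cont]) (use t in simp)
  have "prob (?E - ?J) \<le> (\<integral>w. A (T w) w \<partial>M) / b"
  proof (rule Markov_prob[OF iA _ _ b])
    show "AE w in M. w \<in> ?E - ?J \<longrightarrow> b \<le> A (T w) w"
    proof (rule AE_I2, rule impI)
      fix w assume w: "w \<in> space M" and E: "w \<in> ?E - ?J"
      have "1 \<le> K t w" using E b by (auto simp: K_def le_max_iff_disj)
      then have "1 \<le> K (T w) w" using t by (intro hp(4)[OF w]) auto
      moreover have "\<bar>I (T w) w\<bar> < a"
      proof (rule ccontr)
        assume "\<not> ?thesis"
        then have "w \<in> ?J" using T01[OF w] w by (auto intro!: bexI[of _ "T w"])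
        then show False using E by blast
      qed
      ultimately show "b \<le> A (T w) w" using a b by (auto simp: K_def le_max_iff_disj)
    qed
  qed (use An mE mJ in auto)
  also have "\<dots> \<le> 4 * a\<^sup>2 / b" using EA b by (intro divide_right_mono) auto
  finally have 1: "prob (?E - ?J) \<le> 4 * a\<^sup>2 / b" .
  have "prob ?E \<le> prob (?J \<union> (?E - ?J))" using mE mJ by (intro finite_measure_mono) auto
  also have "\<dots> \<le> prob ?J + prob (?E - ?J)" using mE mJ by (intro measure_Un_le) auto
  finally show ?thesis using 1 by simp
qed

text \<open>A maximal inequality of weak type with first power of \<open>a\<close>, since only first
  moments are available for \<open>J\<close>. It holds with \<open>\<theta> = \<alpha>\<close> for
  \<open>J\<close> and with \<open>\<theta> = 1/2\<close> for the Brownian motion.\<close>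

definition small_at_0 :: "real \<Rightarrow> real \<Rightarrow> bool" where
  "small_at_0 C \<theta> \<longleftrightarrow> 0 < C \<and> 0 < \<theta> \<and>
     (\<forall>t a. 0 < t \<and> 0 < a \<longrightarrow> prob {w\<in>space M. \<exists>s\<in>{0..t}. a \<le> \<bar>I s w\<bar>} \<le> C * t powr \<theta> / a)"

lemma integral_rate:
  assumes "small_at_0 C \<theta>" "0 \<le> \<eta>" "\<eta> < \<theta>"
  shows "AE w in M. \<exists>K>0. \<exists>t>0. \<forall>s. 0 < s \<and> s \<le> t \<longrightarrow> \<bar>I s w\<bar> \<le> K * s powr \<eta>"
proof (rule pathwise_rate[OF I_cont _ assms(2)])
  show "summable (\<lambda>n. C * ((1/2)^n) powr (\<theta> - \<eta>))" using assms by (intro summable_half_powr) auto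
  fix n :: nat
  have "prob {w\<in>space M. \<exists>s\<in>{0..(1/2)^n}. ((1/2)^n) powr \<eta> \<le> \<bar>I s w\<bar>} \<le> C * ((1/2)^n) powr \<theta> / ((1/2)^n) powr \<eta>"
    using assms(1) by (auto simp: small_at_0_def)
  also have "\<dots> = C * ((1/2)^n) powr (\<theta> - \<eta>)" by (simp add: powr_diff)
  finally show "prob {w\<in>space M. \<exists>s\<in>{0..(1/2)^n}. ((1/2)^n) powr \<eta> \<le> \<bar>I s w\<bar>} \<le> C * ((1/2)^n) powr (\<theta> - \<eta>)" .
qed

lemma energy_rate:
  assumes "small_at_0 C \<theta>" "0 \<le> \<eta>" "\<eta> < \<theta>"
  shows "AE w in M. \<exists>K>0. \<exists>t>0. \<forall>s. 0 < s \<and> s \<le> t \<longrightarrow> \<bar>A s w\<bar> \<le> K * s powr (2 * \<eta>)"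
proof (rule pathwise_rate[OF A_cont])
  \<comment> \<open>With thresholds \<open>t^\<zeta>\<close> for the integral and
    \<open>t^(2 \<eta>)\<close> for the energy, the two error terms are of order
    \<open>t^(\<theta> - \<zeta>)\<close> and \<open>t^(2 (\<zeta> - \<eta>))\<close>. Any
    \<open>\<zeta>\<close> strictly between makes both summable along dyadic times.\<close>
  define \<zeta> where "\<zeta> = (\<eta> + \<theta>) / 2"
  have \<zeta>: "\<eta> < \<zeta>" "\<zeta> < \<theta>" using assms by (auto simp: \<zeta>_def)
  show "summable (\<lambda>n. C * ((1/2)^n) powr (\<theta> - \<zeta>) + 4 * ((1/2)^n) powr (2 * (\<zeta> - \<eta>)))"
    using \<zeta> by (intro summable_add summable_half_powr) auto
  fix n :: nat
  let ?t = "(1/2::real)^n"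
  have "{w\<in>space M. \<exists>s\<in>{0..?t}. ?t powr (2 * \<eta>) \<le> \<bar>A s w\<bar>} \<subseteq> {w\<in>space M. ?t powr (2 * \<eta>) \<le> A ?t w}"
  proof safe
    fix w s assume "w \<in> space M" "s \<in> {0..?t}" "?t powr (2 * \<eta>) \<le> \<bar>A s w\<bar>"
    then show "?t powr (2 * \<eta>) \<le> A ?t w" using A_mono[of w s ?t] A_nonneg[of w s] by simp
  qed
  moreover have mA: "{w\<in>space M. ?t powr (2 * \<eta>) \<le> A ?t w} \<in> sets M"
    using continuous_adaptedD(2)[OF A_cont, of ?t] by measurable
  ultimately have "prob {w\<in>space M. \<exists>s\<in>{0..?t}. ?t powr (2 * \<eta>) \<le> \<bar>A s w\<bar>} \<le> prob {w\<in>space M. ?t powr (2 * \<eta>) \<le> A ?t w}"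
    by (rule finite_measure_mono)
  also have "\<dots> \<le> prob {w\<in>space M. \<exists>s\<in>{0..?t}. ?t powr \<zeta> \<le> \<bar>I s w\<bar>} + 4 * (?t powr \<zeta>)\<^sup>2 / ?t powr (2 * \<eta>)"
    by (rule energy_tail) auto
  also have "\<dots> \<le> C * ?t powr \<theta> / ?t powr \<zeta> + 4 * (?t powr \<zeta>)\<^sup>2 / ?t powr (2 * \<eta>)"
    using assms(1) by (auto simp: small_at_0_def)
  also have "(?t powr \<zeta>)\<^sup>2 = ?t powr (2 * \<zeta>)" by (simp add: powr_power mult.commute)
  also have "C * ?t powr \<theta> / ?t powr \<zeta> + 4 * ?t powr (2 * \<zeta>) / ?t powr (2 * \<eta>) = C * ?t powr (\<theta> - \<zeta>) + 4 * ?t powr (2 * (\<zeta> - \<eta>))"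
    by (simp add: powr_diff right_diff_distrib)
  finally show "prob {w\<in>space M. \<exists>s\<in>{0..?t}. ?t powr (2 * \<eta>) \<le> \<bar>A s w\<bar>} \<le> C * ?t powr (\<theta> - \<zeta>) + 4 * ?t powr (2 * (\<zeta> - \<eta>))" .
qed (use assms in auto)

end

section \<open>Rates of the Brownian motion\<close>

context brownian_space begin

lemma B_0: "AE w in M. B 0 w = 0"
  using brownian by (simp add: brownian_motion_def)

text \<open>The constant 1 on the interval from 0 to \<open>t\<close> integrates exactly to
  \<open>B\<close> once \<open>B\<close> starts at 0. With this the results on power weights apply
  to the Brownian motion itself.\<close>

lemma B_ito: "ito_integral M F B (\<lambda>_ _. 1) B"
proof (rule ito_integralI[OF _ _ B_cont])
  show "progressive F (\<lambda>_ _. 1)" by (simp add: progressive_def)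
  show "AE w in M. \<forall>t\<ge>0. set_integrable lborel {0..t} (\<lambda>s::real. (1::real)\<^sup>2)"
    using borel_integrable_atLeastAtMost'[of 0 _ "\<lambda>_. 1::real"] by auto
  show "ito_approx B (\<lambda>_ _. 1) B"
    unfolding ito_approx_def
  proof (intro allI impI)
    fix t e :: real assume te: "0 \<le> t" "0 < e"
    let ?S = "(Suc 0, \<lambda>i. if i = 0 then 0 else t, \<lambda>_ _. 1 :: real) :: 'a simple_data"
    have "(sq_int {0..t} (\<lambda>s. simple_process ?S s w - 1)) = (\<integral>\<^sup>+s. 0 \<partial>(lborel :: real measure))" for w
    proof (rule nn_integral_cong_AE)
      show "AE s in lborel. ennreal ((simple_process ?S s w - 1)\<^sup>2) * indicator {0..t} s = 0"
        using AE_lborel_singleton[of "0::real"] by eventually_elim (auto split: split_indicator)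
    qed
    then have z: "(sq_int {0..t} (\<lambda>s. simple_process ?S s w - 1)) = 0" for w by simp
    have "likely e (\<lambda>w. B 0 w = 0)" by (rule likely_AE[OF B_0 te(2)])
    then have "likely e (\<lambda>w. (sq_int {0..t} (\<lambda>s. simple_process ?S s w - 1)) \<le> ennreal e \<and>
       (\<forall>s\<in>{0..t}. \<bar>simple_integral B ?S s w - B s w\<bar> \<le> e))"
      by (rule likely_mono) (use te in \<open>auto simp del: simple_process.simps simp: z min_absorb1\<close>)
    then show "\<exists>S. simple_integrand M F S \<and> likely e (\<lambda>w. (sq_int {0..t} (\<lambda>s. simple_process S s w - 1)) \<le> ennreal e \<and>
       (\<forall>s\<in>{0..t}. \<bar>simple_integral B S s w - B s w\<bar> \<le> e))"
      using te by (intro exI[of _ ?S] conjI) auto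
  qed
qed

lemma B_energy: "energy_process (\<lambda>_ _. 1) (\<lambda>t _. max 0 t)"
proof -
  have "(sq_int {0..t} (\<lambda>s. 1::real)) = ennreal t" if "0 \<le> t" for t :: real
    using that by simp
  then show ?thesis
    by (auto simp: energy_process_def continuous_adapted_def adapted_def mono_on_def intro!: continuous_intros)
qed

sublocale BI: ito_space M F B "\<lambda>_ _. 1" B "\<lambda>t _. max 0 t"
  by unfold_locales (rule B_ito, rule B_energy)

text \<open>The second moment at the hitting time of level \<open>a\<close> is at most
  \<open>4 * t\<close>, by the comparison with the energy; Markov then bounds the probability by the
  square of the desired quantity.\<close>

lemma B_small: "BI.small_at_0 2 (1/2)"
  unfolding BI.small_at_0_def
proof (intro conjI allI impI)
  fix t a :: real assume "0 < t \<and> 0 < a"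
  then have t: "0 < t" "0 \<le> t" and a: "0 < a" by auto
  define K where "K s w = \<bar>B s w\<bar> / a" for s w
  have K: "continuous_adapted M F K"
    unfolding K_def by (intro continuous_adapted_intros B_cont)
  define T where "T = hit t K"
  note hp = hit_props[where K=K, OF continuous_adaptedD(5)[OF K] t(2), folded T_def]
  have st: "stopping_time F T" unfolding T_def by (rule hit_stopping_time[OF K t(2)])
  have T01: "0 \<le> T w \<and> T w \<le> t" if "w \<in> space M" for w using hp(1,2)[OF that] by simp
  have le: "AE w in M. max 0 (T w) \<le> t" using T01 t by (auto intro!: AE_I2)
  have "(\<integral>\<^sup>+w. ennreal ((B (T w) w)\<^sup>2) \<partial>M) \<le> 4 * (\<integral>\<^sup>+w. ennreal (max 0 (T w)) \<partial>M)"
    by (rule BI.ito_stopped_square[OF st t(1) T01 t(2) le])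
  also have "(\<integral>\<^sup>+w. ennreal (max 0 (T w)) \<partial>M) \<le> (\<integral>\<^sup>+w. ennreal t \<partial>M)"
    using T01 t by (intro nn_integral_mono ennreal_leI) auto
  finally have b: "(\<integral>\<^sup>+w. ennreal ((B (T w) w)\<^sup>2) \<partial>M) \<le> ennreal (4 * t)"
    using t by (simp add: emeasure_space_1 ennreal_mult mult_left_mono)
  have m: "(\<lambda>w. B (T w) w) \<in> borel_measurable M"
    by (rule random_time_measurable[OF B_cont stopping_time_measurable_M[OF st], of t]) (use T01 in auto)
  have i: "integrable M (\<lambda>w. (B (T w) w)\<^sup>2)"
    using b m by (intro integrableI_nonneg) (auto intro: order_le_less_trans)
  have EB: "(\<integral>w. (B (T w) w)\<^sup>2 \<partial>M) \<le> 4 * t"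
    using b t by (subst (asm) nn_integral_eq_integral[OF i]) auto
  let ?J = "{w\<in>space M. \<exists>s\<in>{0..t}. a \<le> \<bar>B s w\<bar>}"
  have mJ: "?J \<in> sets M"
    by (rule reach_abs_sets[OF B_cont]) (use t in simp)
  have "prob ?J \<le> (\<integral>w. (B (T w) w)\<^sup>2 \<partial>M) / a\<^sup>2"
  proof (rule Markov_prob[OF i _ mJ])
    show "AE w in M. w \<in> ?J \<longrightarrow> a\<^sup>2 \<le> (B (T w) w)\<^sup>2"
    proof (rule AE_I2, rule impI)
      fix w assume w: "w \<in> space M" and J: "w \<in> ?J"
      have "1 \<le> K (T w) w" using J a by (intro hp(4)[OF w]) (auto simp: K_def)
      then show "a\<^sup>2 \<le> (B (T w) w)\<^sup>2" using a by (simp add: K_def abs_le_square_iff[symmetric])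
    qed
  qed (use a in auto)
  also have "\<dots> \<le> 4 * t / a\<^sup>2" using EB a by (intro divide_right_mono) auto
  finally have 1: "prob ?J \<le> (2 * t powr (1/2) / a)\<^sup>2"
    using t by (simp add: power_divide power_mult_distrib powr_half_sqrt)
  \<comment> \<open>The bound obtained is \<open>x^2\<close>. If \<open>x \<le> 1\<close> this is at
    most \<open>x\<close>; otherwise \<open>x\<close> exceeds any probability.\<close>
  define x where "x = 2 * t powr (1/2) / a"
  have x: "0 \<le> x" using t a by (simp add: x_def)
  show "prob ?J \<le> 2 * t powr (1/2) / a"
  proof (cases "x \<le> 1")
    case True
    then have "x\<^sup>2 \<le> x" using x by (simp add: power2_eq_square mult_left_le)
    then show ?thesis using 1 by (simp add: x_def)
  next
    case False
    then have "1 \<le> 2 * t powr (1/2) / a" by (simp add: x_def)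
    then show ?thesis using prob_le_1[of ?J] by linarith
  qed
qed auto

end

text \<open>\<open>I\<close> and \<open>J\<close> are the martingale parts of \<open>R^2\<close> and
  \<open>R^(2 \<alpha>)\<close>, up to the factors 2 and \<open>2 \<alpha>\<close>;
  \<open>AI\<close> and \<open>AJ\<close> are their energies, whose boundedness is what stopping
  requires.\<close>

locale bessel_space = brownian_space M F B for M :: "'a measure" and F B +
  fixes d \<alpha> :: real and R L I J AI AJ :: "real \<Rightarrow> 'a \<Rightarrow> real"
  assumes d: "0 < d" and \<alpha>: "0 < \<alpha>" "\<alpha> < 1"
    and R_cont: "continuous_adapted M F R" and R_nonneg: "AE w in M. \<forall>t\<ge>0. 0 \<le> R t w"
    and I_ito: "ito_integral M F B R I" and AI: "energy_process R AI"
    and R_square: "AE w in M. \<forall>t\<ge>0. (R t w)\<^sup>2 = 2 * I t w + d * t"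
    and L_cont: "continuous_adapted M F L" and L_mono: "AE w in M. mono_on {0..} (\<lambda>t. L t w)"
    and J_ito: "ito_integral M F B (\<lambda>t w. R t w powr (2 * \<alpha> - 1)) J"
    and AJ: "energy_process (\<lambda>t w. R t w powr (2 * \<alpha> - 1)) AJ"
    and R_powr: "AE w in M. \<forall>t\<ge>0. R t w powr (2 * \<alpha>) = 2 * \<alpha> * J t w + L t w"
begin

sublocale RI: ito_space M F B R I AI
  by unfold_locales (rule I_ito, rule AI)

sublocale JI: ito_space M F B "\<lambda>t w. R t w powr (2 * \<alpha> - 1)" J AJ
  by unfold_locales (rule J_ito, rule AJ)

lemma initial_values: "AE w in M. R 0 w = 0 \<and> L 0 w = 0 \<and> J 0 w = 0"
  using R_square R_powr RI.ito_integral_0 JI.ito_integral_0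
proof eventually_elim
  case (elim w)
  have "(R 0 w)\<^sup>2 = 0" using elim(1)[rule_format, of 0] elim(3) by simp
  then have "R 0 w = 0" by simp
  then show ?case using elim(2)[rule_format, of 0] elim(4) by simp
qed

lemma L_nonneg: "AE w in M. \<forall>t\<ge>0. 0 \<le> L t w"
  using initial_values L_mono by eventually_elim (metis atLeast_iff mono_onD order_refl)

text \<open>An affine majorant, in the variable \<open>x^2\<close>, of the concave power with
  exponent \<open>\<alpha>\<close>. At \<open>l = d * t\<close> it turns the bound
  \<open>d * t\<close> for the mean of \<open>R^2\<close> into \<open>2 * (d * t)^\<alpha>\<close>
  for that of \<open>R^(2 \<alpha>)\<close>.\<close>

lemma powr_alpha_le:
  assumes "0 \<le> (x::real)" "0 < l"
  shows "x powr (2 * \<alpha>) \<le> l powr \<alpha> + l powr (\<alpha> - 1) * x\<^sup>2"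
proof (cases "x\<^sup>2 \<le> l")
  case True
  have "x powr (2 * \<alpha>) = (x\<^sup>2) powr \<alpha>" using assms by (cases "x = 0") (simp_all add: powr_powr flip: powr_numeral)
  also have "\<dots> \<le> l powr \<alpha>" using True \<alpha> by (intro powr_mono2) auto
  also have "\<dots> \<le> l powr \<alpha> + l powr (\<alpha> - 1) * x\<^sup>2" by simp
  finally show ?thesis .
next
  case False
  then have x: "x\<^sup>2 > l" "x > 0" using assms by (auto simp: order_less_le)
  have "x powr (2 * \<alpha>) = (x\<^sup>2) powr \<alpha>" using x by (simp add: powr_powr flip: powr_numeral)
  also have "\<dots> = (x\<^sup>2) powr (\<alpha> - 1) * x\<^sup>2" using x by (simp add: powr_diff)
  also have "\<dots> \<le> l powr (\<alpha> - 1) * x\<^sup>2" using x assms \<alpha> by (intro mult_right_mono powr_mono2') auto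
  also have "\<dots> \<le> l powr \<alpha> + l powr (\<alpha> - 1) * x\<^sup>2" by simp
  finally show ?thesis .
qed

text \<open>\<open>\<E>(R\<^sub>T\<^sup>2) \<le> dt\<close> bounds \<open>R\<^sub>T\<^sup>2\<^sup>\<alpha>\<close> by concavity, and \<open>L\<^sub>T\<close> has the same mean as \<open>R\<^sub>T\<^sup>2\<^sup>\<alpha>\<close>.\<close>

lemma stopped_moments:
  assumes st: "stopping_time F T" and t: "0 < t" and T01: "\<And>w. w \<in> space M \<Longrightarrow> 0 \<le> T w \<and> T w \<le> t"
    and c: "0 \<le> c" and leI: "AE w in M. AI (T w) w \<le> c" and leJ: "AE w in M. AJ (T w) w \<le> c"
  shows "integrable M (\<lambda>w. L (T w) w)" "(\<integral>w. L (T w) w \<partial>M) \<le> 2 * (d * t) powr \<alpha>"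
    "integrable M (\<lambda>w. \<bar>J (T w) w\<bar>)" "(\<integral>w. \<bar>J (T w) w\<bar> \<partial>M) \<le> 2 / \<alpha> * (d * t) powr \<alpha>"
proof -
  have Tm: "T \<in> borel_measurable M" by (rule stopping_time_measurable_M[OF st])
  have m: "(\<lambda>w. X (T w) w) \<in> borel_measurable M" if "continuous_adapted M F X" for X
    by (rule random_time_measurable[OF that Tm, of t]) (use T01 in auto)
  have [measurable]: "T \<in> borel_measurable M" "(\<lambda>w. R (T w) w) \<in> borel_measurable M" "(\<lambda>w. L (T w) w) \<in> borel_measurable M"
    using Tm m[OF R_cont] m[OF L_cont] by auto
  note iI = RI.ito_stopped_integrable[OF st t T01 c leI] RI.ito_stopped_mean[OF st t T01 c leI]
  note iJ = JI.ito_stopped_integrable[OF st t T01 c leJ] JI.ito_stopped_mean[OF st t T01 c leJ]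
  have iT: "integrable M T" by (rule integrable_const_bound[where B=t]) (use T01 in \<open>auto intro!: AE_I2\<close>)
  have R2: "AE w in M. (R (T w) w)\<^sup>2 = 2 * I (T w) w + d * T w"
    using R_square AE_space by eventually_elim (use T01 in auto)
  have iR: "integrable M (\<lambda>w. (R (T w) w)\<^sup>2)"
    by (subst integrable_cong_AE[OF _ _ R2]) (use iI iT m[OF RI.I_cont] in auto)
  have "(\<integral>w. (R (T w) w)\<^sup>2 \<partial>M) = (\<integral>w. 2 * I (T w) w + d * T w \<partial>M)"
    by (rule integral_cong_AE[OF _ _ R2]) (use m[OF RI.I_cont] in auto)
  also have "\<dots> = d * (\<integral>w. T w \<partial>M)" using iI iT by simp
  also have "\<dots> \<le> d * t"
  proof (intro mult_left_mono)
    show "(\<integral>w. T w \<partial>M) \<le> t" using integral_mono[OF iT, of "\<lambda>_. t"] T01 by (simp add: prob_space)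
  qed (use d in simp)
  finally have ER: "(\<integral>w. (R (T w) w)\<^sup>2 \<partial>M) \<le> d * t" .
  let ?X = "\<lambda>w. R (T w) w powr (2 * \<alpha>)" and ?l = "d * t"
  have l: "0 < ?l" using d t by simp
  have Xle: "AE w in M. ?X w \<le> ?l powr \<alpha> + ?l powr (\<alpha> - 1) * (R (T w) w)\<^sup>2"
    using R_nonneg AE_space by eventually_elim (use T01 l in \<open>auto intro!: powr_alpha_le\<close>)
  have ib: "integrable M (\<lambda>w. ?l powr \<alpha> + ?l powr (\<alpha> - 1) * (R (T w) w)\<^sup>2)" using iR by simp
  have iX: "integrable M ?X"
    by (rule Bochner_Integration.integrable_bound[OF ib])
      (use Xle in \<open>auto elim!: eventually_mono intro: order_trans[OF _ abs_ge_self]\<close>)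
  have "(\<integral>w. ?X w \<partial>M) \<le> (\<integral>w. ?l powr \<alpha> + ?l powr (\<alpha> - 1) * (R (T w) w)\<^sup>2 \<partial>M)"
    by (rule integral_mono_AE[OF iX ib Xle])
  also have "\<dots> = ?l powr \<alpha> + ?l powr (\<alpha> - 1) * (\<integral>w. (R (T w) w)\<^sup>2 \<partial>M)" using iR by (simp add: prob_space)
  also have "\<dots> \<le> ?l powr \<alpha> + ?l powr (\<alpha> - 1) * ?l" using ER by (intro add_left_mono mult_left_mono) auto
  also have "\<dots> = 2 * ?l powr \<alpha>" using l by (simp add: powr_diff)
  finally have EX: "(\<integral>w. ?X w \<partial>M) \<le> 2 * ?l powr \<alpha>" .
  have X: "AE w in M. ?X w = 2 * \<alpha> * J (T w) w + L (T w) w"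
    using R_powr AE_space by eventually_elim (use T01 in auto)
  then have LX: "AE w in M. L (T w) w = ?X w - 2 * \<alpha> * J (T w) w" by eventually_elim simp
  show iL: "integrable M (\<lambda>w. L (T w) w)"
    by (subst integrable_cong_AE[OF _ _ LX]) (use iJ iX m[OF JI.I_cont] in auto)
  have "(\<integral>w. L (T w) w \<partial>M) = (\<integral>w. ?X w - 2 * \<alpha> * J (T w) w \<partial>M)"
    by (rule integral_cong_AE[OF _ _ LX]) (use m[OF JI.I_cont] in auto)
  also have "\<dots> = (\<integral>w. ?X w \<partial>M)" using iJ iX by simp
  finally show EL: "(\<integral>w. L (T w) w \<partial>M) \<le> 2 * (d * t) powr \<alpha>" using EX by simp
  show iJa: "integrable M (\<lambda>w. \<bar>J (T w) w\<bar>)" using iJ by simp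
  \<comment> \<open>\<open>2 \<alpha> J\<close> is the difference of two non-negative variables,
    each of mean at most \<open>2 * (d * t)^\<alpha>\<close>; dividing the sum of the bounds by
    \<open>2 \<alpha>\<close> gives the constant \<open>2 / \<alpha>\<close>.\<close>
  have "2 * \<alpha> * (\<integral>w. \<bar>J (T w) w\<bar> \<partial>M) = (\<integral>w. 2 * \<alpha> * \<bar>J (T w) w\<bar> \<partial>M)" by simp
  also have "\<dots> \<le> (\<integral>w. ?X w + L (T w) w \<partial>M)"
  proof (rule integral_mono_AE)
    show "AE w in M. 2 * \<alpha> * \<bar>J (T w) w\<bar> \<le> ?X w + L (T w) w"
      using X L_nonneg AE_space
    proof eventually_elim
      case (elim w)
      have "0 \<le> L (T w) w" using elim T01 by auto
      moreover have "0 \<le> ?X w" by simp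
      ultimately have "\<bar>2 * \<alpha> * J (T w) w\<bar> \<le> ?X w + L (T w) w" using elim(1) by linarith
      then show ?case using \<alpha> by (simp add: abs_mult)
    qed
  qed (use iJa iX iL in auto)
  also have "\<dots> \<le> 2 * ?l powr \<alpha> + 2 * ?l powr \<alpha>" using EX EL iX iL by simp
  finally show "(\<integral>w. \<bar>J (T w) w\<bar> \<partial>M) \<le> 2 / \<alpha> * (d * t) powr \<alpha>"
    using \<alpha> by (simp add: field_simps)
qed

lemma energies_bounded_eventually:
  "AE w in M. \<forall>\<^sub>F n in sequentially. AI t w + AJ t w < real (Suc n)"
proof (rule AE_I2)
  fix w
  show "\<forall>\<^sub>F n in sequentially. AI t w + AJ t w < real (Suc n)"
    using eventually_ge_at_top[of "nat \<lceil>AI t w + AJ t w\<rceil>"] by eventually_elim linarith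
qed

text \<open>Markov for the absolute value of \<open>J\<close> at the hitting time of level
  \<open>a\<close>, on the event that the energies stay below \<open>n+1\<close>. The bound does not
  involve \<open>n\<close>, so the truncation can be removed.\<close>

lemma J_small: "JI.small_at_0 (2 / \<alpha> * d powr \<alpha>) \<alpha>"
  unfolding JI.small_at_0_def
proof (intro conjI allI impI)
  fix t a :: real assume "0 < t \<and> 0 < a"
  then have t: "0 < t" "0 \<le> t" and a: "0 < a" by auto
  let ?E = "{w\<in>space M. \<exists>s\<in>{0..t}. a \<le> \<bar>J s w\<bar>}"
  have mE: "?E \<in> sets M"
    by (rule reach_abs_sets[OF JI.I_cont]) (use t in simp)
  have [measurable]: "AI t \<in> borel_measurable M" "AJ t \<in> borel_measurable M"
    using continuous_adaptedD(2)[OF RI.A_cont t(2)] continuous_adaptedD(2)[OF JI.A_cont t(2)] by auto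
  have "prob ?E \<le> 2 / \<alpha> * (d * t) powr \<alpha> / a"
  proof (rule prob_le_of_truncations[OF mE _ energies_bounded_eventually[of t]])
    fix n
    \<comment> \<open>The second component stops before the energies exceed \<open>n+1\<close>. On
      the truncation event it remains below 1, so the stop is due to \<open>J\<close> having reached
      \<open>a\<close>.\<close>
    define K where "K s w = max (\<bar>J s w\<bar> / a) ((AI s w + AJ s w) / real (Suc n))" for s w
    have K: "continuous_adapted M F K"
      unfolding K_def by (intro continuous_adapted_intros RI.A_cont JI.A_cont JI.I_cont)
    define T where "T = hit t K"
    note hp = hit_props[where K=K, OF continuous_adaptedD(5)[OF K] t(2), folded T_def]
    have st: "stopping_time F T" unfolding T_def by (rule hit_stopping_time[OF K t(2)])
    have T01: "0 \<le> T w \<and> T w \<le> t" if "w \<in> space M" for w using hp(1,2)[OF that] by simp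
    have le: "AE w in M. AI (T w) w \<le> real (Suc n) \<and> AJ (T w) w \<le> real (Suc n)"
      using JI.ito_integral_0 AE_space
    proof eventually_elim
      case (elim w)
      have "K (T w) w \<le> 1" by (rule hp(5)[OF elim(2)]) (use elim RI.A_0 JI.A_0 in \<open>simp add: K_def\<close>)
      then have "AI (T w) w + AJ (T w) w \<le> real (Suc n)" by (simp add: K_def divide_le_eq_1_pos del: of_nat_Suc)
      then show ?case using RI.A_nonneg[OF elim(2), of "T w"] JI.A_nonneg[OF elim(2), of "T w"] T01[OF elim(2)] by linarith
    qed
    have le': "AE w in M. AI (T w) w \<le> real (Suc n)" "AE w in M. AJ (T w) w \<le> real (Suc n)"
      using le by (auto elim: eventually_mono)
    have pos: "0 \<le> real (Suc n)" by simp
    note mom = stopped_moments[OF st t(1) T01 pos le']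
    have "prob {w\<in>?E. AI t w + AJ t w < real (Suc n)} \<le> (\<integral>w. \<bar>J (T w) w\<bar> \<partial>M) / a"
    proof (rule Markov_prob[OF mom(3) _ _ a])
      have "{w\<in>?E. AI t w + AJ t w < real (Suc n)} = ?E \<inter> {w\<in>space M. AI t w + AJ t w < real (Suc n)}" by auto
      then show "{w\<in>?E. AI t w + AJ t w < real (Suc n)} \<in> sets M" using mE by simp
      show "AE w in M. w \<in> {w\<in>?E. AI t w + AJ t w < real (Suc n)} \<longrightarrow> a \<le> \<bar>J (T w) w\<bar>"
      proof (rule AE_I2, rule impI)
        fix w assume w: "w \<in> space M" and E: "w \<in> {w\<in>?E. AI t w + AJ t w < real (Suc n)}"
        have "\<exists>s\<in>{0..t}. 1 \<le> K s w" using E a by (auto simp: K_def le_max_iff_disj)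
        from hp(4)[OF w this] have 1: "1 \<le> K (T w) w" .
        have "AI (T w) w + AJ (T w) w \<le> AI t w + AJ t w"
          using RI.A_mono[OF w, of "T w" t] JI.A_mono[OF w, of "T w" t] T01[OF w] by simp
        then have "AI (T w) w + AJ (T w) w < real (Suc n)" using E by simp
        then have "(AI (T w) w + AJ (T w) w) / real (Suc n) < 1" by (simp add: divide_less_eq_1_pos del: of_nat_Suc)
        then have "1 \<le> \<bar>J (T w) w\<bar> / a" using 1 unfolding K_def by linarith
        then show "a \<le> \<bar>J (T w) w\<bar>" using a by simp
      qed
    qed auto
    also have "\<dots> \<le> 2 / \<alpha> * (d * t) powr \<alpha> / a" using mom(4) a by (intro divide_right_mono) auto
    finally show "prob {w\<in>?E. AI t w + AJ t w < real (Suc n)} \<le> 2 / \<alpha> * (d * t) powr \<alpha> / a" .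
  qed measurable
  then show "prob ?E \<le> 2 / \<alpha> * d powr \<alpha> * t powr \<alpha> / a" using d t by (simp add: powr_mult mult.assoc)
qed (use \<alpha> d in auto)

text \<open>By monotonicity the value at \<open>t\<close> already controls the whole interval, so
  only the energies are stopped; on the truncation event the stopping time equals
  \<open>t\<close>.\<close>

lemma L_tail:
  assumes t: "0 < t" and a: "0 < a"
  shows "prob {w\<in>space M. a \<le> L t w} \<le> 2 * (d * t) powr \<alpha> / a"
proof -
  have t0: "0 \<le> t" using t by simp
  let ?E = "{w\<in>space M. a \<le> L t w}"
  have [measurable]: "AI t \<in> borel_measurable M" "AJ t \<in> borel_measurable M" "L t \<in> borel_measurable M"
    using continuous_adaptedD(2)[OF RI.A_cont t0] continuous_adaptedD(2)[OF JI.A_cont t0] continuous_adaptedD(2)[OF L_cont t0] by auto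
  have mE: "?E \<in> sets M" by measurable
  show ?thesis
  proof (rule prob_le_of_truncations[OF mE _ energies_bounded_eventually[of t]])
    fix n
    define K where "K s w = (AI s w + AJ s w) / real (Suc n)" for s w
    have K: "continuous_adapted M F K"
      unfolding K_def by (intro continuous_adapted_intros RI.A_cont JI.A_cont)
    define T where "T = hit t K"
    note hp = hit_props[where K=K, OF continuous_adaptedD(5)[OF K] t0, folded T_def]
    have st: "stopping_time F T" unfolding T_def by (rule hit_stopping_time[OF K t0])
    have T01: "0 \<le> T w \<and> T w \<le> t" if "w \<in> space M" for w using hp(1,2)[OF that] by simp
    have le: "AI (T w) w \<le> real (Suc n) \<and> AJ (T w) w \<le> real (Suc n)" if w: "w \<in> space M" for w
    proof -
      have "K (T w) w \<le> 1" by (rule hp(5)[OF w]) (use w RI.A_0 JI.A_0 in \<open>simp add: K_def\<close>)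
      then have "AI (T w) w + AJ (T w) w \<le> real (Suc n)" by (simp add: K_def divide_le_eq_1_pos del: of_nat_Suc)
      then show ?thesis using RI.A_nonneg[OF w, of "T w"] JI.A_nonneg[OF w, of "T w"] T01[OF w] by linarith
    qed
    have le': "AE w in M. AI (T w) w \<le> real (Suc n)" "AE w in M. AJ (T w) w \<le> real (Suc n)"
      using le by (auto intro!: AE_I2)
    have pos: "0 \<le> real (Suc n)" by simp
    note mom = stopped_moments[OF st t T01 pos le']
    have "prob {w\<in>?E. AI t w + AJ t w < real (Suc n)} \<le> (\<integral>w. L (T w) w \<partial>M) / a"
    proof (rule Markov_prob[OF mom(1) _ _ a])
      have "{w\<in>?E. AI t w + AJ t w < real (Suc n)} = ?E \<inter> {w\<in>space M. AI t w + AJ t w < real (Suc n)}" by auto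
      then show "{w\<in>?E. AI t w + AJ t w < real (Suc n)} \<in> sets M" using mE by simp
      show "AE w in M. 0 \<le> L (T w) w" using L_nonneg AE_space by eventually_elim (use T01 in auto)
      show "AE w in M. w \<in> {w\<in>?E. AI t w + AJ t w < real (Suc n)} \<longrightarrow> a \<le> L (T w) w"
      proof (rule AE_I2, rule impI)
        fix w assume w: "w \<in> space M" and E: "w \<in> {w\<in>?E. AI t w + AJ t w < real (Suc n)}"
        have "K s w < 1" if "s \<in> {0..t}" for s
        proof -
          have "AI s w + AJ s w \<le> AI t w + AJ t w"
            using RI.A_mono[OF w, of s t] JI.A_mono[OF w, of s t] that by simp
          then have "AI s w + AJ s w < real (Suc n)" using E by simp
          then show ?thesis by (simp add: K_def divide_less_eq_1_pos del: of_nat_Suc)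
        qed
        then have "{s\<in>{0..t}. 1 \<le> K s w} = {}" by (metis (no_types, lifting) empty_Collect_eq not_le)
        then have "T w = t" unfolding T_def hit_def by (simp only: cInf_singleton)
        then show "a \<le> L (T w) w" using E by simp
      qed
    qed
    also have "\<dots> \<le> 2 * (d * t) powr \<alpha> / a" using mom(2) a by (intro divide_right_mono) auto
    finally show "prob {w\<in>?E. AI t w + AJ t w < real (Suc n)} \<le> 2 * (d * t) powr \<alpha> / a" .
  qed measurable
qed

lemma L_rate:
  assumes "0 \<le> \<eta>" "\<eta> < \<alpha>"
  shows "AE w in M. \<exists>K>0. \<exists>t>0. \<forall>s. 0 < s \<and> s \<le> t \<longrightarrow> \<bar>L s w\<bar> \<le> K * s powr \<eta>"
proof (rule pathwise_rate[OF L_cont _ assms(1)])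
  show "summable (\<lambda>n. (2 * d powr \<alpha>) * ((1/2)^n) powr (\<alpha> - \<eta>))" using assms by (intro summable_half_powr) auto
  fix n :: nat
  let ?t = "(1/2::real)^n"
  have m: "{w\<in>space M. \<exists>s\<in>{0..?t}. ?t powr \<eta> \<le> \<bar>L s w\<bar>} \<in> sets M"
    by (rule reach_abs_sets[OF L_cont]) simp
  have mL: "{w\<in>space M. ?t powr \<eta> \<le> L ?t w} \<in> sets M"
    using continuous_adaptedD(2)[OF L_cont, of ?t] by measurable
  have "AE w in M. w \<in> {w\<in>space M. \<exists>s\<in>{0..?t}. ?t powr \<eta> \<le> \<bar>L s w\<bar>} \<longrightarrow> w \<in> {w\<in>space M. ?t powr \<eta> \<le> L ?t w}"
    using L_nonneg L_mono
  proof eventually_elim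
    case (elim w)
    have "\<bar>L s w\<bar> \<le> L ?t w" if "s \<in> {0..?t}" for s
      using elim mono_onD[OF elim(2), of s ?t] that by auto
    then show ?case by (auto intro: order_trans)
  qed
  then have "prob {w\<in>space M. \<exists>s\<in>{0..?t}. ?t powr \<eta> \<le> \<bar>L s w\<bar>} \<le> prob {w\<in>space M. ?t powr \<eta> \<le> L ?t w}"
    by (rule finite_measure_mono_AE[OF _ mL])
  also have "\<dots> \<le> 2 * (d * ?t) powr \<alpha> / ?t powr \<eta>" by (rule L_tail) auto
  also have "\<dots> = (2 * d powr \<alpha>) * ?t powr (\<alpha> - \<eta>)" using d by (simp add: powr_mult powr_diff)
  finally show "prob {w\<in>space M. \<exists>s\<in>{0..?t}. ?t powr \<eta> \<le> \<bar>L s w\<bar>} \<le> (2 * d powr \<alpha>) * ?t powr (\<alpha> - \<eta>)" .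
qed

end

subsection \<open>Pathwise integration by parts\<close>

text \<open>\<open>weighted \<beta> Y Z\<close> says that \<open>dZ\<^sub>s = s\<^sup>\<beta> dY\<^sub>s\<close> on \<open>(0,\<infinity>)\<close>, in the form given by integration by parts;
  no bounded variation of \<open>Y\<close> is needed.\<close>

definition weighted :: "real \<Rightarrow> (real \<Rightarrow> real) \<Rightarrow> (real \<Rightarrow> real) \<Rightarrow> bool" where
  "weighted \<beta> Y Z \<longleftrightarrow> (\<forall>v y. 0 < v \<and> v \<le> y \<longrightarrow>
     Z y - Z v = v powr \<beta> * (Y y - Y v) + \<beta> * integral {v..y} (\<lambda>s. (Y y - Y s) * s powr (\<beta> - 1)))"

lemma weightedD:
  "weighted \<beta> Y Z \<Longrightarrow> 0 < v \<Longrightarrow> v \<le> y \<Longrightarrow>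
     Z y - Z v = v powr \<beta> * (Y y - Y v) + \<beta> * integral {v..y} (\<lambda>s. (Y y - Y s) * s powr (\<beta> - 1))"
  by (simp add: weighted_def)

lemma weighted_integrand_integrable:
  fixes Y :: "real \<Rightarrow> real"
  assumes "continuous_on {0..} Y" "0 < v"
  shows "(\<lambda>s. (Y y - Y s) * s powr \<beta>) integrable_on {v..y}"
  using assms
  by (intro integrable_continuous_real continuous_intros continuous_on_subset[OF assms(1)]) auto

lemma weighted_lincomb:
  assumes "weighted \<beta> Y Z" "weighted \<beta> Y' Z'" "continuous_on {0..} Y" "continuous_on {0..} Y'"
  shows "weighted \<beta> (\<lambda>t. a * Y t + b * Y' t) (\<lambda>t. a * Z t + b * Z' t)"
  unfolding weighted_def
proof (intro allI impI)
  fix v y :: real assume v: "0 < v \<and> v \<le> y"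
  note i = weighted_integrand_integrable[OF assms(3), of v y] weighted_integrand_integrable[OF assms(4), of v y]
  have "integral {v..y} (\<lambda>s. (a * Y y + b * Y' y - (a * Y s + b * Y' s)) * s powr (\<beta> - 1)) =
     integral {v..y} (\<lambda>s. a * ((Y y - Y s) * s powr (\<beta> - 1)) + b * ((Y' y - Y' s) * s powr (\<beta> - 1)))"
    by (intro integral_cong) (simp add: algebra_simps)
  also have "\<dots> = a * integral {v..y} (\<lambda>s. (Y y - Y s) * s powr (\<beta> - 1)) + b * integral {v..y} (\<lambda>s. (Y' y - Y' s) * s powr (\<beta> - 1))"
    using i v integrable_on_cmult_left[OF i(1), of a] integrable_on_cmult_left[OF i(2), of b] by (subst Henstock_Kurzweil_Integration.integral_add) auto
  finally have "integral {v..y} (\<lambda>s. (a * Y y + b * Y' y - (a * Y s + b * Y' s)) * s powr (\<beta> - 1)) =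
     a * integral {v..y} (\<lambda>s. (Y y - Y s) * s powr (\<beta> - 1)) + b * integral {v..y} (\<lambda>s. (Y' y - Y' s) * s powr (\<beta> - 1))" .
  moreover have "a * Z y + b * Z' y - (a * Z v + b * Z' v) = a * (Z y - Z v) + b * (Z' y - Z' v)"
    by (simp add: algebra_simps)
  ultimately show "a * Z y + b * Z' y - (a * Z v + b * Z' v) = v powr \<beta> * (a * Y y + b * Y' y - (a * Y v + b * Y' v)) +
     \<beta> * integral {v..y} (\<lambda>s. (a * Y y + b * Y' y - (a * Y s + b * Y' s)) * s powr (\<beta> - 1))"
    using weightedD[OF assms(1), of v y] weightedD[OF assms(2), of v y] v by (simp add: algebra_simps)
qed

text \<open>Past \<open>c\<close> both paths are frozen and the integrand vanishes, so the integral
  ends at \<open>c\<close>. Stopped paths are the building blocks of simple integrals.\<close>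

lemma weighted_stop:
  assumes w: "weighted \<beta> Y Z" and Y: "continuous_on {0..} Y" and c: "0 \<le> c"
  shows "weighted \<beta> (\<lambda>t. Y (min t c)) (\<lambda>t. Z (min t c))"
  unfolding weighted_def
proof (intro allI impI)
  fix v y :: real assume v: "0 < v \<and> v \<le> y"
  let ?f = "\<lambda>s. (Y (min y c) - Y (min s c)) * s powr (\<beta> - 1)"
  have z: "integral {x..y} ?f = 0" if "c \<le> x" "x \<le> y" for x
  proof -
    have "integral {x..y} ?f = integral {x..y} (\<lambda>_. 0)"
      using that by (intro integral_cong) (auto simp: min_absorb2)
    then show ?thesis by simp
  qed
  have Yc: "continuous_on {0..} (\<lambda>t. Y (min t c))"
    using c by (intro continuous_on_compose2[OF Y] continuous_intros) auto
  consider "y \<le> c" | "c \<le> v" | "v \<le> c" "c \<le> y" by linarith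
  then show "Z (min y c) - Z (min v c) = v powr \<beta> * (Y (min y c) - Y (min v c)) + \<beta> * integral {v..y} ?f"
  proof cases
    case 1
    then have "integral {v..y} ?f = integral {v..y} (\<lambda>s. (Y y - Y s) * s powr (\<beta> - 1))"
      using v by (intro integral_cong) (auto simp: min_absorb1)
    then show ?thesis using 1 v weightedD[OF w, of v y] by (simp add: min_absorb1)
  next
    case 2 then show ?thesis using z[of v] v by (simp add: min_absorb2)
  next
    case 3
    have "integral {v..y} ?f = integral {v..c} ?f + integral {c..y} ?f"
      using 3 v weighted_integrand_integrable[OF Yc, of v y "\<beta> - 1"] by (intro Henstock_Kurzweil_Integration.integral_combine[symmetric]) auto
    also have "integral {v..c} ?f = integral {v..c} (\<lambda>s. (Y c - Y s) * s powr (\<beta> - 1))"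
      using 3 by (intro integral_cong) (auto simp: min_absorb1 min_absorb2)
    finally show ?thesis using z[of c] weightedD[OF w, of v c] 3 v by (simp add: min_absorb1 min_absorb2)
  qed
qed

lemma weighted_sum:
  fixes n :: nat
  assumes "\<And>i. i < n \<Longrightarrow> weighted \<beta> (Y i) (Z i)" "\<And>i. i < n \<Longrightarrow> continuous_on {0..} (Y i)"
  shows "weighted \<beta> (\<lambda>t. \<Sum>i<n. c i * Y i t) (\<lambda>t. \<Sum>i<n. c i * Z i t)"
  using assms
proof (induction n)
  case 0 then show ?case by (simp add: weighted_def)
next
  case (Suc n)
  have "continuous_on {0..} (\<lambda>t. \<Sum>i<n. c i * Y i t)"
    using Suc.prems by (intro continuous_intros) auto
  then show ?case
    using weighted_lincomb[OF Suc.IH Suc.prems(1)[of n], of 1 "c n"] Suc.prems by (simp add: algebra_simps)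
qed

text \<open>On a short interval the weight is almost constant: the error is the oscillation of
  \<open>Y\<close> times the length. Summed over a partition it tends to 0 for every continuous
  \<open>Y\<close>, whatever its variation.\<close>

lemma weighted_increment_bound:
  assumes w: "weighted \<beta> Y Z" and Y: "continuous_on {0..} Y" and v: "0 < v" "v \<le> y"
    and osc: "\<And>s. v \<le> s \<Longrightarrow> s \<le> y \<Longrightarrow> \<bar>Y y - Y s\<bar> \<le> \<omega>"
    and D: "\<And>s. v \<le> s \<Longrightarrow> s \<le> y \<Longrightarrow> s powr (\<beta> - 1) \<le> D"
  shows "\<bar>(Z y - Z v) - v powr \<beta> * (Y y - Y v)\<bar> \<le> \<bar>\<beta>\<bar> * \<omega> * D * (y - v)"
proof -
  have \<omega>: "0 \<le> \<omega>" using osc[of y] v by simp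
  have D0: "0 \<le> D" using D[of y] v powr_ge_zero[of y "\<beta> - 1"] by linarith
  have "norm (integral {v..y} (\<lambda>s. (Y y - Y s) * s powr (\<beta> - 1))) \<le> (\<omega> * D) * (y - v)"
  proof (rule integral_bound[OF v(2)])
    show "continuous_on {v..y} (\<lambda>s. (Y y - Y s) * s powr (\<beta> - 1))"
      using v by (intro continuous_intros continuous_on_subset[OF Y]) auto
    show "norm ((Y y - Y s) * s powr (\<beta> - 1)) \<le> \<omega> * D" if "s \<in> {v..y}" for s
      using that osc[of s] D[of s] \<omega> by (auto simp: abs_mult intro!: mult_mono)
  qed
  then have "\<bar>\<beta>\<bar> * \<bar>integral {v..y} (\<lambda>s. (Y y - Y s) * s powr (\<beta> - 1))\<bar> \<le> \<bar>\<beta>\<bar> * ((\<omega> * D) * (y - v))"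
    by (intro mult_left_mono) auto
  then show ?thesis using weightedD[OF w v] by (simp add: abs_mult mult.assoc)
qed

section \<open>Riemann sums with power weights\<close>

definition grid_point :: "real \<Rightarrow> real \<Rightarrow> nat \<Rightarrow> nat \<Rightarrow> real" where
  "grid_point a b m i = a + real i * (b - a) / real m"

lemma grid_point_props:
  assumes "a \<le> b" "0 < m"
  shows "grid_point a b m 0 = a" "grid_point a b m m = b" "grid_point a b m i \<le> grid_point a b m (Suc i)"
    "grid_point a b m (Suc i) - grid_point a b m i = (b - a) / real m" "a \<le> grid_point a b m i"
    "i \<le> m \<Longrightarrow> grid_point a b m i \<le> b" "i \<le> j \<Longrightarrow> grid_point a b m i \<le> grid_point a b m j"
proof -
  show "grid_point a b m 0 = a" "grid_point a b m m = b" using assms by (auto simp: grid_point_def)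
  show "i \<le> j \<Longrightarrow> grid_point a b m i \<le> grid_point a b m j" for i j
    unfolding grid_point_def using assms by (intro add_left_mono divide_right_mono mult_right_mono) auto
  then show "grid_point a b m i \<le> grid_point a b m (Suc i)" "i \<le> m \<Longrightarrow> grid_point a b m i \<le> b"
    using \<open>grid_point a b m m = b\<close> by (auto) (metis)
  show "grid_point a b m (Suc i) - grid_point a b m i = (b - a) / real m"
    unfolding grid_point_def by (simp add: add_divide_distrib[symmetric] diff_divide_distrib[symmetric] algebra_simps)
  show "a \<le> grid_point a b m i" unfolding grid_point_def using assms by simp
qed

text \<open>Each cell contributes an error of order \<open>\<omega> * (b - a) / m\<close>, so the
  total is governed by the oscillation \<open>\<omega>\<close> at the mesh size. The coefficients
  \<open>\<psi>\<close> are 1 when the weight is inserted, and reciprocal powers when it is divided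
  out.\<close>

lemma riemann_cells:
  assumes w: "weighted \<beta> Y Z" and Y: "continuous_on {0..} Y" and ab: "0 < a" "a \<le> b" and m: "0 < m"
    and osc: "\<And>x y. a \<le> x \<Longrightarrow> x \<le> y \<Longrightarrow> y \<le> b \<Longrightarrow> y - x \<le> (b - a) / real m \<Longrightarrow> \<bar>Y y - Y x\<bar> \<le> \<omega>"
    and D: "\<And>s. a \<le> s \<Longrightarrow> s \<le> b \<Longrightarrow> s powr (\<beta> - 1) \<le> D" and C: "\<And>i. i < m \<Longrightarrow> \<bar>\<psi> i\<bar> \<le> C" and t: "t \<le> b"
  defines "v \<equiv> grid_point a b m"
  shows "\<bar>(\<Sum>i<m. \<psi> i * (Z (min t (v (Suc i))) - Z (min t (v i)))) -
          (\<Sum>i<m. \<psi> i * v i powr \<beta> * (Y (min t (v (Suc i))) - Y (min t (v i))))\<bar> \<le> C * \<bar>\<beta>\<bar> * \<omega> * D * (b - a)"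
proof -
  note gp = grid_point_props[OF ab(2) m, folded v_def]
  have \<omega>: "0 \<le> \<omega>" using osc[of a a] ab by simp
  have D0: "0 \<le> D" using D[of a] ab powr_ge_zero[of a "\<beta> - 1"] by linarith
  have C0: "0 \<le> C" using C[of 0] m by linarith
  have cell: "\<bar>\<psi> i * ((Z (min t (v (Suc i))) - Z (min t (v i))) - v i powr \<beta> * (Y (min t (v (Suc i))) - Y (min t (v i))))\<bar>
     \<le> C * (\<bar>\<beta>\<bar> * \<omega> * D * ((b - a) / real m))" if i: "i < m" for i
  proof (cases "t \<le> v i")
    case True
    then have "min t (v (Suc i)) = t" "min t (v i) = t" using gp(3)[of i] by auto
    then show ?thesis using C0 \<omega> D0 ab by simp
  next
    case False
    define y where "y = min t (v (Suc i))"
    have vy: "v i \<le> y" "y \<le> b" "y - v i \<le> (b - a) / real m" "a \<le> v i"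
      using False gp(3)[of i] gp(4)[of i] gp(5)[of i] t unfolding y_def by auto
    have "\<bar>(Z y - Z (v i)) - v i powr \<beta> * (Y y - Y (v i))\<bar> \<le> \<bar>\<beta>\<bar> * \<omega> * D * (y - v i)"
      using vy ab by (intro weighted_increment_bound[OF w Y] osc D) auto
    also have "\<dots> \<le> \<bar>\<beta>\<bar> * \<omega> * D * ((b - a) / real m)"
      using vy \<omega> D0 by (intro mult_left_mono) auto
    finally have "\<bar>(Z y - Z (v i)) - v i powr \<beta> * (Y y - Y (v i))\<bar> \<le> \<bar>\<beta>\<bar> * \<omega> * D * ((b - a) / real m)" .
    then have "\<bar>\<psi> i\<bar> * \<bar>(Z y - Z (v i)) - v i powr \<beta> * (Y y - Y (v i))\<bar> \<le> C * (\<bar>\<beta>\<bar> * \<omega> * D * ((b - a) / real m))"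
      using C[OF i] C0 by (intro mult_mono) auto
    moreover have "min t (v i) = v i" using False by simp
    ultimately show ?thesis by (simp only: abs_mult y_def)
  qed
  have eq: "(\<Sum>i<m. \<psi> i * (Z (min t (v (Suc i))) - Z (min t (v i)))) -
          (\<Sum>i<m. \<psi> i * v i powr \<beta> * (Y (min t (v (Suc i))) - Y (min t (v i)))) =
     (\<Sum>i<m. \<psi> i * ((Z (min t (v (Suc i))) - Z (min t (v i))) - v i powr \<beta> * (Y (min t (v (Suc i))) - Y (min t (v i)))))"
    unfolding sum_subtractf[symmetric] by (intro sum.cong) (auto simp: algebra_simps)
  show ?thesis unfolding eq
  proof (rule order_trans[OF sum_abs])
    have "(\<Sum>i<m. \<bar>\<psi> i * ((Z (min t (v (Suc i))) - Z (min t (v i))) - v i powr \<beta> * (Y (min t (v (Suc i))) - Y (min t (v i))))\<bar>)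
      \<le> (\<Sum>i<m. C * (\<bar>\<beta>\<bar> * \<omega> * D * ((b - a) / real m)))"
      by (rule sum_mono) (rule cell, simp)
    also have "\<dots> = C * \<bar>\<beta>\<bar> * \<omega> * D * (b - a)" using m by simp
    finally show "(\<Sum>i<m. \<bar>\<psi> i * ((Z (min t (v (Suc i))) - Z (min t (v i))) - v i powr \<beta> * (Y (min t (v (Suc i))) - Y (min t (v i))))\<bar>)
      \<le> C * \<bar>\<beta>\<bar> * \<omega> * D * (b - a)" .
  qed
qed

lemma sum_grid_telescope:
  fixes f :: "real \<Rightarrow> real"
  assumes "a \<le> b" "0 < m" "t \<le> b"
  shows "(\<Sum>i<m. f (min t (grid_point a b m (Suc i))) - f (min t (grid_point a b m i))) = f t - f (min t a)"
proof -
  have "(\<Sum>i<m. f (min t (grid_point a b m (Suc i))) - f (min t (grid_point a b m i))) =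
     f (min t (grid_point a b m m)) - f (min t (grid_point a b m 0))"
    by (rule sum_lessThan_telescope)
  then show ?thesis using grid_point_props(1,2)[OF assms(1,2)] assms(3) by simp
qed

lemma powr_bounded_on:
  assumes "0 < a"
  obtains D :: real where "0 < D" "\<And>s. a \<le> s \<Longrightarrow> s \<le> b \<Longrightarrow> s powr \<beta> \<le> D"
proof -
  have "s powr \<beta> \<le> a powr \<beta> + b powr \<beta>" if "a \<le> s" "s \<le> b" for s
  proof (cases "0 \<le> \<beta>")
    case True
    then have "s powr \<beta> \<le> b powr \<beta>" using that assms by (intro powr_mono2) auto
    then show ?thesis by (simp add: add_increasing)
  next
    case False
    then have "s powr \<beta> \<le> a powr \<beta>" using that assms by (intro powr_mono2') auto
    then show ?thesis by (simp add: add_increasing2)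
  qed
  moreover have "0 < a powr \<beta> + b powr \<beta>" using assms by (simp add: add_pos_nonneg)
  ultimately show ?thesis using that by blast
qed

lemma uniform_modulus:
  fixes Y :: "real \<Rightarrow> real"
  assumes "continuous_on {a..b} Y" "0 < \<delta>"
  obtains h where "0 < h" "\<And>x y. a \<le> x \<Longrightarrow> x \<le> b \<Longrightarrow> a \<le> y \<Longrightarrow> y \<le> b \<Longrightarrow> \<bar>y - x\<bar> < h \<Longrightarrow> \<bar>Y y - Y x\<bar> < \<delta>"
  using compact_uniformly_continuous[OF assms(1) compact_Icc] assms(2)
  unfolding uniformly_continuous_on_def dist_real_def by (metis atLeastAtMost_iff)

lemma small_mesh:
  fixes a b h :: real
  assumes "0 < h" shows "\<forall>\<^sub>F m in sequentially. 0 < m \<and> (b - a) / real m < h"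
proof -
  have "(\<lambda>m. (b - a) / real m) \<longlonglongrightarrow> 0" by (rule lim_const_over_n)
  from order_tendstoD(2)[OF this assms] eventually_gt_at_top[of 0] show ?thesis
    by eventually_elim auto
qed

text \<open>Applied to Brownian paths, where it gives the increments of the weighted process, and to
  the identity path, where it gives their variance.\<close>

lemma riemann_limit:
  assumes w: "weighted \<beta> Y Z" and Y: "continuous_on {0..} Y" and ab: "0 < a" "a \<le> b"
  shows "(\<lambda>m. \<Sum>i<m. grid_point a b m i powr \<beta> * (Y (grid_point a b m (Suc i)) - Y (grid_point a b m i))) \<longlonglongrightarrow> Z b - Z a"
proof (rule LIMSEQ_I)
  fix e :: real assume e: "0 < e"
  obtain D where D: "0 < D" "\<And>s. a \<le> s \<Longrightarrow> s \<le> b \<Longrightarrow> s powr (\<beta> - 1) \<le> D"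
    using powr_bounded_on[OF ab(1)] by blast
  define \<delta> where "\<delta> = e / (\<bar>\<beta>\<bar> * D * (b - a) + 1)"
  have pos: "0 < \<bar>\<beta>\<bar> * D * (b - a) + 1" using D ab by (simp add: add_nonneg_pos)
  then have \<delta>: "0 < \<delta>" using e by (simp add: \<delta>_def)
  obtain h where h: "0 < h" "\<And>x y. a \<le> x \<Longrightarrow> x \<le> b \<Longrightarrow> a \<le> y \<Longrightarrow> y \<le> b \<Longrightarrow> \<bar>y - x\<bar> < h \<Longrightarrow> \<bar>Y y - Y x\<bar> < \<delta>"
  proof (rule uniform_modulus[of a b Y \<delta>])
    show "continuous_on {a..b} Y" by (rule continuous_on_subset[OF Y]) (use ab in auto)
  qed (use \<delta> in \<open>auto intro: that\<close>)
  obtain m0 where m0: "\<And>m. m \<ge> m0 \<Longrightarrow> 0 < m \<and> (b - a) / real m < h"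
    using small_mesh[OF h(1), of b a] by (auto simp: eventually_sequentially)
  have "norm ((\<Sum>i<m. grid_point a b m i powr \<beta> * (Y (grid_point a b m (Suc i)) - Y (grid_point a b m i))) - (Z b - Z a)) < e"
    if "m \<ge> m0" for m
  proof -
    have m: "0 < m" "(b - a) / real m < h" using m0[OF that] by auto
    let ?v = "grid_point a b m"
    have "\<bar>(\<Sum>i<m. 1 * (Z (min b (?v (Suc i))) - Z (min b (?v i)))) -
          (\<Sum>i<m. 1 * ?v i powr \<beta> * (Y (min b (?v (Suc i))) - Y (min b (?v i))))\<bar> \<le> 1 * \<bar>\<beta>\<bar> * \<delta> * D * (b - a)"
    proof (rule riemann_cells[OF w Y ab m(1) _ D(2)])
      show "\<bar>Y y - Y x\<bar> \<le> \<delta>" if "a \<le> x" "x \<le> y" "y \<le> b" "y - x \<le> (b - a) / real m" for x y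
        using h(2)[of x y] that m by simp
    qed auto
    moreover have "(\<Sum>i<m. 1 * (Z (min b (?v (Suc i))) - Z (min b (?v i)))) = Z b - Z a"
      using sum_grid_telescope[OF ab(2) m(1), of b Z] ab by simp
    moreover have "(\<Sum>i<m. 1 * ?v i powr \<beta> * (Y (min b (?v (Suc i))) - Y (min b (?v i)))) =
       (\<Sum>i<m. ?v i powr \<beta> * (Y (?v (Suc i)) - Y (?v i)))"
      using grid_point_props(6)[OF ab(2) m(1)] by (intro sum.cong) (auto simp: min_absorb2)
    moreover have "1 * \<bar>\<beta>\<bar> * \<delta> * D * (b - a) < e"
    proof -
      have "\<bar>\<beta>\<bar> * D * (b - a) * \<delta> < (\<bar>\<beta>\<bar> * D * (b - a) + 1) * \<delta>" using \<delta> by simp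
      also have "\<dots> = e" using pos by (simp add: \<delta>_def)
      finally show ?thesis by (simp add: ac_simps)
    qed
    ultimately show ?thesis by (simp add: abs_minus_commute)
  qed
  then show "\<exists>m0. \<forall>m\<ge>m0. norm ((\<Sum>i<m. grid_point a b m i powr \<beta> * (Y (grid_point a b m (Suc i)) - Y (grid_point a b m i))) - (Z b - Z a)) < e"
    by blast
qed

lemma powr_has_integral:
  fixes v y :: real
  assumes "0 < v" "v \<le> y"
  shows "((\<lambda>s. \<beta> * s powr (\<beta> - 1)) has_integral (y powr \<beta> - v powr \<beta>)) {v..y}"
proof (rule fundamental_theorem_of_calculus[OF assms(2)])
  fix s assume "s \<in> {v..y}"
  then have "0 < s" using assms by simp
  then show "((\<lambda>s. s powr \<beta>) has_vector_derivative \<beta> * s powr (\<beta> - 1)) (at s within {v..y})"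
    unfolding has_real_derivative_iff_has_vector_derivative[symmetric]
    by (auto intro!: derivative_eq_intros)
qed

text \<open>The time axis regarded as a path: its weighted version is the antiderivative of the
  power. With \<open>2 * \<beta>\<close> for the exponent this evaluates the limiting
  variance.\<close>

lemma weighted_identity:
  assumes "\<beta> \<noteq> -1"
  shows "weighted \<beta> (\<lambda>s. s) (\<lambda>s. s powr (\<beta> + 1) / (\<beta> + 1))"
  unfolding weighted_def
proof (intro allI impI)
  fix v y :: real assume v: "0 < v \<and> v \<le> y"
  \<comment> \<open>An antiderivative of the integrand: differentiating the power in the product
    leaves the wanted term, and the two remaining powers \<open>s^\<beta>\<close> cancel.\<close>
  let ?g = "\<lambda>s. (y - s) * s powr \<beta> + s powr (\<beta> + 1) / (\<beta> + 1)"
  have "((\<lambda>s. \<beta> * ((y - s) * s powr (\<beta> - 1))) has_integral (?g y - ?g v)) {v..y}"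
  proof (rule fundamental_theorem_of_calculus)
    fix s assume "s \<in> {v..y}"
    then have "0 < s" using v by simp
    then show "(?g has_vector_derivative \<beta> * ((y - s) * s powr (\<beta> - 1))) (at s within {v..y})"
      unfolding has_real_derivative_iff_has_vector_derivative[symmetric] using assms
      by (auto intro!: derivative_eq_intros)
  qed (use v in simp)
  then have "\<beta> * integral {v..y} (\<lambda>s. (y - s) * s powr (\<beta> - 1)) = ?g y - ?g v"
    using integral_unique[OF \<open>((\<lambda>s. \<beta> * ((y - s) * s powr (\<beta> - 1))) has_integral (?g y - ?g v)) {v..y}\<close>]
    by (simp only: integral_mult_right)
  then show "y powr (\<beta> + 1) / (\<beta> + 1) - v powr (\<beta> + 1) / (\<beta> + 1) = v powr \<beta> * (y - v) + \<beta> * integral {v..y} (\<lambda>s. (y - s) * s powr (\<beta> - 1))"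
    by (simp add: algebra_simps)
qed

lemma powr_set_integrable:
  assumes "-1 < p" "0 \<le> c"
  shows "set_integrable lborel {0..c} (\<lambda>s. s powr p :: real)"
proof -
  have "(\<lambda>s. s powr p) absolutely_integrable_on {0..c}"
    using integrable_on_powr_from_0[OF assms(1), of c] assms(2)
    by (intro nonnegative_absolutely_integrable_1) auto
  then have "integrable (completion lborel) (\<lambda>s. indicator {0..c} s *\<^sub>R s powr p)"
    by (simp add: set_integrable_def)
  then show ?thesis unfolding set_integrable_def
    by (subst (asm) integrable_completion) auto
qed

text \<open>Near 0 the integrand is dominated by a multiple of
  \<open>s^(\<beta> + \<eta> - 1)\<close>, integrable since \<open>\<beta> + \<eta> > 0\<close>;
  away from 0 it is continuous.\<close>

lemma by_parts_integrable:
  fixes Y :: "real \<Rightarrow> real"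
  assumes Y: "continuous_on {0..} Y" and t0: "0 < t0"
    and rate: "\<And>s. 0 < s \<Longrightarrow> s \<le> t0 \<Longrightarrow> \<bar>Y s\<bar> \<le> K * s powr \<eta>" and \<eta>: "0 < \<beta> + \<eta>"
  shows "set_integrable lborel {0..u} (\<lambda>s. Y s * s powr (\<beta> - 1))"
proof -
  have m: "(\<lambda>s. indicator {0..u} s *\<^sub>R (Y s * s powr (\<beta> - 1))) \<in> borel_measurable borel" for u
  proof -
    have "(\<lambda>s. indicator {0..} s *\<^sub>R Y s) \<in> borel_measurable borel"
      by (rule borel_measurable_continuous_on_indicator[OF _ Y]) simp
    then have "(\<lambda>s. indicator {0..u} s * ((indicator {0..} s *\<^sub>R Y s) * s powr (\<beta> - 1))) \<in> borel_measurable borel"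
      by measurable
    also have "(\<lambda>s. indicator {0..u} s * ((indicator {0..} s *\<^sub>R Y s) * s powr (\<beta> - 1))) = (\<lambda>s. indicator {0..u} s *\<^sub>R (Y s * s powr (\<beta> - 1)))"
      by (auto split: split_indicator)
    finally show ?thesis .
  qed
  have 1: "set_integrable lborel {0..t0} (\<lambda>s. Y s * s powr (\<beta> - 1))"
    unfolding set_integrable_def
  proof (rule Bochner_Integration.integrable_bound)
    show "integrable lborel (\<lambda>s. \<bar>K\<bar> * (indicator {0..t0} s *\<^sub>R s powr (\<beta> + \<eta> - 1)))"
      using powr_set_integrable[of "\<beta> + \<eta> - 1" t0] \<eta> t0 unfolding set_integrable_def by (intro integrable_mult_right) auto
    show "AE s in lborel. norm (indicator {0..t0} s *\<^sub>R (Y s * s powr (\<beta> - 1))) \<le> norm (\<bar>K\<bar> * (indicator {0..t0} s *\<^sub>R s powr (\<beta> + \<eta> - 1)))"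
    proof (rule AE_I2)
      fix s :: real
      show "norm (indicator {0..t0} s *\<^sub>R (Y s * s powr (\<beta> - 1))) \<le> norm (\<bar>K\<bar> * (indicator {0..t0} s *\<^sub>R s powr (\<beta> + \<eta> - 1)))"
      proof (cases "0 < s \<and> s \<le> t0")
        case True
        have "\<bar>Y s\<bar> * s powr (\<beta> - 1) \<le> (\<bar>K\<bar> * s powr \<eta>) * s powr (\<beta> - 1)"
          using rate[of s] True by (intro mult_right_mono order_trans[OF rate] mult_right_mono) auto
        also have "\<dots> = \<bar>K\<bar> * s powr (\<beta> + \<eta> - 1)" by (simp add: mult.assoc powr_add[symmetric] algebra_simps)
        finally show ?thesis using True by (simp add: abs_mult)
      next
        case False
        then show ?thesis by (cases "s = 0") auto
      qed
    qed
  qed (use m in simp)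
  have 2: "set_integrable lborel {t0..max t0 u} (\<lambda>s. Y s * s powr (\<beta> - 1))"
    using t0 by (intro borel_integrable_atLeastAtMost' continuous_intros continuous_on_subset[OF Y]) auto
  have "set_integrable lborel ({0..t0} \<union> {t0..max t0 u}) (\<lambda>s. Y s * s powr (\<beta> - 1))"
    by (rule set_integrable_Un[OF 1 2]) auto
  then show ?thesis
    by (rule set_integrable_subset) auto
qed

text \<open>The integral of \<open>s^\<beta>\<close> against \<open>dY\<close> from 0 to
  \<open>u\<close>, after integration by parts. There is no boundary term at 0 because
  \<open>s^\<beta> Y_s\<close> tends to 0 under the growth bounds with which the definition is
  used.\<close>

definition by_parts :: "real \<Rightarrow> (real \<Rightarrow> real) \<Rightarrow> real \<Rightarrow> real" where
  "by_parts \<beta> Y u = u powr \<beta> * Y u - \<beta> * (LINT s:{0..u}|lborel. Y s * s powr (\<beta> - 1))"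

lemma by_parts_props:
  assumes Y: "continuous_on {0..} Y" and t0: "0 < t0"
    and rate: "\<And>s. 0 < s \<Longrightarrow> s \<le> t0 \<Longrightarrow> \<bar>Y s\<bar> \<le> K * s powr \<eta>" and \<eta>: "0 < \<beta> + \<eta>"
  shows "by_parts \<beta> Y 0 = 0" "weighted \<beta> Y (by_parts \<beta> Y)" "continuous_on {0..} (by_parts \<beta> Y)"
    "continuous_on {0..} (\<lambda>u. u powr \<beta> * Y u)"
proof -
  let ?f = "\<lambda>s. Y s * s powr (\<beta> - 1)"
  note int = by_parts_integrable[OF Y t0 rate \<eta>]
  have io: "?f integrable_on {0..u}" and eq: "(LINT s:{0..u}|lborel. ?f s) = integral {0..u} ?f" for u
    using set_borel_integral_eq_integral[OF int[of u]] by auto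
  have bp: "by_parts \<beta> Y u = u powr \<beta> * Y u - \<beta> * integral {0..u} ?f" for u
    unfolding by_parts_def eq ..
  \<comment> \<open>\<open>0 powr \<beta>\<close> is 0 for every exponent, so the boundary term
    vanishes even for negative \<open>\<beta>\<close>.\<close>
  show "by_parts \<beta> Y 0 = 0" unfolding bp by simp
  show "weighted \<beta> Y (by_parts \<beta> Y)"
    unfolding weighted_def
  proof (intro allI impI)
    fix v y :: real assume v: "0 < v \<and> v \<le> y"
    have 1: "integral {0..y} ?f = integral {0..v} ?f + integral {v..y} ?f"
      using v io by (intro Henstock_Kurzweil_Integration.integral_combine[symmetric]) auto
    have c: "?f integrable_on {v..y}"
      by (rule integrable_on_subinterval[OF io[of y]]) (use v in auto)
    have p: "(\<lambda>s. s powr (\<beta> - 1)) integrable_on {v..y}"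
      using v by (intro integrable_continuous_real continuous_intros) auto
    have "integral {v..y} (\<lambda>s. (Y y - Y s) * s powr (\<beta> - 1)) = integral {v..y} (\<lambda>s. Y y * s powr (\<beta> - 1) - ?f s)"
      by (intro integral_cong) (simp add: algebra_simps)
    also have "\<dots> = Y y * integral {v..y} (\<lambda>s. s powr (\<beta> - 1)) - integral {v..y} ?f"
      using p c integrable_on_cmult_left[OF p, of "Y y"] by (subst Henstock_Kurzweil_Integration.integral_diff) auto
    finally have 2: "\<beta> * integral {v..y} (\<lambda>s. (Y y - Y s) * s powr (\<beta> - 1)) =
       Y y * (\<beta> * integral {v..y} (\<lambda>s. s powr (\<beta> - 1))) - \<beta> * integral {v..y} ?f"
      by (simp only: right_diff_distrib mult.left_commute)
    have 3: "\<beta> * integral {v..y} (\<lambda>s. s powr (\<beta> - 1)) = y powr \<beta> - v powr \<beta>"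
      using integral_unique[OF powr_has_integral[of v y \<beta>]] v by simp
    show "by_parts \<beta> Y y - by_parts \<beta> Y v = v powr \<beta> * (Y y - Y v) + \<beta> * integral {v..y} (\<lambda>s. (Y y - Y s) * s powr (\<beta> - 1))"
      unfolding 2 3 bp 1 by (simp add: algebra_simps)
  qed
  have c1: "continuous_on {0..} (\<lambda>u. integral {0..u} ?f)"
    by (rule continuous_on_halfline) (rule indefinite_integral_continuous_1[OF io])
  show c2: "continuous_on {0..} (\<lambda>u. u powr \<beta> * Y u)"
    unfolding continuous_on_eq_continuous_within
  proof
    fix x :: real assume x: "x \<in> {0..}"
    show "continuous (at x within {0..}) (\<lambda>u. u powr \<beta> * Y u)"
    proof (cases "x = 0")
      case False
      then have x0: "0 < x" using x by simp
      have "continuous_on {x/2..x + 1} (\<lambda>u. u powr \<beta> * Y u)"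
        using x0 by (intro continuous_intros continuous_on_subset[OF Y]) auto
      then have "continuous (at x within {x/2..x + 1}) (\<lambda>u. u powr \<beta> * Y u)"
        using x0 by (auto simp: continuous_on_eq_continuous_within)
      moreover have "at x within {0..} = at x within {x/2..x + 1}"
        by (rule at_within_nhd[of _ "{x/2<..<x + 1}"]) (use x0 in auto)
      ultimately show ?thesis by simp
    next
      case True
      \<comment> \<open>Continuity at 0 is the only critical point: there the product is bounded by
        a multiple of the positive power \<open>u^(\<beta> + \<eta>)\<close>.\<close>
      have "((\<lambda>u. u powr \<beta> * Y u) \<longlongrightarrow> 0) (at 0 within {0..})"
      proof (rule Lim_null_comparison)
        have "norm (u powr \<beta> * Y u) \<le> \<bar>K\<bar> * u powr (\<beta> + \<eta>)" if u: "0 < u" "u < t0" for u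
        proof -
          have "\<bar>Y u\<bar> \<le> \<bar>K\<bar> * u powr \<eta>"
            using rate[of u] u by (intro order_trans[OF rate] mult_right_mono) auto
          then have "u powr \<beta> * \<bar>Y u\<bar> \<le> u powr \<beta> * (\<bar>K\<bar> * u powr \<eta>)" by (intro mult_left_mono) auto
          then show ?thesis by (simp add: abs_mult powr_add mult.left_commute)
        qed
        then show "\<forall>\<^sub>F u in at 0 within {0..}. norm (u powr \<beta> * Y u) \<le> \<bar>K\<bar> * u powr (\<beta> + \<eta>)"
          unfolding eventually_at using t0 by (intro exI[of _ t0]) (auto simp: dist_real_def)
        have "((\<lambda>u::real. \<bar>K\<bar> * u powr (\<beta> + \<eta>)) \<longlongrightarrow> \<bar>K\<bar> * 0 powr (\<beta> + \<eta>)) (at 0 within {0..})"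
          using \<eta> by (intro tendsto_intros tendsto_powr') (auto simp: eventually_at_filter)
        then show "((\<lambda>u::real. \<bar>K\<bar> * u powr (\<beta> + \<eta>)) \<longlongrightarrow> 0) (at 0 within {0..})" by simp
      qed
      then show ?thesis using True by (simp add: continuous_within)
    qed
  qed
  have "continuous_on {0..} (\<lambda>u. u powr \<beta> * Y u - \<beta> * integral {0..u} ?f)"
    by (rule continuous_on_diff[OF c2 continuous_on_mult[OF continuous_on_const c1]])
  then show "continuous_on {0..} (by_parts \<beta> Y)" unfolding bp[abs_def] .
qed

text \<open>The relation fixes increments on the open half-line only, so two solutions differ there
  by a constant; continuity at 0 and the common initial value make it zero.\<close>

lemma weighted_unique:
  assumes "weighted \<beta> Y Z" "weighted \<beta> Y Z'" "continuous_on {0..} Z" "continuous_on {0..} Z'" "Z 0 = Z' 0" "0 \<le> t"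
  shows "Z t = Z' t"
proof (cases "t = 0")
  case False
  then have t: "0 < t" using assms by simp
  let ?D = "\<lambda>s. Z s - Z' s"
  have D: "?D s = ?D t" if "0 < s" "s \<le> t" for s
    using weightedD[OF assms(1), of s t] weightedD[OF assms(2), of s t] that by simp
  have "(\<lambda>n. t / real (Suc n)) \<longlonglongrightarrow> 0"
    by (rule LIMSEQ_Suc[OF lim_const_over_n])
  then have "(\<lambda>n. ?D (t / real (Suc n))) \<longlonglongrightarrow> ?D 0"
    using t by (intro continuous_on_tendsto_compose[of "{0..}" ?D] continuous_intros assms) auto
  moreover have const: "(\<lambda>n. ?D (t / real (Suc n))) = (\<lambda>n. ?D t)"
  proof (rule ext, rule D)
    fix n
    show "t / real (Suc n) \<le> t"
      using t mult_left_mono[of 1 "real (Suc n)" t] by (simp add: pos_divide_le_eq del: of_nat_Suc)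
    show "0 < t / real (Suc n)" using t by simp
  qed
  ultimately have "(\<lambda>n::nat. ?D t) \<longlonglongrightarrow> ?D 0" by (simp only:)
  then have "?D t = ?D 0" by (simp only: LIMSEQ_const_iff)
  then show ?thesis using assms by simp
qed (use assms in simp)

text \<open>On the shell below \<open>r n\<close> the weight is comparable to
  \<open>(r n)^\<gamma>\<close> and the mass is at most of order \<open>(r n)^\<kappa>\<close>,
  which leaves a geometric series because \<open>\<gamma> + \<kappa> > 0\<close>. It is used for the
  energy as a measure in time and for the Stieltjes measure of the local time.\<close>

lemma dyadic_moment_finite:
  assumes \<mu>: "sets \<mu> = sets (borel :: real measure)" and t0: "0 < t0" and \<gamma>: "0 < \<gamma> + \<kappa>"
    and bd: "\<And>s. 0 < s \<Longrightarrow> s \<le> t0 \<Longrightarrow> emeasure \<mu> {0<..s} \<le> ennreal (K * s powr \<kappa>)"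
  shows "(\<integral>\<^sup>+s\<in>{0<..t0}. ennreal (s powr \<gamma>) \<partial>\<mu>) < \<infinity>"
proof -
  define r where "r n = t0 * (1/2)^n" for n :: nat
  have r: "0 < r n" "r n \<le> t0" for n using t0 by (auto simp: r_def mult_left_le power_le_one)
  \<comment> \<open>Bounds \<open>s^\<gamma>\<close> for \<open>r n / 2 < s \<le> r n\<close>; the
    factor with the absolute value of \<open>\<gamma>\<close> covers both signs.\<close>
  define c where "c n = 2 powr \<bar>\<gamma>\<bar> * r n powr \<gamma>" for n
  have c0: "0 \<le> c n" for n by (simp add: c_def)
  have [measurable_cong]: "sets \<mu> = sets borel" by (rule \<mu>)
  have pt: "ennreal (s powr \<gamma>) * indicator {0<..t0} s \<le> (\<Sum>n. ennreal (c n) * indicator {0<..r n} s)" for s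
  proof (cases "0 < s \<and> s \<le> t0")
    case True
    then have s: "0 < s" "s \<le> t0" by auto
    have "\<exists>n. (1/2)^n < s / t0" using real_arch_pow_inv[of "s / t0" "1/2"] s t0 by auto
    then have ex: "\<exists>n. r n < s" using t0 by (auto simp: r_def field_simps)
    define n where "n = (LEAST n. r n < s)"
    have n: "r n < s" unfolding n_def by (rule LeastI_ex[OF ex])
    have "n \<noteq> 0"
    proof
      assume "n = 0" then show False using n s by (simp add: r_def)
    qed
    then obtain k where k: "n = Suc k" by (cases n) auto
    have "\<not> r k < s" using not_less_Least[of k "\<lambda>n. r n < s"] k unfolding n_def[symmetric] by simp
    then have sk: "s \<le> r k" "r k / 2 < s" using n k by (auto simp: r_def)
    have "s powr \<gamma> \<le> c k"
    proof (cases "0 \<le> \<gamma>")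
      case True
      then have "s powr \<gamma> \<le> r k powr \<gamma>" using sk s by (intro powr_mono2) auto
      also have "\<dots> \<le> c k" unfolding c_def using True ge_one_powr_ge_zero[of 2 "\<bar>\<gamma>\<bar>"] by (simp add: mult_le_cancel_right1)
      finally show ?thesis .
    next
      case False
      then have "s powr \<gamma> \<le> (r k / 2) powr \<gamma>" using sk r[of k] by (intro powr_mono2') auto
      also have "\<dots> = r k powr \<gamma> / 2 powr \<gamma>" by (rule powr_divide)
      also have "\<dots> = 2 powr (- \<gamma>) * r k powr \<gamma>" by (simp add: powr_minus divide_inverse)
      also have "\<dots> = c k" using False by (simp add: c_def)
      finally show ?thesis .
    qed
    then have "ennreal (s powr \<gamma>) \<le> ennreal (c k) * indicator {0<..r k} s" using sk s by (simp add: ennreal_leI)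
    also have "\<dots> \<le> (\<Sum>n. ennreal (c n) * indicator {0<..r n} s)"
      using sum_le_suminf[of "\<lambda>n. ennreal (c n) * indicator {0<..r n} s" "{k}"]
      by (simp only: summableI finite.intros sum.insert sum.empty empty_iff not_False_eq_True add_0_right zero_le)
    finally show ?thesis using True by simp
  qed auto
  have "(\<integral>\<^sup>+s\<in>{0<..t0}. ennreal (s powr \<gamma>) \<partial>\<mu>) \<le> (\<integral>\<^sup>+s. (\<Sum>n. ennreal (c n) * indicator {0<..r n} s) \<partial>\<mu>)"
    by (intro nn_integral_mono pt)
  also have "\<dots> = (\<Sum>n. \<integral>\<^sup>+s. ennreal (c n) * indicator {0<..r n} s \<partial>\<mu>)"
    by (intro nn_integral_suminf) measurable
  also have "\<dots> = (\<Sum>n. ennreal (c n) * emeasure \<mu> {0<..r n})"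
    by (simp add: nn_integral_cmult_indicator \<mu>)
  also have "\<dots> \<le> (\<Sum>n. ennreal (c n * (\<bar>K\<bar> * r n powr \<kappa>)))"
  proof (intro suminf_le allI)
    fix n
    have "emeasure \<mu> {0<..r n} \<le> ennreal (\<bar>K\<bar> * r n powr \<kappa>)"
      by (rule order_trans[OF bd[OF r]]) (intro ennreal_leI mult_right_mono, auto)
    then show "ennreal (c n) * emeasure \<mu> {0<..r n} \<le> ennreal (c n * (\<bar>K\<bar> * r n powr \<kappa>))"
      using c0[of n] by (subst ennreal_mult) (auto intro: mult_left_mono)
  qed auto
  also have "\<dots> < \<infinity>"
  proof -
    have "c n * (\<bar>K\<bar> * r n powr \<kappa>) = (2 powr \<bar>\<gamma>\<bar> * \<bar>K\<bar> * t0 powr (\<gamma> + \<kappa>)) * ((1/2)^n) powr (\<gamma> + \<kappa>)" for n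
    proof -
      have "c n * (\<bar>K\<bar> * r n powr \<kappa>) = 2 powr \<bar>\<gamma>\<bar> * \<bar>K\<bar> * (r n powr \<gamma> * r n powr \<kappa>)" by (simp add: c_def)
      also have "r n powr \<gamma> * r n powr \<kappa> = r n powr (\<gamma> + \<kappa>)" by (simp add: powr_add)
      also have "\<dots> = t0 powr (\<gamma> + \<kappa>) * ((1/2)^n) powr (\<gamma> + \<kappa>)" using t0 by (simp add: r_def powr_mult)
      finally show ?thesis by simp
    qed
    moreover have "summable (\<lambda>n. (2 powr \<bar>\<gamma>\<bar> * \<bar>K\<bar> * t0 powr (\<gamma> + \<kappa>)) * ((1/2)^n) powr (\<gamma> + \<kappa>))"
    proof -
      have "(1/2) powr (\<gamma> + \<kappa>) < (1 :: real)" using powr_less_mono2[of "\<gamma> + \<kappa>" "1/2" 1] \<gamma> by simp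
      then have "summable (\<lambda>n. (2 powr \<bar>\<gamma>\<bar> * \<bar>K\<bar> * t0 powr (\<gamma> + \<kappa>)) * ((1/2) powr (\<gamma> + \<kappa>))^n)"
        by (intro summable_mult summable_geometric) auto
      moreover have "((1/2)^n) powr (\<gamma> + \<kappa>) = ((1/2) powr (\<gamma> + \<kappa>))^n" for n :: nat
        by (simp add: powr_realpow[symmetric] powr_powr powr_power mult.commute)
      ultimately show ?thesis by simp
    qed
    ultimately have "summable (\<lambda>n. c n * (\<bar>K\<bar> * r n powr \<kappa>))" by (simp only:)
    then show ?thesis
      by (subst suminf_ennreal2) (auto simp: c0)
  qed
  finally show ?thesis .
qed

subsection \<open>Power weights and change of integrator\<close>

lemma rational_near:
  fixes x :: real
  assumes "x \<in> {0..N}" "0 < r"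
  obtains q where "q \<in> {0..N} \<inter> \<rat>" "\<bar>q - x\<bar> < r"
proof -
  have "continuous_on {0..N} (\<lambda>s. - \<bar>s - x\<bar>)" by (intro continuous_intros)
  moreover have "\<exists>s\<in>{0..N}. - r < - \<bar>s - x\<bar>" using assms by (intro bexI[of _ x]) auto
  ultimately obtain q where "q \<in> {0..N} \<inter> \<rat>" "- r < - \<bar>q - x\<bar>"
    using ex_less_iff_rational[of N "\<lambda>s. - \<bar>s - x\<bar>" "- r"] assms(1) by auto
  then show ?thesis using that by auto
qed

lemma sets_Collect_Ball_countable:
  assumes "countable X" "\<And>x. x \<in> X \<Longrightarrow> {w\<in>space M. P x w} \<in> sets M"
  shows "{w\<in>space M. \<forall>x\<in>X. P x w} \<in> sets M"
proof -
  have "{w\<in>space M. \<forall>x\<in>X. P x w} = space M - (\<Union>x\<in>X. space M - {w\<in>space M. P x w})" by auto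
  also have "\<dots> \<in> sets M" using assms by (intro sets.Diff sets.countable_UN' sets.top) auto
  finally show ?thesis .
qed

lemma grid_step_value:
  assumes "a \<le> b" "0 < m"
  defines "v \<equiv> grid_point a b m"
  shows "a < s \<Longrightarrow> s \<le> b \<Longrightarrow> \<exists>i<m. v i < s \<and> s \<le> v (Suc i) \<and> (\<Sum>i<m. \<psi> i * indicator {v i<..v (Suc i)} s) = (\<psi> i :: real)"
    and "\<not> (a < s \<and> s \<le> b) \<Longrightarrow> (\<Sum>i<m. \<psi> i * indicator {v i<..v (Suc i)} s) = (0 :: real)"
proof -
  note gp = grid_point_props[OF assms(1,2), folded v_def]
  show "\<exists>i<m. v i < s \<and> s \<le> v (Suc i) \<and> (\<Sum>i<m. \<psi> i * indicator {v i<..v (Suc i)} s) = \<psi> i" if s: "a < s" "s \<le> b"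
  proof -
    have ex: "s \<le> v m" using s gp(2) by simp
    define k where "k = (LEAST k. s \<le> v k)"
    have k: "s \<le> v k" unfolding k_def by (rule LeastI[of "\<lambda>k. s \<le> v k", OF ex])
    have km: "k \<le> m" unfolding k_def by (rule Least_le[of "\<lambda>k. s \<le> v k", OF ex])
    have "k \<noteq> 0"
    proof
      assume "k = 0" then show False using k s gp(1) by simp
    qed
    then obtain i where i: "k = Suc i" by (cases k) auto
    have "v i < s" using not_less_Least[of i "\<lambda>k. s \<le> v k"] i unfolding k_def[symmetric] by simp
    have "(\<Sum>j<m. \<psi> j * indicator {v j<..v (Suc j)} s) = (\<Sum>j\<in>{i}. \<psi> j * indicator {v j<..v (Suc j)} s)"
    proof (rule sum.mono_neutral_right)
      show "\<forall>j\<in>{..<m} - {i}. \<psi> j * indicator {v j<..v (Suc j)} s = 0"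
      proof
        fix j assume j: "j \<in> {..<m} - {i}"
        then consider "j < i" | "i < j" by fastforce
        then have "s \<notin> {v j<..v (Suc j)}"
        proof cases
          case 1 then show ?thesis using gp(7)[of "Suc j" i] \<open>v i < s\<close> by auto
        next
          case 2 then show ?thesis using gp(7)[of "Suc i" j] k i by auto
        qed
        then show "\<psi> j * indicator {v j<..v (Suc j)} s = 0" by simp
      qed
    qed (use i km in auto)
    also have "\<dots> = \<psi> i" using \<open>v i < s\<close> k i by simp
    finally show ?thesis using \<open>v i < s\<close> k i km by (intro exI[of _ i]) auto
  qed
  show "(\<Sum>i<m. \<psi> i * indicator {v i<..v (Suc i)} s) = 0" if s: "\<not> (a < s \<and> s \<le> b)"
  proof (rule sum.neutral, rule ballI)
    fix i assume "i \<in> {..<m}"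
    then have "a \<le> v i" "v (Suc i) \<le> b" using gp(5)[of i] gp(6)[of "Suc i"] by auto
    then have "s \<notin> {v i<..v (Suc i)}" using s by auto
    then show "\<psi> i * indicator {v i<..v (Suc i)} s = 0" by simp
  qed
qed

section \<open>Uniform control of continuous paths off a small event\<close>

context filtered_space begin

text \<open>Every path has a modulus of continuity of its own, so one deterministic \<open>h\<close>
  works off a small event. The defining property is tested on rational times first, for the sake of
  measurability.\<close>

lemma modulus_likely:
  fixes Y :: "real \<Rightarrow> 'a \<Rightarrow> real"
  assumes m: "\<And>u. 0 \<le> u \<Longrightarrow> Y u \<in> borel_measurable M"
    and cont: "\<And>w. w \<in> space M \<Longrightarrow> continuous_on {0..} (\<lambda>t. Y t w)" and \<delta>: "0 < \<delta>" and e: "0 < e"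
  obtains h where "0 < h" "likely e (\<lambda>w. \<forall>x y. 0 \<le> x \<and> x \<le> N \<and> 0 \<le> y \<and> y \<le> N \<and> \<bar>y - x\<bar> < h \<longrightarrow> \<bar>Y y w - Y x w\<bar> \<le> \<delta>)"
proof -
  define Q where "Q n w \<longleftrightarrow> (\<forall>x\<in>{0..N} \<inter> \<rat>. \<forall>y\<in>{0..N} \<inter> \<rat>. \<bar>y - x\<bar> < inverse (real (Suc n)) \<longrightarrow> \<bar>Y y w - Y x w\<bar> \<le> \<delta>)" for n w
  have cnt: "countable ({0..N} \<inter> \<rat>)" using countable_rat by (rule countable_subset[rotated]) auto
  have "{w\<in>space M. Q n w} \<in> sets M" for n
  proof -
    let ?R = "{0..N} \<inter> \<rat>"
    have 1: "{w\<in>space M. \<bar>y - x\<bar> < inverse (real (Suc n)) \<longrightarrow> \<bar>Y y w - Y x w\<bar> \<le> \<delta>} \<in> sets M"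
      if xy: "x \<in> ?R" "y \<in> ?R" for x y
    proof -
      have [measurable]: "Y x \<in> borel_measurable M" "Y y \<in> borel_measurable M" using m xy by auto
      show ?thesis by measurable
    qed
    have 2: "{w\<in>space M. \<forall>y\<in>?R. \<bar>y - x\<bar> < inverse (real (Suc n)) \<longrightarrow> \<bar>Y y w - Y x w\<bar> \<le> \<delta>} \<in> sets M"
      if "x \<in> ?R" for x
      by (rule sets_Collect_Ball_countable[OF cnt 1[OF that]])
    show ?thesis unfolding Q_def by (rule sets_Collect_Ball_countable[OF cnt 2])
  qed
  then have mQ: "{w\<in>space M. \<not> Q n w} \<in> sets M" for n by (rule sets.sets_Collect_neg)
  have ev: "AE w in M. \<forall>\<^sub>F n in sequentially. Q n w"
  proof (rule AE_I2)
    fix w assume w: "w \<in> space M"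
    have c: "continuous_on {0..N} (\<lambda>t. Y t w)" by (rule continuous_on_subset[OF cont[OF w]]) auto
    obtain h where h: "0 < h" "\<And>x y. 0 \<le> x \<Longrightarrow> x \<le> N \<Longrightarrow> 0 \<le> y \<Longrightarrow> y \<le> N \<Longrightarrow> \<bar>y - x\<bar> < h \<Longrightarrow> \<bar>Y y w - Y x w\<bar> < \<delta>"
      by (rule uniform_modulus[OF c \<delta>]) (assumption | rule that)+
    have "\<forall>\<^sub>F n in sequentially. inverse (real (Suc n)) < h"
      by (rule order_tendstoD(2)[OF LIMSEQ_inverse_real_of_nat h(1)])
    then show "\<forall>\<^sub>F n in sequentially. Q n w"
    proof eventually_elim
      case (elim n)
      then show ?case unfolding Q_def using h(2) by (auto intro!: less_imp_le)
    qed
  qed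
  obtain n where n: "likely e (Q n)"
    using likely_eventually[OF mQ ev e] by (auto simp: eventually_sequentially)
  show ?thesis
  proof (rule that[of "inverse (real (Suc n))"])
    show "0 < inverse (real (Suc n))" by simp
    show "likely e (\<lambda>w. \<forall>x y. 0 \<le> x \<and> x \<le> N \<and> 0 \<le> y \<and> y \<le> N \<and> \<bar>y - x\<bar> < inverse (real (Suc n)) \<longrightarrow> \<bar>Y y w - Y x w\<bar> \<le> \<delta>)"
    proof (rule likely_mono[OF n order_refl], intro allI impI)
      fix w x y assume w: "w \<in> space M" "Q n w"
        and xy: "0 \<le> x \<and> x \<le> N \<and> 0 \<le> y \<and> y \<le> N \<and> \<bar>y - x\<bar> < inverse (real (Suc n))"
      show "\<bar>Y y w - Y x w\<bar> \<le> \<delta>"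
      proof (rule field_le_epsilon)
        fix \<epsilon> :: real assume \<epsilon>: "0 < \<epsilon>"
        have c: "continuous_on {0..N} (\<lambda>t. Y t w)" by (rule continuous_on_subset[OF cont[OF w(1)]]) auto
        obtain h where h: "0 < h" "\<And>x y. 0 \<le> x \<Longrightarrow> x \<le> N \<Longrightarrow> 0 \<le> y \<Longrightarrow> y \<le> N \<Longrightarrow> \<bar>y - x\<bar> < h \<Longrightarrow> \<bar>Y y w - Y x w\<bar> < \<epsilon> / 2"
          by (rule uniform_modulus[OF c half_gt_zero[OF \<epsilon>]]) (assumption | rule that)+
        \<comment> \<open>Rational neighbours within \<open>r\<close> remain closer than
          \<open>1/(n+1)\<close> to each other, and the path moves by less than
          \<open>\<epsilon> / 2\<close> at either end.\<close>
        define r where "r = min h ((inverse (real (Suc n)) - \<bar>y - x\<bar>) / 2)"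
        have r: "0 < r" "r \<le> h" "2 * r \<le> inverse (real (Suc n)) - \<bar>y - x\<bar>"
          using h(1) xy by (auto simp: r_def min_def)
        obtain x' where x': "x' \<in> {0..N} \<inter> \<rat>" "\<bar>x' - x\<bar> < r" by (rule rational_near[of x N r]) (use xy r in auto)
        obtain y' where y': "y' \<in> {0..N} \<inter> \<rat>" "\<bar>y' - y\<bar> < r" by (rule rational_near[of y N r]) (use xy r in auto)
        have "\<bar>y' - x'\<bar> < inverse (real (Suc n))" using x' y' r by linarith
        then have "\<bar>Y y' w - Y x' w\<bar> \<le> \<delta>" using w(2) x' y' unfolding Q_def by blast
        moreover have "\<bar>Y x' w - Y x w\<bar> < \<epsilon> / 2" using x' xy r by (intro h(2)) auto
        moreover have "\<bar>Y y' w - Y y w\<bar> < \<epsilon> / 2" using y' xy r by (intro h(2)) auto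
        ultimately show "\<bar>Y y w - Y x w\<bar> \<le> \<delta> + \<epsilon>" by linarith
      qed
    qed
  qed
qed

lemma small_initially:
  fixes Y :: "real \<Rightarrow> 'a \<Rightarrow> real"
  assumes m: "\<And>u. 0 \<le> u \<Longrightarrow> Y u \<in> borel_measurable M"
    and cont: "\<And>w. w \<in> space M \<Longrightarrow> continuous_on {0..} (\<lambda>t. Y t w)"
    and zero: "AE w in M. Y 0 w = 0" and \<delta>: "0 < \<delta>" and e: "0 < e"
  obtains a where "0 < a" "a \<le> 1" "likely e (\<lambda>w. \<forall>s\<in>{0..a}. \<bar>Y s w\<bar> \<le> \<delta>)"
proof -
  obtain h where h: "0 < h" "likely (e/2) (\<lambda>w. \<forall>x y. 0 \<le> x \<and> x \<le> 1 \<and> 0 \<le> y \<and> y \<le> 1 \<and> \<bar>y - x\<bar> < h \<longrightarrow> \<bar>Y y w - Y x w\<bar> \<le> \<delta>)"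
    by (rule modulus_likely[OF m cont \<delta> half_gt_zero[OF e], of 1]) (assumption | rule that)+
  define a where "a = min 1 (h/2)"
  have a: "0 < a" "a \<le> 1" "a < h" using h(1) by (auto simp: a_def)
  have "likely (e/2 + e/2) (\<lambda>w. (\<forall>x y. 0 \<le> x \<and> x \<le> 1 \<and> 0 \<le> y \<and> y \<le> 1 \<and> \<bar>y - x\<bar> < h \<longrightarrow> \<bar>Y y w - Y x w\<bar> \<le> \<delta>) \<and> Y 0 w = 0)"
    by (intro likely_conj h(2) likely_AE zero half_gt_zero e)
  then have "likely e (\<lambda>w. \<forall>s\<in>{0..a}. \<bar>Y s w\<bar> \<le> \<delta>)"
  proof (rule likely_mono)
    fix w assume A: "(\<forall>x y. 0 \<le> x \<and> x \<le> 1 \<and> 0 \<le> y \<and> y \<le> 1 \<and> \<bar>y - x\<bar> < h \<longrightarrow> \<bar>Y y w - Y x w\<bar> \<le> \<delta>) \<and> Y 0 w = 0"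
    show "\<forall>s\<in>{0..a}. \<bar>Y s w\<bar> \<le> \<delta>"
    proof
      fix s assume "s \<in> {0..a}"
      then show "\<bar>Y s w\<bar> \<le> \<delta>" using conjunct1[OF A, rule_format, of 0 s] conjunct2[OF A] a by simp
    qed
  qed simp
  then show ?thesis using that a by blast
qed

lemma bounded_likely:
  fixes Y :: "'a \<Rightarrow> real"
  assumes Y: "Y \<in> borel_measurable M" and e: "0 < e"
  obtains \<Lambda> where "0 < \<Lambda>" "likely e (\<lambda>w. Y w \<le> \<Lambda>)"
proof -
  have "\<forall>\<^sub>F n in sequentially. likely e (\<lambda>w. Y w \<le> real (Suc n))"
  proof (rule likely_eventually[OF _ _ e])
    show "{w\<in>space M. \<not> Y w \<le> real (Suc n)} \<in> sets M" for n using Y by measurable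
    show "AE w in M. \<forall>\<^sub>F n in sequentially. Y w \<le> real (Suc n)"
    proof (rule AE_I2)
      fix w show "\<forall>\<^sub>F n in sequentially. Y w \<le> real (Suc n)"
        using eventually_ge_at_top[of "nat \<lceil>Y w\<rceil>"] by eventually_elim linarith
    qed
  qed
  then obtain n where "likely e (\<lambda>w. Y w \<le> real (Suc n))" by (auto simp: eventually_sequentially)
  then show ?thesis by (intro that[of "real (Suc n)"]) auto
qed

lemma simple_process_bounded:
  assumes "simple_integrand M F S"
  obtains C where "0 \<le> C" "\<And>s w. w \<in> space M \<Longrightarrow> \<bar>simple_process S s w\<bar> \<le> C"
proof -
  obtain n \<tau> \<xi> where S: "S = (n, \<tau>, \<xi>)" by (cases S) auto
  have "\<forall>i. \<exists>C. i < n \<longrightarrow> (\<forall>w\<in>space M. \<bar>\<xi> i w\<bar> \<le> C)" using assms by (auto simp: S)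
  then obtain C where C: "\<And>i w. i < n \<Longrightarrow> w \<in> space M \<Longrightarrow> \<bar>\<xi> i w\<bar> \<le> C i" by metis
  have "\<bar>simple_process S s w\<bar> \<le> (\<Sum>i<n. \<bar>C i\<bar>)" if "w \<in> space M" for s w
    unfolding S simple_process.simps
  proof (rule order_trans[OF sum_abs], rule sum_mono)
    fix i assume "i \<in> {..<n}"
    then show "\<bar>\<xi> i w * indicator {\<tau> i<..\<tau> (Suc i)} s\<bar> \<le> \<bar>C i\<bar>"
      using C[of i w] that by (auto split: split_indicator)
  qed
  then show ?thesis using that[of "\<Sum>i<n. \<bar>C i\<bar>"] by (auto intro: sum_nonneg)
qed

lemma simple_integral_0:
  assumes "simple_integrand M F S"
  shows "simple_integral X S 0 w = 0"
proof -
  obtain n \<tau> \<xi> where Sd: "S = (n, \<tau>, \<xi>)" by (cases S) auto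
  show ?thesis using simple_partition_nonneg[OF assms[unfolded Sd]] by (auto simp: Sd min_absorb1 intro!: sum.neutral)
qed

text \<open>Along one path the coefficients are constants, so a simple integral is a linear
  combination of stopped paths. This is associativity of integration in the elementary case, path by
  path.\<close>

lemma simple_integral_weighted:
  assumes S: "simple_integrand M F S" and wtd: "weighted \<beta> (\<lambda>t. X t w) (\<lambda>t. W t w)"
    and X: "continuous_on {0..} (\<lambda>t. X t w)"
  shows "weighted \<beta> (\<lambda>t. simple_integral X S t w) (\<lambda>t. simple_integral W S t w)"
proof -
  obtain n \<tau> \<xi> where Sd: "S = (n, \<tau>, \<xi>)" by (cases S) auto
  note S' = S[unfolded Sd]
  have st: "weighted \<beta> (\<lambda>t. X (min t (\<tau> i)) w) (\<lambda>t. W (min t (\<tau> i)) w)"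
    and ct: "continuous_on {0..} (\<lambda>t. X (min t (\<tau> i)) w)" if "i \<le> n" for i
  proof -
    have \<tau>: "0 \<le> \<tau> i" by (rule simple_partition_nonneg[OF S' that])
    show "weighted \<beta> (\<lambda>t. X (min t (\<tau> i)) w) (\<lambda>t. W (min t (\<tau> i)) w)"
      by (rule weighted_stop[OF wtd X \<tau>])
    show "continuous_on {0..} (\<lambda>t. X (min t (\<tau> i)) w)"
      using \<tau> by (intro continuous_on_compose2[OF X] continuous_intros) auto
  qed
  have "weighted \<beta> (\<lambda>t. \<Sum>i<n. \<xi> i w * (1 * X (min t (\<tau> (Suc i))) w + (-1) * X (min t (\<tau> i)) w))
     (\<lambda>t. \<Sum>i<n. \<xi> i w * (1 * W (min t (\<tau> (Suc i))) w + (-1) * W (min t (\<tau> i)) w))"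
  proof (rule weighted_sum)
    fix i assume "i < n"
    then show "weighted \<beta> (\<lambda>t. 1 * X (min t (\<tau> (Suc i))) w + (-1) * X (min t (\<tau> i)) w)
       (\<lambda>t. 1 * W (min t (\<tau> (Suc i))) w + (-1) * W (min t (\<tau> i)) w)"
      by (intro weighted_lincomb st ct) auto
    show "continuous_on {0..} (\<lambda>t. 1 * X (min t (\<tau> (Suc i))) w + (-1) * X (min t (\<tau> i)) w)"
      using \<open>i < n\<close> by (intro continuous_on_add continuous_on_mult continuous_on_const ct) auto
  qed
  then show ?thesis by (simp add: Sd)
qed

end

lemma set_nn_integral_add_le:
  fixes f g h :: "real \<Rightarrow> ennreal"
  assumes "\<And>s. s \<in> J \<Longrightarrow> k s \<le> f s * indicator J1 s + g s * indicator J2 s + h s * indicator J3 s"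
    and "f \<in> borel_measurable borel" "g \<in> borel_measurable borel" "h \<in> borel_measurable borel"
    and "J1 \<in> sets borel" "J2 \<in> sets borel" "J3 \<in> sets borel"
  shows "(\<integral>\<^sup>+s\<in>J. k s \<partial>lborel) \<le> (\<integral>\<^sup>+s\<in>J1. f s \<partial>lborel) + (\<integral>\<^sup>+s\<in>J2. g s \<partial>lborel) + (\<integral>\<^sup>+s\<in>J3. h s \<partial>lborel)"
proof -
  have "(\<integral>\<^sup>+s\<in>J. k s \<partial>lborel) \<le> (\<integral>\<^sup>+s. (f s * indicator J1 s + g s * indicator J2 s) + h s * indicator J3 s \<partial>lborel)"
    using assms(1) by (intro nn_integral_mono) (auto split: split_indicator)
  also have "\<dots> = (\<integral>\<^sup>+s\<in>J1. f s \<partial>lborel) + (\<integral>\<^sup>+s\<in>J2. g s \<partial>lborel) + (\<integral>\<^sup>+s\<in>J3. h s \<partial>lborel)"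
    using assms(2-) by (simp add: nn_integral_add)
  finally show ?thesis .
qed

lemma square_product_le:
  "(x * v - r * y)\<^sup>2 \<le> 2 * (v\<^sup>2 * (x - y)\<^sup>2) + 2 * ((v - r)\<^sup>2 * y\<^sup>2)" for x y v r :: real
proof -
  have "x * v - r * y = v * (x - y) + (v - r) * y" by (simp add: algebra_simps)
  moreover have "(v * (x - y) + (v - r) * y)\<^sup>2 \<le> 2 * (v * (x - y))\<^sup>2 + 2 * ((v - r) * y)\<^sup>2"
    using square_le_2[of "v * (x - y) + (v - r) * y" "(v - r) * y"] by simp
  ultimately show ?thesis by (simp add: power_mult_distrib)
qed

lemma small_factor: "0 \<le> x \<Longrightarrow> 0 < e \<Longrightarrow> x * (e / (x + 1)) \<le> (e :: real)"
  by (simp add: field_simps)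

context ito_space begin

section \<open>Power weights on a given stochastic integral\<close>

context
  fixes C \<theta> \<beta> :: real
  assumes small: "small_at_0 C \<theta>" and \<beta>: "- \<theta> < \<beta>"
begin

text \<open>The midpoint between the larger of 0 and \<open>-\<beta>\<close> and the critical
  exponent \<open>\<theta>\<close>: small enough to hold almost surely as a growth rate, large
  enough to compensate the weight.\<close>

definition rate :: real where "rate = (max 0 (- \<beta>) + \<theta>) / 2"

lemma rate: "0 \<le> rate" "rate < \<theta>" "0 < \<beta> + rate"
proof -
  have "0 < \<theta>" using small by (simp add: small_at_0_def)
  then show "0 \<le> rate" "rate < \<theta>" "0 < \<beta> + rate" using \<beta> by (auto simp: rate_def max_def field_simps)
qed

text \<open>Up to the time for which the rate holds, the dyadic estimate is applied with exponents
  \<open>2 * \<beta>\<close> and \<open>2 * rate\<close>; later the weight is bounded and the energy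
  of \<open>H\<close> finite.\<close>

lemma powr_square_integrable:
  "AE w in M. \<forall>t\<ge>0. set_integrable lborel {0..t} (\<lambda>s. (s powr \<beta> * H s w)\<^sup>2)"
  using energy_rate[OF small rate(1,2)] A_eq AE_space
proof eventually_elim
  case (elim w)
  obtain K t0 where K: "0 < t0" "\<And>s. 0 < s \<Longrightarrow> s \<le> t0 \<Longrightarrow> \<bar>A s w\<bar> \<le> K * s powr (2 * rate)"
    using elim(1) by blast
  show ?case
  proof (intro allI impI)
    fix t :: real assume t: "0 \<le> t"
    define N where "N = max t t0"
    have N: "0 \<le> N" "t \<le> N" "t0 \<le> N" using t by (auto simp: N_def)
    let ?H = "\<lambda>s. indicator {0..N} s * H s w"
    have [measurable]: "?H \<in> borel_measurable borel" by (rule H_path_measurable[OF elim(3) N(1)])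
    have meas: "(\<lambda>s. (s powr \<beta> * ?H s)\<^sup>2) \<in> borel_measurable borel" by measurable
    \<comment> \<open>The energy of \<open>H\<close> as a measure in time: it gives the interval
      from 0 to \<open>s\<close> the mass \<open>A s\<close>.\<close>
    define \<mu> where "\<mu> = density lborel (\<lambda>s. ennreal ((?H s)\<^sup>2))"
    have s\<mu>: "sets \<mu> = sets borel" by (simp add: \<mu>_def)
    have bd: "emeasure \<mu> {0<..s} \<le> ennreal (K * s powr (2 * rate))" if s: "0 < s" "s \<le> t0" for s
    proof -
      have "emeasure \<mu> {0<..s} = (\<integral>\<^sup>+x. ennreal ((?H x)\<^sup>2) * indicator {0<..s} x \<partial>lborel)"
        unfolding \<mu>_def by (rule emeasure_density) auto
      also have "\<dots> \<le> (sq_int {0..s} (\<lambda>x. H x w))"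
        by (intro nn_integral_mono) (auto split: split_indicator)
      also have "\<dots> = ennreal (A s w)" using elim(2) s by simp
      also have "\<dots> \<le> ennreal (K * s powr (2 * rate))" using K(2)[OF s] by (intro ennreal_leI) simp
      finally show ?thesis .
    qed
    have "0 < 2 * \<beta> + 2 * rate" using rate(3) by simp
    from dyadic_moment_finite[OF s\<mu> K(1) this bd]
    have "(\<integral>\<^sup>+s\<in>{0<..t0}. ennreal (s powr (2 * \<beta>)) \<partial>\<mu>) < \<infinity>" .
    also have "(\<integral>\<^sup>+s\<in>{0<..t0}. ennreal (s powr (2 * \<beta>)) \<partial>\<mu>) = (\<integral>\<^sup>+s. ennreal ((?H s)\<^sup>2) * (ennreal (s powr (2 * \<beta>)) * indicator {0<..t0} s) \<partial>lborel)"
      unfolding \<mu>_def by (rule nn_integral_density) auto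
    finally have fin: "(\<integral>\<^sup>+s. ennreal ((?H s)\<^sup>2) * (ennreal (s powr (2 * \<beta>)) * indicator {0<..t0} s) \<partial>lborel) < \<infinity>" .
    obtain D where D: "0 < D" "\<And>s. t0 \<le> s \<Longrightarrow> s \<le> N \<Longrightarrow> s powr (2 * \<beta>) \<le> D"
      by (rule powr_bounded_on[OF K(1)]) (assumption | rule that)+
    have sq: "(s powr \<beta>)\<^sup>2 = s powr (2 * \<beta>)" for s :: real
      by (simp add: power2_eq_square powr_add[symmetric])
    have "(\<integral>\<^sup>+s. ennreal ((s powr \<beta> * ?H s)\<^sup>2) \<partial>lborel) \<le>
      (\<integral>\<^sup>+s. ennreal ((?H s)\<^sup>2) * (ennreal (s powr (2 * \<beta>)) * indicator {0<..t0} s) + ennreal D * (ennreal ((?H s)\<^sup>2) * indicator {0..N} s) \<partial>lborel)"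
    proof (rule nn_integral_mono)
      fix s :: real
      consider "0 < s" "s \<le> t0" | "t0 < s" "s \<le> N" | "s \<le> 0" | "N < s" by linarith
      then show "ennreal ((s powr \<beta> * ?H s)\<^sup>2) \<le> ennreal ((?H s)\<^sup>2) * (ennreal (s powr (2 * \<beta>)) * indicator {0<..t0} s) + ennreal D * (ennreal ((?H s)\<^sup>2) * indicator {0..N} s)"
      proof cases
        case 1
        then have "ennreal ((s powr \<beta> * ?H s)\<^sup>2) = ennreal ((?H s)\<^sup>2) * ennreal (s powr (2 * \<beta>))"
          by (simp add: power_mult_distrib sq ennreal_mult[symmetric] mult.commute)
        then show ?thesis using 1 by simp
      next
        case 2
        then have "(s powr \<beta> * ?H s)\<^sup>2 \<le> D * (?H s)\<^sup>2"
          using D(2)[of s] by (simp add: power_mult_distrib sq mult_right_mono)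
        then have "ennreal ((s powr \<beta> * ?H s)\<^sup>2) \<le> ennreal D * ennreal ((?H s)\<^sup>2)"
          using D(1) by (simp add: ennreal_mult[symmetric] ennreal_leI)
        then show ?thesis using 2 K(1) by simp
      next
        case 3
        then show ?thesis by (cases "s = 0") auto
      qed auto
    qed
    also have "\<dots> = (\<integral>\<^sup>+s. ennreal ((?H s)\<^sup>2) * (ennreal (s powr (2 * \<beta>)) * indicator {0<..t0} s) \<partial>lborel) + ennreal D * (\<integral>\<^sup>+s. ennreal ((?H s)\<^sup>2) * indicator {0..N} s \<partial>lborel)"
      by (subst nn_integral_add) (auto simp: nn_integral_cmult)
    also have "(\<integral>\<^sup>+s. ennreal ((?H s)\<^sup>2) * indicator {0..N} s \<partial>lborel) = (sq_int {0..N} (\<lambda>s. H s w))"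
      by (intro nn_integral_cong) (auto split: split_indicator)
    also have "\<dots> = ennreal (A N w)" using elim(2) N by simp
    finally have "(\<integral>\<^sup>+s. ennreal ((s powr \<beta> * ?H s)\<^sup>2) \<partial>lborel) < \<infinity>"
      using fin by (auto simp: ennreal_mult_less_top intro: order_le_less_trans)
    then have "integrable lborel (\<lambda>s. (s powr \<beta> * ?H s)\<^sup>2)"
      using meas by (intro integrableI_nonneg) auto
    then have "integrable lborel (\<lambda>s. indicator {0..t} s *\<^sub>R (s powr \<beta> * ?H s)\<^sup>2)"
      by (intro integrable_mult_indicator) auto
    also have "(\<lambda>s. indicator {0..t} s *\<^sub>R (s powr \<beta> * ?H s)\<^sup>2) = (\<lambda>s. indicator {0..t} s *\<^sub>R (s powr \<beta> * H s w)\<^sup>2)"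
      using N by (auto split: split_indicator)
    finally show "set_integrable lborel {0..t} (\<lambda>s. (s powr \<beta> * H s w)\<^sup>2)" by (simp add: set_integrable_def)
  qed
qed

lemma powr_progressive: "progressive F (\<lambda>s w. s powr \<beta> * H s w)"
  unfolding progressive_def
proof (intro allI impI)
  fix t :: real assume "0 \<le> t"
  then have 1: "(\<lambda>(s, w). H s w) \<in> borel_measurable (restrict_space borel {0..t} \<Otimes>\<^sub>M F t)"
    using H_progressive by (simp add: progressive_def)
  have "(\<lambda>s. s powr \<beta>) \<in> borel_measurable (restrict_space borel {0..t})"
    by (rule measurable_restrict_space1) simp
  from measurable_compose[OF measurable_fst this]
  have "(\<lambda>z. fst z powr \<beta>) \<in> borel_measurable (restrict_space borel {0..t} \<Otimes>\<^sub>M F t)" .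
  from borel_measurable_times[OF this 1]
  show "(\<lambda>(s, w). s powr \<beta> * H s w) \<in> borel_measurable (restrict_space borel {0..t} \<Otimes>\<^sub>M F t)"
    by (simp add: case_prod_beta)
qed

lemma by_parts_measurable:
  assumes u: "0 \<le> u"
  shows "(\<lambda>w. by_parts \<beta> (\<lambda>s. I s w) u) \<in> borel_measurable (F u)"
proof -
  have m1: "(\<lambda>(s, w). indicator {0..u} s * I s w) \<in> borel_measurable (borel \<Otimes>\<^sub>M F u)"
    by (rule progressive_measurable[OF continuous_adapted_progressive[OF I_cont] u])
  have "(\<lambda>z. (snd z, fst z)) \<in> F u \<Otimes>\<^sub>M lborel \<rightarrow>\<^sub>M borel \<Otimes>\<^sub>M F u" by measurable
  from measurable_compose[OF this m1]
  have m2: "(\<lambda>z. indicator {0..u} (snd z) * I (snd z) (fst z)) \<in> borel_measurable (F u \<Otimes>\<^sub>M lborel)" by simp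
  have m3: "(\<lambda>z. snd z powr (\<beta> - 1)) \<in> borel_measurable (F u \<Otimes>\<^sub>M lborel)" by measurable
  have "(\<lambda>(w, s). indicator {0..u} s * I s w * s powr (\<beta> - 1)) \<in> borel_measurable (F u \<Otimes>\<^sub>M lborel)"
    using borel_measurable_times[OF m2 m3] by (simp add: case_prod_beta)
  then have "(\<lambda>w. \<integral>s. indicator {0..u} s * I s w * s powr (\<beta> - 1) \<partial>lborel) \<in> borel_measurable (F u)"
    by (rule sigma_finite_measure.borel_measurable_lebesgue_integral[OF sigma_finite_lborel])
  then have "(\<lambda>w. LINT s:{0..u}|lborel. I s w * s powr (\<beta> - 1)) \<in> borel_measurable (F u)"
    by (simp add: set_lebesgue_integral_def mult.assoc)
  then show ?thesis
    unfolding by_parts_def using continuous_adaptedD(1)[OF I_cont u] by simp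
qed

text \<open>The null set of paths without a growth rate belongs to every \<open>F t\<close>, so
  setting \<open>Y\<close> to 0 there preserves adaptedness and makes all paths continuous.\<close>

lemma powr_integral_process:
  obtains Y where "continuous_adapted M F Y"
    "AE w in M. Y 0 w = 0 \<and> weighted \<beta> (\<lambda>s. I s w) (\<lambda>s. Y s w)"
proof -
  obtain N where N: "N \<in> null_sets M" "\<And>t. 0 \<le> t \<Longrightarrow> N \<in> sets (F t)"
    "\<And>w. w \<in> space M - N \<Longrightarrow> \<exists>K>0. \<exists>t>0. \<forall>s. 0 < s \<and> s \<le> t \<longrightarrow> \<bar>I s w\<bar> \<le> K * s powr rate"
    by (rule AE_null_setE[OF integral_rate[OF small rate(1,2)]]) (assumption | rule that)+
  define Y where "Y u w = (if w \<in> N then 0 else by_parts \<beta> (\<lambda>s. I s w) u)" for u w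
  have good: "by_parts \<beta> (\<lambda>s. I s w) 0 = 0" "weighted \<beta> (\<lambda>s. I s w) (by_parts \<beta> (\<lambda>s. I s w))"
    "continuous_on {0..} (by_parts \<beta> (\<lambda>s. I s w))" if w: "w \<in> space M - N" for w
  proof -
    have c: "continuous_on {0..} (\<lambda>s. I s w)" using continuous_adaptedD(4)[OF I_cont] w by simp
    obtain K t0 where K: "0 < t0" "\<And>s. 0 < s \<Longrightarrow> s \<le> t0 \<Longrightarrow> \<bar>I s w\<bar> \<le> K * s powr rate" using N(3)[OF w] by blast
    show "by_parts \<beta> (\<lambda>s. I s w) 0 = 0" "weighted \<beta> (\<lambda>s. I s w) (by_parts \<beta> (\<lambda>s. I s w))"
      "continuous_on {0..} (by_parts \<beta> (\<lambda>s. I s w))"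
      by (rule by_parts_props(1)[OF c K rate(3)] by_parts_props(2)[OF c K rate(3)] by_parts_props(3)[OF c K rate(3)]; assumption)+
  qed
  show ?thesis
  proof (rule that[of Y])
    have "adapted F Y" unfolding adapted_def
    proof (intro allI impI)
      fix u :: real assume u: "0 \<le> u"
      show "Y u \<in> borel_measurable (F u)"
        unfolding Y_def[abs_def] using by_parts_measurable[OF u] N(2)[OF u] sets.Int_space_eq2[of N "F u"]
        by (intro measurable_If_set) auto
    qed
    moreover have "continuous_on {0..} (\<lambda>u. Y u w)" if "w \<in> space M" for w
      using good(3)[of w] that by (cases "w \<in> N") (auto simp: Y_def)
    ultimately show "continuous_adapted M F Y" by (simp add: continuous_adapted_def)
    show "AE w in M. Y 0 w = 0 \<and> weighted \<beta> (\<lambda>s. I s w) (\<lambda>s. Y s w)"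
      using AE_not_in[OF N(1)] AE_space by eventually_elim (use good in \<open>auto simp: Y_def\<close>)
  qed
qed

text \<open>Away from \<open>0\<close> the weight is replaced by a step function, which turns simple integrands for \<open>H\<close> into
  simple integrands for \<open>s\<^sup>\<beta> H\<^sub>s\<close>; the contribution of a neighbourhood of \<open>0\<close> is small by the rates.\<close>

lemma powr_ito_approx:
  assumes Y: "continuous_adapted M F Y" and Y0: "AE w in M. Y 0 w = 0"
    and wtd: "AE w in M. weighted \<beta> (\<lambda>s. I s w) (\<lambda>s. Y s w)"
  shows "ito_approx B (\<lambda>s w. s powr \<beta> * H s w) Y"
  unfolding ito_approx_def
proof (intro allI impI)
  fix t e :: real assume t: "0 \<le> t" and e: "0 < e"
  define N where "N = t + 1"
  have N: "0 < N" "0 \<le> N" "1 \<le> N" "t \<le> N" using t by (auto simp: N_def)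
  \<comment> \<open>Budget in units of \<open>e8\<close>: at most six for the exceptional events,
    three for the energy distance and three for the distance of the integrals.\<close>
  define e8 where "e8 = e / 8"
  have e8: "0 < e8" using e by (simp add: e8_def)
  \<comment> \<open>The energy of the weighted integrand itself. Being continuous and 0 at time 0,
    it makes the part of the integrand before \<open>a\<close> negligible.\<close>
  obtain A' where A': "energy_process (\<lambda>s w. s powr \<beta> * H s w) A'"
    by (rule energy_process_exists[OF powr_progressive powr_square_integrable]) (assumption | rule that)+
  obtain a1 where a1: "0 < a1" "a1 \<le> 1" "likely e8 (\<lambda>w. \<forall>s\<in>{0..a1}. \<bar>Y s w\<bar> \<le> e8)"
    by (rule small_initially[OF continuous_adaptedD(2)[OF Y] continuous_adaptedD(4)[OF Y] Y0 e8 e8]) (assumption | rule that)+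
  have A'0: "AE w in M. A' 0 w = 0" using energy_processD(2)[OF A'] by (auto intro!: AE_I2)
  note A'c = energy_processD(1)[OF A']
  obtain a2 where a2: "0 < a2" "a2 \<le> 1" "likely e8 (\<lambda>w. \<forall>s\<in>{0..a2}. \<bar>A' s w\<bar> \<le> e8)"
    by (rule small_initially[OF continuous_adaptedD(2)[OF A'c] continuous_adaptedD(4)[OF A'c] A'0 e8 e8]) (assumption | rule that)+
  define a where "a = min a1 a2"
  have a: "0 < a" "a \<le> a1" "a \<le> a2" "a \<le> N" using a1 a2 N by (auto simp: a_def)
  obtain D0 where D0: "0 < D0" "\<And>s. a \<le> s \<Longrightarrow> s \<le> N \<Longrightarrow> s powr \<beta> \<le> D0"
    by (rule powr_bounded_on[OF a(1)]) (assumption | rule that)+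
  obtain D1 where D1: "0 < D1" "\<And>s. a \<le> s \<Longrightarrow> s \<le> N \<Longrightarrow> s powr (\<beta> - 1) \<le> D1"
    by (rule powr_bounded_on[OF a(1)]) (assumption | rule that)+
  obtain \<Lambda> where \<Lambda>: "0 < \<Lambda>" "likely e8 (\<lambda>w. A N w \<le> \<Lambda>)"
    by (rule bounded_likely[OF continuous_adaptedD(2)[OF A_cont N(2)] e8]) (assumption | rule that)+
  \<comment> \<open>Chosen so that the total Riemann error, of size
    \<open>\<bar>\<beta>\<bar> * D1 * N * \<delta>1\<close>, stays within \<open>e8\<close>.\<close>
  define \<delta>1 where "\<delta>1 = e8 / (\<bar>\<beta>\<bar> * D1 * N + 1)"
  have \<delta>1: "0 < \<delta>1" "\<bar>\<beta>\<bar> * D1 * N * \<delta>1 \<le> e8"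
    using D1 N e8 small_factor[of "\<bar>\<beta>\<bar> * D1 * N" e8] by (auto simp: \<delta>1_def add_nonneg_pos)
  obtain h1 where h1: "0 < h1"
    "likely e8 (\<lambda>w. \<forall>x y. 0 \<le> x \<and> x \<le> N \<and> 0 \<le> y \<and> y \<le> N \<and> \<bar>y - x\<bar> < h1 \<longrightarrow> \<bar>I y w - I x w\<bar> \<le> \<delta>1)"
    by (rule modulus_likely[OF continuous_adaptedD(2)[OF I_cont] continuous_adaptedD(4)[OF I_cont] \<delta>1(1) e8]) (assumption | rule that)+
  \<comment> \<open>The tolerance for replacing the weight by its value at the left grid point;
    multiplied by an energy of at most \<open>\<Lambda>\<close> it must cost no more than
    \<open>e8\<close>.\<close>
  define \<delta>2 where "\<delta>2 = min 1 (e8 / (2 * \<Lambda> + 1))"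
  have \<delta>2: "0 < \<delta>2" "2 * \<Lambda> * \<delta>2\<^sup>2 \<le> e8"
  proof -
    show "0 < \<delta>2" using \<Lambda> e8 by (simp add: \<delta>2_def)
    moreover have "\<delta>2 \<le> 1" by (simp add: \<delta>2_def)
    ultimately have "\<delta>2\<^sup>2 \<le> \<delta>2" by (simp add: power2_eq_square mult_left_le)
    also have "\<delta>2 \<le> e8 / (2 * \<Lambda> + 1)" by (simp add: \<delta>2_def)
    finally have "2 * \<Lambda> * \<delta>2\<^sup>2 \<le> 2 * \<Lambda> * (e8 / (2 * \<Lambda> + 1))" using \<Lambda> by (intro mult_left_mono) auto
    also have "\<dots> \<le> e8" using \<Lambda> e8 by (intro small_factor) auto
    finally show "2 * \<Lambda> * \<delta>2\<^sup>2 \<le> e8" .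
  qed
  have "continuous_on {a..N} (\<lambda>s. s powr \<beta>)" using a by (intro continuous_intros) auto
  then obtain h2 where h2: "0 < h2" "\<And>x y. a \<le> x \<Longrightarrow> x \<le> N \<Longrightarrow> a \<le> y \<Longrightarrow> y \<le> N \<Longrightarrow> \<bar>y - x\<bar> < h2 \<Longrightarrow> \<bar>y powr \<beta> - x powr \<beta>\<bar> < \<delta>2"
    by (rule uniform_modulus[OF _ \<delta>2(1)]) (assumption | rule that)+
  have "\<exists>m. 0 < m \<and> (N - a) / real m < min h1 h2"
    using small_mesh[of "min h1 h2" N a] h1 h2 by (auto simp: eventually_sequentially)
  then obtain m where m: "0 < m" "(N - a) / real m < h1" "(N - a) / real m < h2" by auto
  define v where "v = grid_point a N m"
  note gp = grid_point_props[OF a(4) m(1), folded v_def]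
  \<comment> \<open>Fixed after the mesh: the errors of \<open>S\<close> at the grid points enter
    once per cell, so the accuracy asked of \<open>S\<close> depends on the number \<open>m\<close>
    of cells.\<close>
  define e3 where "e3 = min e8 (min (e8 / (2 * D0\<^sup>2 + 1)) (e8 / (2 * real m * D0 + 1)))"
  have e3: "0 < e3" "e3 \<le> e8" "2 * D0\<^sup>2 * e3 \<le> e8" "2 * real m * D0 * e3 \<le> e8"
  proof -
    show "0 < e3" "e3 \<le> e8" using e8 D0 m by (auto simp: e3_def add_nonneg_pos)
    have "2 * D0\<^sup>2 * e3 \<le> 2 * D0\<^sup>2 * (e8 / (2 * D0\<^sup>2 + 1))" by (intro mult_left_mono) (auto simp: e3_def)
    also have "\<dots> \<le> e8" by (intro small_factor e8) auto
    finally show "2 * D0\<^sup>2 * e3 \<le> e8" .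
    have "2 * real m * D0 * e3 \<le> 2 * real m * D0 * (e8 / (2 * real m * D0 + 1))" using D0 by (intro mult_left_mono) (auto simp: e3_def)
    also have "\<dots> \<le> e8" using D0 by (intro small_factor e8) auto
    finally show "2 * real m * D0 * e3 \<le> e8" .
  qed
  have ap: "ito_approx B H I" by (rule ito_approxI[OF B_cont ito])
  obtain S where S: "simple_integrand M F S"
    "likely e3 (\<lambda>w. (sq_int {0..N} (\<lambda>s. simple_process S s w - H s w)) \<le> ennreal e3 \<and>
       (\<forall>s\<in>{0..N}. \<bar>simple_integral B S s w - I s w\<bar> \<le> e3))"
    using ap[unfolded ito_approx_def, rule_format, OF N(2) e3(1)] by blast
  have v0: "0 \<le> v i" "v i \<le> v (Suc i)" for i using gp(3)[of i] gp(5)[of i] a by auto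
  obtain U where U: "simple_integrand M F U"
    "\<And>s w. simple_process U s w = simple_process S s w * (\<Sum>i<m. v i powr \<beta> * indicator {v i<..v (Suc i)} s)"
    "\<And>X t w. simple_integral X U t w =
       (\<Sum>i<m. v i powr \<beta> * (simple_integral X S (min t (v (Suc i))) w - simple_integral X S (min t (v i)) w))"
    by (rule simple_mult_steps[where v=v and \<psi>="\<lambda>i _. v i powr \<beta>" and m=m and C="\<lambda>i. v i powr \<beta>", OF S(1) v0(1) v0(2)])
      (auto intro: that)
  have "likely (e8 + e8 + e8 + e8 + e3 + e8) (\<lambda>w. (((((\<forall>s\<in>{0..a1}. \<bar>Y s w\<bar> \<le> e8) \<and> (\<forall>s\<in>{0..a2}. \<bar>A' s w\<bar> \<le> e8)) \<and> A N w \<le> \<Lambda>) \<and>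
     (\<forall>x y. 0 \<le> x \<and> x \<le> N \<and> 0 \<le> y \<and> y \<le> N \<and> \<bar>y - x\<bar> < h1 \<longrightarrow> \<bar>I y w - I x w\<bar> \<le> \<delta>1)) \<and>
     ((sq_int {0..N} (\<lambda>s. simple_process S s w - H s w)) \<le> ennreal e3 \<and>
       (\<forall>s\<in>{0..N}. \<bar>simple_integral B S s w - I s w\<bar> \<le> e3))) \<and>
     (weighted \<beta> (\<lambda>s. I s w) (\<lambda>s. Y s w) \<and> (\<forall>t\<ge>0. (sq_int {0..t} (\<lambda>s. H s w)) = ennreal (A t w)) \<and>
      (\<forall>t\<ge>0. (sq_int {0..t} (\<lambda>s. s powr \<beta> * H s w)) = ennreal (A' t w))))"
    using wtd A_eq energy_processD(4)[OF A'] by (intro likely_conj a1 a2 \<Lambda> h1 S(2) likely_AE e8 AE_conjI)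
  then have "likely e (\<lambda>w. (sq_int {0..t} (\<lambda>s. simple_process U s w - s powr \<beta> * H s w)) \<le> ennreal e \<and>
       (\<forall>s\<in>{0..t}. \<bar>simple_integral B U s w - Y s w\<bar> \<le> e))"
  proof (rule likely_mono)
    show "e8 + e8 + e8 + e8 + e3 + e8 \<le> e" using e3 e by (simp add: e8_def)
    fix w assume w: "w \<in> space M"
    assume G: "(((((\<forall>s\<in>{0..a1}. \<bar>Y s w\<bar> \<le> e8) \<and> (\<forall>s\<in>{0..a2}. \<bar>A' s w\<bar> \<le> e8)) \<and> A N w \<le> \<Lambda>) \<and>
     (\<forall>x y. 0 \<le> x \<and> x \<le> N \<and> 0 \<le> y \<and> y \<le> N \<and> \<bar>y - x\<bar> < h1 \<longrightarrow> \<bar>I y w - I x w\<bar> \<le> \<delta>1)) \<and>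
     ((sq_int {0..N} (\<lambda>s. simple_process S s w - H s w)) \<le> ennreal e3 \<and>
       (\<forall>s\<in>{0..N}. \<bar>simple_integral B S s w - I s w\<bar> \<le> e3))) \<and>
     (weighted \<beta> (\<lambda>s. I s w) (\<lambda>s. Y s w) \<and> (\<forall>t\<ge>0. (sq_int {0..t} (\<lambda>s. H s w)) = ennreal (A t w)) \<and>
      (\<forall>t\<ge>0. (sq_int {0..t} (\<lambda>s. s powr \<beta> * H s w)) = ennreal (A' t w)))"
    from G have gY: "\<And>s. s \<in> {0..a1} \<Longrightarrow> \<bar>Y s w\<bar> \<le> e8" by blast
    from G have gA': "\<And>s. s \<in> {0..a2} \<Longrightarrow> \<bar>A' s w\<bar> \<le> e8" by blast
    from G have gA: "A N w \<le> \<Lambda>" by blast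
    from G have gI: "\<And>x y. 0 \<le> x \<and> x \<le> N \<and> 0 \<le> y \<and> y \<le> N \<and> \<bar>y - x\<bar> < h1 \<Longrightarrow> \<bar>I y w - I x w\<bar> \<le> \<delta>1" by blast
    from G have gS: "(sq_int {0..N} (\<lambda>s. simple_process S s w - H s w)) \<le> ennreal e3" by blast
    from G have gX: "\<And>s. s \<in> {0..N} \<Longrightarrow> \<bar>simple_integral B S s w - I s w\<bar> \<le> e3" by blast
    from G have gw: "weighted \<beta> (\<lambda>s. I s w) (\<lambda>s. Y s w)" by blast
    from G have gE: "\<And>t. 0 \<le> t \<Longrightarrow> (sq_int {0..t} (\<lambda>s. H s w)) = ennreal (A t w)" by blast
    from G have gE': "\<And>t. 0 \<le> t \<Longrightarrow> (sq_int {0..t} (\<lambda>s. s powr \<beta> * H s w)) = ennreal (A' t w)" by blast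
    let ?H = "\<lambda>s. indicator {0..N} s * H s w" and ?S = "\<lambda>s. simple_process S s w"
    have [measurable]: "?H \<in> borel_measurable borel" "?S \<in> borel_measurable borel"
      by (rule H_path_measurable[OF w N(2)] simple_path_measurable[OF S(1) w])+
    \<comment> \<open>Before \<open>a\<close> the process \<open>U\<close> vanishes and only the
      energy of the weighted integrand remains. After \<open>a\<close> the error splits into the
      step weight times \<open>S - H\<close> and the error of the weight times
      \<open>H\<close>.\<close>
    have "(sq_int {0..t} (\<lambda>s. simple_process U s w - s powr \<beta> * H s w)) \<le>
      (sq_int {0..a} (\<lambda>s. s powr \<beta> * ?H s)) +
      (\<integral>\<^sup>+s\<in>{0..N}. ennreal (2 * D0\<^sup>2) * ennreal ((?S s - ?H s)\<^sup>2) \<partial>lborel) +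
      (\<integral>\<^sup>+s\<in>{0..N}. ennreal (2 * \<delta>2\<^sup>2) * ennreal ((?H s)\<^sup>2) \<partial>lborel)"
    proof (rule set_nn_integral_add_le)
      fix s assume s: "s \<in> {0..t}"
      show "ennreal ((simple_process U s w - s powr \<beta> * H s w)\<^sup>2) \<le>
         ennreal ((s powr \<beta> * ?H s)\<^sup>2) * indicator {0..a} s +
         ennreal (2 * D0\<^sup>2) * ennreal ((?S s - ?H s)\<^sup>2) * indicator {0..N} s +
         ennreal (2 * \<delta>2\<^sup>2) * ennreal ((?H s)\<^sup>2) * indicator {0..N} s"
      proof (cases "a < s")
        case False
        then have "simple_process U s w = 0"
          unfolding U(2) using grid_step_value(2)[OF a(4) m(1), folded v_def, of s "\<lambda>i. v i powr \<beta>"] by simp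
        then show ?thesis using s False N by (simp add: add_increasing2)
      next
        case True
        then obtain i where i: "i < m" "v i < s" "s \<le> v (Suc i)"
          "(\<Sum>i<m. v i powr \<beta> * indicator {v i<..v (Suc i)} s) = v i powr \<beta>"
          using grid_step_value(1)[OF a(4) m(1), folded v_def, of s "\<lambda>i. v i powr \<beta>"] s N by auto
        have vi: "a \<le> v i" "v i \<le> N" "s - v i \<le> (N - a) / real m" using gp(5)[of i] gp(6)[of i] gp(4)[of i] i by auto
        have s': "s \<le> N" "a \<le> s" using s N True by auto
        have "(?S s * v i powr \<beta> - s powr \<beta> * H s w)\<^sup>2 \<le> 2 * ((v i powr \<beta>)\<^sup>2 * (?S s - H s w)\<^sup>2) + 2 * ((v i powr \<beta> - s powr \<beta>)\<^sup>2 * (H s w)\<^sup>2)"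
          by (rule square_product_le)
        also have "\<dots> \<le> 2 * (D0\<^sup>2 * (?S s - H s w)\<^sup>2) + 2 * (\<delta>2\<^sup>2 * (H s w)\<^sup>2)"
        proof (intro add_mono mult_left_mono mult_right_mono)
          show "(v i powr \<beta>)\<^sup>2 \<le> D0\<^sup>2" using D0(2)[OF vi(1,2)] by (intro power_mono) auto
          have "\<bar>v i powr \<beta> - s powr \<beta>\<bar> < \<delta>2" using vi s' m i by (intro h2(2)) auto
          then show "(v i powr \<beta> - s powr \<beta>)\<^sup>2 \<le> \<delta>2\<^sup>2" using abs_le_square_iff[of "v i powr \<beta> - s powr \<beta>" \<delta>2] \<delta>2(1) by simp
        qed auto
        finally have "ennreal ((?S s * v i powr \<beta> - s powr \<beta> * H s w)\<^sup>2) \<le> ennreal (2 * D0\<^sup>2 * (?S s - H s w)\<^sup>2 + 2 * \<delta>2\<^sup>2 * (H s w)\<^sup>2)"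
          by (intro ennreal_leI) (simp only: mult.assoc)
        also have "\<dots> = ennreal (2 * D0\<^sup>2) * ennreal ((?S s - H s w)\<^sup>2) + ennreal (2 * \<delta>2\<^sup>2) * ennreal ((H s w)\<^sup>2)"
          by (subst ennreal_plus) (auto simp: ennreal_mult)
        finally show ?thesis using s' s a True unfolding U(2) i(4) by simp
      qed
    qed measurable
    also have "(sq_int {0..a} (\<lambda>s. s powr \<beta> * ?H s)) = (sq_int {0..a} (\<lambda>s. s powr \<beta> * H s w))"
      using a by (intro nn_integral_cong) (auto split: split_indicator)
    also have "\<dots> = ennreal (A' a w)" by (rule gE') (use a in simp)
    also have "\<dots> \<le> ennreal e8" using gA'[of a] a by (intro ennreal_leI) auto
    also have "(\<integral>\<^sup>+s\<in>{0..N}. ennreal (2 * D0\<^sup>2) * ennreal ((?S s - ?H s)\<^sup>2) \<partial>lborel) = ennreal (2 * D0\<^sup>2) * (sq_int {0..N} (\<lambda>s. ?S s - ?H s))"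
      by (subst nn_integral_cmult[symmetric]) (auto simp: mult.assoc)
    also have "(sq_int {0..N} (\<lambda>s. ?S s - ?H s)) = (sq_int {0..N} (\<lambda>s. simple_process S s w - H s w))"
      by (intro nn_integral_cong) (auto split: split_indicator)
    also note gS
    also have "(\<integral>\<^sup>+s\<in>{0..N}. ennreal (2 * \<delta>2\<^sup>2) * ennreal ((?H s)\<^sup>2) \<partial>lborel) = ennreal (2 * \<delta>2\<^sup>2) * (sq_int {0..N} ?H)"
      by (subst nn_integral_cmult[symmetric]) (auto simp: mult.assoc)
    also have "(sq_int {0..N} ?H) = (sq_int {0..N} (\<lambda>s. H s w))"
      by (intro nn_integral_cong) (auto split: split_indicator)
    also have "\<dots> = ennreal (A N w)" by (rule gE[OF N(2)])
    also have "\<dots> \<le> ennreal \<Lambda>" by (intro ennreal_leI gA)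
    finally have "(sq_int {0..t} (\<lambda>s. simple_process U s w - s powr \<beta> * H s w)) \<le>
       ennreal e8 + ennreal (2 * D0\<^sup>2) * ennreal e3 + ennreal (2 * \<delta>2\<^sup>2) * ennreal \<Lambda>"
      by (simp add: add_mono mult_left_mono)
    also have "\<dots> = ennreal (e8 + 2 * D0\<^sup>2 * e3 + 2 * \<delta>2\<^sup>2 * \<Lambda>)"
    proof -
      have "ennreal (2 * D0\<^sup>2) * ennreal e3 = ennreal (2 * D0\<^sup>2 * e3)" "ennreal (2 * \<delta>2\<^sup>2) * ennreal \<Lambda> = ennreal (2 * \<delta>2\<^sup>2 * \<Lambda>)"
        using e3 \<Lambda> by (simp_all only: ennreal_mult[symmetric] zero_le_power2 mult_nonneg_nonneg zero_le_numeral less_imp_le)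
      moreover have "0 \<le> 2 * D0\<^sup>2 * e3" "0 \<le> 2 * \<delta>2\<^sup>2 * \<Lambda>" "0 \<le> e8" using e3 \<Lambda> e8 by auto
      ultimately show ?thesis by (simp only: ennreal_plus[symmetric] add_nonneg_nonneg)
    qed
    also have "\<dots> \<le> ennreal e"
    proof (rule ennreal_leI)
      have "2 * \<delta>2\<^sup>2 * \<Lambda> \<le> e8" using \<delta>2(2) by (simp add: mult.commute mult.left_commute)
      then show "e8 + 2 * D0\<^sup>2 * e3 + 2 * \<delta>2\<^sup>2 * \<Lambda> \<le> e" using e3(3) e by (simp add: e8_def)
    qed
    finally have 1: "(sq_int {0..t} (\<lambda>s. simple_process U s w - s powr \<beta> * H s w)) \<le> ennreal e" .
    \<comment> \<open>Three errors of size \<open>e8\<close>: replacing the integral of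
      \<open>S\<close> by \<open>I\<close> at the grid points, replacing the Riemann sum by the
      increment of \<open>Y\<close>, and the part of \<open>Y\<close> before
      \<open>a\<close>.\<close>
    have "\<bar>simple_integral B U s w - Y s w\<bar> \<le> e" if s: "s \<in> {0..t}" for s
    proof -
      have sN: "s \<le> N" "0 \<le> s" using s N by auto
      let ?X = "\<lambda>u. simple_integral B S u w"
      have mi: "min s (v i) \<in> {0..N}" for i using sN v0(1)[of i] by auto
      have "\<bar>(\<Sum>i<m. v i powr \<beta> * (?X (min s (v (Suc i))) - ?X (min s (v i)))) - (\<Sum>i<m. v i powr \<beta> * (I (min s (v (Suc i))) w - I (min s (v i)) w))\<bar>
        \<le> (\<Sum>i<m. D0 * (2 * e3))"
        unfolding sum_subtractf[symmetric]
      proof (rule order_trans[OF sum_abs], rule sum_mono)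
        fix i assume i: "i \<in> {..<m}"
        have "\<bar>(?X (min s (v (Suc i))) - I (min s (v (Suc i))) w) - (?X (min s (v i)) - I (min s (v i)) w)\<bar> \<le> 2 * e3"
          using gX[OF mi[of i]] gX[OF mi[of "Suc i"]] by linarith
        then have "v i powr \<beta> * \<bar>(?X (min s (v (Suc i))) - I (min s (v (Suc i))) w) - (?X (min s (v i)) - I (min s (v i)) w)\<bar> \<le> D0 * (2 * e3)"
          using D0 gp(5)[of i] gp(6)[of i] i by (intro mult_mono) auto
        moreover have "v i powr \<beta> * (?X (min s (v (Suc i))) - ?X (min s (v i))) - v i powr \<beta> * (I (min s (v (Suc i))) w - I (min s (v i)) w) =
          v i powr \<beta> * ((?X (min s (v (Suc i))) - I (min s (v (Suc i))) w) - (?X (min s (v i)) - I (min s (v i)) w))" by (simp add: algebra_simps)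
        ultimately show "\<bar>v i powr \<beta> * (?X (min s (v (Suc i))) - ?X (min s (v i))) - v i powr \<beta> * (I (min s (v (Suc i))) w - I (min s (v i)) w)\<bar> \<le> D0 * (2 * e3)"
          by (simp only: abs_mult powr_ge_zero abs_of_nonneg)
      qed
      also have "(\<Sum>i<m. D0 * (2 * e3)) \<le> e8" using e3(4) by (simp add: ac_simps)
      finally have p1: "\<bar>simple_integral B U s w - (\<Sum>i<m. v i powr \<beta> * (I (min s (v (Suc i))) w - I (min s (v i)) w))\<bar> \<le> e8"
        unfolding U(3) .
      have "\<bar>(\<Sum>i<m. 1 * (Y (min s (v (Suc i))) w - Y (min s (v i)) w)) - (\<Sum>i<m. 1 * v i powr \<beta> * (I (min s (v (Suc i))) w - I (min s (v i)) w))\<bar>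
        \<le> 1 * \<bar>\<beta>\<bar> * \<delta>1 * D1 * (N - a)"
        unfolding v_def
      proof (rule riemann_cells[OF gw continuous_adaptedD(4)[OF I_cont w] a(1,4) m(1) _ D1(2)])
        show "\<bar>I y w - I x w\<bar> \<le> \<delta>1" if "a \<le> x" "x \<le> y" "y \<le> N" "y - x \<le> (N - a) / real m" for x y
          using that a m by (intro gI) auto
      qed (use sN in auto)
      also have "\<dots> \<le> e8"
      proof -
        have "\<bar>\<beta>\<bar> * \<delta>1 * D1 * (N - a) \<le> \<bar>\<beta>\<bar> * \<delta>1 * D1 * N" using a \<delta>1 D1 by (intro mult_left_mono) auto
        then show ?thesis using \<delta>1(2) by (simp add: ac_simps)
      qed
      finally have p2: "\<bar>(\<Sum>i<m. 1 * (Y (min s (v (Suc i))) w - Y (min s (v i)) w)) - (\<Sum>i<m. v i powr \<beta> * (I (min s (v (Suc i))) w - I (min s (v i)) w))\<bar> \<le> e8"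
        by simp
      have tel: "(\<Sum>i<m. 1 * (Y (min s (v (Suc i))) w - Y (min s (v i)) w)) = Y s w - Y (min s a) w"
        unfolding v_def using sum_grid_telescope[OF a(4) m(1) sN(1), of "\<lambda>u. Y u w"] by simp
      have p3: "\<bar>Y (min s a) w\<bar> \<le> e8" by (rule gY) (use sN a in auto)
      have "\<bar>simple_integral B U s w - Y s w\<bar> \<le> 3 * e8" using p1 p2 p3 unfolding tel by linarith
      then show ?thesis using e by (simp add: e8_def)
    qed
    with 1 show "(sq_int {0..t} (\<lambda>s. simple_process U s w - s powr \<beta> * H s w)) \<le> ennreal e \<and>
       (\<forall>s\<in>{0..t}. \<bar>simple_integral B U s w - Y s w\<bar> \<le> e)" by blast
  qed
  with U(1) show "\<exists>S. simple_integrand M F S \<and> likely e (\<lambda>w. (sq_int {0..t} (\<lambda>s. simple_process S s w - s powr \<beta> * H s w)) \<le> ennreal e \<and>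
       (\<forall>s\<in>{0..t}. \<bar>simple_integral B S s w - Y s w\<bar> \<le> e))" by blast
qed

end

end

section \<open>Change of integrator\<close>

context brownian_space begin

lemma simple_integral_measurable_continuous:
  assumes "simple_integrand M F S"
  shows "0 \<le> u \<Longrightarrow> simple_integral B S u \<in> borel_measurable M"
    "w \<in> space M \<Longrightarrow> continuous_on {0..} (\<lambda>t. simple_integral B S t w)"
  by (rule simple_integral_measurable[OF assms continuous_adaptedD(2)[OF B_cont]], assumption+)
    (rule simple_integral_continuous[OF assms continuous_adaptedD(4)[OF B_cont]])

lemma simple_integral_cmult: "simple_integral (\<lambda>t w. c * X t w) S t w = c * simple_integral X S t w"
  by (cases S) (simp add: sum_distrib_left algebra_simps)

text \<open>If \<open>dW = s\<^sup>\<beta> dB\<close>, simple integrands for \<open>K\<close> with respect to \<open>B\<close>, divided by a step approximation of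
  \<open>c s\<^sup>\<beta>\<close>, serve as integrands with respect to \<open>cW\<close>.\<close>

lemma integrator_change:
  assumes wtd: "AE w in M. weighted \<beta> (\<lambda>s. B s w) (\<lambda>s. W s w)"
    and K: "progressive F K" "AE w in M. \<forall>t\<ge>0. set_integrable lborel {0..t} (\<lambda>s. (K s w)\<^sup>2)"
    and ap: "ito_approx B K Y" and c: "0 < c" and t: "0 \<le> t" and e: "0 < e"
  shows "\<exists>S. simple_integrand M F S \<and> likely e (\<lambda>w.
      (sq_int {0..t} (\<lambda>s. simple_process S s w * (c * s powr \<beta>) - K s w)) \<le> ennreal e \<and>
      (\<forall>s\<in>{0..t}. \<bar>simple_integral (\<lambda>t w. c * W t w) S s w - Y s w\<bar> \<le> e))"
proof -
  define N where "N = t + 1"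
  have N: "0 < N" "0 \<le> N" "1 \<le> N" "t \<le> N" using t by (auto simp: N_def)
  define e8 where "e8 = e / 8"
  have e8: "0 < e8" using e by (simp add: e8_def)
  obtain AK where AK: "energy_process K AK"
    by (rule energy_process_exists[OF K]) (assumption | rule that)+
  note AKc = energy_processD(1)[OF AK]
  have AK0: "AE w in M. AK 0 w = 0" using energy_processD(2)[OF AK] by (auto intro!: AE_I2)
  obtain a2 where a2: "0 < a2" "a2 \<le> 1" "likely e8 (\<lambda>w. \<forall>s\<in>{0..a2}. \<bar>AK s w\<bar> \<le> e8)"
    by (rule small_initially[OF continuous_adaptedD(2)[OF AKc] continuous_adaptedD(4)[OF AKc] AK0 e8 e8]) (assumption | rule that)+
  define e3 where "e3 = e8 / 2"
  have e3: "0 < e3" "2 * e3 = e8" using e8 by (auto simp: e3_def)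
  \<comment> \<open>Fixed before the mesh, since the bound \<open>C\<close> of \<open>S\<close> and
    the modulus of continuity of its integral decide how fine the steps have to be.\<close>
  obtain S where S: "simple_integrand M F S"
    "likely e3 (\<lambda>w. (sq_int {0..N} (\<lambda>s. simple_process S s w - K s w)) \<le> ennreal e3 \<and>
       (\<forall>s\<in>{0..N}. \<bar>simple_integral B S s w - Y s w\<bar> \<le> e3))"
    using ap[unfolded ito_approx_def, rule_format, OF N(2) e3(1)] by blast
  note X = simple_integral_measurable_continuous[OF S(1)]
  have X0: "AE w in M. simple_integral B S 0 w = 0" using simple_integral_0[OF S(1)] by simp
  obtain C where C: "0 \<le> C" "\<And>s w. w \<in> space M \<Longrightarrow> \<bar>simple_process S s w\<bar> \<le> C"
    by (rule simple_process_bounded[OF S(1)]) (assumption | rule that)+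
  obtain a1 where a1: "0 < a1" "a1 \<le> 1" "likely e8 (\<lambda>w. \<forall>s\<in>{0..a1}. \<bar>simple_integral B S s w\<bar> \<le> e8)"
    by (rule small_initially[OF X X0 e8 e8]) (assumption | rule that)+
  define a where "a = min a1 a2"
  have a: "0 < a" "a \<le> a1" "a \<le> a2" "a \<le> N" using a1 a2 N by (auto simp: a_def)
  obtain D0 where D0: "0 < D0" "\<And>s. a \<le> s \<Longrightarrow> s \<le> N \<Longrightarrow> s powr (- \<beta>) \<le> D0"
    by (rule powr_bounded_on[OF a(1)]) (assumption | rule that)+
  obtain D1 where D1: "0 < D1" "\<And>s. a \<le> s \<Longrightarrow> s \<le> N \<Longrightarrow> s powr (\<beta> - 1) \<le> D1"
    by (rule powr_bounded_on[OF a(1)]) (assumption | rule that)+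
  define \<delta>1 where "\<delta>1 = e8 / (D0 * \<bar>\<beta>\<bar> * D1 * N + 1)"
  have \<delta>1: "0 < \<delta>1" "D0 * \<bar>\<beta>\<bar> * D1 * N * \<delta>1 \<le> e8"
    using D0 D1 N e8 small_factor[of "D0 * \<bar>\<beta>\<bar> * D1 * N" e8] by (auto simp: \<delta>1_def add_nonneg_pos)
  obtain h1 where h1: "0 < h1"
    "likely e8 (\<lambda>w. \<forall>x y. 0 \<le> x \<and> x \<le> N \<and> 0 \<le> y \<and> y \<le> N \<and> \<bar>y - x\<bar> < h1 \<longrightarrow> \<bar>simple_integral B S y w - simple_integral B S x w\<bar> \<le> \<delta>1)"
    by (rule modulus_likely[OF X \<delta>1(1) e8]) (assumption | rule that)+
  define \<delta>2 where "\<delta>2 = min 1 (e8 / (2 * C\<^sup>2 * N + 1))"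
  have \<delta>2: "0 < \<delta>2" "2 * C\<^sup>2 * N * \<delta>2\<^sup>2 \<le> e8"
  proof -
    have "0 < 2 * C\<^sup>2 * N + 1" using N by (intro add_nonneg_pos) auto
    then show "0 < \<delta>2" using e8 by (simp add: \<delta>2_def)
    moreover have "\<delta>2 \<le> 1" by (simp add: \<delta>2_def)
    ultimately have "\<delta>2\<^sup>2 \<le> \<delta>2" by (simp add: power2_eq_square mult_left_le)
    also have "\<delta>2 \<le> e8 / (2 * C\<^sup>2 * N + 1)" by (simp add: \<delta>2_def)
    finally have "2 * C\<^sup>2 * N * \<delta>2\<^sup>2 \<le> 2 * C\<^sup>2 * N * (e8 / (2 * C\<^sup>2 * N + 1))" using N by (intro mult_left_mono) auto
    also have "\<dots> \<le> e8" using N e8 by (intro small_factor) auto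
    finally show "2 * C\<^sup>2 * N * \<delta>2\<^sup>2 \<le> e8" .
  qed
  have "continuous_on {a..N} (\<lambda>s. s powr \<beta>)" using a by (intro continuous_intros) auto
  \<comment> \<open>After multiplication by the reciprocal weight, bounded by \<open>D0\<close>, the
    quotient of the weights differs from 1 by at most \<open>\<delta>2\<close>.\<close>
  moreover have "0 < \<delta>2 / D0" using \<delta>2 D0 by simp
  ultimately obtain h2 where h2: "0 < h2" "\<And>x y. a \<le> x \<Longrightarrow> x \<le> N \<Longrightarrow> a \<le> y \<Longrightarrow> y \<le> N \<Longrightarrow> \<bar>y - x\<bar> < h2 \<Longrightarrow> \<bar>y powr \<beta> - x powr \<beta>\<bar> < \<delta>2 / D0"
    by (rule uniform_modulus) (assumption | rule that)+
  have "\<exists>m. 0 < m \<and> (N - a) / real m < min h1 h2"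
    using small_mesh[of "min h1 h2" N a] h1 h2 by (auto simp: eventually_sequentially)
  then obtain m where m: "0 < m" "(N - a) / real m < h1" "(N - a) / real m < h2" by auto
  define v where "v = grid_point a N m"
  note gp = grid_point_props[OF a(4) m(1), folded v_def]
  have v0: "0 \<le> v i" "v i \<le> v (Suc i)" "0 < v i" for i using gp(3)[of i] gp(5)[of i] a by auto
  have vinv: "v i powr (- \<beta>) * v i powr \<beta> = 1" for i using v0(3)[of i] by (simp add: powr_add[symmetric])
  obtain U where U: "simple_integrand M F U"
    "\<And>s w. simple_process U s w = simple_process S s w * (\<Sum>i<m. v i powr (- \<beta>) / c * indicator {v i<..v (Suc i)} s)"
    "\<And>X t w. simple_integral X U t w =
       (\<Sum>i<m. v i powr (- \<beta>) / c * (simple_integral X S (min t (v (Suc i))) w - simple_integral X S (min t (v i)) w))"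
    by (rule simple_mult_steps[where v=v and \<psi>="\<lambda>i _. v i powr (- \<beta>) / c" and m=m and C="\<lambda>i. v i powr (- \<beta>) / c", OF S(1) v0(1) v0(2)])
      (use c in \<open>auto intro: that\<close>)
  have "likely (e8 + e8 + e8 + e3 + e8) (\<lambda>w. ((((\<forall>s\<in>{0..a1}. \<bar>simple_integral B S s w\<bar> \<le> e8) \<and> (\<forall>s\<in>{0..a2}. \<bar>AK s w\<bar> \<le> e8)) \<and>
     (\<forall>x y. 0 \<le> x \<and> x \<le> N \<and> 0 \<le> y \<and> y \<le> N \<and> \<bar>y - x\<bar> < h1 \<longrightarrow> \<bar>simple_integral B S y w - simple_integral B S x w\<bar> \<le> \<delta>1)) \<and>
     ((sq_int {0..N} (\<lambda>s. simple_process S s w - K s w)) \<le> ennreal e3 \<and>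
       (\<forall>s\<in>{0..N}. \<bar>simple_integral B S s w - Y s w\<bar> \<le> e3))) \<and>
     (weighted \<beta> (\<lambda>s. B s w) (\<lambda>s. W s w) \<and>
      (\<forall>t\<ge>0. (sq_int {0..t} (\<lambda>s. K s w)) = ennreal (AK t w))))"
    using wtd energy_processD(4)[OF AK] by (intro likely_conj a1 a2 h1 S(2) likely_AE e8 AE_conjI)
  then have "likely e (\<lambda>w. (sq_int {0..t} (\<lambda>s. simple_process U s w * (c * s powr \<beta>) - K s w)) \<le> ennreal e \<and>
      (\<forall>s\<in>{0..t}. \<bar>simple_integral (\<lambda>t w. c * W t w) U s w - Y s w\<bar> \<le> e))"
  proof (rule likely_mono)
    show "e8 + e8 + e8 + e3 + e8 \<le> e" using e3 e by (simp add: e8_def)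
    fix w assume w: "w \<in> space M"
    assume G: "((((\<forall>s\<in>{0..a1}. \<bar>simple_integral B S s w\<bar> \<le> e8) \<and> (\<forall>s\<in>{0..a2}. \<bar>AK s w\<bar> \<le> e8)) \<and>
     (\<forall>x y. 0 \<le> x \<and> x \<le> N \<and> 0 \<le> y \<and> y \<le> N \<and> \<bar>y - x\<bar> < h1 \<longrightarrow> \<bar>simple_integral B S y w - simple_integral B S x w\<bar> \<le> \<delta>1)) \<and>
     ((sq_int {0..N} (\<lambda>s. simple_process S s w - K s w)) \<le> ennreal e3 \<and>
       (\<forall>s\<in>{0..N}. \<bar>simple_integral B S s w - Y s w\<bar> \<le> e3))) \<and>
     (weighted \<beta> (\<lambda>s. B s w) (\<lambda>s. W s w) \<and>
      (\<forall>t\<ge>0. (sq_int {0..t} (\<lambda>s. K s w)) = ennreal (AK t w)))"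
    from G have gX: "\<And>s. s \<in> {0..a1} \<Longrightarrow> \<bar>simple_integral B S s w\<bar> \<le> e8" by blast
    from G have gA: "\<And>s. s \<in> {0..a2} \<Longrightarrow> \<bar>AK s w\<bar> \<le> e8" by blast
    from G have gO: "\<And>x y. 0 \<le> x \<and> x \<le> N \<and> 0 \<le> y \<and> y \<le> N \<and> \<bar>y - x\<bar> < h1 \<Longrightarrow> \<bar>simple_integral B S y w - simple_integral B S x w\<bar> \<le> \<delta>1" by blast
    from G have gS: "(sq_int {0..N} (\<lambda>s. simple_process S s w - K s w)) \<le> ennreal e3" by blast
    from G have gY: "\<And>s. s \<in> {0..N} \<Longrightarrow> \<bar>simple_integral B S s w - Y s w\<bar> \<le> e3" by blast
    from G have gw: "weighted \<beta> (\<lambda>s. B s w) (\<lambda>s. W s w)" by blast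
    from G have gE: "\<And>t. 0 \<le> t \<Longrightarrow> (sq_int {0..t} (\<lambda>s. K s w)) = ennreal (AK t w)" by blast
    let ?K = "\<lambda>s. indicator {0..N} s * K s w" and ?S = "\<lambda>s. simple_process S s w"
    have [measurable]: "?K \<in> borel_measurable borel"
      using measurable_compose[OF measurable_Pair2'[OF w] progressive_measurable_M[OF K(1) N(2)]] by simp
    have [measurable]: "?S \<in> borel_measurable borel"
      using measurable_compose[OF measurable_Pair2'[OF w] simple_process_measurable[OF S(1)]] by simp
    have "(sq_int {0..t} (\<lambda>s. simple_process U s w * (c * s powr \<beta>) - K s w)) \<le>
      (sq_int {0..a} ?K) +
      (\<integral>\<^sup>+s\<in>{0..N}. 2 * ennreal ((?S s - ?K s)\<^sup>2) \<partial>lborel) +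
      (\<integral>\<^sup>+s\<in>{0..N}. ennreal (2 * (C\<^sup>2 * \<delta>2\<^sup>2)) \<partial>lborel)"
    proof (rule set_nn_integral_add_le)
      fix s assume s: "s \<in> {0..t}"
      show "ennreal ((simple_process U s w * (c * s powr \<beta>) - K s w)\<^sup>2) \<le>
         ennreal ((?K s)\<^sup>2) * indicator {0..a} s +
         2 * ennreal ((?S s - ?K s)\<^sup>2) * indicator {0..N} s +
         ennreal (2 * (C\<^sup>2 * \<delta>2\<^sup>2)) * indicator {0..N} s"
      proof (cases "a < s")
        case False
        then have "simple_process U s w = 0"
          unfolding U(2) using grid_step_value(2)[OF a(4) m(1), folded v_def, of s "\<lambda>i. v i powr (- \<beta>) / c"] by simp
        then show ?thesis using s False N by (simp add: add_increasing2)
      next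
        case True
        then obtain i where i: "i < m" "v i < s" "s \<le> v (Suc i)"
          "(\<Sum>i<m. v i powr (- \<beta>) / c * indicator {v i<..v (Suc i)} s) = v i powr (- \<beta>) / c"
          using grid_step_value(1)[OF a(4) m(1), folded v_def, of s "\<lambda>i. v i powr (- \<beta>) / c"] s N by auto
        have vi: "a \<le> v i" "v i \<le> N" "s - v i \<le> (N - a) / real m" using gp(5)[of i] gp(6)[of i] gp(4)[of i] i by auto
        have s': "s \<le> N" "a \<le> s" using s N True by auto
        let ?r = "v i powr (- \<beta>) * s powr \<beta>"
        \<comment> \<open>The product \<open>?r\<close> of the reciprocal weight at the left grid
          point with the weight at \<open>s\<close> would be 1 for exact division; its deviation
          from 1 is the only error besides that of \<open>S\<close>.\<close>
        have "?r - 1 = v i powr (- \<beta>) * (s powr \<beta> - v i powr \<beta>)" using vinv[of i] by (simp add: algebra_simps)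
        then have "\<bar>?r - 1\<bar> = v i powr (- \<beta>) * \<bar>s powr \<beta> - v i powr \<beta>\<bar>" by (simp only: abs_mult abs_of_nonneg powr_ge_zero)
        also have "\<dots> \<le> D0 * (\<delta>2 / D0)"
          using D0(2)[OF vi(1,2)] D0(1) h2(2)[of "v i" s] vi s' m i by (intro mult_mono) auto
        also have "\<dots> = \<delta>2" using D0 by simp
        finally have r: "(?r - 1)\<^sup>2 \<le> \<delta>2\<^sup>2" using abs_le_square_iff[of "?r - 1" \<delta>2] \<delta>2(1) by simp
        have sq: "(?S s)\<^sup>2 \<le> C\<^sup>2" using C(2)[OF w, of s] C(1) by (simp add: abs_le_square_iff[symmetric])
        have "(?S s * ?r - K s w)\<^sup>2 = ((?S s - K s w) + ?S s * (?r - 1))\<^sup>2" by (simp add: algebra_simps)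
        also have "\<dots> \<le> 2 * (?S s - K s w)\<^sup>2 + 2 * (?S s * (?r - 1))\<^sup>2"
          using square_le_2[of "(?S s - K s w) + ?S s * (?r - 1)" "?S s * (?r - 1)"] by simp
        also have "(?S s * (?r - 1))\<^sup>2 \<le> C\<^sup>2 * \<delta>2\<^sup>2"
          unfolding power_mult_distrib using r sq by (intro mult_mono) auto
        finally have "ennreal ((?S s * ?r - K s w)\<^sup>2) \<le> ennreal (2 * (?S s - K s w)\<^sup>2 + 2 * (C\<^sup>2 * \<delta>2\<^sup>2))"
          by (intro ennreal_leI) simp
        also have "\<dots> = 2 * ennreal ((?S s - K s w)\<^sup>2) + ennreal (2 * (C\<^sup>2 * \<delta>2\<^sup>2))"
          by (subst ennreal_plus) (auto simp: ennreal_mult)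
        finally have "ennreal ((?S s * ?r - K s w)\<^sup>2) \<le> 2 * ennreal ((?S s - K s w)\<^sup>2) + ennreal (2 * (C\<^sup>2 * \<delta>2\<^sup>2))" .
        moreover have "simple_process U s w * (c * s powr \<beta>) = ?S s * ?r" unfolding U(2) i(4) using c by simp
        ultimately have "ennreal ((simple_process U s w * (c * s powr \<beta>) - K s w)\<^sup>2) \<le>
          2 * ennreal ((?S s - K s w)\<^sup>2) + ennreal (2 * (C\<^sup>2 * \<delta>2\<^sup>2))" by (simp only:)
        then show ?thesis using s' s True by simp
      qed
    qed measurable
    also have "(sq_int {0..a} ?K) = (sq_int {0..a} (\<lambda>s. K s w))"
      using a by (intro nn_integral_cong) (auto split: split_indicator)
    also have "\<dots> = ennreal (AK a w)" by (rule gE) (use a in simp)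
    also have "\<dots> \<le> ennreal e8" using gA[of a] a by (intro ennreal_leI) auto
    also have "(\<integral>\<^sup>+s\<in>{0..N}. 2 * ennreal ((?S s - ?K s)\<^sup>2) \<partial>lborel) = 2 * (sq_int {0..N} (\<lambda>s. ?S s - ?K s))"
      by (subst nn_integral_cmult[symmetric]) (auto simp: mult.assoc)
    also have "(sq_int {0..N} (\<lambda>s. ?S s - ?K s)) = (sq_int {0..N} (\<lambda>s. simple_process S s w - K s w))"
      by (intro nn_integral_cong) (auto split: split_indicator)
    also note gS
    also have "(\<integral>\<^sup>+s\<in>{0..N}. ennreal (2 * (C\<^sup>2 * \<delta>2\<^sup>2)) \<partial>lborel) = ennreal (2 * (C\<^sup>2 * \<delta>2\<^sup>2)) * ennreal N"
      using N by (subst nn_integral_cmult_indicator) auto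
    finally have "(sq_int {0..t} (\<lambda>s. simple_process U s w * (c * s powr \<beta>) - K s w)) \<le>
       ennreal e8 + 2 * ennreal e3 + ennreal (2 * (C\<^sup>2 * \<delta>2\<^sup>2)) * ennreal N"
      by (simp add: add_mono mult_left_mono)
    also have "\<dots> = ennreal (e8 + 2 * e3 + 2 * (C\<^sup>2 * \<delta>2\<^sup>2) * N)"
    proof -
      have "2 * ennreal e3 = ennreal (2 * e3)" using e3 ennreal_mult[of 2 e3] by simp
      moreover have "ennreal (2 * (C\<^sup>2 * \<delta>2\<^sup>2)) * ennreal N = ennreal (2 * (C\<^sup>2 * \<delta>2\<^sup>2) * N)"
        using N by (intro ennreal_mult[symmetric]) auto
      moreover have "0 \<le> 2 * e3" "0 \<le> 2 * (C\<^sup>2 * \<delta>2\<^sup>2) * N" "0 \<le> e8" using e3 N e8 by auto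
      ultimately show ?thesis by (simp only: ennreal_plus[symmetric] add_nonneg_nonneg)
    qed
    also have "\<dots> \<le> ennreal e"
    proof (rule ennreal_leI)
      have "2 * (C\<^sup>2 * \<delta>2\<^sup>2) * N \<le> e8" using \<delta>2(2) by (simp add: mult.commute mult.left_commute)
      then show "e8 + 2 * e3 + 2 * (C\<^sup>2 * \<delta>2\<^sup>2) * N \<le> e" using e3 e by (simp add: e8_def)
    qed
    finally have 1: "(sq_int {0..t} (\<lambda>s. simple_process U s w * (c * s powr \<beta>) - K s w)) \<le> ennreal e" .
    have "\<bar>simple_integral (\<lambda>t w. c * W t w) U s w - Y s w\<bar> \<le> e" if s: "s \<in> {0..t}" for s
    proof -
      have sN: "s \<le> N" "0 \<le> s" using s N by auto
      let ?X = "\<lambda>u. simple_integral B S u w" and ?Z = "\<lambda>u. simple_integral W S u w"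
      \<comment> \<open>The integral of \<open>S\<close> against \<open>W\<close> is the weighted
        version of that against \<open>B\<close>. Riemann sums with reciprocal weights therefore
        lead from \<open>?Z\<close> back to increments of \<open>?X\<close>.\<close>
      have wXZ: "weighted \<beta> ?X ?Z"
        by (rule simple_integral_weighted[where X=B and W=W and w=w, OF S(1) gw continuous_adaptedD(4)[OF B_cont w]])
      have "\<bar>(\<Sum>i<m. v i powr (- \<beta>) * (?Z (min s (v (Suc i))) - ?Z (min s (v i)))) - (\<Sum>i<m. v i powr (- \<beta>) * v i powr \<beta> * (?X (min s (v (Suc i))) - ?X (min s (v i))))\<bar>
        \<le> D0 * \<bar>\<beta>\<bar> * \<delta>1 * D1 * (N - a)"
        unfolding v_def
      proof (rule riemann_cells[OF wXZ X(2)[OF w] a(1,4) m(1) _ D1(2)])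
        show "\<bar>?X y - ?X x\<bar> \<le> \<delta>1" if "a \<le> x" "x \<le> y" "y \<le> N" "y - x \<le> (N - a) / real m" for x y
          using that a m by (intro gO) auto
        show "\<bar>grid_point a N m i powr (- \<beta>)\<bar> \<le> D0" if "i < m" for i
          using D0(2)[of "grid_point a N m i"] gp(5)[of i] gp(6)[of i] that by (simp add: v_def)
      qed (use sN in auto)
      also have "\<dots> \<le> e8"
      proof -
        have "D0 * \<bar>\<beta>\<bar> * \<delta>1 * D1 * (N - a) \<le> D0 * \<bar>\<beta>\<bar> * \<delta>1 * D1 * N" using a \<delta>1 D0 D1 by (intro mult_left_mono) auto
        then show ?thesis using \<delta>1(2) by (simp add: ac_simps)
      qed
      finally have p2: "\<bar>(\<Sum>i<m. v i powr (- \<beta>) * (?Z (min s (v (Suc i))) - ?Z (min s (v i)))) - (\<Sum>i<m. ?X (min s (v (Suc i))) - ?X (min s (v i)))\<bar> \<le> e8"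
        by (simp only: vinv mult_1)
      have U': "simple_integral (\<lambda>t w. c * W t w) U s w = (\<Sum>i<m. v i powr (- \<beta>) * (?Z (min s (v (Suc i))) - ?Z (min s (v i))))"
        unfolding simple_integral_cmult U(3) sum_distrib_left using c by (intro sum.cong) auto
      have tel: "(\<Sum>i<m. ?X (min s (v (Suc i))) - ?X (min s (v i))) = ?X s - ?X (min s a)"
        unfolding v_def by (rule sum_grid_telescope[OF a(4) m(1) sN(1)])
      have p3: "\<bar>?X (min s a)\<bar> \<le> e8" by (rule gX) (use sN a in auto)
      have p4: "\<bar>?X s - Y s w\<bar> \<le> e3" by (rule gY) (use sN in auto)
      have "\<bar>simple_integral (\<lambda>t w. c * W t w) U s w - Y s w\<bar> \<le> e8 + e8 + e3" using p2 p3 p4 unfolding tel U' by linarith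
      then show ?thesis using e e3 by (simp add: e8_def)
    qed
    with 1 show "(sq_int {0..t} (\<lambda>s. simple_process U s w * (c * s powr \<beta>) - K s w)) \<le> ennreal e \<and>
      (\<forall>s\<in>{0..t}. \<bar>simple_integral (\<lambda>t w. c * W t w) U s w - Y s w\<bar> \<le> e)" by blast
  qed
  with U(1) show ?thesis by blast
qed

end

section \<open>Characteristic functions and Brownian increments\<close>

lemma char_normal:
  assumes "prob_space N" and d: "distributed N lborel X (\<lambda>x. ennreal (normal_density 0 \<sigma> x))" and \<sigma>: "0 < \<sigma>"
  shows "(\<integral>w. iexp (\<theta> * X w) \<partial>N) = complex_of_real (exp (- (\<theta>\<^sup>2 * \<sigma>\<^sup>2 / 2)))"
proof -
  interpret prob_space N by fact
  have [measurable]: "X \<in> borel_measurable N" using distributed_measurable[OF d] by simp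
  have d': "distributed N lborel (\<lambda>x. X x / \<sigma>) (\<lambda>x. ennreal (std_normal_density x))"
    using d normal_standard_normal_convert[OF \<sigma>, of X 0] by simp
  have "(\<integral>w. iexp (\<theta> * X w) \<partial>N) = (\<integral>w. iexp ((\<theta> * \<sigma>) * (X w / \<sigma>)) \<partial>N)" using \<sigma> by simp
  also have "\<dots> = (\<integral>x. iexp ((\<theta> * \<sigma>) * x) \<partial>(distr N lborel (\<lambda>x. X x / \<sigma>)))"
    by (subst integral_distr) auto
  also have "distr N lborel (\<lambda>x. X x / \<sigma>) = std_normal_distribution"
    using distributed_distr_eq_density[OF d'] by simp
  also have "(\<integral>x. iexp ((\<theta> * \<sigma>) * x) \<partial>std_normal_distribution) = char std_normal_distribution (\<theta> * \<sigma>)"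
    by (simp add: char_def)
  also have "\<dots> = complex_of_real (exp (- (\<theta>\<^sup>2 * \<sigma>\<^sup>2 / 2)))"
    by (simp add: char_std_normal_distribution power_mult_distrib)
  finally show ?thesis .
qed

context filtered_space begin

text \<open>Under the conditional probability given any event of \<open>F s\<close> of positive
  probability, \<open>X\<close> has the same normal characteristic function. By uniqueness its
  conditional law is always the same, which is independence; the whole space gives the law
  itself.\<close>

lemma normal_indep_of_char:
  assumes X: "X \<in> borel_measurable M" and v: "0 < v"
    and ch: "\<And>A \<theta>. A \<in> sets (F s) \<Longrightarrow>
      (\<integral>w. indicator A w *\<^sub>R iexp (\<theta> * X w) \<partial>M) = complex_of_real (prob A * exp (- (\<theta>\<^sup>2 * v / 2)))"
  shows "distributed M lborel X (\<lambda>x. ennreal (normal_density 0 (sqrt v) x))"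
    and "indep_set (sets (F s)) {X -` C \<inter> space M |C. C \<in> sets borel}"
proof -
  define \<nu> where "\<nu> = density lborel (\<lambda>x. ennreal (normal_density 0 (sqrt v) x))"
  have sv: "0 < sqrt v" using v by simp
  interpret \<nu>: prob_space \<nu> unfolding \<nu>_def by (rule prob_space_normal_density[OF sv])
  have r\<nu>: "real_distribution \<nu>" by unfold_locales (auto simp: \<nu>_def)
  have "distributed \<nu> lborel (\<lambda>x. x) (\<lambda>x. ennreal (normal_density 0 (sqrt v) x))"
    unfolding distributed_def \<nu>_def by (auto simp: distr_id2)
  from char_normal[OF \<nu>.prob_space_axioms this sv] v
  have char\<nu>: "char \<nu> \<theta> = complex_of_real (exp (- (\<theta>\<^sup>2 * v / 2)))" for \<theta> by (simp add: char_def)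
  have key: "prob (A \<inter> (X -` C \<inter> space M)) = prob A * measure \<nu> C" if A: "A \<in> sets (F s)" and C: "C \<in> sets borel" for A C
  proof (cases "prob A = 0")
    case True
    have "prob (A \<inter> (X -` C \<inter> space M)) \<le> prob A" using sets_F_M[OF A] by (intro finite_measure_mono) auto
    then show ?thesis using True measure_nonneg[of M "A \<inter> (X -` C \<inter> space M)"] by simp
  next
    case False
    have AM [measurable]: "A \<in> sets M" by (rule sets_F_M[OF A])
    have pA: "0 < prob A" using False measure_nonneg[of M A] by linarith
    \<comment> \<open>The conditional probability given \<open>A\<close>.\<close>
    define \<mu> where "\<mu> = density M (\<lambda>w. ennreal (indicator A w / prob A))"
    have em: "emeasure \<mu> Y = ennreal (prob (A \<inter> Y) / prob A)" if Y: "Y \<in> sets M" for Y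
    proof -
      have "emeasure \<mu> Y = (\<integral>\<^sup>+w. ennreal (1 / prob A) * indicator (A \<inter> Y) w \<partial>M)"
        unfolding \<mu>_def using Y by (subst emeasure_density) (auto intro!: nn_integral_cong split: split_indicator)
      also have "\<dots> = ennreal (1 / prob A) * emeasure M (A \<inter> Y)" using Y by (intro nn_integral_cmult_indicator) auto
      also have "\<dots> = ennreal (prob (A \<inter> Y) / prob A)"
        unfolding emeasure_eq_measure using pA by (simp add: ennreal_mult[symmetric])
      finally show ?thesis .
    qed
    have "A \<inter> space M = A" using sets.sets_into_space[OF AM] by auto
    then have "emeasure \<mu> (space M) = 1" using em[OF sets.top] pA by simp
    then have "emeasure \<mu> (space \<mu>) = 1" by (simp add: \<mu>_def)
    then interpret \<mu>: prob_space \<mu> by (rule prob_spaceI)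
    have X\<mu> [measurable]: "X \<in> borel_measurable \<mu>" using X by (simp add: \<mu>_def)
    define \<rho> where "\<rho> = distr \<mu> borel X"
    have r\<rho>: "real_distribution \<rho>" unfolding \<rho>_def by (rule \<mu>.real_distribution_distr[OF X\<mu>])
    have "char \<rho> \<theta> = char \<nu> \<theta>" for \<theta>
    proof -
      have "char \<rho> \<theta> = (\<integral>w. iexp (\<theta> * X w) \<partial>\<mu>)"
        unfolding char_def \<rho>_def by (subst integral_distr) auto
      also have "\<dots> = (\<integral>w. (indicator A w / prob A) *\<^sub>R iexp (\<theta> * X w) \<partial>M)"
        unfolding \<mu>_def using X pA by (subst integral_density) auto
      also have "\<dots> = (\<integral>w. (1 / prob A) *\<^sub>R (indicator A w *\<^sub>R iexp (\<theta> * X w)) \<partial>M)"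
        by (intro Bochner_Integration.integral_cong) auto
      also have "\<dots> = (1 / prob A) *\<^sub>R (\<integral>w. indicator A w *\<^sub>R iexp (\<theta> * X w) \<partial>M)"
        by (rule integral_scaleR_right)
      also have "\<dots> = char \<nu> \<theta>" unfolding ch[OF A] char\<nu> using pA by (simp add: scaleR_conv_of_real)
      finally show ?thesis .
    qed
    then have "char \<rho> = char \<nu>" by auto
    then have "\<rho> = \<nu>" by (rule Levy_uniqueness[OF r\<rho> r\<nu>])
    then have "measure \<nu> C = measure \<rho> C" by simp
    also have "\<dots> = measure \<mu> (X -` C \<inter> space M)"
      unfolding \<rho>_def using C X by (subst measure_distr) (auto simp: \<mu>_def)
    also have "\<dots> = prob (A \<inter> (X -` C \<inter> space M)) / prob A"
      using em[of "X -` C \<inter> space M"] measurable_sets[OF X C] by (simp add: measure_def)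
    finally show ?thesis using pA by simp
  qed
  have pX: "prob (X -` C \<inter> space M) = measure \<nu> C" if "C \<in> sets borel" for C
  proof -
    have "space M \<in> sets (F s)" using sets.top[of "F s"] by simp
    moreover have "space M \<inter> (X -` C \<inter> space M) = X -` C \<inter> space M" by auto
    ultimately show ?thesis using key[of "space M" C] that by (simp add: prob_space)
  qed
  have "distr M lborel X = \<nu>"
  proof (rule measure_eqI)
    fix C assume C: "C \<in> sets (distr M lborel X)"
    then have "emeasure (distr M lborel X) C = ennreal (prob (X -` C \<inter> space M))"
      using X by (subst emeasure_distr) (auto simp: emeasure_eq_measure)
    also have "\<dots> = ennreal (measure \<nu> C)" using pX[of C] C by simp
    also have "\<dots> = emeasure \<nu> C" by (simp add: \<nu>.emeasure_eq_measure)
    finally show "emeasure (distr M lborel X) C = emeasure \<nu> C" .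
  qed (simp add: \<nu>_def)
  then show "distributed M lborel X (\<lambda>x. ennreal (normal_density 0 (sqrt v) x))"
    unfolding distributed_def \<nu>_def using X by auto
  show "indep_set (sets (F s)) {X -` C \<inter> space M |C. C \<in> sets borel}"
  proof (rule indep_setI)
    show "sets (F s) \<subseteq> events" using sets_F_M by auto
    show "{X -` C \<inter> space M |C. C \<in> sets borel} \<subseteq> events" using measurable_sets[OF X] by auto
    fix A Y assume A: "A \<in> sets (F s)" and "Y \<in> {X -` C \<inter> space M |C. C \<in> sets borel}"
    then obtain C where "Y = X -` C \<inter> space M" "C \<in> sets borel" by auto
    then show "prob (A \<inter> Y) = prob A * prob Y" using key[OF A] pX by simp
  qed
qed

end

context brownian_space begin

text \<open>The last increment is independent of the indicator and of all earlier increments, so its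
  exponential factors out and multiplies the accumulated Gaussian factor.\<close>

lemma char_step_sum:
  assumes v: "0 \<le> v 0" "\<And>i. i < n \<Longrightarrow> v i \<le> v (Suc i)" and A: "A \<in> sets (F (v 0))" and "k \<le> n"
  shows "(\<integral>w. indicator A w *\<^sub>R iexp (\<theta> * (\<Sum>i<k. c i * (B (v (Suc i)) w - B (v i) w))) \<partial>M) =
    complex_of_real (prob A * exp (- (\<theta>\<^sup>2 * (\<Sum>i<k. (c i)\<^sup>2 * (v (Suc i) - v i)) / 2)))"
  using \<open>k \<le> n\<close>
proof (induction k)
  case 0
  have "A \<in> sets M" by (rule sets_F_M[OF A])
  then show ?case by (simp add: scaleR_conv_of_real)
next
  case (Suc k)
  have mono: "v i \<le> v j" if "i \<le> j" "j \<le> n" for i j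
    using that
  proof (induction j)
    case (Suc j) then show ?case using v(2)[of j] by (cases "i = Suc j") auto
  qed simp
  have vk: "0 \<le> v k" "v k \<le> v (Suc k)" using mono[of 0 k] mono[of k "Suc k"] v(1) Suc.prems by auto
  let ?\<Phi> = "\<lambda>w. \<Sum>i<k. c i * (B (v (Suc i)) w - B (v i) w)" and ?\<Delta> = "\<lambda>w. B (v (Suc k)) w - B (v k) w"
  let ?E = "\<lambda>w. indicator A w *\<^sub>R iexp (\<theta> * ?\<Phi> w)"
  have IH: "(\<integral>w. ?E w \<partial>M) = complex_of_real (prob A * exp (- (\<theta>\<^sup>2 * (\<Sum>i<k. (c i)\<^sup>2 * (v (Suc i) - v i)) / 2)))"
    using Suc by simp
  have split: "indicator A w *\<^sub>R iexp (\<theta> * (\<Sum>i<Suc k. c i * (B (v (Suc i)) w - B (v i) w))) = ?E w * iexp ((\<theta> * c k) * ?\<Delta> w)" for w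
    by (simp add: exp_add[symmetric] algebra_simps scaleR_conv_of_real)
  show ?case
  proof (cases "v k = v (Suc k)")
    case True
    then show ?thesis unfolding split using IH by simp
  next
    case False
    then have lt: "v k < v (Suc k)" using vk by simp
    have B [measurable]: "B (v i) \<in> borel_measurable (F (v k))" if "i \<le> k" for i
      using mono[of 0 i] mono[of i k] v(1) that Suc.prems by (intro B_measurable) auto
    have \<Phi>: "?\<Phi> \<in> borel_measurable (F (v k))"
      by (intro borel_measurable_sum borel_measurable_times borel_measurable_diff borel_measurable_const B) auto
    have Ak: "A \<in> sets (F (v k))" using A sets_F_mono[of "v 0" "v k"] mono[of 0 k] Suc.prems by auto
    have Em: "?E \<in> borel_measurable (F (v k))"
      using \<Phi> Ak by (intro borel_measurable_scaleR borel_measurable_indicator measurable_compose[OF _ borel_measurable_exp]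
        borel_measurable_times borel_measurable_const borel_measurable_of_real) auto
    have ind': "indep_var borel ?E borel (\<lambda>w. iexp ((\<theta> * c k) * ?\<Delta> w))"
      by (rule increment_indep[OF vk(1) lt Em]) simp
    have iE: "integrable M ?E"
      using measurable_from_subalg[OF subalg Em]
      by (intro integrable_const_bound[where B=1] AE_I2) (auto split: split_indicator)
    have \<Delta>m: "?\<Delta> \<in> borel_measurable M"
      using continuous_adaptedD(2)[OF B_cont] vk by auto
    have i\<Delta>: "integrable M (\<lambda>w. iexp ((\<theta> * c k) * ?\<Delta> w))"
    proof (rule integrable_const_bound[where B=1])
      have "(\<lambda>x. iexp ((\<theta> * c k) * x)) \<in> borel_measurable borel" by measurable
      from measurable_compose[OF \<Delta>m this]
      show "(\<lambda>w. iexp ((\<theta> * c k) * ?\<Delta> w)) \<in> borel_measurable M" .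
    qed (simp add: norm_exp_i_times del: of_real_mult)
    have d: "distributed M lborel ?\<Delta> (\<lambda>x. ennreal (normal_density 0 (sqrt (v (Suc k) - v k)) x))"
      using brownian vk(1) lt by (auto simp: brownian_motion_def)
    have "(\<integral>w. iexp ((\<theta> * c k) * ?\<Delta> w) \<partial>M) = complex_of_real (exp (- ((\<theta> * c k)\<^sup>2 * (sqrt (v (Suc k) - v k))\<^sup>2 / 2)))"
      by (rule char_normal[OF prob_space_axioms d]) (use lt in simp)
    also have "(sqrt (v (Suc k) - v k))\<^sup>2 = v (Suc k) - v k" using lt by simp
    finally have c\<Delta>: "(\<integral>w. iexp ((\<theta> * c k) * ?\<Delta> w) \<partial>M) = complex_of_real (exp (- ((\<theta> * c k)\<^sup>2 * (v (Suc k) - v k) / 2)))" .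
    have "(\<integral>w. indicator A w *\<^sub>R iexp (\<theta> * (\<Sum>i<Suc k. c i * (B (v (Suc i)) w - B (v i) w))) \<partial>M) = (\<integral>w. ?E w * iexp ((\<theta> * c k) * ?\<Delta> w) \<partial>M)"
      by (intro Bochner_Integration.integral_cong refl split)
    also have "\<dots> = (\<integral>w. ?E w \<partial>M) * (\<integral>w. iexp ((\<theta> * c k) * ?\<Delta> w) \<partial>M)"
      by (rule indep_var_lebesgue_integral[OF ind' iE i\<Delta>])
    also have "\<dots> = complex_of_real (prob A * (exp (- (\<theta>\<^sup>2 * (\<Sum>i<k. (c i)\<^sup>2 * (v (Suc i) - v i)) / 2)) * exp (- ((\<theta> * c k)\<^sup>2 * (v (Suc k) - v k) / 2))))"
      unfolding IH c\<Delta> by simp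
    also have "exp (- (\<theta>\<^sup>2 * (\<Sum>i<k. (c i)\<^sup>2 * (v (Suc i) - v i)) / 2)) * exp (- ((\<theta> * c k)\<^sup>2 * (v (Suc k) - v k) / 2)) =
       exp (- (\<theta>\<^sup>2 * (\<Sum>i<Suc k. (c i)\<^sup>2 * (v (Suc i) - v i)) / 2))"
    proof -
      have "- (\<theta>\<^sup>2 * Q / 2) + - ((\<theta> * c k)\<^sup>2 * x / 2) = - (\<theta>\<^sup>2 * (Q + (c k)\<^sup>2 * x) / 2)" for Q x
        by (simp add: power_mult_distrib distrib_left add_divide_distrib)
      then show ?thesis by (simp only: exp_add[symmetric] sum.lessThan_Suc)
    qed
    finally show ?thesis .
  qed
qed

text \<open>Left-endpoint sums converge path by path to the increment of \<open>W\<close>, and their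
  variances, being Riemann sums of \<open>s^(2 \<beta>)\<close>, converge to its integral;
  exponentials are bounded, so expectations follow. The Riemann limit requires \<open>s > 0\<close>,
  and \<open>s = 0\<close> is reached by continuity of \<open>W\<close>.\<close>

lemma char_weighted_increment:
  assumes W: "continuous_adapted M F W" and wtd: "AE w in M. W 0 w = 0 \<and> weighted \<beta> (\<lambda>s. B s w) (\<lambda>s. W s w)"
    and \<beta>: "- 1 / 2 < \<beta>" and st: "0 \<le> s" "s < t" and A: "A \<in> sets (F s)"
  shows "(\<integral>w. indicator A w *\<^sub>R iexp (\<theta> * (W t w - W s w)) \<partial>M) =
    complex_of_real (prob A * exp (- (\<theta>\<^sup>2 * ((t powr (2 * \<beta> + 1) - s powr (2 * \<beta> + 1)) / (2 * \<beta> + 1)) / 2)))"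
proof -
  let ?Z = "\<lambda>u. u powr (2 * \<beta> + 1) / (2 * \<beta> + 1)"
  have AM: "A \<in> sets M" by (rule sets_F_M[OF A])
  have Wm: "W u \<in> borel_measurable M" if "0 \<le> u" for u by (rule continuous_adaptedD(2)[OF W that])
  have dom: "(\<lambda>n. \<integral>w. indicator A w *\<^sub>R iexp (\<theta> * X n w) \<partial>M) \<longlonglongrightarrow> (\<integral>w. indicator A w *\<^sub>R iexp (\<theta> * X' w) \<partial>M)"
    if X: "\<And>n. X n \<in> borel_measurable M" "X' \<in> borel_measurable M" "AE w in M. (\<lambda>n. X n w) \<longlonglongrightarrow> X' w" for X :: "nat \<Rightarrow> 'a \<Rightarrow> real" and X'
  proof (rule integral_dominated_convergence[where w="\<lambda>_. 1"])
    show "AE w in M. (\<lambda>n. indicator A w *\<^sub>R iexp (\<theta> * X n w)) \<longlonglongrightarrow> indicator A w *\<^sub>R iexp (\<theta> * X' w)"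
      using X(3) by eventually_elim (intro tendsto_intros)
    show "AE w in M. norm (indicator A w *\<^sub>R iexp (\<theta> * X n w)) \<le> 1" for n
      by (intro AE_I2) (auto split: split_indicator)
  qed (use X AM in auto)
  have pos: "(\<integral>w. indicator A w *\<^sub>R iexp (\<theta> * (W t w - W s w)) \<partial>M) = complex_of_real (prob A * exp (- (\<theta>\<^sup>2 * (?Z t - ?Z s) / 2)))"
    if s: "0 < s" "s < t" and A: "A \<in> sets (F s)" for s
  proof -
    let ?v = "\<lambda>m. grid_point s t (Suc m)"
    have st': "s \<le> t" using s by simp
    note gp = grid_point_props[OF st', of "Suc _"]
    let ?X = "\<lambda>m w. \<Sum>i<Suc m. ?v m i powr \<beta> * (B (?v m (Suc i)) w - B (?v m i) w)"
    have Bm: "B u \<in> borel_measurable M" if "0 \<le> u" for u by (rule continuous_adaptedD(2)[OF B_cont that])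
    have L1: "(\<lambda>m. \<integral>w. indicator A w *\<^sub>R iexp (\<theta> * ?X m w) \<partial>M) \<longlonglongrightarrow> (\<integral>w. indicator A w *\<^sub>R iexp (\<theta> * (W t w - W s w)) \<partial>M)"
    proof (rule dom)
      show "?X m \<in> borel_measurable M" for m
      proof (intro borel_measurable_sum borel_measurable_times borel_measurable_diff borel_measurable_const Bm)
        show "0 \<le> ?v m i" "0 \<le> ?v m (Suc i)" for i
          using gp(5)[of m i] gp(5)[of m "Suc i"] s by auto
      qed
      show "(\<lambda>w. W t w - W s w) \<in> borel_measurable M" using Wm s by auto
      show "AE w in M. (\<lambda>m. ?X m w) \<longlonglongrightarrow> W t w - W s w"
        using wtd AE_space
      proof eventually_elim
        case (elim w)
        show ?case
          using LIMSEQ_Suc[OF riemann_limit[OF conjunct2[OF elim(1)] continuous_adaptedD(4)[OF B_cont elim(2)] s(1) st']] .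
      qed
    qed
    have L2: "(\<integral>w. indicator A w *\<^sub>R iexp (\<theta> * ?X m w) \<partial>M) =
       complex_of_real (prob A * exp (- (\<theta>\<^sup>2 * (\<Sum>i<Suc m. ?v m i powr (2 * \<beta>) * (?v m (Suc i) - ?v m i)) / 2)))" for m
    proof -
      have "(x powr \<beta>)\<^sup>2 = x powr (2 * \<beta>)" for x :: real by (simp add: power2_eq_square powr_add[symmetric])
      moreover have "A \<in> sets (F (?v m 0))" "0 \<le> ?v m 0" using A gp(1)[of m] s by auto
      ultimately show ?thesis
        using char_step_sum[of "?v m" "Suc m" A "Suc m" \<theta> "\<lambda>i. ?v m i powr \<beta>"] gp(3)[of m] by simp
    qed
    have L3: "(\<lambda>m. complex_of_real (prob A * exp (- (\<theta>\<^sup>2 * (\<Sum>i<Suc m. ?v m i powr (2 * \<beta>) * (?v m (Suc i) - ?v m i)) / 2))))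
       \<longlonglongrightarrow> complex_of_real (prob A * exp (- (\<theta>\<^sup>2 * (?Z t - ?Z s) / 2)))"
    proof (intro tendsto_of_real tendsto_mult tendsto_const tendsto_exp tendsto_minus tendsto_divide)
      have "2 * \<beta> \<noteq> -1" using \<beta> by simp
      from LIMSEQ_Suc[OF riemann_limit[OF weighted_identity[OF this] continuous_on_id s(1) st']]
      show "(\<lambda>m. \<Sum>i<Suc m. ?v m i powr (2 * \<beta>) * (?v m (Suc i) - ?v m i)) \<longlonglongrightarrow> ?Z t - ?Z s" .
    qed simp
    show ?thesis by (rule LIMSEQ_unique[OF L1 L3[folded L2]])
  qed
  have Zs: "(t powr (2 * \<beta> + 1) - s powr (2 * \<beta> + 1)) / (2 * \<beta> + 1) = ?Z t - ?Z s" by (simp add: diff_divide_distrib)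
  show ?thesis
  proof (cases "s = 0")
    case False
    then show ?thesis unfolding Zs using pos[OF _ st(2) A] st by simp
  next
    case True
    \<comment> \<open>The offset 2 keeps every \<open>r n\<close> strictly below \<open>t\<close>,
      as the case of a positive left end demands.\<close>
    define r where "r n = t / real (Suc (Suc n))" for n
    have t0: "0 < t" using st by simp
    have r: "0 < r n" "r n < t" for n
    proof -
      show "0 < r n" using t0 by (simp add: r_def)
      have "t * 1 < t * real (Suc (Suc n))" using t0 by (intro mult_strict_left_mono) auto
      then show "r n < t" using t0 by (simp add: r_def pos_divide_less_eq del: of_nat_Suc)
    qed
    have r0: "r \<longlonglongrightarrow> 0" unfolding r_def by (intro LIMSEQ_Suc lim_const_over_n)
    have L1: "(\<lambda>n. \<integral>w. indicator A w *\<^sub>R iexp (\<theta> * (W t w - W (r n) w)) \<partial>M) \<longlonglongrightarrow> (\<integral>w. indicator A w *\<^sub>R iexp (\<theta> * (W t w - W s w)) \<partial>M)"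
    proof (rule dom)
      show "(\<lambda>w. W t w - W (r n) w) \<in> borel_measurable M" for n using Wm[of t] Wm[of "r n"] r(1)[of n] t0 by auto
      show "(\<lambda>w. W t w - W s w) \<in> borel_measurable M" using Wm[of t] Wm[of s] st by auto
      show "AE w in M. (\<lambda>n. W t w - W (r n) w) \<longlonglongrightarrow> W t w - W s w"
      proof (rule AE_I2)
        fix w assume w: "w \<in> space M"
        have "(\<lambda>n. W (r n) w) \<longlonglongrightarrow> W 0 w"
        proof (rule continuous_on_tendsto_compose[OF continuous_adaptedD(4)[OF W w] r0])
          show "\<forall>\<^sub>F n in sequentially. r n \<in> {0..}"
            using less_imp_le[OF r(1)] by (intro always_eventually allI) simp
        qed simp
        then show "(\<lambda>n. W t w - W (r n) w) \<longlonglongrightarrow> W t w - W s w" using True by (intro tendsto_intros) simp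
      qed
    qed
    have "A \<in> sets (F (r n))" for n using A True sets_F_mono[of 0 "r n"] r(1)[of n] by auto
    then have L2: "(\<integral>w. indicator A w *\<^sub>R iexp (\<theta> * (W t w - W (r n) w)) \<partial>M) = complex_of_real (prob A * exp (- (\<theta>\<^sup>2 * (?Z t - ?Z (r n)) / 2)))" for n
      by (intro pos r)
    have L3: "(\<lambda>n. complex_of_real (prob A * exp (- (\<theta>\<^sup>2 * (?Z t - ?Z (r n)) / 2)))) \<longlonglongrightarrow> complex_of_real (prob A * exp (- (\<theta>\<^sup>2 * (?Z t - ?Z 0) / 2)))"
    proof (intro tendsto_of_real tendsto_mult tendsto_const tendsto_exp tendsto_minus tendsto_divide tendsto_diff)
      have "(\<lambda>n. r n powr (2 * \<beta> + 1)) \<longlonglongrightarrow> 0 powr (2 * \<beta> + 1)"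
      proof (rule tendsto_powr'[OF r0 tendsto_const])
        have "\<forall>\<^sub>F n in sequentially. 0 \<le> r n"
          by (intro always_eventually allI less_imp_le r(1))
        then show "0 \<noteq> (0::real) \<or> 0 < 2 * \<beta> + 1 \<and> (\<forall>\<^sub>F n in sequentially. 0 \<le> r n)" using \<beta> by simp
      qed
      then show "(\<lambda>n. r n powr (2 * \<beta> + 1)) \<longlonglongrightarrow> 0 powr (2 * \<beta> + 1)" .
    qed (use \<beta> in auto)
    show ?thesis unfolding Zs by (rule LIMSEQ_unique[OF L1 L3[folded L2, folded True]])
  qed
qed

end

subsection \<open>Stieltjes integrals and time change\<close>

lemma
  assumes l: "continuous_on {0..} l" "mono_on {0..} l"
  shows sets_stieltjes: "sets (stieltjes l) = sets borel" and space_stieltjes: "space (stieltjes l) = UNIV"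
    and emeasure_stieltjes: "a \<le> b \<Longrightarrow> emeasure (stieltjes l) {a<..b} = ennreal (l (max 0 b) - l (max 0 a))"
proof -
  have c: "continuous_on UNIV (\<lambda>s. l (max 0 s))"
    by (intro continuous_on_compose2[OF l(1)] continuous_intros) auto
  show "sets (stieltjes l) = sets borel" "space (stieltjes l) = UNIV" by (auto simp: stieltjes_def)
  show "emeasure (stieltjes l) {a<..b} = ennreal (l (max 0 b) - l (max 0 a))" if "a \<le> b"
    unfolding stieltjes_def
  proof (rule emeasure_interval_measure_Ioc[OF that])
    show "l (max 0 x) \<le> l (max 0 y)" if "x \<le> y" for x y
      using that by (intro mono_onD[OF l(2)]) auto
    show "continuous (at_right a) (\<lambda>s. l (max 0 s))" for a
      using c by (meson UNIV_I continuous_on_eq_continuous_within continuous_within_subset subset_UNIV)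
  qed
qed

text \<open>The increments of D are o(y - v), so its derivative vanishes.\<close>

lemma constant_if_small_increments:
  fixes D l :: "real \<Rightarrow> real"
  assumes l: "continuous_on {0..} l" and ab: "0 < a" "a \<le> b"
    and bd: "\<And>v y. a / 2 \<le> v \<Longrightarrow> v \<le> y \<Longrightarrow> y \<le> b + 1 \<Longrightarrow> \<bar>D y - D v\<bar> \<le> C * (y - v) * (l y - l v)"
  shows "D a = D b"
proof -
  \<comment> \<open>The hypothesis extends beyond \<open>{a..b}\<close> on both sides, which leaves
    room for two-sided difference quotients at the endpoints.\<close>
  have "(D has_real_derivative 0) (at x)" if x: "x \<in> {a..b}" for x
    unfolding DERIV_def
  proof (rule Lim_null_comparison)
    have "continuous_on {a/2<..<b+1} l" using ab by (intro continuous_on_subset[OF l]) auto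
    then have "isCont l x" using x ab by (auto simp: continuous_on_eq_continuous_at)
    then have "((\<lambda>h. \<bar>C\<bar> * \<bar>l (x + h) - l x\<bar>) \<longlongrightarrow> \<bar>C\<bar> * \<bar>l x - l x\<bar>) (at 0)"
      by (intro tendsto_intros) (simp add: isCont_iff)
    then show "((\<lambda>h. \<bar>C\<bar> * \<bar>l (x + h) - l x\<bar>) \<longlongrightarrow> 0) (at 0)" by simp
    have "norm ((D (x + h) - D x) / h) \<le> \<bar>C\<bar> * \<bar>l (x + h) - l x\<bar>" if h: "h \<noteq> 0" "\<bar>h\<bar> < min (a/2) 1" for h
    proof -
      have "\<bar>D (x + h) - D x\<bar> \<le> C * h * (l (x + h) - l x)"
      proof (cases "0 < h")
        case True then show ?thesis using bd[of x "x + h"] x h by simp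
      next
        case False
        have "C * (x - (x + h)) * (l x - l (x + h)) = C * h * (l (x + h) - l x)" by (simp add: algebra_simps)
        then show ?thesis using bd[of "x + h" x] x h False by (simp only: abs_minus_commute) auto
      qed
      also have "\<dots> \<le> \<bar>C\<bar> * \<bar>h\<bar> * \<bar>l (x + h) - l x\<bar>" by (metis abs_ge_self abs_mult)
      finally have "\<bar>D (x + h) - D x\<bar> \<le> \<bar>C\<bar> * \<bar>h\<bar> * \<bar>l (x + h) - l x\<bar>" .
      then show ?thesis using h by (simp add: pos_divide_le_eq mult_ac)
    qed
    then show "\<forall>\<^sub>F h in at 0. norm ((D (x + h) - D x) / h) \<le> \<bar>C\<bar> * \<bar>l (x + h) - l x\<bar>"
      unfolding eventually_at using ab by (intro exI[of _ "min (a/2) 1"]) (auto simp: dist_real_def)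
  qed
  note D = this
  have "continuous_on {a..b} D"
    using DERIV_continuous_on[of "{a..b}" D "\<lambda>_. 0"] D by (auto intro: has_field_derivative_at_within)
  then show ?thesis
    using DERIV_isconst_end[of a b D] ab D by (cases "a = b") auto
qed

text \<open>One path of the local time together with its growth at 0; the condition on
  \<open>\<gamma> + \<eta>\<close> lets the exponent \<open>\<gamma>\<close> be negative.\<close>

locale monotone_path =
  fixes l :: "real \<Rightarrow> real" and \<gamma> K \<eta> t0 :: real
  assumes cont: "continuous_on {0..} l" and mono: "mono_on {0..} l" and l_0: "l 0 = 0"
    and t0: "0 < t0" and rate: "\<And>s. 0 < s \<Longrightarrow> s \<le> t0 \<Longrightarrow> \<bar>l s\<bar> \<le> K * s powr \<eta>" and \<eta>: "0 < \<gamma> + \<eta>"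
begin

lemmas measure_Ioc = emeasure_stieltjes[OF cont mono]
lemmas sets_l [simp, measurable_cong] = sets_stieltjes[OF cont mono]
lemmas space_l [simp] = space_stieltjes[OF cont mono]

lemma l_mono: "0 \<le> s \<Longrightarrow> s \<le> t \<Longrightarrow> l s \<le> l t"
  by (intro mono_onD[OF mono]) auto

text \<open>Up to \<open>t0\<close> the growth of \<open>l\<close> feeds the dyadic estimate; beyond
  it the weight is bounded and the mass finite.\<close>

lemma powr_integrable_pos: "set_integrable (stieltjes l) {0<..u} (\<lambda>s. s powr \<gamma>)"
proof -
  have "(\<integral>\<^sup>+s\<in>{0<..t0}. ennreal (s powr \<gamma>) \<partial>stieltjes l) < \<infinity>"
  proof (rule dyadic_moment_finite[where K = K and \<kappa> = \<eta>])
    show "emeasure (stieltjes l) {0<..s} \<le> ennreal (K * s powr \<eta>)" if "0 < s" "s \<le> t0" for s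
      using rate[OF that] that l_0 by (simp add: measure_Ioc ennreal_leI)
  qed (use t0 \<eta> in auto)
  then have 1: "set_integrable (stieltjes l) {0<..t0} (\<lambda>s. s powr \<gamma>)"
    unfolding set_integrable_def
  proof (intro integrableI_bounded)
    have "ennreal (norm (indicator {0<..t0} s *\<^sub>R s powr \<gamma>)) = ennreal (s powr \<gamma>) * indicator {0<..t0} s" for s
      by (simp split: split_indicator)
    then show "(\<integral>\<^sup>+s\<in>{0<..t0}. ennreal (s powr \<gamma>) \<partial>stieltjes l) < \<infinity> \<Longrightarrow>
      (\<integral>\<^sup>+s. ennreal (norm (indicator {0<..t0} s *\<^sub>R s powr \<gamma>)) \<partial>stieltjes l) < \<infinity>" by (simp only:)
  qed measurable
  obtain C where C: "0 < C" "\<And>s. t0 \<le> s \<Longrightarrow> s \<le> max t0 u \<Longrightarrow> s powr \<gamma> \<le> C"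
    using powr_bounded_on[OF t0] by blast
  have 2: "set_integrable (stieltjes l) {t0<..max t0 u} (\<lambda>s. s powr \<gamma>)"
    unfolding set_integrable_def
  proof (rule Bochner_Integration.integrable_bound)
    show "integrable (stieltjes l) (\<lambda>s. C * indicator {t0<..max t0 u} s)"
      by (intro integrable_mult_right integrable_real_indicator) (auto simp: measure_Ioc)
  qed (use C in \<open>auto split: split_indicator\<close>)
  show ?thesis
    by (rule set_integrable_subset[OF set_integrable_Un[OF 1 2]]) auto
qed

lemma powr_integrable: "set_integrable (stieltjes l) {0..u} (\<lambda>s. s powr \<gamma>)"
proof -
  \<comment> \<open>The added point 0 contributes nothing, since \<open>0 powr \<gamma>\<close> is
    0.\<close>
  have "(\<lambda>s. indicator {0..u} s *\<^sub>R s powr \<gamma>) = (\<lambda>s. indicator {0<..u} s *\<^sub>R s powr \<gamma>)"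
    by (auto split: split_indicator)
  then show ?thesis using powr_integrable_pos[of u] by (simp only: set_integrable_def)
qed

definition Z :: "real \<Rightarrow> real" where
  "Z u = (LINT s:{0..u}|stieltjes l. s powr \<gamma>)"

lemma Z_diff:
  assumes "0 \<le> a" "a \<le> b" shows "Z b - Z a = (LINT s:{a<..b}|stieltjes l. s powr \<gamma>)"
proof -
  have "(LINT s:{0..a} \<union> {a<..b}|stieltjes l. s powr \<gamma>) = Z a + (LINT s:{a<..b}|stieltjes l. s powr \<gamma>)"
    unfolding Z_def
    by (intro set_integral_Un powr_integrable set_integrable_subset[OF powr_integrable_pos[of b]]) (use assms in auto)
  moreover have "{0..a} \<union> {a<..b} = {0..b}" using assms by auto
  ultimately show ?thesis by (simp add: Z_def)
qed

lemma Z_mono: "0 \<le> a \<Longrightarrow> a \<le> b \<Longrightarrow> Z a \<le> Z b"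
  by (subst diff_ge_0_iff_ge[symmetric], subst Z_diff)
    (auto simp: set_lebesgue_integral_def intro!: Bochner_Integration.integral_nonneg)

text \<open>On the interval the weight varies by at most
  \<open>\<bar>\<gamma>\<bar> * D * (y - v)\<close>, by the mean value bound, and the measure has
  mass \<open>l y - l v\<close>. The error is a product of two small increments.\<close>

lemma Z_increment:
  assumes v: "0 < v" "v \<le> y" and D: "\<And>s. v \<le> s \<Longrightarrow> s \<le> y \<Longrightarrow> s powr (\<gamma> - 1) \<le> D"
  shows "\<bar>(Z y - Z v) - v powr \<gamma> * (l y - l v)\<bar> \<le> \<bar>\<gamma>\<bar> * D * (y - v) * (l y - l v)"
proof -
  have m: "measure (stieltjes l) {v<..y} = l y - l v" "emeasure (stieltjes l) {v<..y} < \<infinity>"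
    using v l_mono[of v y] by (auto simp: measure_def measure_Ioc)
  have c: "set_integrable (stieltjes l) {v<..y} (\<lambda>s. c)" "(LINT s:{v<..y}|stieltjes l. c) = c * (l y - l v)" for c :: real
    using m by (auto simp: set_integrable_def set_lebesgue_integral_def)
  have p: "set_integrable (stieltjes l) {v<..y} (\<lambda>s. s powr \<gamma>)"
    by (rule set_integrable_subset[OF powr_integrable_pos[of y]]) (use v in auto)
  have bound: "\<bar>s powr \<gamma> - v powr \<gamma>\<bar> \<le> \<bar>\<gamma>\<bar> * D * (y - v)" if s: "v \<le> s" "s \<le> y" for s
  proof -
    have D0: "0 \<le> D" using D[of v] v powr_ge_zero[of v "\<gamma> - 1"] by linarith
    have "norm (s powr \<gamma> - v powr \<gamma>) \<le> (\<bar>\<gamma>\<bar> * D) * norm (s - v)"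
    proof (rule field_differentiable_bound[of "{v..y}" "\<lambda>s. s powr \<gamma>" "\<lambda>s. \<gamma> * s powr (\<gamma> - 1)"])
      show "((\<lambda>s. s powr \<gamma>) has_field_derivative \<gamma> * z powr (\<gamma> - 1)) (at z within {v..y})" if "z \<in> {v..y}" for z
        using that v by (intro has_field_derivative_at_within[OF has_real_derivative_powr]) auto
      show "norm (\<gamma> * z powr (\<gamma> - 1)) \<le> \<bar>\<gamma>\<bar> * D" if "z \<in> {v..y}" for z
        using that D[of z] by (auto simp: abs_mult intro!: mult_left_mono)
    qed (use s in auto)
    also have "\<dots> \<le> (\<bar>\<gamma>\<bar> * D) * (y - v)" using s D0 by (intro mult_left_mono) auto
    finally show ?thesis by simp
  qed
  have "(Z y - Z v) - v powr \<gamma> * (l y - l v) = (LINT s:{v<..y}|stieltjes l. s powr \<gamma> - v powr \<gamma>)"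
    using v by (simp add: Z_diff set_integral_diff(2)[OF p c(1)] c(2))
  also have "\<bar>\<dots>\<bar> \<le> (LINT s:{v<..y}|stieltjes l. \<bar>s powr \<gamma> - v powr \<gamma>\<bar>)"
    using set_integral_norm_bound[OF set_integral_diff(1)[OF p c(1)]] by simp
  also have "\<dots> \<le> (LINT s:{v<..y}|stieltjes l. \<bar>\<gamma>\<bar> * D * (y - v))"
    using bound set_integrable_norm[OF set_integral_diff(1)[OF p c(1)]] by (intro set_integral_mono c(1)) auto
  finally show ?thesis by (simp add: c(2) mult_ac)
qed

lemmas by_parts_l = by_parts_props[OF cont t0 rate \<eta>]

text \<open>Integration by parts for the Stieltjes integral. Both sides have the increment
  \<open>v^\<gamma> * (l y - l v)\<close> up to a product of two small increments, so their
  difference has derivative zero on the open half-line. It vanishes because \<open>Z\<close> tends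
  to 0 there, the intervals \<open>{0..a n}\<close> shrinking to a point that carries no
  weight.\<close>

lemma Z_eq: assumes "0 \<le> u" shows "Z u = by_parts \<gamma> l u"
proof -
  let ?D = "\<lambda>u. Z u - by_parts \<gamma> l u"
  have const: "?D a = ?D b" if ab: "0 < a" "a \<le> b" for a b
  proof -
    obtain C where C: "0 < C" "\<And>s. a/2 \<le> s \<Longrightarrow> s \<le> b + 1 \<Longrightarrow> s powr (\<gamma> - 1) \<le> C"
      using powr_bounded_on[of "a/2"] ab by auto
    show ?thesis
    proof (rule constant_if_small_increments[OF cont ab, where C = "2 * (\<bar>\<gamma>\<bar> * C)"])
      fix v y assume v: "a / 2 \<le> v" "v \<le> y" "y \<le> b + 1"
      have "\<bar>(Z y - Z v) - v powr \<gamma> * (l y - l v)\<bar> \<le> \<bar>\<gamma>\<bar> * C * (y - v) * (l y - l v)"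
        using v ab by (intro Z_increment C) auto
      moreover have "\<bar>(by_parts \<gamma> l y - by_parts \<gamma> l v) - v powr \<gamma> * (l y - l v)\<bar> \<le> \<bar>\<gamma>\<bar> * (l y - l v) * C * (y - v)"
        using v ab l_mono by (intro weighted_increment_bound[OF by_parts_l(2) cont] C) (auto simp: abs_le_iff)
      ultimately show "\<bar>?D y - ?D v\<bar> \<le> 2 * (\<bar>\<gamma>\<bar> * C) * (y - v) * (l y - l v)"
        unfolding mult.assoc mult.left_commute[of "l y - l v"] mult.commute[of "l y - l v"] by linarith
    qed
  qed
  show ?thesis
  proof (cases "u = 0")
    case True
    have "Z 0 = (LINT s|stieltjes l. 0)" unfolding Z_def set_lebesgue_integral_def
      by (rule Bochner_Integration.integral_cong) (auto split: split_indicator)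
    then show ?thesis using True by_parts_l(1) by simp
  next
    case False
    then have u: "0 < u" using assms by simp
    define a where "a n = u / real (Suc n)" for n
    have a: "0 < a n" "a n \<le> u" for n using u mult_left_mono[of 1 "real (Suc n)" u] by (auto simp: a_def pos_divide_le_eq simp del: of_nat_Suc)
    have a0: "a \<longlonglongrightarrow> 0" unfolding a_def by (rule LIMSEQ_Suc[OF lim_const_over_n])
    have dec: "decseq (\<lambda>n. {0..a n})" using u by (auto simp: decseq_def a_def intro!: divide_left_mono elim!: order_trans)
    have "(\<Inter>n. {0..a n}) = {0}"
    proof (intro equalityI subsetI)
      fix x assume "x \<in> (\<Inter>n. {0..a n})"
      then have "0 \<le> x" "\<And>n. x \<le> a n" by auto
      then show "x \<in> {0}" using LIMSEQ_le_const[OF a0, of x] by auto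
    qed (use a in \<open>auto intro: less_imp_le\<close>)
    moreover have "(LINT s:{0}|stieltjes l. s powr \<gamma>) = (LINT s|stieltjes l. 0)" unfolding set_lebesgue_integral_def
      by (rule Bochner_Integration.integral_cong) (auto split: split_indicator)
    ultimately have "(\<lambda>n. Z (a n)) \<longlonglongrightarrow> 0"
      using set_integral_cont_down[OF _ dec powr_integrable] by (simp add: Z_def)
    moreover have "(\<lambda>n. by_parts \<gamma> l (a n)) \<longlonglongrightarrow> by_parts \<gamma> l 0"
      using a by (intro continuous_on_tendsto_compose[OF by_parts_l(3)] a0) (auto intro!: always_eventually less_imp_le)
    ultimately have "(\<lambda>n. ?D (a n)) \<longlonglongrightarrow> 0 - by_parts \<gamma> l 0" by (rule tendsto_diff)
    moreover have "?D (a n) = ?D u" for n by (rule const[OF a])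
    ultimately have "(\<lambda>n::nat. ?D u) \<longlonglongrightarrow> 0 - by_parts \<gamma> l 0" by (simp only:)
    then have "?D u = 0 - by_parts \<gamma> l 0" by (simp only: LIMSEQ_const_iff)
    then show ?thesis using by_parts_l(1) by simp
  qed
qed

lemma Z_cont: "continuous_on {0..} Z"
  using by_parts_l(3) by (subst continuous_on_cong[OF refl Z_eq]) auto

lemma time_changed_cont:
  assumes "0 < q" shows "continuous_on {0..} (\<lambda>t. k * Z (t powr q))"
  using assms by (intro continuous_intros continuous_on_compose2[OF Z_cont] continuous_on_powr') auto

lemma time_changed_mono:
  assumes "0 < q" "0 \<le> k" shows "mono_on {0..} (\<lambda>t. k * Z (t powr q))"
  using assms by (intro mono_onI mult_left_mono Z_mono powr_mono2) auto

text \<open>Identifies the measure of the time-changed path as an image of a density with respect to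
  the original one. Both measures are compared on half-open intervals, where each is an increment of
  \<open>Z\<close>.\<close>

lemma time_changed_stieltjes:
  assumes q: "0 < q" and k: "0 \<le> k"
  shows "stieltjes (\<lambda>t. k * Z (t powr q)) =
    distr (density (stieltjes l) (\<lambda>s. ennreal k * (ennreal (s powr \<gamma>) * indicator {0<..} s))) borel (\<lambda>u. u powr (1 / q))"
    (is "?A = ?D")
proof (rule measure_eqI_generator_eq[where \<Omega> = UNIV and E = "range (\<lambda>(a, b). {a<..b::real})" and A = "\<lambda>n. {- real n<..real n}"])
  note st = emeasure_stieltjes[OF time_changed_cont[OF q] time_changed_mono[OF q k]]
  show "Int_stable (range (\<lambda>(a, b). {a<..b::real}))" by (auto simp: Int_stable_def)
  show "sets ?A = sigma_sets UNIV (range (\<lambda>(a, b). {a<..b::real}))"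
    by (simp add: sets_stieltjes[OF time_changed_cont[OF q] time_changed_mono[OF q k]] borel_sigma_sets_Ioc)
  show "sets ?D = sigma_sets UNIV (range (\<lambda>(a, b). {a<..b::real}))" by (simp add: borel_sigma_sets_Ioc)
  show "(\<Union>n. {- real n<..real n}) = UNIV"
  proof (intro equalityI subsetI)
    fix x :: real
    obtain n where "\<bar>x\<bar> < real n" using reals_Archimedean2 by blast
    then show "x \<in> (\<Union>n. {- real n<..real n})" by (intro UN_I[of n]) auto
  qed simp
  show "emeasure ?A {- real n<..real n} \<noteq> \<infinity>" for n by (simp add: st)
  fix X assume "X \<in> range (\<lambda>(a, b). {a<..b::real})"
  then obtain a b where X: "X = {a<..b}" by auto
  show "emeasure ?A X = emeasure ?D X"
  proof (cases "a \<le> b")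
    case False then show ?thesis by (simp add: X)
  next
    case True
    \<comment> \<open>Clamping at 0 takes care of intervals reaching into the negative half-line,
      which neither measure charges.\<close>
    define a' b' where "a' = max 0 a powr q" and "b' = max 0 b powr q"
    have ab: "0 \<le> a'" "a' \<le> b'" using True q by (auto simp: a'_def b'_def intro!: powr_mono2)
    have iff: "s powr (1 / q) \<in> {a<..b} \<longleftrightarrow> s \<in> {a'<..b'}" if s: "0 < s" for s
    proof -
      have r: "0 < s powr (1 / q)" "s = (s powr (1/q)) powr q" using s q by (auto simp: powr_powr)
      have lt: "x < y \<longleftrightarrow> x powr q < y powr q" if "0 \<le> x" "0 \<le> y" for x y :: real
        using that q by (metis less_le_not_le linorder_not_le powr_less_mono2 powr_mono2 less_imp_le)
      have "a < s powr (1/q) \<longleftrightarrow> a' < s"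
        using lt[of "max 0 a" "s powr (1/q)"] r by (auto simp: a'_def)
      moreover have "s powr (1/q) \<le> b \<longleftrightarrow> s \<le> b'"
        using lt[of "max 0 b" "s powr (1/q)"] r less_trans[of b 0 "s powr (1/q)", OF _ r(1)] by (auto simp: b'_def not_less[symmetric] max_def split: if_splits)
      ultimately show ?thesis by auto
    qed
    have "emeasure ?D X = (\<integral>\<^sup>+s\<in>(\<lambda>u. u powr (1/q)) -` {a<..b}. ennreal k * (ennreal (s powr \<gamma>) * indicator {0<..} s) \<partial>stieltjes l)"
      using measurable_sets_borel[of "\<lambda>u. u powr (1/q)" borel "{a<..b}"]
      unfolding X by (subst emeasure_distr) (auto simp: emeasure_density)
    also have "\<dots> = (\<integral>\<^sup>+s. ennreal k * ennreal (indicator {a'<..b'} s *\<^sub>R s powr \<gamma>) \<partial>stieltjes l)"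
    proof (rule nn_integral_cong)
      fix s :: real
      show "ennreal k * (ennreal (s powr \<gamma>) * indicator {0<..} s) * indicator ((\<lambda>u. u powr (1/q)) -` {a<..b}) s =
        ennreal k * ennreal (indicator {a'<..b'} s *\<^sub>R s powr \<gamma>)"
        using iff[of s] ab by (cases "0 < s") (auto split: split_indicator)
    qed
    also have "\<dots> = ennreal k * (\<integral>\<^sup>+s. ennreal (indicator {a'<..b'} s *\<^sub>R s powr \<gamma>) \<partial>stieltjes l)"
      by (intro nn_integral_cmult) measurable
    moreover have Ioc: "{a'<..b'} \<subseteq> {0<..b'}" using ab by auto
    have "(\<integral>\<^sup>+s. ennreal (indicator {a'<..b'} s *\<^sub>R s powr \<gamma>) \<partial>stieltjes l) = ennreal (Z b' - Z a')"
      unfolding Z_diff[OF ab] set_lebesgue_integral_def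
      using set_integrable_subset[OF powr_integrable_pos[of b'], of "{a'<..b'}"] ab Ioc
      by (intro nn_integral_eq_integral) (auto simp: set_integrable_def)
    moreover have "ennreal k * ennreal (Z b' - Z a') = emeasure ?A X"
      using True k Z_mono[OF ab] by (simp add: X st a'_def b'_def ennreal_mult'[symmetric] algebra_simps)
    ultimately show ?thesis by (simp only:)
  qed
qed (auto simp: space_borel)

text \<open>A density does not destroy singularity, and the map with exponent \<open>1/q\<close> is
  differentiable on the positive half-line, hence sends null sets to null sets.\<close>

lemma time_changed_singular:
  assumes q: "0 < q" and k: "0 \<le> k" and sing: "lebesgue_singular (stieltjes l)"
  shows "lebesgue_singular (stieltjes (\<lambda>t. k * Z (t powr q)))"
proof -
  obtain N where N: "N \<in> null_sets lborel" "emeasure (stieltjes l) (- N) = 0"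
    using sing by (auto simp: lebesgue_singular_def)
  have Nb [measurable]: "N \<in> sets borel" using N(1) by (simp add: null_sets_def)
  \<comment> \<open>Restricted to positive times, where the power map is differentiable; the image
    measure lives on positive times as well.\<close>
  define N' where "N' = {t. 0 < t \<and> t powr q \<in> N}"
  have N'b [measurable]: "N' \<in> sets borel" unfolding N'_def by measurable
  have "N' \<subseteq> (\<lambda>u. u powr (1/q)) ` (N \<inter> {0<..})"
  proof
    fix t assume "t \<in> N'"
    then show "t \<in> (\<lambda>u. u powr (1/q)) ` (N \<inter> {0<..})"
      using q by (intro image_eqI[of _ _ "t powr q"]) (auto simp: N'_def powr_powr)
  qed
  moreover have "negligible ((\<lambda>u. u powr (1/q)) ` (N \<inter> {0<..}))"
  proof (rule negligible_differentiable_image_negligible)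
    have "negligible N" using N(1) Nb by (simp add: negligible_iff_null_sets null_sets_completion_iff)
    then show "negligible (N \<inter> {0<..})" by (rule negligible_subset) auto
    show "(\<lambda>u. u powr (1/q)) differentiable_on N \<inter> {0<..}"
      unfolding differentiable_on_def
    proof
      fix u assume "u \<in> N \<inter> {0<..}"
      then have "((\<lambda>u. u powr (1/q)) has_real_derivative (1/q) * u powr (1/q - 1)) (at u)"
        by (intro has_real_derivative_powr) auto
      then show "(\<lambda>u. u powr (1/q)) differentiable at u within N \<inter> {0<..}"
        by (meson real_differentiable_def differentiable_at_withinI)
    qed
  qed simp
  ultimately have "negligible N'" by (meson negligible_subset)
  then have null: "N' \<in> null_sets lborel" using N'b by (simp add: negligible_iff_null_sets null_sets_completion_iff)
  have "emeasure (stieltjes (\<lambda>t. k * Z (t powr q))) (- N') =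
      (\<integral>\<^sup>+s. ennreal k * (ennreal (s powr \<gamma>) * indicator {0<..} s) * indicator ((\<lambda>u. u powr (1/q)) -` (- N')) s \<partial>stieltjes l)"
    unfolding time_changed_stieltjes[OF q k]
    using measurable_sets_borel[of "\<lambda>u. u powr (1/q)" borel "- N'"] by (subst emeasure_distr) (auto simp: emeasure_density)
  also have "\<dots> = 0"
  proof (subst nn_integral_0_iff_AE)
    have "AE s in stieltjes l. s \<in> N"
      by (rule AE_I'[of "- N"]) (use N(2) Nb in \<open>auto simp: null_sets_def\<close>)
    then show "AE s in stieltjes l. ennreal k * (ennreal (s powr \<gamma>) * indicator {0<..} s) * indicator ((\<lambda>u. u powr (1/q)) -` (- N')) s = 0"
      by eventually_elim (use q in \<open>auto simp: N'_def powr_powr split: split_indicator\<close>)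
  qed measurable
  finally show ?thesis using null by (auto simp: lebesgue_singular_def)
qed

end

text \<open>The derivative \<open>q * s^(q-1)\<close> may be unbounded at 0, so the substitution is
  carried out on \<open>{a n..t}\<close> and extended by monotone convergence.\<close>

lemma nn_integral_powr_substitution:
  fixes f :: "real \<Rightarrow> ennreal"
  assumes [measurable]: "f \<in> borel_measurable borel" and q: "0 < q" and t: "0 \<le> t"
  shows "(\<integral>\<^sup>+u\<in>{0<..t powr q}. f u \<partial>lborel) = (\<integral>\<^sup>+s\<in>{0<..t}. f (s powr q) * ennreal (q * s powr (q - 1)) \<partial>lborel)"
proof (cases "t = 0")
  case False
  then have t: "0 < t" using t by simp
  define a where "a n = t / real (Suc (Suc n))" for n
  have a: "0 < a n" "a n < t" for n using t mult_strict_left_mono[of 1 "real (Suc (Suc n))" t] by (auto simp: a_def pos_divide_less_eq simp del: of_nat_Suc)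
  have a0: "a \<longlonglongrightarrow> 0" unfolding a_def by (rule LIMSEQ_Suc[OF LIMSEQ_Suc[OF lim_const_over_n]])
  have dec: "decseq a" using t by (auto simp: decseq_def a_def intro!: divide_left_mono)
  have un: "(\<Union>n. {a n..t}) = {0<..t}"
  proof (intro equalityI subsetI)
    fix s assume s: "s \<in> {0<..t}"
    then obtain n where "a n < s" using order_tendstoD(2)[OF a0, of s] by (auto simp: eventually_sequentially)
    then show "s \<in> (\<Union>n. {a n..t})" using s by (auto intro: less_imp_le)
  qed (use a in \<open>auto intro: less_le_trans\<close>)
  have un': "(\<Union>n. {a n powr q..t powr q}) = {0<..t powr q}"
  proof (intro equalityI subsetI)
    fix u assume u: "u \<in> {0<..t powr q}"
    then have "0 < u powr (1/q)" by simp
    then obtain n where "a n < u powr (1/q)" using order_tendstoD(2)[OF a0, of "u powr (1/q)"] by (auto simp: eventually_sequentially)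
    then have "a n powr q \<le> (u powr (1/q)) powr q" using a[of n] q by (intro powr_mono2) auto
    then show "u \<in> (\<Union>n. {a n powr q..t powr q})" using u q by (auto simp: powr_powr)
  next
    fix u assume "u \<in> (\<Union>n. {a n powr q..t powr q})"
    then obtain n where "a n powr q \<le> u" "u \<le> t powr q" by auto
    then show "u \<in> {0<..t powr q}" using a[of n] less_le_trans[of 0 "a n powr q" u] by auto
  qed
  have mono_lim: "(\<integral>\<^sup>+s\<in>(\<Union>n. A n). g s \<partial>lborel) = (SUP n. \<integral>\<^sup>+s\<in>A n. g s \<partial>lborel)"
    if "g \<in> borel_measurable borel" "incseq A" "\<And>n. A n \<in> sets borel" for g :: "real \<Rightarrow> ennreal" and A :: "nat \<Rightarrow> real set"
    using that SUP_emeasure_incseq[of A "density lborel g"] by (auto simp: emeasure_density image_subset_iff)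
  have i1: "incseq (\<lambda>n. {a n..t})" using dec by (force simp: incseq_def decseq_def intro: order_trans)
  have i2: "incseq (\<lambda>n. {a n powr q..t powr q})"
    unfolding incseq_def
  proof (intro allI impI)
    fix m n :: nat assume "m \<le> n"
    then have "a n \<le> a m" using dec by (simp add: decseq_def)
    then have "a n powr q \<le> a m powr q" using a[of n] q by (intro powr_mono2) auto
    then show "{a m powr q..t powr q} \<subseteq> {a n powr q..t powr q}" by auto
  qed
  have "(\<integral>\<^sup>+u\<in>{a n powr q..t powr q}. f u \<partial>lborel) = (\<integral>\<^sup>+s\<in>{a n..t}. f (s powr q) * ennreal (q * s powr (q - 1)) \<partial>lborel)" for n
  proof (rule nn_integral_substitution_aux)
    show "((\<lambda>s. s powr q) has_real_derivative q * x powr (q - 1)) (at x)" if "x \<in> {a n..t}" for x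
      using that a[of n] by (intro has_real_derivative_powr) auto
    show "continuous_on {a n..t} (\<lambda>s. q * s powr (q - 1))"
      using a[of n] by (intro continuous_intros) auto
  qed (use a q in auto)
  then show ?thesis
    unfolding un[symmetric] un'[symmetric] using i1 i2 by (subst (1 2) mono_lim) auto
qed simp

text \<open>The factor \<open>a\<close> may be negative, as it is for \<open>p < 0\<close>; the
  increments are dominated by those of the non-decreasing path with \<open>\<bar>a\<bar>\<close> in
  its place.\<close>

lemma bounded_variation_path_mono_combination:
  assumes f: "mono_on {0..} f" and g: "mono_on {0..} g"
  shows "bounded_variation_path (\<lambda>t. a * f t + g t)"
  unfolding bounded_variation_path_def
proof (intro allI impI exI)
  fix t :: real and n :: nat and u :: "nat \<Rightarrow> real"
  assume t: "0 \<le> t" and u: "mono_on {..n} u" "u ` {..n} \<subseteq> {0..t}"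
  let ?h = "\<lambda>s. \<bar>a\<bar> * f s + g s"
  have h: "?h x \<le> ?h y" if "0 \<le> x" "x \<le> y" for x y
    using that by (intro add_mono mult_left_mono mono_onD[OF f] mono_onD[OF g]) auto
  have u0: "0 \<le> u i \<and> u i \<le> t" if "i \<le> n" for i using u(2) that by auto
  have "(\<Sum>i<n. \<bar>(a * f (u (Suc i)) + g (u (Suc i))) - (a * f (u i) + g (u i))\<bar>) \<le> (\<Sum>i<n. ?h (u (Suc i)) - ?h (u i))"
  proof (rule sum_mono)
    fix i assume i: "i \<in> {..<n}"
    have le: "u i \<le> u (Suc i)" using mono_onD[OF u(1), of i "Suc i"] i by auto
    have tri: "\<bar>a * x + y\<bar> \<le> \<bar>a\<bar> * x + y" if "0 \<le> x" "0 \<le> y" for x y :: real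
      using abs_triangle_ineq[of "a * x" y] that by (simp add: abs_mult)
    have "0 \<le> f (u (Suc i)) - f (u i)" "0 \<le> g (u (Suc i)) - g (u i)"
      using mono_onD[OF f, of "u i" "u (Suc i)"] mono_onD[OF g, of "u i" "u (Suc i)"] u0[of i] u0[of "Suc i"] i le by auto
    from tri[OF this] show "\<bar>(a * f (u (Suc i)) + g (u (Suc i))) - (a * f (u i) + g (u i))\<bar> \<le> ?h (u (Suc i)) - ?h (u i)"
      by (simp add: algebra_simps)
  qed
  also have "\<dots> = ?h (u n) - ?h (u 0)" by (rule sum_lessThan_telescope)
  also have "\<dots> \<le> ?h t - ?h 0" using h[of "u n" t] h[of 0 "u 0"] u0[of n] u0[of 0] by linarith
  finally show "(\<Sum>i<n. \<bar>(a * f (u (Suc i)) + g (u (Suc i))) - (a * f (u i) + g (u i))\<bar>) \<le> ?h t - ?h 0" .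
qed

subsection \<open>The reinforced Bessel process\<close>

lemma set_integral_powr_substitution:
  fixes g :: "real \<Rightarrow> real"
  assumes g [measurable]: "g \<in> borel_measurable borel" and g0: "\<And>u. 0 \<le> g u" and q: "0 < q" and t: "0 \<le> t"
    and int: "set_integrable lborel {0..t powr q} g"
  shows "set_integrable lborel {0..t} (\<lambda>s. g (s powr q) * (q * s powr (q - 1)))"
    and "(LINT s:{0..t}|lborel. g (s powr q) * (q * s powr (q - 1))) = (LINT u:{0..t powr q}|lborel. g u)"
proof -
  let ?h = "\<lambda>s. g (s powr q) * (q * s powr (q - 1))"
  have eq: "(\<integral>\<^sup>+s. ennreal (indicator {0..T} s *\<^sub>R f s) \<partial>lborel) = (\<integral>\<^sup>+s\<in>{0<..T}. ennreal (f s) \<partial>lborel)" for T and f :: "real \<Rightarrow> real"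
  proof (rule nn_integral_cong_AE)
    show "AE s in lborel. ennreal (indicator {0..T} s *\<^sub>R f s) = ennreal (f s) * indicator {0<..T} s"
      using AE_lborel_singleton[of 0] by eventually_elim (auto split: split_indicator)
  qed
  have "(\<integral>\<^sup>+u. ennreal (indicator {0..t powr q} u *\<^sub>R g u) \<partial>lborel) = (\<integral>\<^sup>+s. ennreal (indicator {0..t} s *\<^sub>R ?h s) \<partial>lborel)"
    unfolding eq using nn_integral_powr_substitution[of "\<lambda>u. ennreal (g u)" q t] q t by (simp add: ennreal_mult' g0)
  moreover have "(\<integral>\<^sup>+u. ennreal (indicator {0..t powr q} u *\<^sub>R g u) \<partial>lborel) = ennreal (LINT u:{0..t powr q}|lborel. g u)"
    using int g0 unfolding set_lebesgue_integral_def set_integrable_def by (intro nn_integral_eq_integral) auto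
  ultimately have nn: "(\<integral>\<^sup>+s. ennreal (indicator {0..t} s *\<^sub>R ?h s) \<partial>lborel) = ennreal (LINT u:{0..t powr q}|lborel. g u)" by simp
  have nonneg: "AE s in lborel. 0 \<le> indicator {0..t} s *\<^sub>R ?h s" using g0 q by auto
  have m: "(\<lambda>s. indicator {0..t} s *\<^sub>R ?h s) \<in> borel_measurable lborel" by measurable
  show "set_integrable lborel {0..t} ?h"
    unfolding set_integrable_def by (rule integrableI_nonneg[OF m nonneg]) (simp only: nn ennreal_less_top infinity_ennreal_def)
  have "0 \<le> (LINT u:{0..t powr q}|lborel. g u)"
    unfolding set_lebesgue_integral_def using g0 by (intro Bochner_Integration.integral_nonneg) auto
  then show "(LINT s:{0..t}|lborel. ?h s) = (LINT u:{0..t powr q}|lborel. g u)"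
    unfolding set_lebesgue_integral_def[of lborel "{0..t}"] integral_eq_nn_integral[OF m nonneg] nn by simp
qed

lemma set_integral_mono_on:
  fixes g :: "real \<Rightarrow> real"
  assumes "\<And>t. 0 \<le> t \<Longrightarrow> set_integrable lborel {0..t} g" "\<And>s. 0 \<le> s \<Longrightarrow> 0 \<le> g s"
  shows "mono_on {0..} (\<lambda>t. LINT s:{0..t}|lborel. g s)"
proof (rule mono_onI)
  fix r t :: real assume "r \<in> {0..}" "t \<in> {0..}" "r \<le> t"
  then show "(LINT s:{0..r}|lborel. g s) \<le> (LINT s:{0..t}|lborel. g s)"
    using assms unfolding set_lebesgue_integral_def set_integrable_def
    by (intro Bochner_Integration.integral_mono) (auto split: split_indicator)
qed

text \<open>By uniqueness \<open>y\<close> is the by-parts integral for \<open>j\<close>. Adding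
  \<open>a\<close> times the formula for \<open>j\<close> to the one for \<open>l\<close> merges the
  boundary terms into \<open>u^\<gamma> x\<close> and the correction terms into the absolutely
  continuous part.\<close>

lemma (in monotone_path) weighted_decomposition:
  fixes j x y :: "real \<Rightarrow> real"
  assumes j: "continuous_on {0..} j" "0 < t1" "\<And>s. 0 < s \<Longrightarrow> s \<le> t1 \<Longrightarrow> \<bar>j s\<bar> \<le> K1 * s powr \<eta>"
    and y: "continuous_on {0..} y" "y 0 = 0" "weighted \<gamma> j y" and x: "\<And>s. 0 \<le> s \<Longrightarrow> x s = a * j s + l s"
    and u: "0 \<le> u"
  shows "set_integrable lborel {0..u} (\<lambda>s. x s * s powr (\<gamma> - 1))"
    and "u powr \<gamma> * x u - a * y u = \<gamma> * (LINT s:{0..u}|lborel. x s * s powr (\<gamma> - 1)) + Z u"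
    and "continuous_on {0..} (\<lambda>u. u powr \<gamma> * x u)"
proof -
  note bj = by_parts_props[OF j \<eta>]
  have y_eq: "y u = by_parts \<gamma> j u"
    by (rule weighted_unique[OF y(3) bj(2) y(1) bj(3)]) (use y bj u in auto)
  have ij: "set_integrable lborel {0..u} (\<lambda>s. a * (j s * s powr (\<gamma> - 1)))"
    using by_parts_integrable[OF j \<eta>] by (intro set_integrable_mult_right) auto
  note il = by_parts_integrable[OF cont t0 rate \<eta>, of u]
  have xs: "x s * s powr (\<gamma> - 1) = a * (j s * s powr (\<gamma> - 1)) + l s * s powr (\<gamma> - 1)" if "s \<in> {0..u}" for s
    using that x[of s] by (simp add: algebra_simps)
  show "set_integrable lborel {0..u} (\<lambda>s. x s * s powr (\<gamma> - 1))"
    using set_integral_add(1)[OF ij il] xs by (subst set_integrable_cong[OF refl refl xs]) auto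
  have "(LINT s:{0..u}|lborel. x s * s powr (\<gamma> - 1)) =
      (LINT s:{0..u}|lborel. a * (j s * s powr (\<gamma> - 1)) + l s * s powr (\<gamma> - 1))"
    by (rule set_lebesgue_integral_cong) (use xs in auto)
  also have "\<dots> = a * (LINT s:{0..u}|lborel. j s * s powr (\<gamma> - 1)) + (LINT s:{0..u}|lborel. l s * s powr (\<gamma> - 1))"
    by (simp add: set_integral_add(2)[OF ij il])
  finally show "u powr \<gamma> * x u - a * y u = \<gamma> * (LINT s:{0..u}|lborel. x s * s powr (\<gamma> - 1)) + Z u"
    unfolding Z_eq[OF u] y_eq by_parts_def x[OF u] by (simp add: algebra_simps)
  have "continuous_on {0..} (\<lambda>u. a * (u powr \<gamma> * j u) + u powr \<gamma> * l u)"
    by (intro continuous_on_add continuous_on_mult continuous_on_const bj(4) by_parts_l(4))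
  then show "continuous_on {0..} (\<lambda>u. u powr \<gamma> * x u)"
    by (rule continuous_on_eq) (simp add: x algebra_simps)
qed

lemma bounded_variation_path_cong:
  assumes "\<And>t. 0 \<le> t \<Longrightarrow> v t = w t" and v: "bounded_variation_path v"
  shows "bounded_variation_path w"
  unfolding bounded_variation_path_def
proof (intro allI impI)
  fix t :: real assume "0 \<le> t"
  then obtain C where C: "\<And>(n::nat) u. mono_on {..n} u \<Longrightarrow> u ` {..n} \<subseteq> {0..t} \<Longrightarrow> (\<Sum>i<n. \<bar>v (u (Suc i)) - v (u i)\<bar>) \<le> C"
    using v unfolding bounded_variation_path_def by blast
  show "\<exists>C. \<forall>(n::nat) u. mono_on {..n} u \<longrightarrow> u ` {..n} \<subseteq> {0..t} \<longrightarrow> (\<Sum>i<n. \<bar>w (u (Suc i)) - w (u i)\<bar>) \<le> C"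
  proof (intro exI allI impI)
    fix n :: nat and u :: "nat \<Rightarrow> real" assume u: "mono_on {..n} u" "u ` {..n} \<subseteq> {0..t}"
    have "v (u i) = w (u i)" if "i \<le> n" for i using u(2) that by (intro assms) auto
    then have "(\<Sum>i<n. \<bar>w (u (Suc i)) - w (u i)\<bar>) = (\<Sum>i<n. \<bar>v (u (Suc i)) - v (u i)\<bar>)"
      by (intro sum.cong) auto
    then show "(\<Sum>i<n. \<bar>w (u (Suc i)) - w (u i)\<bar>) \<le> C" using C[OF u] by simp
  qed
qed

lemma powr_powr_inverse: "0 \<le> (x::real) \<Longrightarrow> q \<noteq> 0 \<Longrightarrow> (x powr (1 / q)) powr q = x"
  "0 \<le> (x::real) \<Longrightarrow> q \<noteq> 0 \<Longrightarrow> (x powr q) powr (1 / q) = x"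
  by (auto simp: powr_powr)

lemma powr_less_inverse_iff:
  fixes x s q :: real
  assumes "0 \<le> x" "0 \<le> s" "0 < q"
  shows "x powr (1 / q) < s \<longleftrightarrow> x < s powr q" "s \<le> x powr (1 / q) \<longleftrightarrow> s powr q \<le> x"
proof -
  show "x powr (1 / q) < s \<longleftrightarrow> x < s powr q"
    using powr_less_mono2[of q "x powr (1/q)" s] powr_less_mono2[of "1/q" x "s powr q"] assms
    by (auto simp: powr_powr_inverse)
  then show "s \<le> x powr (1 / q) \<longleftrightarrow> s powr q \<le> x" by (simp add: not_less[symmetric])
qed

lemma min_powr:
  fixes s x q :: real
  assumes "0 \<le> x" "0 \<le> s" "0 < q"
  shows "min s (x powr (1 / q)) powr q = min (s powr q) x"
  using powr_less_inverse_iff[OF assms] assms by (auto simp: min_def powr_powr_inverse)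

text \<open>\<open>W\<close> and \<open>Y\<close> are the integrals of \<open>s^\<beta>\<close>
  against \<open>B\<close> and of \<open>s^\<gamma>\<close> against \<open>J\<close>. The constant
  \<open>c\<close> gives the time-changed \<open>W\<close> unit variance, and \<open>k\<close>,
  which equals \<open>c\<close> to the power \<open>2 \<alpha>\<close>, is the scale of the
  \<open>2 \<alpha>\<close>-th power of the reinforced process.\<close>

locale reinforced_bessel = bessel_space M F B d \<alpha> R L I J AI AJ for M :: "'a measure" and F B d \<alpha> R L I J AI AJ +
  fixes p q \<beta> \<gamma> c k :: real and W Y :: "real \<Rightarrow> 'a \<Rightarrow> real"
  assumes q: "q = 1 - 2 * p" "0 < q" and \<beta>: "\<beta> = p / q" and \<gamma>: "\<gamma> = 2 * \<alpha> * p / q"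
    and c: "c = 1 / sqrt q" and k: "k = q powr (- \<alpha>)"
    and W_cont: "continuous_adapted M F W"
    and W: "AE w in M. W 0 w = 0 \<and> weighted \<beta> (\<lambda>s. B s w) (\<lambda>s. W s w)"
    and Y_cont: "continuous_adapted M F Y"
    and Y: "AE w in M. Y 0 w = 0 \<and> weighted \<gamma> (\<lambda>s. J s w) (\<lambda>s. Y s w)"
    and L_singular: "AE w in M. lebesgue_singular (stieltjes (\<lambda>t. L t w))"
begin

abbreviation G :: "real \<Rightarrow> 'a measure" where "G \<equiv> reinforced_filtration p F"

sublocale G: filtered_space M G
  by unfold_locales (rule complete_reinforced_filtration[OF complete], use q in simp)

lemma G_eq: "0 \<le> t \<Longrightarrow> G t = F (t powr q)"
  by (simp add: reinforced_filtration_def q)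

lemma parameters: "0 < c" "0 < k" "c\<^sup>2 * q = 1" "c powr (2 * \<alpha>) = k" "- 1 / 2 < \<beta>" "2 * \<beta> + 1 = 1 / q"
  "- \<alpha> < \<gamma>" "\<gamma> = 2 * \<alpha> * \<beta>" "q * \<beta> = p" "q * \<gamma> = 2 * \<alpha> * p"
proof -
  show "0 < c" "0 < k" "c\<^sup>2 * q = 1" using q by (auto simp: c k power_divide)
  have "c = q powr (- 1 / 2)" using q by (simp add: c powr_minus powr_half_sqrt inverse_eq_divide)
  then show "c powr (2 * \<alpha>) = k" by (simp add: powr_powr k)
  show b: "2 * \<beta> + 1 = 1 / q" using q by (simp add: \<beta> field_simps)
  then have "0 < 2 * \<beta> + 1" using q by simp
  then show *: "- 1 / 2 < \<beta>" by simp
  show g: "\<gamma> = 2 * \<alpha> * \<beta>" by (simp add: \<gamma> \<beta>)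
  have "\<alpha> * (- 1 / 2) < \<alpha> * \<beta>" using * \<alpha> by (intro mult_strict_left_mono) auto
  then show "- \<alpha> < \<gamma>" unfolding g by simp
  show "q * \<beta> = p" "q * \<gamma> = 2 * \<alpha> * p" using q by (auto simp: \<beta> \<gamma>)
qed

lemma time_change_continuous_adapted:
  assumes "continuous_adapted M F X"
  shows "continuous_adapted M G (\<lambda>t w. a * X (t powr q) w)"
  unfolding continuous_adapted_def adapted_def
proof (intro conjI ballI allI impI)
  show "(\<lambda>w. a * X (t powr q) w) \<in> borel_measurable (G t)" if "0 \<le> t" for t
    using continuous_adaptedD(1)[OF assms, of "t powr q"] by (simp add: G_eq that)
  show "continuous_on {0..} (\<lambda>t. a * X (t powr q) w)" if "w \<in> space M" for w
    using q by (intro continuous_intros continuous_on_compose2[OF continuous_adaptedD(4)[OF assms that]] continuous_on_powr') auto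
qed

definition B' :: "real \<Rightarrow> 'a \<Rightarrow> real" where "B' t w = c * W (t powr q) w"

lemma B'_cont: "continuous_adapted M G B'"
  using time_change_continuous_adapted[OF W_cont, of c] by (simp add: B'_def[abs_def])

text \<open>The exponent \<open>2 \<beta> + 1\<close> is \<open>1/q\<close>, so the increment of
  \<open>W\<close> over the changed times has variance \<open>q * (t - s)\<close>, and
  \<open>c^2 * q = 1\<close>. Given the characteristic functions relative to \<open>G s\<close>, law
  and independence follow together.\<close>

lemma B'_brownian: "brownian_motion M G B'"
  unfolding brownian_motion_def
proof (intro conjI allI impI)
  show "continuous_adapted M G B'" by (rule B'_cont)
  show "AE w in M. B' 0 w = 0" using W by eventually_elim (simp add: B'_def)
  fix s t :: real assume st: "0 \<le> s \<and> s < t"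
  let ?X = "\<lambda>w. B' t w - B' s w"
  have m: "?X \<in> borel_measurable M"
    using st G.continuous_adaptedD(2)[OF B'_cont] by auto
  have lt: "s powr q < t powr q" using st q by (intro powr_less_mono2) auto
  have sq: "(r powr q) powr (2 * \<beta> + 1) = r" if "0 \<le> r" for r
    unfolding parameters(6) using that q by (intro powr_powr_inverse) auto
  have ch: "(\<integral>w. indicator A w *\<^sub>R iexp (\<theta> * ?X w) \<partial>M) = complex_of_real (prob A * exp (- (\<theta>\<^sup>2 * (t - s) / 2)))"
    if A: "A \<in> sets (G s)" for A \<theta>
  proof -
    have "(\<integral>w. indicator A w *\<^sub>R iexp ((\<theta> * c) * (W (t powr q) w - W (s powr q) w)) \<partial>M) =
       complex_of_real (prob A * exp (- ((\<theta> * c)\<^sup>2 * (((t powr q) powr (2 * \<beta> + 1) - (s powr q) powr (2 * \<beta> + 1)) / (2 * \<beta> + 1)) / 2)))"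
      using A st by (intro char_weighted_increment[OF W_cont W parameters(5) _ lt]) (auto simp: G_eq)
    moreover have "(\<theta> * c)\<^sup>2 * (((t powr q) powr (2 * \<beta> + 1) - (s powr q) powr (2 * \<beta> + 1)) / (2 * \<beta> + 1)) = \<theta>\<^sup>2 * (t - s)"
    proof -
      have "(\<theta> * c)\<^sup>2 * ((t - s) / (1 / q)) = \<theta>\<^sup>2 * (t - s) * (c\<^sup>2 * q)" by (simp add: power_mult_distrib)
      moreover have "(t powr q) powr (2 * \<beta> + 1) = t" "(s powr q) powr (2 * \<beta> + 1) = s" using st by (auto intro: sq)
      ultimately show ?thesis by (simp only: parameters(3,6) mult_1_right)
    qed
    moreover have "\<theta> * (B' t w - B' s w) = \<theta> * c * (W (t powr q) w - W (s powr q) w)" for w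
      by (simp add: B'_def algebra_simps)
    ultimately show ?thesis by (simp only:)
  qed
  show "distributed M lborel ?X (\<lambda>x. ennreal (normal_density 0 (sqrt (t - s)) x))"
    "indep_set (sets (G s)) {?X -` A \<inter> space M |A. A \<in> sets borel}"
    using G.normal_indep_of_char[OF m _ ch] st by auto
qed

lemma reinforced_eq:
  assumes "0 < s" shows "reinforced p R s w = c * (s powr q) powr \<beta> * R (s powr q) w"
proof -
  have "(s powr q) powr \<beta> = s powr p" by (simp add: powr_powr parameters(9))
  then show ?thesis using assms by (simp add: reinforced_def c q(1))
qed

text \<open>The second identity matches integrands: at \<open>u = s^q\<close> the differential of
  \<open>B'\<close> is \<open>c u^\<beta>\<close> times that of \<open>B\<close>, so integrating the
  reinforced integrand against \<open>B'\<close> means integrating \<open>k u^\<gamma>\<close> times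
  the original one against \<open>B\<close>.\<close>

lemma reinforced_powr:
  assumes "0 < s" "0 \<le> R (s powr q) w"
  shows "reinforced p R s w powr (2 * \<alpha>) = k * ((s powr q) powr \<gamma> * R (s powr q) w powr (2 * \<alpha>))"
    and "c * (s powr q) powr \<beta> * reinforced p R s w powr (2 * \<alpha> - 1) = k * ((s powr q) powr \<gamma> * R (s powr q) w powr (2 * \<alpha> - 1))"
proof -
  have g: "((s powr q) powr \<beta>) powr (2 * \<alpha>) = (s powr q) powr \<gamma>" by (simp add: powr_powr parameters(8) mult_ac)
  have pm: "reinforced p R s w powr x = (c * (s powr q) powr \<beta>) powr x * R (s powr q) w powr x" for x
    unfolding reinforced_eq[OF assms(1)] by (rule powr_mult)
  have k: "(c * (s powr q) powr \<beta>) powr (2 * \<alpha>) = k * (s powr q) powr \<gamma>"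
    using parameters(1) by (subst powr_mult) (auto simp: parameters(4) g)
  show "reinforced p R s w powr (2 * \<alpha>) = k * ((s powr q) powr \<gamma> * R (s powr q) w powr (2 * \<alpha>))"
    unfolding pm k by simp
  have pos: "0 < c * (s powr q) powr \<beta>" using assms(1) parameters(1) by simp
  have "c * (s powr q) powr \<beta> * (c * (s powr q) powr \<beta>) powr (2 * \<alpha> - 1) = (c * (s powr q) powr \<beta>) powr (2 * \<alpha>)"
    using pos powr_add[of "c * (s powr q) powr \<beta>" 1 "2 * \<alpha> - 1"] by simp
  then show "c * (s powr q) powr \<beta> * reinforced p R s w powr (2 * \<alpha> - 1) = k * ((s powr q) powr \<gamma> * R (s powr q) w powr (2 * \<alpha> - 1))"
    unfolding pm by (simp only: mult.assoc[symmetric] k[symmetric])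
qed

text \<open>Continuity of the reinforced paths at 0 is not assumed: joint measurability comes from
  the explicit formula in the time and the continuous time-changed process.\<close>

lemma reinforced_progressive: "progressive G (\<lambda>s w. reinforced p R s w powr x)"
  unfolding progressive_def
proof (intro allI impI)
  fix t :: real assume "0 \<le> t"
  let ?K = "restrict_space borel {0..t} \<Otimes>\<^sub>M G t"
  define f where "f z = 1 * R (fst z powr q) (snd z)" for z
  have f: "f \<in> borel_measurable ?K"
    using G.continuous_adapted_progressive[OF time_change_continuous_adapted[OF R_cont, of 1]] \<open>0 \<le> t\<close>
    by (simp add: progressive_def split_beta' f_def[abs_def])
  have 1: "(\<lambda>z. fst z) \<in> borel_measurable ?K"
    by (rule measurable_compose[OF measurable_fst measurable_restrict_space1]) simp
  have [measurable]: "(\<lambda>(u, v). (if u = 0 then 0 else u powr p / sqrt (1 - 2 * p) * v) powr x) \<in> borel_measurable (borel \<Otimes>\<^sub>M borel)"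
    by measurable
  from measurable_compose[OF measurable_Pair[OF 1 f] this]
  have "(\<lambda>z. (if fst z = 0 then 0 else fst z powr p / sqrt (1 - 2 * p) * f z) powr x) \<in> borel_measurable ?K"
    by (simp only: prod.case)
  then show "(\<lambda>(s, w). reinforced p R s w powr x) \<in> borel_measurable ?K"
    by (simp only: reinforced_def split_beta' q(1) f_def mult_1)
qed


text \<open>The squared weight \<open>c^2 u^(2 \<beta>)\<close> cancels the Jacobian
  \<open>q s^(q-1)\<close> exactly, which reflects the unit speed of \<open>B'\<close>; energies are
  therefore preserved.\<close>

lemma square_integral_time_change:
  assumes [measurable]: "f \<in> borel_measurable borel" and t: "0 \<le> t"
    and g: "\<And>s. 0 < s \<Longrightarrow> s \<le> t \<Longrightarrow> c * (s powr q) powr \<beta> * g s = f (s powr q)"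
  shows "(sq_int {0..t} g) = (sq_int {0..t powr q} f)"
proof -
  have ae: "(\<integral>\<^sup>+s\<in>{0..T}. h s \<partial>lborel) = (\<integral>\<^sup>+s\<in>{0<..T}. h s \<partial>lborel)" for T and h :: "real \<Rightarrow> ennreal"
  proof (rule nn_integral_cong_AE)
    show "AE s in lborel. h s * indicator {0..T} s = h s * indicator {0<..T} s"
      using AE_lborel_singleton[of 0] by eventually_elim (auto split: split_indicator)
  qed
  have "(\<integral>\<^sup>+s\<in>{0<..t}. ennreal ((f (s powr q))\<^sup>2) * ennreal (q * s powr (q - 1)) \<partial>lborel) = (sq_int {0<..t} g)"
  proof (rule nn_integral_cong)
    fix s :: real
    show "ennreal ((f (s powr q))\<^sup>2) * ennreal (q * s powr (q - 1)) * indicator {0<..t} s = ennreal ((g s)\<^sup>2) * indicator {0<..t} s"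
    proof (cases "0 < s \<and> s \<le> t")
      case True
      then have s: "0 < s" "s \<le> t" by auto
      \<comment> \<open>The exponents add up to \<open>2 * p + q - 1\<close>, which is 0.\<close>
      have "((s powr q) powr \<beta>)\<^sup>2 * s powr (q - 1) = s powr (p + p + (q - 1))"
        by (simp add: powr_powr parameters(9) power2_eq_square flip: powr_add)
      also have "\<dots> = 1" using s by (simp add: q(1))
      finally have "(c\<^sup>2 * q) * (((s powr q) powr \<beta>)\<^sup>2 * s powr (q - 1)) = 1" by (simp add: parameters(3))
      then have "(c * (s powr q) powr \<beta>)\<^sup>2 * (q * s powr (q - 1)) = 1" by (simp add: power_mult_distrib mult_ac)
      moreover have "(f (s powr q))\<^sup>2 * (q * s powr (q - 1)) = (g s)\<^sup>2 * ((c * (s powr q) powr \<beta>)\<^sup>2 * (q * s powr (q - 1)))"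
        unfolding g[OF s, symmetric] by (simp add: power_mult_distrib)
      ultimately have "(f (s powr q))\<^sup>2 * (q * s powr (q - 1)) = (g s)\<^sup>2" by simp
      then show ?thesis by (simp add: ennreal_mult'[symmetric])
    qed auto
  qed
  then show ?thesis
    unfolding ae using nn_integral_powr_substitution[of "\<lambda>u. ennreal ((f u)\<^sup>2)" q t] q t by simp
qed

abbreviation H :: "real \<Rightarrow> 'a \<Rightarrow> real" where "H s w \<equiv> R s w powr (2 * \<alpha> - 1)"

abbreviation H' :: "real \<Rightarrow> 'a \<Rightarrow> real" where "H' s w \<equiv> reinforced p R s w powr (2 * \<alpha> - 1)"

definition I' :: "real \<Rightarrow> 'a \<Rightarrow> real" where "I' t w = k * Y (t powr q) w"

lemma R_path_measurable: "w \<in> space M \<Longrightarrow> (\<lambda>s. R (max 0 s) w) \<in> borel_measurable borel"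
  by (intro borel_measurable_continuous_onI continuous_on_compose2[OF continuous_adaptedD(4)[OF R_cont]] continuous_intros) auto

lemma reinforced_square_integrable: "AE w in M. \<forall>t\<ge>0. set_integrable lborel {0..t} (\<lambda>s. (H' s w)\<^sup>2)"
  using JI.powr_square_integrable[OF J_small parameters(7)] R_nonneg AE_space
proof eventually_elim
  case (elim w)
  note [measurable] = R_path_measurable[OF elim(3)]
  show ?case
  proof (intro allI impI)
    fix t :: real assume t: "0 \<le> t"
    \<comment> \<open>The path is extended to the whole line by \<open>max 0\<close>, which makes it
      Borel and alters nothing on \<open>{0..}\<close>.\<close>
    let ?f = "\<lambda>u. k * (u powr \<gamma> * R (max 0 u) w powr (2 * \<alpha> - 1))"
    have int: "set_integrable lborel {0..t powr q} (\<lambda>u. (u powr \<gamma> * H u w)\<^sup>2)" using elim(1) by simp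
    have "(sq_int {0..t} (\<lambda>s. H' s w)) = (sq_int {0..t powr q} ?f)"
      using elim(2) t by (intro square_integral_time_change) (auto simp: reinforced_powr(2))
    also have "\<dots> = (\<integral>\<^sup>+u\<in>{0..t powr q}. ennreal (k\<^sup>2) * ennreal ((u powr \<gamma> * H u w)\<^sup>2) \<partial>lborel)"
      by (intro nn_integral_cong) (auto simp: power_mult_distrib ennreal_mult'[symmetric] split: split_indicator)
    also have "\<dots> = (\<integral>\<^sup>+u. ennreal (k\<^sup>2 * (indicator {0..t powr q} u *\<^sub>R (u powr \<gamma> * H u w)\<^sup>2)) \<partial>lborel)"
      by (intro nn_integral_cong) (auto simp: ennreal_mult'[symmetric] split: split_indicator)
    also have "\<dots> < \<infinity>"
      using integrableD(2)[OF integrable_mult_right[OF int[unfolded set_integrable_def], of "k\<^sup>2"]]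
      by (simp add: top.not_eq_extremum)
    finally have fin: "(sq_int {0..t} (\<lambda>s. H' s w)) < \<infinity>" .
    have "(\<lambda>s. indicator {0..t} s *\<^sub>R (H' s w)\<^sup>2) = (\<lambda>s. indicator {0..t} s *\<^sub>R
        ((if s = 0 then 0 else s powr p / sqrt (1 - 2 * p) * R (max 0 (s powr (1 - 2 * p))) w) powr (2 * \<alpha> - 1))\<^sup>2)"
      by (auto simp: reinforced_def)
    also have "\<dots> \<in> borel_measurable lborel" by measurable
    finally have m: "(\<lambda>s. indicator {0..t} s *\<^sub>R (H' s w)\<^sup>2) \<in> borel_measurable lborel" .
    have "(\<integral>\<^sup>+s. ennreal (indicator {0..t} s *\<^sub>R (H' s w)\<^sup>2) \<partial>lborel) < \<infinity>"
    proof (rule le_less_trans[OF eq_refl fin])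
      show "(\<integral>\<^sup>+s. ennreal (indicator {0..t} s *\<^sub>R (H' s w)\<^sup>2) \<partial>lborel) = (sq_int {0..t} (\<lambda>s. H' s w))"
        by (intro nn_integral_cong) (auto split: split_indicator)
    qed
    then show "set_integrable lborel {0..t} (\<lambda>s. (H' s w)\<^sup>2)"
      unfolding set_integrable_def by (intro integrableI_nonneg[OF m]) auto
  qed
qed

text \<open>The inverse time change of the partition: \<open>G\<close> at time
  \<open>\<tau> i powr (1 / q)\<close> is \<open>F\<close> at \<open>\<tau> i\<close>, so the
  coefficients remain known in time.\<close>

fun time_changed_data :: "'a simple_data \<Rightarrow> 'a simple_data" where
  "time_changed_data (n, \<tau>, \<xi>) = (n, \<lambda>i. \<tau> i powr (1 / q), \<xi>)"

lemma simple_times_nonneg: "simple_integrand M F (n, \<tau>, \<xi>) \<Longrightarrow> i \<le> n \<Longrightarrow> 0 \<le> \<tau> i"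
  by (induction i) (auto intro: order_trans Suc_leD)

lemma time_changed_data:
  assumes S: "simple_integrand M F S"
  shows "simple_integrand M G (time_changed_data S)"
    and "0 \<le> s \<Longrightarrow> simple_process (time_changed_data S) s w = simple_process S (s powr q) w"
    and "0 \<le> s \<Longrightarrow> simple_integral (\<lambda>t w. X (t powr q) w) (time_changed_data S) s w = simple_integral X S (s powr q) w"
proof -
  obtain n \<tau> \<xi> where S_eq: "S = (n, \<tau>, \<xi>)" by (cases S)
  note \<tau> = simple_times_nonneg[OF S[unfolded S_eq]]
  show "simple_integrand M G (time_changed_data S)"
    using S \<tau> q(2) by (auto simp: S_eq G_eq powr_powr_inverse Suc_leI intro!: powr_mono2)
  show "simple_process (time_changed_data S) s w = simple_process S (s powr q) w" if "0 \<le> s"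
    unfolding S_eq simple_process.simps time_changed_data.simps
    using that \<tau> q by (intro sum.cong) (auto simp: powr_less_inverse_iff indicator_def)
  show "simple_integral (\<lambda>t w. X (t powr q) w) (time_changed_data S) s w = simple_integral X S (s powr q) w" if "0 \<le> s"
    unfolding S_eq simple_integral.simps time_changed_data.simps
    using that \<tau> q by (intro sum.cong) (auto simp: min_powr)
qed

text \<open>Approximations relative to \<open>c / k\<close> times \<open>W\<close>, provided by the
  change of integrator, are transported by the time change; scaling by \<open>k\<close> turns them
  into approximations relative to \<open>B'\<close>.\<close>

lemma ito_approx_time_change: "G.ito_approx B' H' I'"
  unfolding G.ito_approx_def
proof (intro allI impI)
  fix t e :: real assume t: "0 \<le> t" and e: "0 < e"
  \<comment> \<open>Scaling by \<open>k\<close> multiplies integrals by \<open>k\<close> and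
    energies by its square; half of the probability is reserved for the positivity of
    \<open>R\<close>.\<close>
  define e' where "e' = min (e / 2) (min (e / k) (e / k\<^sup>2))"
  have e': "0 < e'" "e' \<le> e / 2" "k * e' \<le> e" "k\<^sup>2 * e' \<le> e"
    using e parameters(2) by (auto simp: e'_def min_def field_simps)
  have ck: "0 < c / k" using parameters by simp
  obtain S where S: "simple_integrand M F S" and l: "likely e' (\<lambda>w.
      (sq_int {0..t powr q} (\<lambda>s. simple_process S s w * (c / k * s powr \<beta>) - s powr \<gamma> * H s w)) \<le> ennreal e' \<and>
      (\<forall>s\<in>{0..t powr q}. \<bar>simple_integral (\<lambda>t w. c / k * W t w) S s w - Y s w\<bar> \<le> e'))"
  proof -
    have wtd: "AE w in M. weighted \<beta> (\<lambda>s. B s w) (\<lambda>s. W s w)" using W by eventually_elim simp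
    have y: "AE w in M. Y 0 w = 0" "AE w in M. weighted \<gamma> (\<lambda>s. J s w) (\<lambda>s. Y s w)"
      using Y by (eventually_elim, simp)+
    from integrator_change[OF wtd JI.powr_progressive[OF J_small parameters(7)] JI.powr_square_integrable[OF J_small parameters(7)]
        JI.powr_ito_approx[OF J_small parameters(7) Y_cont y] ck powr_ge_zero[of t q] e'(1)]
    show ?thesis by (elim exE conjE) (rule that)
  qed
  show "\<exists>S'. simple_integrand M G S' \<and> likely e (\<lambda>w.
      (sq_int {0..t} (\<lambda>s. simple_process S' s w - H' s w)) \<le> ennreal e \<and>
      (\<forall>s\<in>{0..t}. \<bar>simple_integral B' S' s w - I' s w\<bar> \<le> e))"
  proof (intro exI conjI)
    show "simple_integrand M G (time_changed_data S)" by (rule time_changed_data(1)[OF S])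
    have good: "likely (e / 2) (\<lambda>w. \<forall>t\<ge>0. 0 \<le> R t w)" by (rule likely_AE[OF R_nonneg]) (use e in simp)
    show "likely e (\<lambda>w.
      (sq_int {0..t} (\<lambda>s. simple_process (time_changed_data S) s w - H' s w)) \<le> ennreal e \<and>
      (\<forall>s\<in>{0..t}. \<bar>simple_integral B' (time_changed_data S) s w - I' s w\<bar> \<le> e))"
    proof (rule likely_mono[OF likely_conj[OF l good]], use e' in simp, elim conjE, intro conjI ballI)
      fix w assume w: "w \<in> space M" and R0: "\<forall>t\<ge>0. 0 \<le> R t w"
      assume sq: "(sq_int {0..t powr q} (\<lambda>s. simple_process S s w * (c / k * s powr \<beta>) - s powr \<gamma> * H s w)) \<le> ennreal e'"
        and sup: "\<forall>s\<in>{0..t powr q}. \<bar>simple_integral (\<lambda>t w. c / k * W t w) S s w - Y s w\<bar> \<le> e'"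
      note [measurable] = R_path_measurable[OF w] JI.simple_path_measurable[OF S w]
      let ?f = "\<lambda>u. simple_process S u w * (c * u powr \<beta>) - k * (u powr \<gamma> * R (max 0 u) w powr (2 * \<alpha> - 1))"
      let ?h = "\<lambda>u. simple_process S u w * (c / k * u powr \<beta>) - u powr \<gamma> * R (max 0 u) w powr (2 * \<alpha> - 1)"
      have "(sq_int {0..t} (\<lambda>s. simple_process (time_changed_data S) s w - H' s w)) =
         (sq_int {0..t powr q} ?f)"
      proof (rule square_integral_time_change)
        fix s assume s: "0 < s" "s \<le> t"
        show "c * (s powr q) powr \<beta> * (simple_process (time_changed_data S) s w - H' s w) = ?f (s powr q)"
          using s R0 by (simp add: time_changed_data(2)[OF S] right_diff_distrib reinforced_powr(2))
      qed (measurable, rule t)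
      also have "\<dots> = (\<integral>\<^sup>+u. ennreal (k\<^sup>2) * (ennreal ((?h u)\<^sup>2) * indicator {0..t powr q} u) \<partial>lborel)"
      proof (rule nn_integral_cong)
        fix u :: real
        have "?f u = k * ?h u" using parameters(2) by (simp add: right_diff_distrib)
        then show "ennreal ((?f u)\<^sup>2) * indicator {0..t powr q} u = ennreal (k\<^sup>2) * (ennreal ((?h u)\<^sup>2) * indicator {0..t powr q} u)"
          by (simp only: power_mult_distrib ennreal_mult' zero_le_power2 mult.assoc)
      qed
      also have "\<dots> = ennreal (k\<^sup>2) * (sq_int {0..t powr q} ?h)"
        by (rule nn_integral_cmult) measurable
      also have "(sq_int {0..t powr q} ?h) =
         (sq_int {0..t powr q} (\<lambda>s. simple_process S s w * (c / k * s powr \<beta>) - s powr \<gamma> * H s w))"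
        by (intro nn_integral_cong) (auto split: split_indicator)
      also have "ennreal (k\<^sup>2) * \<dots> \<le> ennreal (k\<^sup>2) * ennreal e'" by (rule mult_left_mono[OF sq]) simp
      also have "\<dots> \<le> ennreal e" using e' by (simp add: ennreal_mult'[symmetric] ennreal_leI)
      finally show "(sq_int {0..t} (\<lambda>s. simple_process (time_changed_data S) s w - H' s w)) \<le> ennreal e" .
      fix s assume s: "s \<in> {0..t}"
      have sq: "s powr q \<in> {0..t powr q}" using s q(2) by (auto intro: powr_mono2)
      have "simple_integral B' (time_changed_data S) s w = simple_integral (\<lambda>t w. c * W t w) S (s powr q) w"
        using time_changed_data(3)[OF S, of s "\<lambda>t w. c * W t w" w] s by (simp add: B'_def[abs_def])
      also have "\<dots> = k * simple_integral (\<lambda>t w. c / k * W t w) S (s powr q) w"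
        unfolding simple_integral_cmult using parameters(2) by simp
      finally have "simple_integral B' (time_changed_data S) s w - I' s w =
          k * (simple_integral (\<lambda>t w. c / k * W t w) S (s powr q) w - Y (s powr q) w)"
        by (simp add: I'_def right_diff_distrib)
      moreover have "k * \<bar>simple_integral (\<lambda>t w. c / k * W t w) S (s powr q) w - Y (s powr q) w\<bar> \<le> k * e'"
        using sup sq parameters(2) by (intro mult_left_mono) auto
      ultimately have "\<bar>simple_integral B' (time_changed_data S) s w - I' s w\<bar> \<le> k * e'"
        by (simp only: abs_mult abs_of_pos[OF parameters(2)])
      then show "\<bar>simple_integral B' (time_changed_data S) s w - I' s w\<bar> \<le> e" using e'(3) by linarith
    qed
  qed
qed

lemma I'_cont: "continuous_adapted M G I'"
  using time_change_continuous_adapted[OF Y_cont, of k] by (simp add: I'_def[abs_def])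

lemma I'_ito: "ito_integral M G B' H' I'"
  by (rule G.ito_integralI[OF reinforced_progressive reinforced_square_integrable I'_cont ito_approx_time_change])

text \<open>The reinforced integral is again an integral against a Brownian motion, now relative to
  \<open>G\<close>, so the general result applies to it.\<close>

lemma I'_local_martingale: "continuous_local_martingale M G (\<lambda>t w. a * I' t w)"
proof -
  obtain A' where "G.energy_process H' A'"
    by (rule G.energy_process_exists[OF reinforced_progressive reinforced_square_integrable]) (assumption | rule that)+
  then interpret GI: ito_space M G B' H' I' A'
    using B'_brownian I'_ito by unfold_locales
  show ?thesis by (rule GI.ito_local_martingale)
qed

abbreviation X' :: "real \<Rightarrow> 'a \<Rightarrow> real" where "X' t w \<equiv> reinforced p R t w powr (2 * \<alpha>)"

abbreviation L' :: "real \<Rightarrow> 'a \<Rightarrow> real" where "L' \<equiv> reinforced_local_time \<alpha> p L"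

text \<open>All pathwise claims in one predicate, so that a single null set excludes every failure
  and the variation part can be redefined on it.\<close>

definition good_path :: "'a \<Rightarrow> bool" where
  "good_path w \<longleftrightarrow> (\<forall>t\<ge>0. set_integrable lborel {0..t} (\<lambda>s. X' s w / s)) \<and>
    (\<forall>t\<ge>0. set_integrable (stieltjes (\<lambda>u. L u w)) {0..t powr (1 - 2 * p)} (\<lambda>s. s powr (2 * \<alpha> * p / (1 - 2 * p)))) \<and>
    (\<forall>t\<ge>0. X' t w - 2 * \<alpha> * I' t w = 2 * \<alpha> * p * (LINT s:{0..t}|lborel. X' s w / s) + L' t w) \<and>
    continuous_on {0..} (\<lambda>t. L' t w) \<and> mono_on {0..} (\<lambda>t. L' t w) \<and> lebesgue_singular (stieltjes (\<lambda>t. L' t w)) \<and>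
    continuous_on {0..} (\<lambda>t. X' t w) \<and> I' 0 w = 0 \<and> bounded_variation_path (\<lambda>t. X' t w - 2 * \<alpha> * I' t w)"

lemma good_path: "AE w in M. good_path w"
proof -
  \<comment> \<open>One exponent for both \<open>J\<close> and \<open>L\<close>: below
    \<open>\<alpha>\<close>, so that the rates hold, and above \<open>-\<gamma>\<close>, so that the
    weighted integrals converge at 0.\<close>
  obtain \<eta> where \<eta>: "0 \<le> \<eta>" "\<eta> < \<alpha>" "0 < \<gamma> + \<eta>"
    using JI.rate[OF J_small parameters(7)] by blast
  show ?thesis
    using R_nonneg R_powr L_mono initial_values Y L_singular JI.integral_rate[OF J_small \<eta>(1,2)] L_rate[OF \<eta>(1,2)] AE_space
  proof eventually_elim
    case (elim w)
    note R0 = elim(1)[rule_format]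
    obtain K1 t1 where j: "0 < t1" "\<And>s. 0 < s \<Longrightarrow> s \<le> t1 \<Longrightarrow> \<bar>J s w\<bar> \<le> K1 * s powr \<eta>" using elim(7) by blast
    obtain K t0 where l: "0 < t0" "\<And>s. 0 < s \<Longrightarrow> s \<le> t0 \<Longrightarrow> \<bar>L s w\<bar> \<le> K * s powr \<eta>" using elim(8) by blast
    interpret l: monotone_path "\<lambda>s. L s w" \<gamma> K \<eta> t0
      using elim(3,4) l \<eta>(3) continuous_adaptedD(4)[OF L_cont elim(9)] by unfold_locales auto
    let ?x = "\<lambda>s. R s w powr (2 * \<alpha>)"
    have y: "Y 0 w = 0" "weighted \<gamma> (\<lambda>s. J s w) (\<lambda>s. Y s w)" using elim(5) by auto
    have x: "?x s = 2 * \<alpha> * J s w + L s w" if "0 \<le> s" for s using elim(2) that by simp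
    note conts = continuous_adaptedD(4)[OF JI.I_cont elim(9)] continuous_adaptedD(4)[OF Y_cont elim(9)]
    note wd = l.weighted_decomposition[where j = "\<lambda>s. J s w" and x = ?x and y = "\<lambda>s. Y s w" and a = "2 * \<alpha>", OF conts(1) j(1) _ conts(2) y]
    have dec: "set_integrable lborel {0..u} (\<lambda>s. ?x s * s powr (\<gamma> - 1))"
      "u powr \<gamma> * ?x u - 2 * \<alpha> * Y u w = \<gamma> * (LINT s:{0..u}|lborel. ?x s * s powr (\<gamma> - 1)) + l.Z u" if "0 \<le> u" for u
      using wd(1,2)[OF j(2) x that] by blast+
    have x_cont: "continuous_on {0..} (\<lambda>u. u powr \<gamma> * ?x u)" using wd(3)[OF j(2) x order_refl] by blast
    have X_eq: "X' t w = k * ((t powr q) powr \<gamma> * ?x (t powr q))" if "0 \<le> t" for t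
      using that R0[of "t powr q"] by (cases "t = 0") (simp add: reinforced_def, simp add: reinforced_powr(1))
    have X_cont: "continuous_on {0..} (\<lambda>t. X' t w)"
    proof (subst continuous_on_cong[OF refl X_eq])
      show "continuous_on {0..} (\<lambda>t. k * ((t powr q) powr \<gamma> * ?x (t powr q)))"
        using q by (intro continuous_on_mult continuous_on_const continuous_on_compose2[OF x_cont] continuous_on_powr') auto
    qed simp
    have L_eq: "L' t w = k * l.Z (t powr q)" for t
      by (simp only: reinforced_local_time_def l.Z_def k q(1)[symmetric] \<gamma>[symmetric])
    note [measurable] = R_path_measurable[OF elim(9)]
    let ?g = "\<lambda>u. R (max 0 u) w powr (2 * \<alpha>) * u powr (\<gamma> - 1)"
    have gi: "set_integrable lborel {0..u} ?g" "(LINT s:{0..u}|lborel. ?g s) = (LINT s:{0..u}|lborel. ?x s * s powr (\<gamma> - 1))"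
      if "0 \<le> u" for u
    proof -
      have gx: "?g s = ?x s * s powr (\<gamma> - 1)" if "s \<in> {0..u}" for s using that by simp
      show "set_integrable lborel {0..u} ?g" using dec(1)[OF that] by (subst set_integrable_cong[OF refl refl gx])
      show "(LINT s:{0..u}|lborel. ?g s) = (LINT s:{0..u}|lborel. ?x s * s powr (\<gamma> - 1))"
        by (rule set_lebesgue_integral_cong) auto
    qed
    have sub: "set_integrable lborel {0..t} (\<lambda>s. X' s w / s)"
      "(LINT s:{0..t}|lborel. X' s w / s) = (k / q) * (LINT s:{0..t powr q}|lborel. ?x s * s powr (\<gamma> - 1))" if t: "0 \<le> t" for t
    proof -
      \<comment> \<open>With \<open>u = s^q\<close> the Jacobian satisfies
        \<open>u^(\<gamma>-1) s^(q-1) = u^\<gamma> / s\<close>, which produces the factor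
        \<open>1/s\<close> in the drift.\<close>
      have eq: "X' s w / s = (k / q) * (?g (s powr q) * (q * s powr (q - 1)))" if "s \<in> {0..t}" for s
      proof (cases "s = 0")
        case False
        then have s: "0 < s" using that by simp
        have "(s powr q) powr (\<gamma> - 1) * s powr (q - 1) = (s powr q) powr \<gamma> * s powr (- q + (q - 1))"
          unfolding powr_powr powr_add[symmetric] by (rule arg_cong[where f = "(powr) s"]) (simp add: algebra_simps)
        also have "s powr (- q + (q - 1)) = 1 / s" using s by (simp add: powr_minus inverse_eq_divide)
        finally have "?g (s powr q) * s powr (q - 1) = ?x (s powr q) * ((s powr q) powr \<gamma> * (1 / s))"
          by (simp add: mult.assoc)
        then have "k * (?g (s powr q) * s powr (q - 1)) = X' s w / s" using X_eq[of s] s by simp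
          then show ?thesis using q(2) by simp
      qed simp
      note si = set_integral_powr_substitution[of ?g q t, OF _ _ q(2) t gi(1)]
      show "set_integrable lborel {0..t} (\<lambda>s. X' s w / s)"
        by (subst set_integrable_cong[OF refl refl eq], assumption, intro set_integrable_mult_right si) (auto intro: that)
      have "(LINT s:{0..t}|lborel. X' s w / s) = (LINT s:{0..t}|lborel. (k / q) * (?g (s powr q) * (q * s powr (q - 1))))"
        by (rule set_lebesgue_integral_cong) (use eq in auto)
      also have "\<dots> = (k / q) * (LINT s:{0..t powr q}|lborel. ?g s)" by (subst set_integral_mult_right, subst si(2)) (use t in auto)
      finally show "(LINT s:{0..t}|lborel. X' s w / s) = (k / q) * (LINT s:{0..t powr q}|lborel. ?x s * s powr (\<gamma> - 1))"
        by (simp add: gi(2))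
    qed
    have V_eq: "X' t w - 2 * \<alpha> * I' t w = 2 * \<alpha> * p * (LINT s:{0..t}|lborel. X' s w / s) + L' t w" if t: "0 \<le> t" for t
    proof -
      have "X' t w - 2 * \<alpha> * I' t w = k * ((t powr q) powr \<gamma> * ?x (t powr q) - 2 * \<alpha> * Y (t powr q) w)"
        using X_eq[OF t] by (simp add: I'_def right_diff_distrib)
      also have "\<dots> = k * \<gamma> * (LINT s:{0..t powr q}|lborel. ?x s * s powr (\<gamma> - 1)) + L' t w"
        unfolding dec(2)[OF powr_ge_zero] L_eq by (simp add: distrib_left)
      also have "k * \<gamma> = 2 * \<alpha> * p * (k / q)" using q(2) by (simp add: \<gamma>)
      finally show ?thesis unfolding sub(2)[OF t] by (simp only: mult.assoc)
    qed
    have L_mono': "mono_on {0..} (\<lambda>t. L' t w)"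
      unfolding L_eq using l.time_changed_mono[OF q(2)] parameters(2) by simp
    have "mono_on {0..} (\<lambda>t. LINT s:{0..t}|lborel. X' s w / s)"
      by (rule set_integral_mono_on[OF sub(1)]) auto
    from bounded_variation_path_cong[OF V_eq[symmetric] bounded_variation_path_mono_combination[OF this L_mono']]
    have bv: "bounded_variation_path (\<lambda>t. X' t w - 2 * \<alpha> * I' t w)" .
    have "continuous_on {0..} (\<lambda>t. L' t w)" unfolding L_eq by (rule l.time_changed_cont[OF q(2)])
    moreover have "lebesgue_singular (stieltjes (\<lambda>t. L' t w))"
      unfolding L_eq using parameters(2) by (intro l.time_changed_singular q(2) elim(6)) simp
    moreover have "I' 0 w = 0" using y(1) by (simp add: I'_def)
    moreover have "set_integrable (stieltjes (\<lambda>u. L u w)) {0..u} (\<lambda>s. s powr (2 * \<alpha> * p / (1 - 2 * p)))" for u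
      using l.powr_integrable unfolding \<gamma> q(1) .
    ultimately show ?case unfolding good_path_def using sub(1) V_eq X_cont L_mono' bv by blast
  qed
qed

lemma X'_adapted: "adapted G X'"
proof -
  have "(\<lambda>w. X' t w) \<in> borel_measurable (G t)" if "0 \<le> t" for t
  proof (cases "t = 0")
    case False
    have "X' t = (\<lambda>w. (t powr p / sqrt q * R (t powr q) w) powr (2 * \<alpha>))"
      using False by (simp add: reinforced_def fun_eq_iff flip: q(1))
    moreover have "(\<lambda>x::real. x powr (2 * \<alpha>)) \<in> borel_measurable borel" by measurable
    ultimately show ?thesis
      using measurable_compose[OF G.continuous_adaptedD(1)[OF time_change_continuous_adapted[OF R_cont] that]] by (simp only:)
  qed (simp add: reinforced_def)
  then show ?thesis by (simp add: adapted_def)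
qed

lemma canonical_decomposition_exists:
  obtains V where "canonical_decomposition M G X' (\<lambda>t w. 2 * \<alpha> * I' t w) V"
    "AE w in M. good_path w \<and> (\<forall>t. V t w = X' t w - 2 * \<alpha> * I' t w)"
proof -
  obtain N where N: "N \<in> null_sets M" "\<And>w. w \<in> space M - N \<Longrightarrow> good_path w" "\<And>t. 0 \<le> t \<Longrightarrow> N \<in> sets (G t)"
    by (rule G.AE_null_setE[OF good_path]) (assumption | rule that)+
  \<comment> \<open>Set to 0 on the null set, since continuity of every path is required of the
    variation part, while \<open>X'\<close> has it only off that set.\<close>
  define V where "V t w = (if w \<in> N then 0 else X' t w - 2 * \<alpha> * I' t w)" for t w
  have off: "AE w in M. good_path w \<and> (\<forall>t. V t w = X' t w - 2 * \<alpha> * I' t w)"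
    using AE_not_in[OF N(1)] AE_space by eventually_elim (auto simp: V_def N(2))
  have X0: "X' 0 w = 0" for w by (simp add: reinforced_def)
  have V: "continuous_adapted M G V"
    unfolding continuous_adapted_def adapted_def
  proof (intro conjI ballI allI impI)
    fix t :: real assume t: "0 \<le> t"
    have [measurable]: "N \<in> sets (G t)" "(\<lambda>w. X' t w) \<in> borel_measurable (G t)" "I' t \<in> borel_measurable (G t)"
      using N(3)[OF t] X'_adapted t G.continuous_adaptedD(1)[OF I'_cont t] by (auto simp: adapted_def)
    have "(\<lambda>w. if w \<in> N then 0 else X' t w - 2 * \<alpha> * I' t w) \<in> borel_measurable (G t)" by measurable
    then show "V t \<in> borel_measurable (G t)" by (simp add: V_def[abs_def])
  next
    fix w assume w: "w \<in> space M"
    show "continuous_on {0..} (\<lambda>t. V t w)"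
    proof (cases "w \<in> N")
      case False
      then have "continuous_on {0..} (\<lambda>t. X' t w)" using N(2) w by (simp add: good_path_def)
      then have "continuous_on {0..} (\<lambda>t. X' t w - 2 * \<alpha> * I' t w)"
        by (intro continuous_on_diff continuous_on_mult continuous_on_const G.continuous_adaptedD(4)[OF I'_cont w])
      then show ?thesis using False by (simp add: V_def)
    qed (simp add: V_def)
  qed
  have "canonical_decomposition M G X' (\<lambda>t w. 2 * \<alpha> * I' t w) V"
    unfolding canonical_decomposition_def
  proof (intro conjI)
    show "AE w in M. continuous_on {0..} (\<lambda>t. X' t w)" using good_path by eventually_elim (simp add: good_path_def)
    show "AE w in M. 2 * \<alpha> * I' 0 w = 0" using good_path by eventually_elim (simp add: good_path_def)
    show "AE w in M. V 0 w = 0" using off by eventually_elim (simp add: good_path_def X0)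
    show "AE w in M. \<forall>t\<ge>0. X' t w = X' 0 w + 2 * \<alpha> * I' t w + V t w" using off by eventually_elim (simp add: X0)
    show "AE w in M. bounded_variation_path (\<lambda>t. V t w)"
      using off by eventually_elim (simp add: good_path_def)
  qed (rule X'_adapted I'_local_martingale V)+
  then show ?thesis using off by (rule that)
qed

end

theorem lemma2p1:
  fixes M :: "'a measure" and F :: "real \<Rightarrow> 'a measure"
    and B R L :: "real \<Rightarrow> 'a \<Rightarrow> real" and d \<alpha> p :: real
  assumes "prob_space M" and "complete_filtration M F"
    and "0 < d" and "d < 2" and "\<alpha> = 1 - d / 2" and "p < 1 / 2"
    and "brownian_motion M F B"
    and "bessel_process M F d B R"
    and "bessel_local_time M F \<alpha> B R L"
    and "AE \<omega> in M. lebesgue_singular (stieltjes (\<lambda>t. L t \<omega>))"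
    and "AE \<omega> in M. emeasure (stieltjes (\<lambda>t. L t \<omega>)) {t. 0 \<le> t \<and> R t \<omega> \<noteq> 0} = 0"
  shows "\<exists>B' I V.
    brownian_motion M (reinforced_filtration p F) B' \<and>
    ito_integral M (reinforced_filtration p F) B'
      (\<lambda>t \<omega>. reinforced p R t \<omega> powr (2 * \<alpha> - 1)) I \<and>
    canonical_decomposition M (reinforced_filtration p F)
      (\<lambda>t \<omega>. reinforced p R t \<omega> powr (2 * \<alpha>)) (\<lambda>t \<omega>. 2 * \<alpha> * I t \<omega>) V \<and>
    (AE \<omega> in M. \<forall>t\<ge>0. reinforced p R t \<omega> powr (2 * \<alpha>) = 2 * \<alpha> * I t \<omega> + V t \<omega>) \<and>
    (AE \<omega> in M.
      (\<forall>t\<ge>0. set_integrable lborel {0..t} (\<lambda>s. reinforced p R s \<omega> powr (2 * \<alpha>) / s)) \<and>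
      (\<forall>t\<ge>0. set_integrable (stieltjes (\<lambda>u. L u \<omega>)) {0..t powr (1 - 2 * p)}
                (\<lambda>s. s powr (2 * \<alpha> * p / (1 - 2 * p)))) \<and>
      (\<forall>t\<ge>0. V t \<omega> =
         2 * \<alpha> * p * (LINT s:{0..t}|lborel. reinforced p R s \<omega> powr (2 * \<alpha>) / s) +
         reinforced_local_time \<alpha> p L t \<omega>) \<and>
      continuous_on {0..} (\<lambda>t. reinforced_local_time \<alpha> p L t \<omega>) \<and>
      mono_on {0..} (\<lambda>t. reinforced_local_time \<alpha> p L t \<omega>) \<and>
      lebesgue_singular (stieltjes (\<lambda>t. reinforced_local_time \<alpha> p L t \<omega>)))"
proof -
  interpret prob_space M by fact
  interpret brownian_space M F B using assms(2,7) by unfold_locales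
  have \<alpha>: "0 < \<alpha>" "\<alpha> < 1" using assms(3-5) by auto
  obtain I where I: "ito_integral M F B R I" "AE \<omega> in M. \<forall>t\<ge>0. (R t \<omega>)\<^sup>2 = 2 * I t \<omega> + d * t"
    using assms(8) unfolding bessel_process_def by blast
  obtain J where J: "ito_integral M F B (\<lambda>t \<omega>. R t \<omega> powr (2 * \<alpha> - 1)) J"
    "AE \<omega> in M. \<forall>t\<ge>0. R t \<omega> powr (2 * \<alpha>) = 2 * \<alpha> * J t \<omega> + L t \<omega>"
    using assms(9) unfolding bessel_local_time_def by blast
  obtain AI where AI: "energy_process R AI"
    using I(1) unfolding ito_integral_def by (elim conjE) (rule energy_process_exists)
  obtain AJ where AJ: "energy_process (\<lambda>t \<omega>. R t \<omega> powr (2 * \<alpha> - 1)) AJ"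
    using J(1) unfolding ito_integral_def by (elim conjE) (rule energy_process_exists)
  interpret bessel_space M F B d \<alpha> R L I J AI AJ
    using assms(3,8,9) \<alpha> I J AI AJ by unfold_locales (simp_all add: bessel_process_def bessel_local_time_def)
  define q where "q = 1 - 2 * p"
  define \<beta> where "\<beta> = p / q"
  define \<gamma> where "\<gamma> = 2 * \<alpha> * p / q"
  have q: "q = 1 - 2 * p" "0 < q" using assms(6) by (auto simp: q_def)
  have \<beta>: "- (1 / 2) < \<beta>" using q by (simp add: \<beta>_def field_simps)
  then have "\<alpha> * (- (1 / 2)) < \<alpha> * \<beta>" using \<alpha> by (intro mult_strict_left_mono)
  then have \<gamma>: "- \<alpha> < \<gamma>" by (simp add: \<gamma>_def \<beta>_def)
  \<comment> \<open>The Brownian motion is treated as the integral of 1, with rate 1/2 against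
    \<open>\<beta> > -1/2\<close>.\<close>
  obtain W where W: "continuous_adapted M F W" "AE \<omega> in M. W 0 \<omega> = 0 \<and> weighted \<beta> (\<lambda>s. B s \<omega>) (\<lambda>s. W s \<omega>)"
    by (rule BI.powr_integral_process[OF B_small \<beta>]) (assumption | rule that)+
  obtain Y where Y: "continuous_adapted M F Y" "AE \<omega> in M. Y 0 \<omega> = 0 \<and> weighted \<gamma> (\<lambda>s. J s \<omega>) (\<lambda>s. Y s \<omega>)"
    by (rule JI.powr_integral_process[OF J_small \<gamma>]) (assumption | rule that)+
  interpret N: reinforced_bessel M F B d \<alpha> R L I J AI AJ p q \<beta> \<gamma> "1 / sqrt q" "q powr (- \<alpha>)" W Y
    using q W Y assms(10) by unfold_locales (simp_all add: \<beta>_def \<gamma>_def)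
  obtain V where V: "canonical_decomposition M (reinforced_filtration p F) (\<lambda>t \<omega>. reinforced p R t \<omega> powr (2 * \<alpha>)) (\<lambda>t \<omega>. 2 * \<alpha> * N.I' t \<omega>) V"
    "AE \<omega> in M. N.good_path \<omega> \<and> (\<forall>t. V t \<omega> = reinforced p R t \<omega> powr (2 * \<alpha>) - 2 * \<alpha> * N.I' t \<omega>)"
    by (rule N.canonical_decomposition_exists) (assumption | rule that)+
  show ?thesis
  proof (intro exI conjI)
    show "brownian_motion M (reinforced_filtration p F) N.B'" by (rule N.B'_brownian)
    show "ito_integral M (reinforced_filtration p F) N.B' (\<lambda>t \<omega>. reinforced p R t \<omega> powr (2 * \<alpha> - 1)) N.I'" by (rule N.I'_ito)
    show "canonical_decomposition M (reinforced_filtration p F) (\<lambda>t \<omega>. reinforced p R t \<omega> powr (2 * \<alpha>)) (\<lambda>t \<omega>. 2 * \<alpha> * N.I' t \<omega>) V"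
      by (rule V(1))
    show "AE \<omega> in M. \<forall>t\<ge>0. reinforced p R t \<omega> powr (2 * \<alpha>) = 2 * \<alpha> * N.I' t \<omega> + V t \<omega>"
      using V(2) by eventually_elim simp
  qed (use V(2) in \<open>eventually_elim, unfold N.good_path_def, elim conjE, simp\<close>)
qed

end
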